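(* Let $n\ge 1$ and let $M\in\mathcal{F}_n$ be an object lying in a block $\mathcal{F}_n^l$, $l\in\{-n,-n+2,\dots,n-2,n\}$. Then: (1) The dual module $M^*$ also lies in the same block $\mathcal{F}_n^l$. (2) For every $k\in\mathbb{Z}$ there is an isomorphism, natural in $M$, $$\Theta_k(M^* )\cong\Pi\left(\Theta_{-k}(M)\right)^*,$$ where $\Theta_k=\Theta_k^{(n)}$ is the $k$-th translation functor on $\mathcal{F}_n$.
   Context: Everything is over $\mathbb{C}$. Superspaces are $\mathbb{Z}/2\mathbb{Z}$-graded vector spaces; $p(\cdot)$ denotes parity, $\Pi$ is the parity-change functor, $\operatorname{str}$ the supertrace. The periplectic Lie superalgebra: let $V_n$ be an $(n|n)$-dimensional superspace with a non-degenerate odd symmetric form $\beta$, i.e. $\beta(v,w)=\beta(w,v)$ and $\beta(v,w)=0$ if $p(v)=p(w)$. Then $\mathfrak{p}(n)\subset\mathfrak{gl}(V_n)=\operatorname{End}_{\mathbb C}(V_n)$ is spanned by the homogeneous $X$ with $\beta(Xv,w)+(-1)^{p(X)p(v)}\beta(v,Xw)=0$ for all homogeneous $v,w$. In dual bases $v_1,\dots,v_n$ of $(V_n)_{\bar 0}$ and $v_{1'},\dots,v_{n'}$ of $(V_n)_{\bar 1}$, its elements are the matrices $\begin{pmatrix}A&B\\ C&-A^t\end{pmatrix}$ with $B^t=B$, $C^t=-C$. Let $\mathfrak{p}(n)_0\cong\mathfrak{gl}(n)$, $\mathfrak{p}(n)_{-1}$, $\mathfrak{p}(n)_1$ be the subspaces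 of $A$-, $C$-, $B$-matrices respectively. $\mathcal{F}_n$ is the category of finite-dimensional $\mathfrak{p}(n)$-modules whose restriction to $\mathfrak{p}(n)_{\bar 0}\cong\mathfrak{gl}(n)$ integrates to an action of $GL(n)$; morphisms are the grading-preserving $\mathfrak{p}(n)$-morphisms. $M^*$ is the usual dual module of a module over a Lie superalgebra. Weights: $\varepsilon_i$ is the weight of $v_i$ with respect to the diagonal Cartan subalgebra. The positive roots are those with simple roots $\varepsilon_2-\varepsilon_1,\dots,\varepsilon_n-\varepsilon_{n-1},-\varepsilon_{n-1}-\varepsilon_n$, i.e. the positive root vectors are the even ones of roots $\varepsilon_j-\varepsilon_i$ ($j>i$) together with all of $\mathfrak{p}(n)_{-1}$. Dominant integral weights are $\lambda=\sum_i\lambda_i\varepsilon_i$ with $\lambda_i\in\mathbb{Z}$, $\lambda_1\le\dots\le\lambda_n$. $L_n(\lambda)$ is the simple module in $\mathcal{F}_n$ with even highest weight vector of weight $\lambda$; every simple object of $\mathcal{F}_n$ is $L_n(\lambda)$ or $\Pi L_n(\lambda)$ for a unique dominant $\lambda$. Blocks: let $\rho^{(n)}=\sum_{i=1}^n(i-1)\varepsilon_i$, $\bar\lambda=\lambda+\rho^{(n)}$ and $\kappa(\lambda)=\sum_i(-1)^{\bar\lambda_i}$. For $l\in\{-n,-n+2,\dots,n\}$, $\mathcal{F}_n^l$ is the full subcategory of $\mathcal{F}_n$ of modules all of whose simple subquotients are of the form $L_n(\lambda)$ or $\Pi L_n(\lambda)$ with $\kappa(\lambda)=l$. It is known that $\mathcal{F}_n=\bigoplus_l\mathcal{F}_n^l$;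 the $\mathcal{F}_n^l$ are called blocks (up to parity). Tensor Casimir: there is a $\mathfrak{p}(n)$-equivariant decomposition $\mathfrak{gl}(V_n)=\mathfrak{p}(n)\oplus\mathfrak{p}(n)^*$, where $\mathfrak{p}(n)^*$ denotes the span of the homogeneous $X$ with $\beta(Xv,w)=(-1)^{p(X)p(v)}\beta(v,Xw)$; both summands are isotropic for the supertrace form and are in duality under it. Choose a homogeneous basis $\{X_i\}$ of $\mathfrak{p}(n)$ and the dual basis $\{X^i\}$ of $\mathfrak{p}(n)^*\subset\mathfrak{gl}(V_n)$, normalized by $\tfrac12\operatorname{str}(X^iX_j)=\delta_{ij}$. For $M\in\mathcal{F}_n$ the tensor Casimir is the $\mathfrak{p}(n)$-endomorphism $\Omega_M^{(n)}=\sum_iX_i|_M\otimes X^i|_{V_n}$ of $M\otimes V_n$, i.e. $m\otimes v\mapsto\sum_i(-1)^{p(X^i)p(m)}X_im\otimes X^iv$ (equivalently, via the symmetry, an endomorphism of $V_n\otimes M$). Translation functors: for $k\in\mathbb{Z}$, $\Theta'^{(n)}_k(M)=\bigcup_{m>0}\operatorname{Ker}(\Omega_M^{(n)}-k\operatorname{Id})^m\subset M\otimes V_n$, and $\Theta_k^{(n)}=\Pi^k\Theta'^{(n)}_k:\mathcal{F}_n\to\mathcal{F}_n$. *)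

theory Defs
  imports Complex_Main "HOL-Library.Function_Algebras" "HOL-Library.Z2"
begin

section \<open>Complex vector spaces\<close>

class complex_space = ab_group_add +
  fixes cscale :: "complex \<Rightarrow> 'a \<Rightarrow> 'a"  (infixr "*\<^sub>C" 75)
  assumes cscale_add_right: "c *\<^sub>C (x + y) = c *\<^sub>C x + c *\<^sub>C y"
    and cscale_add_left: "(c + d) *\<^sub>C x = c *\<^sub>C x + d *\<^sub>C x"
    and cscale_cscale: "c *\<^sub>C d *\<^sub>C x = (c * d) *\<^sub>C x"
    and cscale_one: "1 *\<^sub>C x = x"

global_interpretation cvs: vector_space "cscale :: complex \<Rightarrow> 'a::complex_space \<Rightarrow> 'a"
  by unfold_locales (rule cscale_add_right cscale_add_left cscale_cscale cscale_one)+

instantiation complex :: complex_space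
begin
definition cscale_complex :: "complex \<Rightarrow> complex \<Rightarrow> complex"
  where "cscale_complex c x = c * x"
instance
  by standard (simp_all add: cscale_complex_def algebra_simps)
end

instantiation "fun" :: (type, complex_space) complex_space
begin
definition cscale_fun :: "complex \<Rightarrow> ('a \<Rightarrow> 'b) \<Rightarrow> 'a \<Rightarrow> 'b"
  where "cscale_fun c f = (\<lambda>x. c *\<^sub>C f x)"
instance
  by standard (simp_all add: cscale_fun_def fun_eq_iff
      cscale_add_right cscale_add_left cscale_cscale cscale_one)
end

definition linear_between ::
    "'a::complex_space set \<Rightarrow> 'b::complex_space set \<Rightarrow> ('a \<Rightarrow> 'b) \<Rightarrow> bool" where
  "linear_between S T f \<longleftrightarrow>
     (\<forall>x\<in>S. f x \<in> T) \<and>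
     (\<forall>x\<in>S. \<forall>y\<in>S. f (x + y) = f x + f y) \<and>
     (\<forall>c. \<forall>x\<in>S. f (c *\<^sub>C x) = c *\<^sub>C f x)"


section \<open>Matrices over an index set\<close>

text \<open>Square matrices with rows and columns indexed by a finite set \<open>I\<close> are functions of two
  indices that vanish outside \<open>I \<times> I\<close>.\<close>

definition mmul :: "'i set \<Rightarrow> ('i \<Rightarrow> 'i \<Rightarrow> complex) \<Rightarrow> ('i \<Rightarrow> 'i \<Rightarrow> complex) \<Rightarrow> 'i \<Rightarrow> 'i \<Rightarrow> complex"
  where "mmul I X Y = (\<lambda>i j. \<Sum>k\<in>I. X i k * Y k j)"

definition mone :: "'i set \<Rightarrow> 'i \<Rightarrow> 'i \<Rightarrow> complex"
  where "mone I = (\<lambda>i j. if i \<in> I \<and> i = j then 1 else 0)"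

definition mats :: "'i set \<Rightarrow> ('i \<Rightarrow> 'i \<Rightarrow> complex) set"
  where "mats I = {X. \<forall>i j. X i j \<noteq> 0 \<longrightarrow> i \<in> I \<and> j \<in> I}"

definition GL :: "nat \<Rightarrow> (nat \<Rightarrow> nat \<Rightarrow> complex) set"
  where "GL n = {g \<in> mats {1..n}. \<exists>h \<in> mats {1..n}.
                   mmul {1..n} g h = mone {1..n} \<and> mmul {1..n} h g = mone {1..n}}"


section \<open>The superspace \<open>V\<^sub>n\<close> and the periplectic Lie superalgebra\<close>

text \<open>Parities are elements of \<open>\<int>/2\<int>\<close>, represented by the type \<open>bit\<close>. The basis vector
  \<open>v\<^sub>i\<close> has index \<open>Inl i\<close> and \<open>v\<^sub>i\<^sub>'\<close> has index \<open>Inr i\<close>, for \<open>1 \<le> i \<le> n\<close>.\<close>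

definition psign :: "bit \<Rightarrow> complex"
  where "psign p = (if p = 0 then 1 else -1)"

type_synonym ix = "nat + nat"
type_synonym gl = "ix \<Rightarrow> ix \<Rightarrow> complex"

definition idx :: "nat \<Rightarrow> ix set"
  where "idx n = {1..n} <+> {1..n}"

definition par :: "ix \<Rightarrow> bit"
  where "par i = case_sum (\<lambda>_. 0) (\<lambda>_. 1) i"

definition V_homog :: "nat \<Rightarrow> bit \<Rightarrow> (ix \<Rightarrow> complex) set"
  where "V_homog n p = {v. \<forall>i. v i \<noteq> 0 \<longrightarrow> i \<in> idx n \<and> par i = p}"

definition mat_vec :: "nat \<Rightarrow> gl \<Rightarrow> (ix \<Rightarrow> complex) \<Rightarrow> ix \<Rightarrow> complex"
  where "mat_vec n X v = (\<lambda>i. \<Sum>j\<in>idx n. X i j * v j)"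

definition oddform :: "nat \<Rightarrow> (ix \<Rightarrow> complex) \<Rightarrow> (ix \<Rightarrow> complex) \<Rightarrow> complex"
  where "oddform n v w = (\<Sum>i=1..n. v (Inl i) * w (Inr i) + v (Inr i) * w (Inl i))"

definition gl_homog :: "nat \<Rightarrow> bit \<Rightarrow> gl set"
  where "gl_homog n p = {X \<in> mats (idx n). \<forall>i j. X i j \<noteq> 0 \<longrightarrow> par i + par j = p}"

definition gl_part :: "bit \<Rightarrow> gl \<Rightarrow> gl"
  where "gl_part p X = (\<lambda>i j. if par i + par j = p then X i j else 0)"

definition supertrace :: "nat \<Rightarrow> gl \<Rightarrow> complex"
  where "supertrace n X = (\<Sum>i\<in>idx n. psign (par i) * X i i)"

definition pe_homog :: "nat \<Rightarrow> bit \<Rightarrow> gl set"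
  where "pe_homog n p = {X \<in> gl_homog n p. \<forall>q r. \<forall>v\<in>V_homog n q. \<forall>w\<in>V_homog n r.
           oddform n (mat_vec n X v) w + psign (p * q) * oddform n v (mat_vec n X w) = 0}"

definition pe :: "nat \<Rightarrow> gl set"
  where "pe n = cvs.span (\<Union>p. pe_homog n p)"

definition pe_dual_homog :: "nat \<Rightarrow> bit \<Rightarrow> gl set"
  where "pe_dual_homog n p = {X \<in> gl_homog n p. \<forall>q r. \<forall>v\<in>V_homog n q. \<forall>w\<in>V_homog n r.
           oddform n (mat_vec n X v) w = psign (p * q) * oddform n v (mat_vec n X w)}"

text \<open>The complement of \<open>pe n\<close> in \<open>gl(V\<^sub>n)\<close>, identified with the dual of \<open>pe n\<close> by the
  supertrace form.\<close>

definition pe_dual :: "nat \<Rightarrow> gl set"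
  where "pe_dual n = cvs.span (\<Union>p. pe_dual_homog n p)"

text \<open>The copy of \<open>gl(n)\<close> in \<open>pe n\<close>: the block matrix with diagonal blocks \<open>A\<close> and \<open>-A\<^sup>t\<close>.\<close>

definition gl_emb :: "(nat \<Rightarrow> nat \<Rightarrow> complex) \<Rightarrow> gl"
  where "gl_emb A = (\<lambda>i j. case (i, j) of
           (Inl a, Inl b) \<Rightarrow> A a b | (Inr a, Inr b) \<Rightarrow> - A b a | _ \<Rightarrow> 0)"

definition pe_minus :: "nat \<Rightarrow> gl set"
  where "pe_minus n = {X \<in> pe n. \<forall>i j. X i j \<noteq> 0 \<longrightarrow> i \<in> range Inr \<and> j \<in> range Inl}"


section \<open>Modules\<close>

text \<open>A module is carried by a subspace of an ambient type. The values of \<open>act\<close> matter only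
  for arguments in \<open>pe n\<close> and in the carrier \<open>carr M\<close>. Since \<open>nat \<Rightarrow> complex\<close> is an instance of
  the class, every finite-dimensional module occurs up to isomorphism.\<close>

record 'v smod =
  homog :: "bit \<Rightarrow> 'v set"
  act :: "gl \<Rightarrow> 'v \<Rightarrow> 'v"

definition carr :: "'v::complex_space smod \<Rightarrow> 'v set"
  where "carr M = {x + y | x y. x \<in> homog M 0 \<and> y \<in> homog M 1}"

definition hpart :: "'v::complex_space smod \<Rightarrow> bit \<Rightarrow> 'v \<Rightarrow> 'v"
  where "hpart M p x = (THE y. y \<in> homog M p \<and> (\<exists>z\<in>homog M (p + 1). x = y + z))"

definition pe_module :: "nat \<Rightarrow> 'v::complex_space smod \<Rightarrow> bool" where
  "pe_module n M \<longleftrightarrow>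
     (\<forall>p. cvs.subspace (homog M p)) \<and> homog M 0 \<inter> homog M 1 = {0} \<and>
     (\<forall>X\<in>pe n. linear_between (carr M) (carr M) (act M X)) \<and>
     (\<forall>x\<in>carr M. linear_between (pe n) (carr M) (\<lambda>X. act M X x)) \<and>
     (\<forall>p q. \<forall>X\<in>pe_homog n p. \<forall>x\<in>homog M q. act M X x \<in> homog M (p + q)) \<and>
     (\<forall>p q. \<forall>X\<in>pe_homog n p. \<forall>Y\<in>pe_homog n q. \<forall>x\<in>carr M.
        act M (mmul (idx n) X Y - psign (p * q) *\<^sub>C mmul (idx n) Y X) x
          = act M X (act M Y x) - psign (p * q) *\<^sub>C act M Y (act M X x))"

definition one_param :: "nat \<Rightarrow> (nat \<Rightarrow> nat \<Rightarrow> complex) \<Rightarrow> (complex \<Rightarrow> nat \<Rightarrow> nat \<Rightarrow> complex) \<Rightarrow> bool"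
  where "one_param n A \<gamma> \<longleftrightarrow>
     (\<forall>t. \<gamma> t \<in> GL n) \<and> (\<forall>s t. \<gamma> (s + t) = mmul {1..n} (\<gamma> s) (\<gamma> t)) \<and>
     (\<forall>i j. ((\<lambda>t. \<gamma> t i j) has_field_derivative A i j) (at 0))"

text \<open>The restriction to \<open>gl(n)\<close> integrates to \<open>GL(n)\<close>: there is an action \<open>G\<close> of the group
  whose derivative along every complex one-parameter subgroup is the given action of \<open>gl(n)\<close>.
  Derivatives in the finite-dimensional carrier are tested against all linear functionals.\<close>

definition integrates :: "nat \<Rightarrow> 'v::complex_space smod \<Rightarrow> bool" where
  "integrates n M \<longleftrightarrow> (\<exists>G.
     (\<forall>g\<in>GL n. linear_between (carr M) (carr M) (G g) \<and> (\<forall>p. G g ` homog M p \<subseteq> homog M p)) \<and>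
     (\<forall>x\<in>carr M. G (mone {1..n}) x = x) \<and>
     (\<forall>g\<in>GL n. \<forall>h\<in>GL n. \<forall>x\<in>carr M. G (mmul {1..n} g h) x = G g (G h x)) \<and>
     (\<forall>A\<in>mats {1..n}. \<forall>\<gamma>. one_param n A \<gamma> \<longrightarrow>
        (\<forall>x\<in>carr M. \<forall>\<xi>::'v \<Rightarrow> complex. linear_between (carr M) UNIV \<xi> \<longrightarrow>
           ((\<lambda>t. \<xi> (G (\<gamma> t) x)) has_field_derivative \<xi> (act M (gl_emb A) x)) (at 0))))"

definition in_F :: "nat \<Rightarrow> 'v::complex_space smod \<Rightarrow> bool" where
  "in_F n M \<longleftrightarrow> pe_module n M \<and> (\<exists>B. finite B \<and> carr M \<subseteq> cvs.span B) \<and> integrates n M"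

definition mod_hom ::
    "nat \<Rightarrow> 'v::complex_space smod \<Rightarrow> 'w::complex_space smod \<Rightarrow> ('v \<Rightarrow> 'w) \<Rightarrow> bool" where
  "mod_hom n M N f \<longleftrightarrow>
     linear_between (carr M) (carr N) f \<and> (\<forall>p. f ` homog M p \<subseteq> homog N p) \<and>
     (\<forall>X\<in>pe n. \<forall>x\<in>carr M. f (act M X x) = act N X (f x))"

definition mod_iso ::
    "nat \<Rightarrow> 'v::complex_space smod \<Rightarrow> 'w::complex_space smod \<Rightarrow> ('v \<Rightarrow> 'w) \<Rightarrow> bool" where
  "mod_iso n M N f \<longleftrightarrow> mod_hom n M N f \<and> bij_betw f (carr M) (carr N)"

definition isomorphic :: "nat \<Rightarrow> 'v::complex_space smod \<Rightarrow> 'w::complex_space smod \<Rightarrow> bool" where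
  "isomorphic n M N \<longleftrightarrow> (\<exists>f. mod_iso n M N f)"

definition submodule :: "nat \<Rightarrow> 'v::complex_space smod \<Rightarrow> 'v smod \<Rightarrow> bool" where
  "submodule n N M \<longleftrightarrow> pe_module n N \<and> act N = act M \<and> (\<forall>p. homog N p \<subseteq> homog M p)"

definition simple_mod :: "nat \<Rightarrow> 'v::complex_space smod \<Rightarrow> bool" where
  "simple_mod n M \<longleftrightarrow> pe_module n M \<and> carr M \<noteq> {0} \<and>
     (\<forall>N. submodule n N M \<longrightarrow> carr N = {0} \<or> carr N = carr M)"

text \<open>\<open>S\<close> is a quotient of a submodule of \<open>M\<close>, up to isomorphism. Every quotient \<open>N/K\<close> can be
  carried by a graded complement of \<open>K\<close> in \<open>N\<close>, so it is enough to let \<open>S\<close> range over modules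
  in the ambient type of \<open>M\<close>.\<close>

definition subquotient :: "nat \<Rightarrow> 'v::complex_space smod \<Rightarrow> 'v smod \<Rightarrow> bool" where
  "subquotient n S M \<longleftrightarrow> pe_module n S \<and>
     (\<exists>N f. submodule n N M \<and> mod_hom n N S f \<and> f ` carr N = carr S)"


subsection \<open>Parity change, duals and tensor products with \<open>V\<^sub>n\<close>\<close>

text \<open>The underlying space of \<open>\<Pi>M\<close> is that of \<open>M\<close> with the grading exchanged and
  \<open>X(\<pi>m) = (-1)\<^bsup>p(X)\<^esup> \<pi>(Xm)\<close>. Hence \<open>\<Pi>\<^sup>2\<close> is the identity, and \<open>\<Pi>\<^sup>k\<close> depends only
  on the parity of \<open>k\<close>. On morphisms, \<open>\<Pi>f\<close> is the same map as \<open>f\<close>.\<close>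

definition Pi_mod :: "'v::complex_space smod \<Rightarrow> 'v smod" where
  "Pi_mod M = \<lparr>homog = (\<lambda>p. homog M (p + 1)),
     act = (\<lambda>X x. \<Sum>p\<in>{0,1}. psign p *\<^sub>C act M (gl_part p X) x)\<rparr>"

definition Pi_pow :: "int \<Rightarrow> 'v::complex_space smod \<Rightarrow> 'v smod" where
  "Pi_pow k M = (if even k then M else Pi_mod M)"

text \<open>Functionals on the carrier are represented by functions that vanish outside it. For
  homogeneous \<open>X\<close> and \<open>\<phi>\<close>, \<open>(X\<phi>)(m) = -(-1)\<^bsup>p(X)p(\<phi>)\<^esup> \<phi>(Xm)\<close>; the parity-\<open>q\<close>
  component of \<open>\<phi>\<close> is \<open>\<phi>\<close> composed with the projection to the parity-\<open>q\<close> part of \<open>M\<close>.\<close>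

definition dual_mod :: "'v::complex_space smod \<Rightarrow> ('v \<Rightarrow> complex) smod" where
  "dual_mod M = \<lparr>
     homog = (\<lambda>p. {\<phi>. linear_between (carr M) UNIV \<phi> \<and> (\<forall>x. x \<notin> carr M \<longrightarrow> \<phi> x = 0) \<and>
                      (\<forall>x\<in>homog M (p + 1). \<phi> x = 0)}),
     act = (\<lambda>X \<phi> x. if x \<in> carr M
              then - (\<Sum>p\<in>{0,1}. \<Sum>q\<in>{0,1}. psign (p * q) * \<phi> (hpart M q (act M (gl_part p X) x)))
              else 0)\<rparr>"

definition dual_map :: "'v::complex_space smod \<Rightarrow> ('v \<Rightarrow> 'w) \<Rightarrow> ('w \<Rightarrow> complex) \<Rightarrow> 'v \<Rightarrow> complex"
  where "dual_map M f \<phi> = (\<lambda>x. if x \<in> carr M then \<phi> (f x) else 0)"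

text \<open>An element \<open>t\<close> of \<open>M \<otimes> V\<^sub>n\<close> is represented by its coordinates: \<open>t\<close> stands for
  \<open>\<Sum>\<^sub>j t(j) \<otimes> v\<^sub>j\<close>. \<open>tensor_op n M a Y\<close> is the operator
  \<open>m \<otimes> v \<mapsto> (-1)\<^bsup>p(Y)p(m)\<^esup> a(m) \<otimes> Yv\<close>, extended bilinearly; the matrix entry
  \<open>Y i j\<close> belongs to the component of \<open>Y\<close> of parity \<open>par i + par j\<close>.\<close>

definition tensor_op ::
    "nat \<Rightarrow> 'v::complex_space smod \<Rightarrow> ('v \<Rightarrow> 'v) \<Rightarrow> gl \<Rightarrow> (ix \<Rightarrow> 'v) \<Rightarrow> ix \<Rightarrow> 'v" where
  "tensor_op n M a Y t = (\<lambda>i. \<Sum>j\<in>idx n. \<Sum>q\<in>{0,1}.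
     (psign ((par i + par j) * q) * Y i j) *\<^sub>C a (hpart M q (t j)))"

definition tensor_V :: "nat \<Rightarrow> 'v::complex_space smod \<Rightarrow> (ix \<Rightarrow> 'v) smod" where
  "tensor_V n M = \<lparr>
     homog = (\<lambda>p. {t. (\<forall>j\<in>idx n. t j \<in> homog M (p + par j)) \<and> (\<forall>j. j \<notin> idx n \<longrightarrow> t j = 0)}),
     act = (\<lambda>X t. tensor_op n M (act M X) (mone (idx n)) t + tensor_op n M id X t)\<rparr>"


subsection \<open>The tensor Casimir and translation functors\<close>

text \<open>\<open>B\<close> is a homogeneous basis of \<open>pe n\<close> and \<open>D\<close> maps its elements \<open>X\<^sub>i\<close> to the elements
  \<open>X\<^sup>i\<close> of the dual basis.\<close>

definition dual_bases :: "nat \<Rightarrow> gl set \<Rightarrow> (gl \<Rightarrow> gl) \<Rightarrow> bool" where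
  "dual_bases n B D \<longleftrightarrow>
     B \<subseteq> (\<Union>p. pe_homog n p) \<and> cvs.independent B \<and> cvs.span B = pe n \<and>
     (\<forall>b\<in>B. D b \<in> pe_dual n) \<and>
     (\<forall>b\<in>B. \<forall>c\<in>B. supertrace n (mmul (idx n) (D b) c) / 2 = (if b = c then 1 else 0))"

definition casimir ::
    "nat \<Rightarrow> gl set \<Rightarrow> (gl \<Rightarrow> gl) \<Rightarrow> 'v::complex_space smod \<Rightarrow> (ix \<Rightarrow> 'v) \<Rightarrow> ix \<Rightarrow> 'v"
  where "casimir n B D M t = (\<Sum>b\<in>B. tensor_op n M (act M b) (D b) t)"

definition Theta' ::
    "nat \<Rightarrow> gl set \<Rightarrow> (gl \<Rightarrow> gl) \<Rightarrow> int \<Rightarrow> 'v::complex_space smod \<Rightarrow> (ix \<Rightarrow> 'v) smod" where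
  "Theta' n B D k M = \<lparr>
     homog = (\<lambda>p. {t \<in> homog (tensor_V n M) p.
        \<exists>m>0. ((\<lambda>s. casimir n B D M s - of_int k *\<^sub>C s) ^^ m) t = 0}),
     act = act (tensor_V n M)\<rparr>"

definition Theta ::
    "nat \<Rightarrow> gl set \<Rightarrow> (gl \<Rightarrow> gl) \<Rightarrow> int \<Rightarrow> 'v::complex_space smod \<Rightarrow> (ix \<Rightarrow> 'v) smod"
  where "Theta n B D k M = Pi_pow k (Theta' n B D k M)"

text \<open>The value of every \<open>Theta n B D k\<close> on a morphism \<open>f\<close> is the restriction of
  \<open>f \<otimes> id\<close>.\<close>

definition Theta_map :: "('v \<Rightarrow> 'w) \<Rightarrow> (ix \<Rightarrow> 'v) \<Rightarrow> ix \<Rightarrow> 'w"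
  where "Theta_map f t = (\<lambda>j. f (t j))"


section \<open>Simple modules and blocks\<close>

definition dominant :: "nat \<Rightarrow> (nat \<Rightarrow> int) \<Rightarrow> bool"
  where "dominant n wt \<longleftrightarrow> (\<forall>i\<in>{1..n}. \<forall>j\<in>{1..n}. i \<le> j \<longrightarrow> wt i \<le> wt j)"

definition has_weight :: "nat \<Rightarrow> 'v::complex_space smod \<Rightarrow> (nat \<Rightarrow> int) \<Rightarrow> 'v \<Rightarrow> bool" where
  "has_weight n M wt x \<longleftrightarrow> (\<forall>a :: nat \<Rightarrow> complex.
     act M (gl_emb (\<lambda>i j. if i = j \<and> i \<in> {1..n} then a i else 0)) x
       = (\<Sum>i=1..n. of_int (wt i) * a i) *\<^sub>C x)"

text \<open>The even positive root vectors are the images of the matrix units \<open>E\<^sub>j\<^sub>i\<close> with \<open>i < j\<close>,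
  of weight \<open>\<epsilon>\<^sub>j - \<epsilon>\<^sub>i\<close>; the odd ones span \<open>pe_minus n\<close>.\<close>

definition highest_weight_vector ::
    "nat \<Rightarrow> 'v::complex_space smod \<Rightarrow> (nat \<Rightarrow> int) \<Rightarrow> 'v \<Rightarrow> bool" where
  "highest_weight_vector n M wt x \<longleftrightarrow>
     x \<in> carr M \<and> x \<noteq> 0 \<and> has_weight n M wt x \<and>
     (\<forall>i\<in>{1..n}. \<forall>j\<in>{1..n}. i < j \<longrightarrow>
        act M (gl_emb (\<lambda>r s. if r = j \<and> s = i then 1 else 0)) x = 0) \<and>
     (\<forall>X\<in>pe_minus n. act M X x = 0)"

text \<open>\<open>S\<close> is a model of the simple module \<open>L\<^sub>n(wt)\<close>, which is determined up to isomorphism.\<close>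

definition is_L :: "nat \<Rightarrow> (nat \<Rightarrow> int) \<Rightarrow> 'v::complex_space smod \<Rightarrow> bool" where
  "is_L n wt S \<longleftrightarrow> in_F n S \<and> simple_mod n S \<and>
     (\<exists>x\<in>homog S 0. highest_weight_vector n S wt x)"

definition rho :: "nat \<Rightarrow> int"
  where "rho i = int i - 1"

definition kappa :: "nat \<Rightarrow> (nat \<Rightarrow> int) \<Rightarrow> int"
  where "kappa n wt = (\<Sum>i=1..n. if even (wt i + rho i) then 1 else -1)"

definition block_labels :: "nat \<Rightarrow> int set"
  where "block_labels n = {- int n + 2 * int j | j. j \<le> n}"

definition in_block :: "nat \<Rightarrow> int \<Rightarrow> 'v::complex_space smod \<Rightarrow> bool" where
  "in_block n l M \<longleftrightarrow> in_F n M \<and>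
     (\<forall>S. subquotient n S M \<and> simple_mod n S \<longrightarrow>
        (\<exists>wt (T :: 'v smod). dominant n wt \<and> kappa n wt = l \<and> is_L n wt T \<and>
           (isomorphic n S T \<or> isomorphic n S (Pi_mod T))))"

definition block_objects :: "nat \<Rightarrow> 'v::complex_space smod set"
  where "block_objects n = {M. \<exists>l\<in>block_labels n. in_block n l M}"

end

theory Submission
  imports Defs
begin

text \<open>
  The form \<open>\<beta>\<close> identifies \<open>V\<^sub>n\<close> with \<open>\<Pi>V\<^sub>n\<^sup>*\<close> and hence \<open>M\<^sup>* \<otimes> V\<^sub>n\<close> with \<open>\<Pi>(M \<otimes> V\<^sub>n)\<^sup>*\<close>.
  Under this identification the tensor Casimir of \<open>M\<^sup>*\<close> becomes minus the transpose of that of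
  \<open>M\<close>, because elements of \<open>p(n)\<close> are skew and elements of its complement are self-adjoint for
  \<open>\<beta>\<close>. By the Fitting decomposition the generalized eigenspace for \<open>k\<close> is then dual to the one
  for \<open>-k\<close>, which is (2).

  For (1), a simple subquotient of \<open>M\<^sup>*\<close> is up to parity the dual of a simple subquotient
  \<open>L(\<lambda>)\<close> of \<open>M\<close>, and its highest weight is minus the weight of a vector of \<open>L(\<lambda>)\<close> that is
  singular for the opposite Borel subalgebra. The opposite Borel subalgebra is reached through a
  chain of Borel subalgebras, each given by a complete isotropic flag, i.e. by a list with one
  entry \<open>\<plusminus>\<epsilon>\<^sub>i\<close> for each \<open>i\<close>; consecutive ones differ by an adjacent transposition
  or by a sign change of the last entry. The invariant is the alternating sum of the signs
  \<open>(-1)\<^bsup>a\<^esup>\<close>, where \<open>a\<close> runs through the entries of the weight in the order of the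
  list: an even reflection permutes the weight along with the list; an odd one either changes the
  parity of both entries that trade places, or fixes the weight, and then the two entries are
  opposite; the sign change, whose root \<open>\<plusminus>2\<epsilon>\<^sub>i\<close> has no negative, fixes the weight.
  The invariant is \<open>\<kappa>\<close> at both ends of the chain.
\<close>

section \<open>Parities and matrices\<close>

text \<open>Root vectors are indexed by all pairs of basis indices, although \<open>(p, q)\<close>
  and \<open>(dix q, dix p)\<close> give proportional ones and some vanish: \<open>rootm p q\<close>
  is twice the projection of a matrix unit to \<open>pe n\<close>, and brackets then follow a single
  formula for even and odd roots alike. The factor 2 matches the normalisation by half the
  supertrace and yields the explicit form \<open>cas\<close> of the Casimir operator, in which no
  basis is left. For blocks, even reflections alone never exchange the two odd parts of p(n), so odd
  roots have to be crossed as well. For an even root, or an odd root whose negative is also a root,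
  the bracket of the two opposite root vectors controls the crossing; for
  \<open>2 \<epsilon>_i\<close> there is no such bracket. Here simplicity of the module is decisive:
  all its vectors singular for one order have the same degree, whereas a nonzero image under this
  root vector would be singular for the old order too, and of smaller degree.\<close>

declare add_bit_eq_xor [simp del] mult_bit_eq_and [simp del] bit_not_zero_iff [simp del] bit_not_one_iff [simp del]

lemma psign_simps [simp]: "psign 0 = 1" "psign 1 = -1"
  by (simp_all add: psign_def)

lemma psign_add: "psign (p + q) = psign p * psign q"
  by (cases p; cases q) simp_all

lemma psign_square [simp]: "psign p * psign p = 1" "psign p * (psign p * c) = c"
  by (cases p; simp)+

lemma psign_nonzero [simp]: "psign p \<noteq> 0"
  by (cases p) simp_all

lemma bit_plus_plus [simp]: "p + (p + q) = q" "p + q + q = p" for p q :: bit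
  by (cases p; cases q; simp)+

section \<open>The matching of basis indices given by the odd form\<close>

definition dix :: "ix \<Rightarrow> ix"
  where "dix = case_sum Inr Inl"

lemma dix_simps [simp]: "dix (Inl i) = Inr i" "dix (Inr i) = Inl i"
  by (simp_all add: dix_def)

lemma dix_dix [simp]: "dix (dix i) = i"
  by (cases i) simp_all

lemma dix_eq_iff [simp]: "dix i = dix j \<longleftrightarrow> i = j"
  by (metis dix_dix)

lemma dix_neq [simp]: "dix i \<noteq> i" "i \<noteq> dix i"
  by (cases i; simp)+

lemma dix_swap: "dix i = j \<longleftrightarrow> i = dix j"
  by auto

lemma par_simps [simp]: "par (Inl i) = 0" "par (Inr i) = 1" "par (dix j) = par j + 1"
  by (simp_all add: par_def) (cases j; simp)

lemma dix_in_idx [simp]: "dix i \<in> idx n \<longleftrightarrow> i \<in> idx n"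
  by (cases i) (auto simp: idx_def)

lemma finite_idx [simp]: "finite (idx n)"
  by (simp add: idx_def)

lemma Inl_in_idx [simp]: "Inl i \<in> idx n \<longleftrightarrow> i \<in> {1..n}"
  and Inr_in_idx [simp]: "Inr i \<in> idx n \<longleftrightarrow> i \<in> {1..n}"
  by (auto simp: idx_def)

lemma sum_dix: "(\<Sum>i\<in>idx n. f (dix i)) = (\<Sum>i\<in>idx n. f i)"
  by (rule sum.reindex_bij_witness[of _ dix dix]) auto

lemma sum_idx: "(\<Sum>i\<in>idx n. f i) = (\<Sum>i=1..n. f (Inl i)) + (\<Sum>i=1..n. f (Inr i))"
  unfolding idx_def by (subst sum.Plus) simp_all

lemma oddform_eq: "oddform n v w = (\<Sum>i\<in>idx n. v (dix i) * w i)"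
  by (simp add: oddform_def sum_idx sum.distrib add.commute)

section \<open>Skew and self-adjoint matrices for the odd form\<close>

definition uvec :: "ix \<Rightarrow> ix \<Rightarrow> complex"
  where "uvec j = (\<lambda>i. if i = j then 1 else 0)"

lemma uvec_homog: "j \<in> idx n \<Longrightarrow> uvec j \<in> V_homog n (par j)"
  by (auto simp: V_homog_def uvec_def)

lemma mat_vec_uvec: "j \<in> idx n \<Longrightarrow> mat_vec n X (uvec j) = (\<lambda>i. X i j)"
  by (auto simp: mat_vec_def uvec_def if_distrib sum.delta cong: if_cong)

text \<open>Serves both summands of \<open>gl(V)\<close>: \<open>\<sigma> = -1\<close> gives
  \<open>pe n\<close>, \<open>\<sigma> = 1\<close> its complement. By bilinearity the condition need
  only be tested on basis vectors. On entries, the parity \<open>p\<close> of \<open>X\<close> may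
  be replaced by \<open>par i + par j\<close>, which equals it wherever an entry is nonzero.\<close>

lemma form_adjoint_iff:
  assumes X: "X \<in> gl_homog n p"
  shows "(\<forall>q r. \<forall>v\<in>V_homog n q. \<forall>w\<in>V_homog n r.
            oddform n (mat_vec n X v) w = \<sigma> * psign (p * q) * oddform n v (mat_vec n X w))
     \<longleftrightarrow> (\<forall>i j. X i j = \<sigma> * psign ((par i + par j) * par j) * X (dix j) (dix i))"
    (is "?L \<longleftrightarrow> ?R")
proof
  assume L: ?L
  have par: "par i + par j = p" if "X i j \<noteq> 0" for i j
    using X that by (auto simp: gl_homog_def)
  have supp: "i \<in> idx n \<and> j \<in> idx n" if "X i j \<noteq> 0" for i j
    using X that by (auto simp: gl_homog_def mats_def)
  have *: "X i j = \<sigma> * psign (p * par j) * X (dix j) (dix i)" if ij: "i \<in> idx n" "j \<in> idx n" for i j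
  proof -
    \<comment> \<open>The form pairs index \<open>i\<close> with \<open>dix i\<close> only, so
      pairing with \<open>uvec (dix i)\<close> reads off coordinate \<open>i\<close>.\<close>
    have "oddform n (mat_vec n X (uvec j)) (uvec (dix i)) = X i j"
      using ij by (simp add: mat_vec_uvec) (simp add: oddform_eq uvec_def if_distrib sum.delta cong: if_cong)
    moreover have "oddform n (uvec j) (mat_vec n X (uvec (dix i))) = X (dix j) (dix i)"
      using ij by (simp add: mat_vec_uvec) (simp add: oddform_eq uvec_def dix_swap if_distrib[of "\<lambda>x. x * _"] sum.delta cong: if_cong)
    ultimately show ?thesis
      using L uvec_homog[of j n] uvec_homog[of "dix i" n] ij by (metis dix_in_idx)
  qed
  show ?R
  proof (intro allI)
    fix i j
    show "X i j = \<sigma> * psign ((par i + par j) * par j) * X (dix j) (dix i)"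
    proof (cases "X i j = 0 \<and> X (dix j) (dix i) = 0")
      case False
      then have "i \<in> idx n" "j \<in> idx n"
        using supp[of i j] supp[of "dix j" "dix i"] by auto
      moreover have "par i + par j = p"
        using par[of i j] par[of "dix j" "dix i"] False by (cases "par i"; cases "par j"; auto)
      ultimately show ?thesis
        using * by metis
    qed simp
  qed
next
  assume R: ?R
  show ?L
  proof (intro allI ballI)
    fix q r v w assume v: "v \<in> V_homog n q" and "w \<in> V_homog n r"
    have "oddform n (mat_vec n X v) w = (\<Sum>i\<in>idx n. \<Sum>j\<in>idx n. X (dix i) j * v j * w i)"
      by (simp add: oddform_eq mat_vec_def sum_distrib_right)
    also have "\<dots> = (\<Sum>i\<in>idx n. \<Sum>j\<in>idx n. \<sigma> * psign (p * q) * (v j * (X (dix j) i * w i)))"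
    proof (intro sum.cong refl)
      fix i j
      show "X (dix i) j * v j * w i = \<sigma> * psign (p * q) * (v j * (X (dix j) i * w i))"
      proof (cases "v j = 0 \<or> X (dix i) j = 0 \<and> X (dix j) i = 0")
        case True
        then show ?thesis by auto
      next
        case False
        then have "par j = q" using v by (auto simp: V_homog_def)
        moreover have "par (dix i) + par j = p"
        proof -
          have "par (dix i) + par j = p \<or> par (dix j) + par i = p"
            using False X unfolding gl_homog_def by blast
          then show ?thesis by (cases "par i"; cases "par j"; auto)
        qed
        moreover have "X (dix i) j = \<sigma> * psign ((par (dix i) + par j) * par j) * X (dix j) i"
          using R by (metis dix_dix)
        ultimately show ?thesis by (simp only: ac_simps)
      qed
    qed
    also have "\<dots> = \<sigma> * psign (p * q) * (\<Sum>j\<in>idx n. v j * mat_vec n X w (dix j))"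
      unfolding mat_vec_def sum_distrib_left by (subst sum.swap) simp
    also have "(\<Sum>j\<in>idx n. v j * mat_vec n X w (dix j)) = oddform n v (mat_vec n X w)"
      unfolding oddform_eq by (subst sum_dix[symmetric]) simp
    finally show "oddform n (mat_vec n X v) w = \<sigma> * psign (p * q) * oddform n v (mat_vec n X w)" .
  qed
qed

text \<open>Equality with \<open>\<sigma>\<close> times the adjoint for the odd form. Written
  entrywise, the condition is linear in \<open>X\<close> and makes sense for inhomogeneous
  matrices.\<close>

definition self_adj :: "complex \<Rightarrow> gl \<Rightarrow> bool"
  where "self_adj \<sigma> X \<longleftrightarrow> (\<forall>i j. X i j = \<sigma> * psign ((par i + par j) * par j) * X (dix j) (dix i))"

lemma self_adjD: "self_adj \<sigma> X \<Longrightarrow> X i j = \<sigma> * psign ((par i + par j) * par j) * X (dix j) (dix i)"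
  unfolding self_adj_def by blast

lemma pe_homog_iff: "X \<in> pe_homog n p \<longleftrightarrow> X \<in> gl_homog n p \<and> self_adj (-1) X"
proof -
  have "X \<in> pe_homog n p \<longleftrightarrow> X \<in> gl_homog n p \<and> (\<forall>q r. \<forall>v\<in>V_homog n q. \<forall>w\<in>V_homog n r.
            oddform n (mat_vec n X v) w = -1 * psign (p * q) * oddform n v (mat_vec n X w))"
    by (auto simp: pe_homog_def eq_neg_iff_add_eq_0)
  then show ?thesis
    using form_adjoint_iff[of X n p "-1"] unfolding self_adj_def by blast
qed

lemma pe_dual_homog_iff: "X \<in> pe_dual_homog n p \<longleftrightarrow> X \<in> gl_homog n p \<and> self_adj 1 X"
proof -
  have "X \<in> pe_dual_homog n p \<longleftrightarrow> X \<in> gl_homog n p \<and> (\<forall>q r. \<forall>v\<in>V_homog n q. \<forall>w\<in>V_homog n r.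
            oddform n (mat_vec n X v) w = 1 * psign (p * q) * oddform n v (mat_vec n X w))"
    by (auto simp: pe_dual_homog_def)
  then show ?thesis
    using form_adjoint_iff[of X n p 1] unfolding self_adj_def by blast
qed

lemma gl_apply [simp]: "((c::complex) *\<^sub>C X) i j = c * X i j" "(X + Y) i j = X i j + Y i j"
  "(X - Y) i j = X i j - Y i j" "(0::gl) i j = 0" for X Y :: gl
  by (simp_all add: cscale_fun_def cscale_complex_def zero_fun_def plus_fun_def)

lemma gl_sum_apply: "(\<Sum>a\<in>A. X a) i j = (\<Sum>a\<in>A. X a i j)" for X :: "'a \<Rightarrow> gl"
  by (induction A rule: infinite_finite_induct) simp_all

lemma gl_part_sum: "X = gl_part 0 X + gl_part 1 X"
proof (intro ext)
  fix i j
  show "X i j = (gl_part 0 X + gl_part 1 X) i j"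
    by (cases "par i + par j") (simp_all add: gl_part_def)
qed

lemma gl_part_homog: "X \<in> mats (idx n) \<Longrightarrow> gl_part p X \<in> gl_homog n p"
  by (auto simp: gl_homog_def gl_part_def mats_def)

lemma gl_part_self_adj: "self_adj \<sigma> X \<Longrightarrow> self_adj \<sigma> (gl_part p X)"
  unfolding self_adj_def gl_part_def
proof (intro allI)
  fix i j
  assume *: "\<forall>i j. X i j = \<sigma> * psign ((par i + par j) * par j) * X (dix j) (dix i)"
  have "par (dix j) + par (dix i) = par i + par j"
    by (cases "par i"; cases "par j"; simp)
  then show "(if par i + par j = p then X i j else 0) = \<sigma> * psign ((par i + par j) * par j) *
      (if par (dix j) + par (dix i) = p then X (dix j) (dix i) else 0)"
    using *[rule_format, of i j] by (auto simp: add.commute[of "par j" "par i"])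
qed

lemma subspace_self_adj: "cvs.subspace {X \<in> mats I. self_adj \<sigma> X}"
proof -
  have "self_adj \<sigma> (X + Y)" if "self_adj \<sigma> X" "self_adj \<sigma> Y" for X Y
    unfolding self_adj_def
  proof (intro allI)
    fix i j
    show "(X + Y) i j = \<sigma> * psign ((par i + par j) * par j) * (X + Y) (dix j) (dix i)"
      using self_adjD[OF that(1), of i j] self_adjD[OF that(2), of i j] by (simp add: algebra_simps)
  qed
  moreover have "self_adj \<sigma> (c *\<^sub>C X)" if "self_adj \<sigma> X" for X c
    unfolding self_adj_def
  proof (intro allI)
    fix i j
    show "(c *\<^sub>C X) i j = \<sigma> * psign ((par i + par j) * par j) * (c *\<^sub>C X) (dix j) (dix i)"
      using self_adjD[OF that(1), of i j] by (simp add: algebra_simps)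
  qed
  moreover have "self_adj \<sigma> 0"
    unfolding self_adj_def by simp
  ultimately show ?thesis
    unfolding cvs.subspace_def by (auto simp: mats_def) (metis add_cancel_right_left)+
qed

text \<open>The entries at \<open>(i, j)\<close> and \<open>(dix j, dix i)\<close> belong to the
  same parity, so the condition passes to the two parity parts of a matrix, and every solution is a
  sum of homogeneous ones.\<close>

lemma span_homog_self_adj:
  "cvs.span (\<Union>p. {X \<in> gl_homog n p. self_adj \<sigma> X}) = {X \<in> mats (idx n). self_adj \<sigma> X}" (is "cvs.span ?S = ?T")
proof (rule subset_antisym)
  show "cvs.span ?S \<subseteq> ?T"
    by (intro cvs.span_minimal subspace_self_adj) (auto simp: gl_homog_def)
  show "?T \<subseteq> cvs.span ?S"
  proof
  fix X assume X: "X \<in> ?T"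
  have "gl_part p X \<in> ?S" for p
    using X gl_part_homog[of X n p] gl_part_self_adj[of \<sigma> X p] by (intro UN_I[of p]) auto
  then have "gl_part 0 X + gl_part 1 X \<in> cvs.span ?S"
    by (intro cvs.span_add cvs.span_base)
  then show "X \<in> cvs.span ?S"
    using gl_part_sum[of X] by simp
  qed
qed

lemma pe_eq: "pe n = {X \<in> mats (idx n). self_adj (-1) X}"
  unfolding pe_def pe_homog_iff[abs_def] span_homog_self_adj[symmetric]
  by (rule arg_cong[where f = cvs.span]) (auto simp: pe_homog_iff)

lemma pe_dual_eq: "pe_dual n = {X \<in> mats (idx n). self_adj 1 X}"
  unfolding pe_dual_def span_homog_self_adj[symmetric]
  by (rule arg_cong[where f = cvs.span]) (auto simp: pe_dual_homog_iff)

lemma subspace_pe: "cvs.subspace (pe n)"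
  unfolding pe_eq by (rule subspace_self_adj)

lemma pe_homog_eq: "pe_homog n p = {X \<in> pe n. \<forall>i j. X i j \<noteq> 0 \<longrightarrow> par i + par j = p}"
  by (auto simp: pe_homog_iff pe_eq gl_homog_def)

lemma pe_homog_pe: "X \<in> pe_homog n p \<Longrightarrow> X \<in> pe n"
  by (auto simp: pe_homog_eq)

lemma pe_homog_par: "X \<in> pe_homog n p \<Longrightarrow> X i j \<noteq> 0 \<Longrightarrow> par i + par j = p"
  by (auto simp: pe_homog_eq)

lemma pe_idx: "X \<in> pe n \<Longrightarrow> X i j \<noteq> 0 \<Longrightarrow> i \<in> idx n \<and> j \<in> idx n"
  by (auto simp: pe_eq mats_def)

lemma pe_adj: "X \<in> pe n \<Longrightarrow> X i j = - psign ((par i + par j) * par j) * X (dix j) (dix i)"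
  using self_adjD[of "-1" X i j] by (simp add: pe_eq)

lemma gl_part_pe: "X \<in> pe n \<Longrightarrow> gl_part p X \<in> pe_homog n p"
  using gl_part_homog gl_part_self_adj by (auto simp: pe_homog_iff pe_eq)

lemma gl_part_homog_eq: "X \<in> pe_homog n p \<Longrightarrow> gl_part q X = (if p = q then X else 0)"
  by (auto simp: fun_eq_iff gl_part_def pe_homog_eq)

lemma gl_part_add: "gl_part p (X + Y) = gl_part p X + gl_part p Y"
  and gl_part_scale: "gl_part p (c *\<^sub>C X) = c *\<^sub>C gl_part p X"
  by (simp_all add: fun_eq_iff gl_part_def)

text \<open>Adjunction reverses products up to \<open>psign (p * q)\<close>, and the signs
  \<open>-1\<close> of the two factors cancel. So the adjoint of the product of \<open>X\<close> and
  \<open>Y\<close> is \<open>psign (p * q)\<close> times the product in the other order, and the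
  super commutator is again skew.\<close>

lemma mmul_pe_bracket:
  assumes X: "X \<in> pe_homog n p" and Y: "Y \<in> pe_homog n q"
  shows "mmul (idx n) X Y - psign (p * q) *\<^sub>C mmul (idx n) Y X \<in> pe_homog n (p + q)" (is "?Z \<in> _")
proof -
  note XY = pe_homog_pe[OF X] pe_homog_pe[OF Y]
  have "par i + par j = p + q" if Z: "?Z i j \<noteq> 0" for i j
  proof -
    have "(\<Sum>k\<in>idx n. X i k * Y k j) \<noteq> 0 \<or> (\<Sum>k\<in>idx n. Y i k * X k j) \<noteq> 0"
      using Z by (auto simp: mmul_def)
    then obtain k where "X i k * Y k j \<noteq> 0 \<or> Y i k * X k j \<noteq> 0"
      using sum.not_neutral_contains_not_neutral by (metis (lifting))
    then have "(par i + par k = p \<and> par k + par j = q) \<or> (par i + par k = q \<and> par k + par j = p)"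
      using pe_homog_par[OF X] pe_homog_par[OF Y] by auto
    then show ?thesis
      by (cases "par i"; cases "par j"; cases "par k"; auto)
  qed
  moreover have "i \<in> idx n \<and> j \<in> idx n" if Z: "?Z i j \<noteq> 0" for i j
  proof -
    have "(\<Sum>k\<in>idx n. X i k * Y k j) \<noteq> 0 \<or> (\<Sum>k\<in>idx n. Y i k * X k j) \<noteq> 0"
      using Z by (auto simp: mmul_def)
    then obtain k where "X i k * Y k j \<noteq> 0 \<or> Y i k * X k j \<noteq> 0"
      using sum.not_neutral_contains_not_neutral by (metis (lifting))
    then show ?thesis
      using pe_idx[OF XY(1)] pe_idx[OF XY(2)] by auto
  qed
  moreover have "self_adj (-1) ?Z"
    unfolding self_adj_def
  proof (intro allI)
    fix i j
    have "X i k * Y k j = psign ((par i + par j) * par j) * psign (p * q) * (Y (dix j) (dix k) * X (dix k) (dix i))" for k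
    proof (cases "X i k * Y k j = 0")
      case True
      then have "X (dix k) (dix i) = 0 \<or> Y (dix j) (dix k) = 0"
        using pe_adj[OF XY(1), of i k] pe_adj[OF XY(2), of k j] by auto
      then show ?thesis using True by auto
    next
      case False
      then have p: "p = par i + par k" "q = par k + par j"
        using pe_homog_par[OF X] pe_homog_par[OF Y] by auto
      show ?thesis
        unfolding pe_adj[OF XY(1), of i k] pe_adj[OF XY(2), of k j] p
        by (cases "par i"; cases "par j"; cases "par k"; simp)
    qed
    note 1 = this
    have "Y i k * X k j = psign ((par i + par j) * par j) * psign (p * q) * (X (dix j) (dix k) * Y (dix k) (dix i))" for k
    proof (cases "Y i k * X k j = 0")
      case True
      then have "Y (dix k) (dix i) = 0 \<or> X (dix j) (dix k) = 0"
        using pe_adj[OF XY(2), of i k] pe_adj[OF XY(1), of k j] by auto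
      then show ?thesis using True by auto
    next
      case False
      then have p: "q = par i + par k" "p = par k + par j"
        using pe_homog_par[OF X] pe_homog_par[OF Y] by auto
      show ?thesis
        unfolding pe_adj[OF XY(2), of i k] pe_adj[OF XY(1), of k j] p
        by (cases "par i"; cases "par j"; cases "par k"; simp)
    qed
    note 2 = this
    have "mmul (idx n) X Y i j = psign ((par i + par j) * par j) * psign (p * q) * mmul (idx n) Y X (dix j) (dix i)"
      unfolding mmul_def sum_distrib_left by (subst sum_dix[symmetric], rule sum.cong[OF refl]) (simp add: 1)
    moreover have "mmul (idx n) Y X i j = psign ((par i + par j) * par j) * psign (p * q) * mmul (idx n) X Y (dix j) (dix i)"
      unfolding mmul_def sum_distrib_left by (subst sum_dix[symmetric], rule sum.cong[OF refl]) (simp add: 2)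
    ultimately show "?Z i j = -1 * psign ((par i + par j) * par j) * ?Z (dix j) (dix i)"
      by (cases p; cases q; simp add: algebra_simps)
  qed
  ultimately show ?thesis
    by (auto simp: pe_homog_eq pe_eq mats_def)
qed


section \<open>Root vectors\<close>

text \<open>A matrix unit minus its adjoint, which is twice its projection to \<open>pe n\<close>.
  It is a root vector of weight \<open>\<epsilon>_p - \<epsilon>_q\<close>, where
  \<open>\<epsilon>\<close> changes sign under \<open>dix\<close>. For \<open>p = q\<close> it lies
  in the Cartan subalgebra, and \<open>rootm (Inr i) (Inl i)\<close> is zero, because
  \<open>-2 \<epsilon>_i\<close> is not a root.\<close>

definition rootm :: "ix \<Rightarrow> ix \<Rightarrow> gl" where
  "rootm p q = (\<lambda>i j. (if i = p \<and> j = q then 1 else 0)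
     - psign ((par p + par q) * par q) * (if i = dix q \<and> j = dix p then 1 else 0))"

lemma rootm_of_bool: "rootm p q i j = of_bool (i = p \<and> j = q)
    - psign ((par p + par q) * par q) * of_bool (i = dix q \<and> j = dix p)"
  unfolding rootm_def of_bool_def by (simp only:)

lemma rootm_pe_homog:
  assumes "p \<in> idx n" "q \<in> idx n"
  shows "rootm p q \<in> pe_homog n (par p + par q)"
proof -
  have "self_adj (-1) (rootm p q)"
    unfolding self_adj_def
  proof (intro allI)
    fix i j
    define s where "s = psign ((par p + par q) * par q)"
    define t where "t = psign ((par i + par j) * par j)"
    have "t = s" if "i = p \<and> j = q \<or> i = dix q \<and> j = dix p"
    proof -
      have "(par i = par p \<and> par j = par q) \<or> (par i = par q + 1 \<and> par j = par p + 1)"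
        using that by force
      then show ?thesis
        unfolding s_def t_def by (cases "par p"; cases "par q") (elim disjE conjE; simp)+
    qed
    moreover have "rootm p q i j = of_bool (i = p \<and> j = q) - s * of_bool (i = dix q \<and> j = dix p)"
      unfolding rootm_of_bool s_def ..
    moreover have "rootm p q (dix j) (dix i) = of_bool (i = dix q \<and> j = dix p) - s * of_bool (i = p \<and> j = q)"
      unfolding rootm_of_bool s_def by (intro arg_cong2[where f = "(-)"] arg_cong2[where f = "(*)"] arg_cong[where f = of_bool] refl) force+
    moreover have "s * s = 1"
      by (simp add: s_def)
    ultimately show "rootm p q i j = -1 * psign ((par i + par j) * par j) * rootm p q (dix j) (dix i)"
      unfolding t_def[symmetric] by (cases "i = p \<and> j = q"; cases "i = dix q \<and> j = dix p"; simp only: of_bool_eq; simp add: algebra_simps)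
  qed
  then show ?thesis
    using assms by (auto simp: pe_homog_iff gl_homog_def mats_def rootm_def ac_simps split: if_splits)
qed

lemma rootm_pe: "p \<in> idx n \<Longrightarrow> q \<in> idx n \<Longrightarrow> rootm p q \<in> pe n"
  by (rule pe_homog_pe[OF rootm_pe_homog])

lemma rootm_dix: "rootm (dix q) (dix p) = (- psign ((par p + par q) * par q)) *\<^sub>C rootm p q"
  by (intro ext, cases "par p"; cases "par q") (auto simp: rootm_def)

text \<open>\<open>X\<close> is its own projection to \<open>pe n\<close>, and
  \<open>rootm p q\<close> is twice the projection of a matrix unit, whence the coefficients
  \<open>X p q / 2\<close>.\<close>

lemma pe_expand:
  assumes "X \<in> pe n"
  shows "X = (\<Sum>p\<in>idx n. \<Sum>q\<in>idx n. (X p q / 2) *\<^sub>C rootm p q)"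
proof (intro ext)
  fix i j
  have "(\<Sum>p\<in>idx n. \<Sum>q\<in>idx n. (X p q / 2) * rootm p q i j)
     = (\<Sum>p\<in>idx n. \<Sum>q\<in>idx n. if i = p then (if j = q then X p q / 2 else 0) else 0)
      - (\<Sum>p\<in>idx n. \<Sum>q\<in>idx n. if p = dix j then (if q = dix i then psign ((par p + par q) * par q) * X p q / 2 else 0) else 0)"
    unfolding sum_subtractf[symmetric]
    by (intro sum.cong refl) (auto simp: rootm_def dix_swap algebra_simps)
  also have "\<dots> = (if i \<in> idx n \<and> j \<in> idx n then X i j / 2 - psign ((par i + par j) * (par i + 1)) * X (dix j) (dix i) / 2 else 0)"
  proof -
    have "(\<Sum>q\<in>idx n. if i = p then (if j = q then X p q / 2 else 0) else 0) =
        (if i = p then (if j \<in> idx n then X i j / 2 else 0) else 0)" for p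
      by (simp add: sum.delta')
    moreover have "(\<Sum>q\<in>idx n. if p = dix j then (if q = dix i then psign ((par p + par q) * par q) * X p q / 2 else 0) else 0) =
        (if p = dix j then (if i \<in> idx n then psign ((par i + par j) * (par i + 1)) * X (dix j) (dix i) / 2 else 0) else 0)" for p
      by (cases "par i"; cases "par j"; simp add: sum.delta)
    ultimately show ?thesis
      by (simp add: sum.delta sum.delta')
  qed
  also have "\<dots> = X i j"
  proof (cases "i \<in> idx n \<and> j \<in> idx n")
    case True
    have "psign ((par i + par j) * (par i + 1)) * X (dix j) (dix i) = - X i j"
      unfolding pe_adj[OF assms, of i j] by (cases "par i"; cases "par j"; simp)
    then show ?thesis using True by simp
  qed (use pe_idx[OF assms] in auto)
  finally show "X i j = (\<Sum>p\<in>idx n. \<Sum>q\<in>idx n. (X p q / 2) *\<^sub>C rootm p q) i j"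
    by (simp add: gl_sum_apply)
qed

text \<open>Under the bracket with \<open>X\<close>, a matrix unit transforms as a vector with index
  \<open>p\<close> times a covector with index \<open>q\<close>. The projection to
  \<open>pe n\<close> commutes with this bracket, so root vectors obey the same rule.\<close>

lemma bracket_rootm:
  assumes X: "X \<in> pe_homog n x" and pq: "p \<in> idx n" "q \<in> idx n"
  shows "mmul (idx n) X (rootm p q) - psign (x * (par p + par q)) *\<^sub>C mmul (idx n) (rootm p q) X
    = (\<Sum>k\<in>idx n. X k p *\<^sub>C rootm k q) - psign (x * (par p + par q)) *\<^sub>C (\<Sum>k\<in>idx n. X q k *\<^sub>C rootm p k)"
proof (intro ext)
  fix i j
  have supp: "X a b = 0" if "a \<notin> idx n \<or> b \<notin> idx n" for a b
    using that pe_idx[OF pe_homog_pe[OF X]] by blast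
  define s where "s = psign ((par p + par q) * par q)"
  have 1: "mmul (idx n) X (rootm p q) i j = (if j = q then X i p else 0) - s * (if j = dix p then X i (dix q) else 0)"
  proof -
    have "mmul (idx n) X (rootm p q) i j = (\<Sum>k\<in>idx n. if k = p then (if j = q then X i k else 0) else 0)
        - (\<Sum>k\<in>idx n. if k = dix q then (if j = dix p then s * X i k else 0) else 0)"
      unfolding mmul_def sum_subtractf[symmetric] by (intro sum.cong refl) (auto simp: rootm_def s_def algebra_simps)
    then show ?thesis using pq by (simp add: sum.delta)
  qed
  have 2: "mmul (idx n) (rootm p q) X i j = (if i = p then X q j else 0) - s * (if i = dix q then X (dix p) j else 0)"
  proof -
    have "mmul (idx n) (rootm p q) X i j = (\<Sum>k\<in>idx n. if k = q then (if i = p then X k j else 0) else 0)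
        - (\<Sum>k\<in>idx n. if k = dix p then (if i = dix q then s * X k j else 0) else 0)"
      unfolding mmul_def sum_subtractf[symmetric] by (intro sum.cong refl) (auto simp: rootm_def s_def algebra_simps)
    then show ?thesis using pq by (simp add: sum.delta)
  qed
  have 3: "(\<Sum>k\<in>idx n. X k p *\<^sub>C rootm k q) i j
     = (if j = q then X i p else 0) - (if i = dix q then psign ((par j + 1 + par q) * par q) * X (dix j) p else 0)"
  proof -
    have "(\<Sum>k\<in>idx n. X k p *\<^sub>C rootm k q) i j = (\<Sum>k\<in>idx n. if i = k then (if j = q then X k p else 0) else 0)
        - (\<Sum>k\<in>idx n. if k = dix j then (if i = dix q then psign ((par k + par q) * par q) * X k p else 0) else 0)"
      unfolding gl_sum_apply sum_subtractf[symmetric] by (intro sum.cong refl) (auto simp: rootm_def algebra_simps)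
    then show ?thesis using pq by (auto simp: sum.delta sum.delta' supp)
  qed
  have 4: "(\<Sum>k\<in>idx n. X q k *\<^sub>C rootm p k) i j
     = (if i = p then X q j else 0) - (if j = dix p then psign ((par p + par i + 1) * (par i + 1)) * X q (dix i) else 0)"
  proof -
    have "(\<Sum>k\<in>idx n. X q k *\<^sub>C rootm p k) i j = (\<Sum>k\<in>idx n. if j = k then (if i = p then X q k else 0) else 0)
        - (\<Sum>k\<in>idx n. if k = dix i then (if j = dix p then psign ((par p + par k) * par k) * X q k else 0) else 0)"
      unfolding gl_sum_apply sum_subtractf[symmetric] by (intro sum.cong refl) (auto simp: rootm_def algebra_simps)
    then show ?thesis using pq by (auto simp: sum.delta sum.delta' supp ac_simps)
  qed
  \<comment> \<open>The terms in \<open>a\<close> and \<open>b\<close> come from the second matrix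
    unit of a root vector; skewness of \<open>X\<close> carries them to the reflected
    entries.\<close>
  have a: "s * X i (dix q) = psign (x * (par p + par q)) * psign ((par p + par i + 1) * (par i + 1)) * (- X q (dix i))"
  proof (cases "X i (dix q) = 0")
    case True
    then show ?thesis using pe_adj[OF pe_homog_pe[OF X], of i "dix q"] by auto
  next
    case False
    then have x: "x = par i + (par q + 1)" using pe_homog_par[OF X] by force
    show ?thesis
      unfolding pe_adj[OF pe_homog_pe[OF X], of i "dix q"] s_def x
      by (cases "par i"; cases "par p"; cases "par q"; simp)
  qed
  have b: "psign (x * (par p + par q)) * s * X (dix p) j = - psign ((par j + 1 + par q) * par q) * X (dix j) p"
  proof (cases "X (dix p) j = 0")
    case True
    then show ?thesis using pe_adj[OF pe_homog_pe[OF X], of "dix p" j] by auto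
  next
    case False
    then have x: "x = par p + 1 + par j" using pe_homog_par[OF X] by force
    show ?thesis
      unfolding pe_adj[OF pe_homog_pe[OF X], of "dix p" j] s_def x
      by (cases "par j"; cases "par p"; cases "par q"; simp)
  qed
  show "(mmul (idx n) X (rootm p q) - psign (x * (par p + par q)) *\<^sub>C mmul (idx n) (rootm p q) X) i j
    = ((\<Sum>k\<in>idx n. X k p *\<^sub>C rootm k q) - psign (x * (par p + par q)) *\<^sub>C (\<Sum>k\<in>idx n. X q k *\<^sub>C rootm p k)) i j"
    unfolding gl_apply 1 2 3 4 using a b by (auto simp: algebra_simps)
qed

section \<open>The supertrace form and dual bases\<close>

lemma supertrace_mmul_sum:
  "supertrace n (mmul (idx n) Z (\<Sum>a\<in>A. c a *\<^sub>C Y a)) = (\<Sum>a\<in>A. c a * supertrace n (mmul (idx n) Z (Y a)))"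
proof -
  have "mmul (idx n) Z (\<Sum>a\<in>A. c a *\<^sub>C Y a) i i = (\<Sum>a\<in>A. c a * mmul (idx n) Z (Y a) i i)" for i
    unfolding mmul_def gl_sum_apply gl_apply sum_distrib_left
    by (subst sum.swap) (simp add: ac_simps)
  then show ?thesis
    unfolding supertrace_def sum_distrib_left by (subst sum.swap) (simp add: sum_distrib_left ac_simps)
qed

text \<open>Both matrix units of \<open>rootm j i\<close> contribute the same amount, since
  \<open>Z\<close> is self-adjoint. This is the 2 that the division by 2 in
  \<open>dual_bases\<close> cancels.\<close>

lemma supertrace_rootm:
  assumes Z: "Z \<in> pe_dual n" and ij: "i \<in> idx n" "j \<in> idx n"
  shows "supertrace n (mmul (idx n) Z (rootm j i)) = 2 * psign (par i) * Z i j"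
proof -
  define s where "s = psign ((par j + par i) * par i)"
  have "mmul (idx n) Z (rootm j i) k k = (if k = i then Z i j else 0) - (if k = dix j then s * Z (dix j) (dix i) else 0)" for k
  proof -
    have "mmul (idx n) Z (rootm j i) k k = (\<Sum>m\<in>idx n. if m = j then (if k = i then Z k m else 0) else 0)
        - (\<Sum>m\<in>idx n. if m = dix i then (if k = dix j then s * Z k m else 0) else 0)"
      unfolding mmul_def sum_subtractf[symmetric] by (intro sum.cong refl) (auto simp: rootm_def s_def algebra_simps)
    then show ?thesis using ij by (simp add: sum.delta)
  qed
  note diag = this
  have "supertrace n (mmul (idx n) Z (rootm j i))
      = (\<Sum>k\<in>idx n. if k = i then psign (par k) * Z i j else 0) - (\<Sum>k\<in>idx n. if k = dix j then psign (par k) * (s * Z (dix j) (dix i)) else 0)"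
    unfolding supertrace_def diag sum_subtractf[symmetric] by (intro sum.cong refl) (auto simp: algebra_simps)
  also have "\<dots> = psign (par i) * Z i j - psign (par j + 1) * s * Z (dix j) (dix i)"
    using ij by (simp add: sum.delta)
  also have "\<dots> = 2 * psign (par i) * Z i j"
  proof -
    have "Z i j = 1 * psign ((par i + par j) * par j) * Z (dix j) (dix i)"
      using Z self_adjD[of 1 Z i j] by (simp add: pe_dual_eq)
    then show ?thesis
      unfolding s_def by (cases "par i"; cases "par j"; simp)
  qed
  finally show ?thesis .
qed

lemma pe_span_rootm: "pe n \<subseteq> cvs.span ((\<lambda>(p, q). rootm p q) ` (idx n \<times> idx n))"
proof
  fix X assume X: "X \<in> pe n"
  show "X \<in> cvs.span ((\<lambda>(p, q). rootm p q) ` (idx n \<times> idx n))"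
    by (subst pe_expand[OF X]) (intro cvs.span_sum cvs.span_scale cvs.span_base, auto)
qed

lemma dual_bases_finite:
  assumes "dual_bases n B D"
  shows "finite B"
proof -
  have "B \<subseteq> pe n"
    using assms by (auto simp: dual_bases_def pe_homog_pe)
  then have "B \<subseteq> cvs.span ((\<lambda>(p, q). rootm p q) ` (idx n \<times> idx n))"
    using pe_span_rootm by blast
  then show ?thesis
    using assms cvs.independent_span_bound[of "(\<lambda>(p, q). rootm p q) ` (idx n \<times> idx n)" B]
    by (simp add: dual_bases_def)
qed

lemma dual_bases_expand:
  assumes BD: "dual_bases n B D" and Y: "Y \<in> pe n"
  shows "Y = (\<Sum>c\<in>B. (supertrace n (mmul (idx n) (D c) Y) / 2) *\<^sub>C c)"
proof -
  obtain u where u: "Y = (\<Sum>b\<in>B. u b *\<^sub>C b)"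
  proof -
    have "Y \<in> cvs.span B"
      using BD Y by (simp add: dual_bases_def)
    then show thesis
      using that unfolding cvs.span_finite[OF dual_bases_finite[OF BD]] by blast
  qed
  have "supertrace n (mmul (idx n) (D c) Y) / 2 = u c" if c: "c \<in> B" for c
  proof -
    have "supertrace n (mmul (idx n) (D c) Y) / 2 = (\<Sum>b\<in>B. u b * (supertrace n (mmul (idx n) (D c) b) / 2))"
      unfolding u supertrace_mmul_sum sum_divide_distrib by simp
    also have "\<dots> = (\<Sum>b\<in>B. if c = b then u b else 0)"
      using BD c by (intro sum.cong refl) (simp add: dual_bases_def)
    finally show ?thesis
      using c dual_bases_finite[OF BD] by (simp add: sum.delta')
  qed
  then show ?thesis
    using u by simp
qed

text \<open>The canonical element \<open>\<Sum>\<^sub>b b \<otimes> D b\<close> does not depend on the choice of the dual bases.\<close>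

lemma dual_bases_canonical:
  assumes BD: "dual_bases n B D" and ij: "i \<in> idx n" "j \<in> idx n"
  shows "(\<Sum>b\<in>B. D b i j *\<^sub>C b) = psign (par i) *\<^sub>C rootm j i"
proof -
  have "rootm j i = (\<Sum>c\<in>B. (psign (par i) * D c i j) *\<^sub>C c)"
    using BD by (subst dual_bases_expand[OF BD rootm_pe[OF ij(2) ij(1)]])
      (intro sum.cong refl, simp add: supertrace_rootm ij dual_bases_def)
  then show ?thesis
    by (simp add: cvs.scale_sum_right)
qed


section \<open>Linear algebra on subspaces\<close>

global_interpretation cvsp: vector_space_pair
  "cscale :: complex \<Rightarrow> 'a::complex_space \<Rightarrow> 'a" "cscale :: complex \<Rightarrow> 'b::complex_space \<Rightarrow> 'b"
  by unfold_locales

abbreviation clin :: "('a::complex_space \<Rightarrow> 'b::complex_space) \<Rightarrow> bool"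
  where "clin \<equiv> Vector_Spaces.linear cscale cscale"

lemma linear_betweenI:
  assumes "\<And>x. x \<in> S \<Longrightarrow> f x \<in> T" "\<And>x y. x \<in> S \<Longrightarrow> y \<in> S \<Longrightarrow> f (x + y) = f x + f y"
    "\<And>c x. x \<in> S \<Longrightarrow> f (c *\<^sub>C x) = c *\<^sub>C f x"
  shows "linear_between S T f"
  using assms by (simp add: linear_between_def)

lemma linear_betweenD:
  assumes "linear_between S T f"
  shows "x \<in> S \<Longrightarrow> f x \<in> T" "x \<in> S \<Longrightarrow> y \<in> S \<Longrightarrow> f (x + y) = f x + f y"
    "x \<in> S \<Longrightarrow> f (c *\<^sub>C x) = c *\<^sub>C f x"
  using assms by (auto simp: linear_between_def)

lemma linear_between_0:
  assumes "linear_between S T f" "cvs.subspace S"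
  shows "f 0 = 0"
  using linear_betweenD(3)[OF assms(1) cvs.subspace_0[OF assms(2)], of 0] by simp

lemma linear_between_neg:
  assumes "linear_between S T f" "x \<in> S"
  shows "f (- x) = - f x"
  using linear_betweenD(3)[OF assms, of "-1"] by simp

lemma linear_between_diff:
  assumes "linear_between S T f" "cvs.subspace S" "x \<in> S" "y \<in> S"
  shows "f (x - y) = f x - f y"
  using linear_betweenD(2)[OF assms(1,3), of "- y"] linear_between_neg[OF assms(1,4)] assms
  by (simp add: cvs.subspace_neg)

lemma linear_between_sum:
  assumes "linear_between S T f" "cvs.subspace S" "\<And>a. a \<in> A \<Longrightarrow> g a \<in> S"
  shows "f (\<Sum>a\<in>A. g a) = (\<Sum>a\<in>A. f (g a))"
  using assms(3)
proof (induction A rule: infinite_finite_induct)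
  case (insert a A)
  then show ?case
    using linear_betweenD(2)[OF assms(1), of "g a" "\<Sum>a\<in>A. g a"] cvs.subspace_sum[OF assms(2), of A g] by simp
qed (simp_all add: linear_between_0[OF assms(1,2)])

lemma clin_linear_between: "clin f \<Longrightarrow> (\<And>x. x \<in> S \<Longrightarrow> f x \<in> T) \<Longrightarrow> linear_between S T f"
  by (simp add: linear_between_def cvsp.linear_add cvsp.linear_scale)

lemma clinI: "linear_between UNIV UNIV f \<Longrightarrow> clin f"
  by (simp add: Vector_Spaces.linear_iff linear_between_def cvs.vector_space_axioms)

lemma span_finiteE:
  assumes "finite B" "x \<in> cvs.span B"
  obtains u where "x = (\<Sum>b\<in>B. u b *\<^sub>C b)"
  using assms(2) unfolding cvs.span_finite[OF assms(1)] by blast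

text \<open>The identity minus a linear retraction onto \<open>A\<close> is a projection with kernel
  \<open>A\<close>, defined on the whole ambient type. Its image is a complement of
  \<open>A\<close>; this is what lets a quotient be carried by the type it comes from.\<close>

lemma exists_complement_projection:
  assumes "cvs.subspace A"
  obtains g :: "'a::complex_space \<Rightarrow> 'a" where "clin g" "\<And>x. x \<in> A \<Longrightarrow> g x = 0" "\<And>x. x - g x \<in> A"
proof -
  obtain h :: "'a \<Rightarrow> 'a" where h: "h ` UNIV \<subseteq> A" "clin h" "\<forall>v\<in>A. h v = v"
    using cvsp.linear_exists_left_inverse_on[of id A] assms cvs.linear_id by (auto simp: id_def)
  show ?thesis
  proof (rule that[of "\<lambda>x. x - h x"])
    show "clin (\<lambda>x. x - h x)"
      using h(2) by (intro clinI linear_betweenI) (simp_all add: cvsp.linear_add cvsp.linear_scale cvs.scale_right_diff_distrib)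
  qed (use h in auto)
qed

lemma exists_separating_functional:
  fixes x :: "'a::complex_space"
  assumes "cvs.subspace A" "x \<notin> A"
  obtains \<phi> :: "'a \<Rightarrow> complex" where "clin \<phi>" "\<And>y. y \<in> A \<Longrightarrow> \<phi> y = 0" "\<phi> x = 1"
proof -
  obtain g :: "'a \<Rightarrow> 'a" where g: "clin g" "\<And>x. x \<in> A \<Longrightarrow> g x = 0" "\<And>x. x - g x \<in> A"
    using exists_complement_projection[OF assms(1)] by blast
  have "g x \<noteq> 0"
    using g(3)[of x] assms(2) by auto
  then have "cvs.independent {g x}"
    by simp
  then obtain h :: "'a \<Rightarrow> complex" where h: "clin h" "h (g x) = 1"
    using cvsp.linear_independent_extend[of "{g x}" "\<lambda>_. 1 :: complex"] by auto
  show ?thesis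
  proof (rule that[of "\<lambda>y. h (g y)"])
    show "clin (\<lambda>y. h (g y))"
      using g(1) h(1) by (intro clinI linear_betweenI) (simp_all add: cvsp.linear_add cvsp.linear_scale)
    show "h (g y) = 0" if "y \<in> A" for y
      using g(2)[OF that] h(1) by (simp add: cvsp.linear_0)
  qed (use h in auto)
qed

definition fin_dim :: "'a::complex_space set \<Rightarrow> bool"
  where "fin_dim S \<longleftrightarrow> (\<exists>B. finite B \<and> S \<subseteq> cvs.span B)"

lemma fin_dim_mono: "fin_dim T \<Longrightarrow> S \<subseteq> T \<Longrightarrow> fin_dim S"
  unfolding fin_dim_def by blast

lemma fin_dim_basis:
  assumes "fin_dim S" "cvs.subspace S"
  obtains B where "finite B" "cvs.independent B" "B \<subseteq> S" "cvs.span B = S"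
proof -
  obtain B where B: "B \<subseteq> S" "cvs.independent B" "S \<subseteq> cvs.span B"
    using cvs.maximal_independent_subset by blast
  obtain C where C: "finite C" "S \<subseteq> cvs.span C"
    using assms(1) by (auto simp: fin_dim_def)
  have "finite B"
    using cvs.independent_span_bound[OF C(1) B(2)] B(1) C(2) by blast
  moreover have "cvs.span B = S"
    using B(1,3) assms(2) by (simp add: cvs.span_minimal subset_antisym)
  ultimately show ?thesis
    using that B by blast
qed

lemma dual_basis_functionals:
  fixes S :: "'a::complex_space set"
  assumes "fin_dim S" "cvs.subspace S"
  obtains B and d :: "'a \<Rightarrow> 'a \<Rightarrow> complex" where "finite B" "B \<subseteq> S"
    "\<And>b. clin (d b)" "\<And>x. x \<in> S \<Longrightarrow> x = (\<Sum>b\<in>B. d b x *\<^sub>C b)"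
proof -
  obtain B where B: "finite B" "cvs.independent B" "B \<subseteq> S" "cvs.span B = S"
    by (rule fin_dim_basis[OF assms])
  have "\<exists>g :: 'a \<Rightarrow> complex. (\<forall>x\<in>B. g x = (if x = b then 1 else 0)) \<and> clin g" for b
    using cvsp.linear_independent_extend[OF B(2), of "\<lambda>x. if x = b then 1 else 0 :: complex"] by blast
  then obtain d :: "'a \<Rightarrow> 'a \<Rightarrow> complex" where d: "\<And>b x. x \<in> B \<Longrightarrow> d b x = (if x = b then 1 else 0)" "\<And>b. clin (d b)"
    by metis
  have "x = (\<Sum>b\<in>B. d b x *\<^sub>C b)" if x: "x \<in> S" for x
  proof -
    obtain u where u: "x = (\<Sum>b\<in>B. u b *\<^sub>C b)"
      using x B span_finiteE[OF B(1), of x thesis] by blast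
    have "d b x = u b" if "b \<in> B" for b
    proof -
      have "d b x = (\<Sum>c\<in>B. u c * d b c)"
        unfolding u cvsp.linear_sum[OF d(2)] cvsp.linear_scale[OF d(2)] by (simp add: cscale_complex_def)
      also have "\<dots> = (\<Sum>c\<in>B. if c = b then u c else 0)"
        by (intro sum.cong refl) (simp add: d(1))
      finally show ?thesis
        using that B(1) by (simp add: sum.delta)
    qed
    then show ?thesis
      using u by simp
  qed
  then show ?thesis
    using that B d by blast
qed

text \<open>Otherwise a vector outside the image, together with the image of a basis, would form an
  independent set with one element more than the basis.\<close>

lemma fin_dim_inj_surj:
  assumes S: "fin_dim S" "cvs.subspace S" and f: "linear_between S S f"
    and inj: "\<And>x. x \<in> S \<Longrightarrow> f x = 0 \<Longrightarrow> x = 0"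
  shows "f ` S = S"
proof (rule ccontr)
  assume "f ` S \<noteq> S"
  then obtain y where y: "y \<in> S" "y \<notin> f ` S"
    using linear_betweenD(1)[OF f] by blast
  obtain B where B: "finite B" "cvs.independent B" "B \<subseteq> S" "cvs.span B = S"
    by (rule fin_dim_basis[OF S])
  have sub: "cvs.subspace (f ` S)"
    unfolding cvs.subspace_def
  proof (intro conjI ballI allI)
    show "0 \<in> f ` S"
      using linear_between_0[OF f S(2)] cvs.subspace_0[OF S(2)] by (metis imageI)
    show "x + y \<in> f ` S" if "x \<in> f ` S" "y \<in> f ` S" for x y
      using that linear_betweenD(2)[OF f] cvs.subspace_add[OF S(2)] by (metis (no_types, lifting) image_iff)
    show "c *\<^sub>C x \<in> f ` S" if "x \<in> f ` S" for c x
      using that linear_betweenD(3)[OF f] cvs.subspace_scale[OF S(2)] by (metis (no_types, lifting) image_iff)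
  qed
  have inj_on: "inj_on f S"
  proof (rule inj_onI)
    fix a b assume ab: "a \<in> S" "b \<in> S" "f a = f b"
    then have "f (a - b) = 0"
      using linear_between_diff[OF f S(2)] by simp
    then show "a = b"
      using inj[of "a - b"] ab cvs.subspace_diff[OF S(2)] by simp
  qed
  have "cvs.independent (f ` B)"
    unfolding cvs.independent_explicit_finite_subsets
  proof (intro allI impI ballI)
    fix T u v assume T: "T \<subseteq> f ` B" "finite T" "(\<Sum>v\<in>T. u v *\<^sub>C v) = 0" and v: "v \<in> T"
    obtain A where A: "A \<subseteq> B" "T = f ` A"
      using T(1) by (auto simp: subset_image_iff)
    have fA: "finite A" and injA: "inj_on f A"
      using A B inj_on by (auto intro: finite_subset inj_on_subset)
    have AS: "u (f a) *\<^sub>C a \<in> S" "a \<in> S" if "a \<in> A" for a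
      using that A B(3) cvs.subspace_scale[OF S(2)] by blast+
    have "f (\<Sum>a\<in>A. u (f a) *\<^sub>C a) = (\<Sum>a\<in>A. f (u (f a) *\<^sub>C a))"
      by (intro linear_between_sum[OF f S(2)] AS)
    also have "\<dots> = (\<Sum>a\<in>A. u (f a) *\<^sub>C f a)"
      by (intro sum.cong refl linear_betweenD(3)[OF f] AS)
    also have "\<dots> = 0"
      using T(3) by (simp add: A(2) sum.reindex[OF injA])
    finally have f0: "f (\<Sum>a\<in>A. u (f a) *\<^sub>C a) = 0" .
    have "(\<Sum>a\<in>A. u (f a) *\<^sub>C a) = 0"
      by (rule inj[OF cvs.subspace_sum[OF S(2)] f0]) (rule AS)
    then show "u v = 0"
      using B(2)[unfolded cvs.independent_explicit_finite_subsets, rule_format, OF A(1) fA, of "\<lambda>a. u (f a)"] v A(2)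
      by blast
  qed
  then have ind: "cvs.independent (insert y (f ` B))"
    using y(2) cvs.span_minimal[OF image_mono[OF B(3)] sub] by (intro cvs.independent_insertI) blast+
  have "insert y (f ` B) \<subseteq> cvs.span B"
    using y(1) B linear_betweenD(1)[OF f] by auto
  then have "card (insert y (f ` B)) \<le> card B"
    using cvs.independent_span_bound[OF B(1) ind] by blast
  moreover have "card (insert y (f ` B)) = Suc (card B)"
    using y(2) B inj_on by (subst card_insert_disjoint) (auto intro!: card_image inj_on_subset[OF inj_on])
  ultimately show False
    by simp
qed


section \<open>Graded spaces and modules\<close>

text \<open>\<open>parop M r\<close> multiplies the elements of parity \<open>q\<close> by \<open>(-1)\<^bsup>rq\<^esup>\<close>; all signs of the
  definitions of dual and tensor modules are absorbed in it.\<close>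

definition parop :: "'v::complex_space smod \<Rightarrow> bit \<Rightarrow> 'v \<Rightarrow> 'v"
  where "parop M r x = (\<Sum>q\<in>{0,1}. psign (r * q) *\<^sub>C hpart M q x)"

locale gspace =
  fixes M :: "'v::complex_space smod"
  assumes homog_subspace: "cvs.subspace (homog M p)"
    and homog_Int: "homog M 0 \<inter> homog M 1 = {0}"
begin

lemma homog_0 [simp]: "0 \<in> homog M p"
  by (rule cvs.subspace_0[OF homog_subspace])

lemmas homog_add = cvs.subspace_add[OF homog_subspace]
lemmas homog_scale = cvs.subspace_scale[OF homog_subspace]
lemmas homog_diff = cvs.subspace_diff[OF homog_subspace]

lemma homog_disjoint: "x \<in> homog M p \<Longrightarrow> x \<in> homog M (p + 1) \<Longrightarrow> x = 0"
  using homog_Int by (cases p) auto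

lemma carr_subspace: "cvs.subspace (carr M)"
  unfolding carr_def by (intro cvs.subspace_sums homog_subspace)

lemma carr_0 [simp]: "0 \<in> carr M"
  by (rule cvs.subspace_0[OF carr_subspace])

lemmas carr_add = cvs.subspace_add[OF carr_subspace]
lemmas carr_scale = cvs.subspace_scale[OF carr_subspace]
lemmas carr_diff = cvs.subspace_diff[OF carr_subspace]
lemmas carr_sum = cvs.subspace_sum[OF carr_subspace]

lemma homog_carr: "x \<in> homog M p \<Longrightarrow> x \<in> carr M"
  unfolding carr_def by (cases p) (auto intro: exI[of _ 0] exI[of _ x])

lemma hpart_unique:
  assumes "y \<in> homog M p" "z \<in> homog M (p + 1)"
  shows "hpart M p (y + z) = y"
  unfolding hpart_def
proof (rule the_equality)
  show "y \<in> homog M p \<and> (\<exists>za\<in>homog M (p + 1). y + z = y + za)"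
    using assms by blast
  fix y' assume "y' \<in> homog M p \<and> (\<exists>z'\<in>homog M (p + 1). y + z = y' + z')"
  then obtain z' where y': "y' \<in> homog M p" "z' \<in> homog M (p + 1)" "y + z = y' + z'"
    by blast
  then have "y' - y = z - z'"
    by (simp add: algebra_simps)
  then have "y' - y = 0"
    using homog_disjoint[of "y' - y" p] homog_diff[OF y'(1) assms(1)] homog_diff[OF assms(2) y'(2)] by simp
  then show "y' = y" by simp
qed

lemma carr_obtain:
  assumes "x \<in> carr M"
  obtains y z where "y \<in> homog M p" "z \<in> homog M (p + 1)" "x = y + z"
  using assms unfolding carr_def by (cases p) (auto simp: add.commute)

lemma hpart_in [simp]: "x \<in> carr M \<Longrightarrow> hpart M p x \<in> homog M p"
  by (metis carr_obtain hpart_unique)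

lemma hpart_carr [simp]: "x \<in> carr M \<Longrightarrow> hpart M p x \<in> carr M"
  by (rule homog_carr[OF hpart_in])

lemma hpart_sum:
  assumes "x \<in> carr M"
  shows "x = hpart M p x + hpart M (p + 1) x"
proof -
  obtain y z where x: "y \<in> homog M p" "z \<in> homog M (p + 1)" "x = y + z"
    using carr_obtain[OF assms] .
  then show ?thesis
    using hpart_unique[of y p z] hpart_unique[of z "p + 1" y] by (simp add: add.commute)
qed

lemma hpart_homog: "x \<in> homog M q \<Longrightarrow> hpart M p x = (if p = q then x else 0)"
  using hpart_unique[of x p 0] hpart_unique[of 0 p x] by (cases p; cases q) auto

lemma hpart_linear: "linear_between (carr M) (homog M p) (hpart M p)"
proof (rule linear_betweenI)
  fix x y assume xy: "x \<in> carr M" "y \<in> carr M"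
  obtain a b where x: "a \<in> homog M p" "b \<in> homog M (p + 1)" "x = a + b"
    using carr_obtain[OF xy(1)] .
  obtain c d where y: "c \<in> homog M p" "d \<in> homog M (p + 1)" "y = c + d"
    using carr_obtain[OF xy(2)] .
  have "x + y = (a + c) + (b + d)"
    using x y by simp
  then show "hpart M p (x + y) = hpart M p x + hpart M p y"
    using x y hpart_unique homog_add by metis
next
  fix k x assume "x \<in> carr M"
  then obtain a b where x: "a \<in> homog M p" "b \<in> homog M (p + 1)" "x = a + b"
    by (rule carr_obtain)
  then show "hpart M p (k *\<^sub>C x) = k *\<^sub>C hpart M p x"
    using hpart_unique homog_scale cscale_add_right by metis
qed simp

lemmas hpart_add = linear_betweenD(2)[OF hpart_linear]
lemmas hpart_scale = linear_betweenD(3)[OF hpart_linear]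
lemmas hpart_0 [simp] = linear_between_0[OF hpart_linear carr_subspace]

lemma carr_induct [consumes 1, case_names homog add]:
  assumes "x \<in> carr M" "\<And>q y. y \<in> homog M q \<Longrightarrow> P y"
    "\<And>y z. y \<in> carr M \<Longrightarrow> z \<in> carr M \<Longrightarrow> P y \<Longrightarrow> P z \<Longrightarrow> P (y + z)"
  shows "P x"
  using hpart_sum[OF assms(1), of 0] assms(3)[OF hpart_carr hpart_carr, OF assms(1) assms(1)]
    assms(2)[OF hpart_in[OF assms(1)]] by metis

lemma parop_eq: "parop M r x = hpart M 0 x + psign r *\<^sub>C hpart M 1 x"
  by (simp add: parop_def cscale_one)

lemma parop_homog: "x \<in> homog M q \<Longrightarrow> parop M r x = psign (r * q) *\<^sub>C x"
  by (cases q) (simp_all add: parop_eq hpart_homog cscale_one)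

lemma parop_linear: "linear_between (carr M) (carr M) (parop M r)"
  unfolding parop_eq
  by (rule linear_betweenI)
    (simp_all add: hpart_add hpart_scale carr_add carr_scale cscale_add_right ac_simps cvs.scale_left_commute)

lemmas parop_carr [simp] = linear_betweenD(1)[OF parop_linear]
lemmas parop_add = linear_betweenD(2)[OF parop_linear]
lemmas parop_scale = linear_betweenD(3)[OF parop_linear]
lemmas parop_0' [simp] = linear_between_0[OF parop_linear carr_subspace]
lemmas parop_sum = linear_between_sum[OF parop_linear carr_subspace]

lemma parop_in: "x \<in> homog M q \<Longrightarrow> parop M r x \<in> homog M q"
  by (simp add: parop_homog homog_scale)

lemma parop_parop: "x \<in> carr M \<Longrightarrow> parop M r (parop M s x) = parop M (r + s) x"
proof (induction rule: carr_induct)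
  case (homog q y)
  then show ?case
    by (simp add: parop_homog parop_scale homog_carr homog_scale distrib_right psign_add)
qed (simp add: parop_add)

lemma parop_0 [simp]: "x \<in> carr M \<Longrightarrow> parop M 0 x = x"
  using hpart_sum[of x 0] by (simp add: parop_eq cscale_one)

end

locale pmod = gspace M for M :: "'v::complex_space smod" +
  fixes n :: nat
  assumes act_linear: "X \<in> pe n \<Longrightarrow> linear_between (carr M) (carr M) (act M X)"
    and act_linear_left: "x \<in> carr M \<Longrightarrow> linear_between (pe n) (carr M) (\<lambda>X. act M X x)"
    and act_homog: "X \<in> pe_homog n p \<Longrightarrow> x \<in> homog M q \<Longrightarrow> act M X x \<in> homog M (p + q)"
    and act_bracket: "X \<in> pe_homog n p \<Longrightarrow> Y \<in> pe_homog n q \<Longrightarrow> x \<in> carr M \<Longrightarrow>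
        act M (mmul (idx n) X Y - psign (p * q) *\<^sub>C mmul (idx n) Y X) x
          = act M X (act M Y x) - psign (p * q) *\<^sub>C act M Y (act M X x)"

lemma pe_module_iff: "pe_module n M \<longleftrightarrow> pmod M n"
  unfolding pe_module_def pmod_def pmod_axioms_def gspace_def by auto

context pmod
begin

lemma pe_module: "pe_module n M"
  using pe_module_iff pmod_axioms by blast

lemmas act_carr [simp] = linear_betweenD(1)[OF act_linear]
lemmas act_add = linear_betweenD(2)[OF act_linear]
lemmas act_scale = linear_betweenD(3)[OF act_linear]
lemmas act_0 [simp] = linear_between_0[OF act_linear carr_subspace]
lemmas act_sum = linear_between_sum[OF act_linear carr_subspace]
lemmas act_add_left = linear_betweenD(2)[OF act_linear_left]
lemmas act_scale_left = linear_betweenD(3)[OF act_linear_left]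
lemmas act_0_left [simp] = linear_between_0[OF act_linear_left subspace_pe]
lemmas act_sum_left = linear_between_sum[OF act_linear_left subspace_pe]
lemmas act_diff_left = linear_between_diff[OF act_linear_left subspace_pe]

lemma act_parts:
  assumes "X \<in> pe n" "x \<in> carr M"
  shows "act M X x = act M (gl_part 0 X) x + act M (gl_part 1 X) x"
  using act_add_left[OF assms(2), of "gl_part 0 X" "gl_part 1 X"] pe_homog_pe[OF gl_part_pe[OF assms(1)]]
  by (metis gl_part_sum)

lemma parop_act:
  assumes X: "X \<in> pe_homog n p"
  shows "x \<in> carr M \<Longrightarrow> parop M r (act M X x) = psign (r * p) *\<^sub>C act M X (parop M r x)"
proof (induction rule: carr_induct)
  case (homog q y)
  then show ?case
    by (simp add: parop_homog[OF act_homog[OF X homog]] parop_homog[OF homog]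
        act_scale[OF pe_homog_pe[OF X] homog_carr] distrib_left psign_add)
qed (simp add: act_add[OF pe_homog_pe[OF X]] pe_homog_pe[OF X] parop_add cscale_add_right)

text \<open>The rule by which any homogeneous element is moved past a root vector, with the bracket
  already expanded into root vectors.\<close>

lemma act_rootm:
  assumes X: "X \<in> pe_homog n p" and ab: "a \<in> idx n" "b \<in> idx n" and x: "x \<in> carr M"
  shows "act M X (act M (rootm a b) x) = psign (p * (par a + par b)) *\<^sub>C act M (rootm a b) (act M X x)
    + ((\<Sum>k\<in>idx n. X k a *\<^sub>C act M (rootm k b) x)
    - psign (p * (par a + par b)) *\<^sub>C (\<Sum>k\<in>idx n. X b k *\<^sub>C act M (rootm a k) x))"
proof -
  note in_pe = cvs.subspace_scale[OF subspace_pe] cvs.subspace_sum[OF subspace_pe]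
  have "act M (\<Sum>k\<in>idx n. X k a *\<^sub>C rootm k b) x = (\<Sum>k\<in>idx n. X k a *\<^sub>C act M (rootm k b) x)"
    using ab by (subst act_sum_left[OF x]) (auto intro!: in_pe sum.cong act_scale_left[OF x] rootm_pe)
  moreover have "act M (\<Sum>k\<in>idx n. X b k *\<^sub>C rootm a k) x = (\<Sum>k\<in>idx n. X b k *\<^sub>C act M (rootm a k) x)"
    using ab by (subst act_sum_left[OF x]) (auto intro!: in_pe sum.cong act_scale_left[OF x] rootm_pe)
  moreover have "act M ((\<Sum>k\<in>idx n. X k a *\<^sub>C rootm k b) - psign (p * (par a + par b)) *\<^sub>C (\<Sum>k\<in>idx n. X b k *\<^sub>C rootm a k)) x
     = act M (\<Sum>k\<in>idx n. X k a *\<^sub>C rootm k b) x - psign (p * (par a + par b)) *\<^sub>C act M (\<Sum>k\<in>idx n. X b k *\<^sub>C rootm a k) x"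
    using ab by (subst act_diff_left[OF x]) (auto intro!: in_pe rootm_pe act_scale_left[OF x])
  ultimately have "act M X (act M (rootm a b) x) - psign (p * (par a + par b)) *\<^sub>C act M (rootm a b) (act M X x)
    = (\<Sum>k\<in>idx n. X k a *\<^sub>C act M (rootm k b) x)
      - psign (p * (par a + par b)) *\<^sub>C (\<Sum>k\<in>idx n. X b k *\<^sub>C act M (rootm a k) x)"
    using act_bracket[OF X rootm_pe_homog[OF ab] x, unfolded bracket_rootm[OF X ab]] by (simp only:)
  then show ?thesis
    by (simp only: diff_eq_eq add.commute)
qed

lemma act_expand:
  assumes "X \<in> pe n" and x: "x \<in> carr M"
  shows "act M X x = (\<Sum>p\<in>idx n. \<Sum>q\<in>idx n. (X p q / 2) *\<^sub>C act M (rootm p q) x)"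
proof -
  note in_pe = cvs.subspace_scale[OF subspace_pe] cvs.subspace_sum[OF subspace_pe] rootm_pe
  have "act M X x = act M (\<Sum>p\<in>idx n. \<Sum>q\<in>idx n. (X p q / 2) *\<^sub>C rootm p q) x"
    using pe_expand[OF assms(1)] by simp
  also have "\<dots> = (\<Sum>p\<in>idx n. act M (\<Sum>q\<in>idx n. (X p q / 2) *\<^sub>C rootm p q) x)"
    by (intro act_sum_left[OF x] in_pe)
  also have "\<dots> = (\<Sum>p\<in>idx n. \<Sum>q\<in>idx n. act M ((X p q / 2) *\<^sub>C rootm p q) x)"
    by (intro sum.cong refl act_sum_left[OF x] in_pe)
  also have "\<dots> = (\<Sum>p\<in>idx n. \<Sum>q\<in>idx n. (X p q / 2) *\<^sub>C act M (rootm p q) x)"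
    by (intro sum.cong refl act_scale_left[OF x] in_pe)
  finally show ?thesis .
qed

lemma submoduleI:
  assumes sub: "\<And>p. cvs.subspace (H p)" and le: "\<And>p. H p \<subseteq> homog M p"
    and act: "\<And>X p x q. X \<in> pe_homog n p \<Longrightarrow> x \<in> H q \<Longrightarrow> act M X x \<in> H (p + q)"
  shows "submodule n \<lparr>homog = H, act = act M\<rparr> M" (is "submodule n ?N M")
proof -
  interpret N: gspace ?N
  proof
    show "cvs.subspace (homog ?N p)" for p
      using sub by simp
    have "H 0 \<inter> H 1 \<subseteq> homog M 0 \<inter> homog M 1"
      using le by blast
    then show "homog ?N 0 \<inter> homog ?N 1 = {0}"
      using homog_Int cvs.subspace_0[OF sub] by auto
  qed
  have carr: "x \<in> carr M" if "x \<in> carr ?N" for x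
    using that by (induction rule: N.carr_induct) (use le homog_carr carr_add in auto)
  have homog_act: "act M X x \<in> carr ?N" if "X \<in> pe_homog n p" "x \<in> carr ?N" for X p x
    using that(2)
  proof (induction rule: N.carr_induct)
    case (homog q y)
    then show ?case
      using act[OF that(1), of y q] N.homog_carr[of _ "p + q"] by simp
  next
    case (add y z)
    then show ?case
      using carr by (simp add: act_add[OF pe_homog_pe[OF that(1)]] N.carr_add)
  qed
  have act_N: "act M X x \<in> carr ?N" if "X \<in> pe n" "x \<in> carr ?N" for X x
    using homog_act[OF gl_part_pe[OF that(1)] that(2)] act_parts[OF that(1) carr[OF that(2)]] N.carr_add by metis
  have "pmod ?N n"
  proof (unfold_locales, goal_cases)
    case (1 X)
    then show ?case
      using act_N carr by (intro linear_betweenI) (auto simp: act_add act_scale)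
  next
    case (2 x)
    then show ?case
      using act_N carr by (intro linear_betweenI) (auto simp: act_add_left act_scale_left)
  qed (use act act_bracket carr in auto)
  then show ?thesis
    using le by (simp add: submodule_def pe_module_iff)
qed

end

lemma submodule_carr: "submodule n N M \<Longrightarrow> x \<in> carr N \<Longrightarrow> x \<in> carr M"
  unfolding submodule_def carr_def by blast


section \<open>Homomorphisms and simple modules\<close>

lemma mod_homD:
  assumes "mod_hom n M N f"
  shows "linear_between (carr M) (carr N) f" "x \<in> homog M p \<Longrightarrow> f x \<in> homog N p"
    "X \<in> pe n \<Longrightarrow> x \<in> carr M \<Longrightarrow> f (act M X x) = act N X (f x)"
  using assms unfolding mod_hom_def by auto

lemma mod_hom_hpart:
  assumes "gspace M" "gspace N" "mod_hom n M N f" "x \<in> carr M"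
  shows "f (hpart M p x) = hpart N p (f x)"
proof -
  interpret M: gspace M by fact
  interpret N: gspace N by fact
  note f = mod_homD[OF assms(3)]
  have "f x = f (hpart M p x) + f (hpart M (p + 1) x)"
    using M.hpart_sum[OF assms(4), of p] linear_betweenD(2)[OF f(1) M.hpart_carr M.hpart_carr, OF assms(4,4)] by metis
  then show ?thesis
    using N.hpart_unique[OF f(2) f(2), OF M.hpart_in M.hpart_in, OF assms(4,4)] by metis
qed

lemma mod_hom_parop:
  assumes "gspace M" "gspace N" "mod_hom n M N f" "x \<in> carr M"
  shows "f (parop M r x) = parop N r (f x)"
proof -
  interpret M: gspace M by fact
  interpret N: gspace N by fact
  note f = mod_homD[OF assms(3)]
  show ?thesis
    using assms(4) by (simp add: M.parop_eq N.parop_eq linear_betweenD(2,3)[OF f(1)] M.carr_scale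
        mod_hom_hpart[OF assms(1-3)])
qed

lemma mod_homI:
  assumes "pmod M n" "pmod N n" "linear_between (carr M) (carr N) f"
    and "\<And>p x. x \<in> homog M p \<Longrightarrow> f x \<in> homog N p"
    and act: "\<And>X p x. X \<in> pe_homog n p \<Longrightarrow> x \<in> carr M \<Longrightarrow> f (act M X x) = act N X (f x)"
  shows "mod_hom n M N f"
proof -
  interpret M: pmod M n by fact
  interpret N: pmod N n by fact
  have "f (act M X x) = act N X (f x)" if X: "X \<in> pe n" and x: "x \<in> carr M" for X x
    using M.act_parts[OF X x] N.act_parts[OF X linear_betweenD(1)[OF assms(3) x]] X x
    by (simp add: linear_betweenD(2)[OF assms(3)] pe_homog_pe[OF gl_part_pe] act[OF gl_part_pe])
  then show ?thesis
    using assms unfolding mod_hom_def by auto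
qed

lemma mod_isoI:
  assumes "gspace M" "mod_hom n M N f" "\<And>x. x \<in> carr M \<Longrightarrow> f x = 0 \<Longrightarrow> x = 0"
    "\<And>y. y \<in> carr N \<Longrightarrow> \<exists>x\<in>carr M. f x = y"
  shows "mod_iso n M N f"
proof -
  interpret M: gspace M by fact
  note f = mod_homD[OF assms(2)]
  have "inj_on f (carr M)"
  proof (rule inj_onI)
    fix x y assume xy: "x \<in> carr M" "y \<in> carr M" "f x = f y"
    then have "f (x - y) = 0"
      using linear_between_diff[OF f(1) M.carr_subspace] by simp
    then show "x = y"
      using assms(3)[of "x - y"] xy M.carr_diff by simp
  qed
  moreover have "f ` carr M = carr N"
    using assms(4) linear_betweenD(1)[OF f(1)] by blast
  ultimately show ?thesis
    using assms(2) unfolding mod_iso_def bij_betw_def by blast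
qed

lemma isomorphic_sym:
  assumes "pmod M n" "pmod N n" "isomorphic n M N"
  shows "isomorphic n N M"
proof -
  interpret M: pmod M n by fact
  interpret N: pmod N n by fact
  obtain f where "mod_iso n M N f"
    using assms(3) by (auto simp: isomorphic_def)
  then have hom: "mod_hom n M N f" and bij: "bij_betw f (carr M) (carr N)"
    by (auto simp: mod_iso_def)
  note f = mod_homD[OF hom]
  define g where "g = inv_into (carr M) f"
  have gf: "g (f x) = x" if "x \<in> carr M" for x
    using bij that unfolding g_def by (simp add: bij_betw_inv_into_left)
  have fg: "f (g y) = y" and g_in: "g y \<in> carr M" if "y \<in> carr N" for y
    using bij that unfolding g_def by (simp_all add: bij_betw_inv_into_right bij_betw_def inv_into_into)
  have g_eq: "g y = x" if "x \<in> carr M" "f x = y" for x y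
    using gf that by blast
  have lin: "linear_between (carr N) (carr M) g"
    by (rule linear_betweenI)
      (auto simp: g_in fg linear_betweenD[OF f(1)] M.carr_add M.carr_scale intro!: g_eq)
  have "g y \<in> homog M p" if y: "y \<in> homog N p" for y p
  proof -
    note y' = N.homog_carr[OF y]
    have "f (hpart M p (g y)) = y"
      using mod_hom_hpart[OF M.gspace_axioms N.gspace_axioms hom g_in[OF y'], of p] fg[OF y'] N.hpart_homog[OF y, of p]
      by simp
    then have "g y = hpart M p (g y)"
      by (intro g_eq M.hpart_carr g_in[OF y'])
    then show ?thesis
      using M.hpart_in[OF g_in[OF y'], of p] by simp
  qed
  moreover have "g (act N X y) = act M X (g y)" if "X \<in> pe_homog n p" "y \<in> carr N" for p X y
    using that f(3)[of X "g y"] fg g_in by (intro g_eq) (auto simp: pe_homog_pe)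
  ultimately have "mod_hom n N M g"
    by (intro mod_homI assms lin)
  moreover have "bij_betw g (carr N) (carr M)"
    unfolding g_def using bij by (rule bij_betw_inv_into)
  ultimately show ?thesis
    unfolding isomorphic_def mod_iso_def by blast
qed

lemma isomorphic_trans:
  assumes "isomorphic n M N" "isomorphic n N P"
  shows "isomorphic n M P"
proof -
  obtain f g where fg: "mod_iso n M N f" "mod_iso n N P g"
    using assms by (auto simp: isomorphic_def)
  note f = mod_homD[OF fg(1)[unfolded mod_iso_def, THEN conjunct1]]
  note g = mod_homD[OF fg(2)[unfolded mod_iso_def, THEN conjunct1]]
  have "mod_hom n M P (g \<circ> f)"
    unfolding mod_hom_def
    using linear_betweenD[OF f(1)] linear_betweenD[OF g(1)] f(2,3) g(2,3)
    by (auto intro!: linear_betweenI)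
  then show ?thesis
    using fg bij_betw_trans unfolding isomorphic_def mod_iso_def by blast
qed

text \<open>Graded submodules without the record around them: the action is always that of
  \<open>M\<close>, so only the two homogeneous pieces vary.\<close>

definition graded_stable :: "nat \<Rightarrow> 'v::complex_space smod \<Rightarrow> (bit \<Rightarrow> 'v set) \<Rightarrow> bool" where
  "graded_stable n M H \<longleftrightarrow> (\<forall>p. cvs.subspace (H p) \<and> H p \<subseteq> homog M p) \<and>
     (\<forall>p q. \<forall>X\<in>pe_homog n p. \<forall>x\<in>H q. act M X x \<in> H (p + q))"

text \<open>Inside \<open>M\<close> a graded subspace and its pair of homogeneous pieces determine
  each other, so the condition that \<open>simple_mod\<close> puts on carriers may be read piece by
  piece.\<close>

lemma (in pmod) simple_mod_iff:
  "simple_mod n M \<longleftrightarrow> (\<exists>p. homog M p \<noteq> {0}) \<and>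
     (\<forall>H. graded_stable n M H \<longrightarrow> (\<forall>p. H p = {0}) \<or> (\<forall>p. H p = homog M p))" (is "_ \<longleftrightarrow> ?R")
proof -
  have carr_0_iff: "carr N = {0} \<longleftrightarrow> (\<forall>p. homog N p = {0})" if "gspace N" for N :: "'v smod"
  proof -
    interpret N: gspace N by fact
    show ?thesis
    proof
      assume "carr N = {0}"
      then show "\<forall>p. homog N p = {0}"
        using N.homog_carr N.homog_0 by blast
    qed (auto simp: carr_def)
  qed
  have carr_eq_iff: "carr N = carr M \<longleftrightarrow> (\<forall>p. homog N p = homog M p)" if "gspace N" and le: "\<And>p. homog N p \<subseteq> homog M p" for N
  proof -
    interpret N: gspace N by fact
    show ?thesis
    proof
      assume eq: "carr N = carr M"
      have "x \<in> homog N p" if x: "x \<in> homog M p" for p x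
      proof -
        have "x \<in> carr N"
          using homog_carr[OF x] eq by simp
        then obtain y z where yz: "y \<in> homog N p" "z \<in> homog N (p + 1)" "x = y + z"
          by (rule N.carr_obtain)
        then have "hpart M p x = y"
          using hpart_unique le by blast
        then show ?thesis
          using hpart_homog[OF x, of p] yz by simp
      qed
      then show "\<forall>p. homog N p = homog M p"
        using le by blast
    qed (simp add: carr_def)
  qed
  have sub: "submodule n N M \<Longrightarrow> gspace N \<and> (\<forall>p. homog N p \<subseteq> homog M p) \<and> graded_stable n M (homog N)" for N
    unfolding submodule_def graded_stable_def pe_module_iff
    using pmod.act_homog pmod.axioms(1) gspace.homog_subspace by metis
  show ?thesis
  proof
    assume simple: "simple_mod n M"
    have "(\<forall>p. H p = {0}) \<or> (\<forall>p. H p = homog M p)" if H: "graded_stable n M H" for H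
    proof -
      let ?N = "\<lparr>homog = H, act = act M\<rparr>"
      have N: "submodule n ?N M"
        using H by (intro submoduleI) (auto simp: graded_stable_def)
      show ?thesis
        using simple N sub[OF N] carr_0_iff[of ?N] carr_eq_iff[of ?N] unfolding simple_mod_def by auto
    qed
    then show ?R
      using simple carr_0_iff[OF gspace_axioms] unfolding simple_mod_def by blast
  next
    assume R: ?R
    have "carr N = {0} \<or> carr N = carr M" if "submodule n N M" for N
    proof -
      note N = sub[OF that]
      have "(\<forall>p. homog N p = {0}) \<or> (\<forall>p. homog N p = homog M p)"
        using R N by simp
      then show ?thesis
        using N carr_0_iff[of N] carr_eq_iff[of N] by simp
    qed
    then show "simple_mod n M"
      unfolding simple_mod_def
      using carr_0_iff[OF gspace_axioms] pe_module R by simp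
  qed
qed

text \<open>A stable family in \<open>N\<close> pulls back along the isomorphism to a stable family
  in \<open>M\<close>.\<close>

lemma isomorphic_simple:
  assumes "pmod M n" "pmod N n" "isomorphic n M N" "simple_mod n M"
  shows "simple_mod n N"
proof -
  interpret M: pmod M n by fact
  interpret N: pmod N n by fact
  obtain f where "mod_iso n M N f"
    using assms(3) by (auto simp: isomorphic_def)
  then have hom: "mod_hom n M N f" and bij: "bij_betw f (carr M) (carr N)"
    by (auto simp: mod_iso_def)
  note f = mod_homD[OF hom]
  have surj: "\<exists>x\<in>homog M p. f x = y" if y: "y \<in> homog N p" for y p
  proof -
    have "y \<in> f ` carr M"
      using N.homog_carr[OF y] bij by (simp add: bij_betw_def)
    then obtain x where x: "x \<in> carr M" "f x = y"
      by blast
    then have "f (hpart M p x) = y"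
      using mod_hom_hpart[OF M.gspace_axioms N.gspace_axioms hom x(1), of p] N.hpart_homog[OF y, of p] by simp
    then show ?thesis
      using M.hpart_in[OF x(1)] by blast
  qed
  have inj: "x = 0" if "x \<in> carr M" "f x = 0" for x
    using that bij linear_between_0[OF f(1) M.carr_subspace] M.carr_0 unfolding bij_betw_def inj_on_def by metis
  have simple: "\<exists>p. homog M p \<noteq> {0}"
    "\<And>H. graded_stable n M H \<Longrightarrow> (\<forall>p. H p = {0}) \<or> (\<forall>p. H p = homog M p)"
    using assms(4) by (auto simp: M.simple_mod_iff)
  show ?thesis
    unfolding N.simple_mod_iff
  proof (intro conjI allI impI)
    obtain p x where x: "x \<in> homog M p" "x \<noteq> 0"
      using simple(1) M.homog_0 by blast
    then have "f x \<noteq> 0"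
      using inj M.homog_carr by blast
    then show "\<exists>p. homog N p \<noteq> {0}"
      using f(2)[OF x(1)] by blast
  next
    fix H assume H: "graded_stable n N H"
    define K where "K p = {x \<in> homog M p. f x \<in> H p}" for p
    have H_sub: "cvs.subspace (H p)" "H p \<subseteq> homog N p" for p
      using H by (auto simp: graded_stable_def)
    have "cvs.subspace (K p)" for p
      unfolding cvs.subspace_def K_def
      using cvs.subspace_0[OF H_sub(1)] cvs.subspace_add[OF H_sub(1)] cvs.subspace_scale[OF H_sub(1)]
        linear_between_0[OF f(1) M.carr_subspace] linear_betweenD(2,3)[OF f(1)] M.homog_carr M.homog_add M.homog_scale
      by auto
    moreover have "act M X x \<in> K (p + q)" if "X \<in> pe_homog n p" "x \<in> K q" for X x p q
      using that H M.act_homog[OF that(1)] f(3)[OF pe_homog_pe[OF that(1)]] M.homog_carr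
      by (auto simp: K_def graded_stable_def)
    ultimately have "graded_stable n M K"
      by (auto simp: graded_stable_def K_def)
    from simple(2)[OF this] show "(\<forall>p. H p = {0}) \<or> (\<forall>p. H p = homog N p)"
    proof
      assume K: "\<forall>p. K p = {0}"
      have "y = 0" if y: "y \<in> H p" for y p
      proof -
        obtain x where x: "x \<in> homog M p" "f x = y"
          using surj y H_sub(2) by blast
        then have "x \<in> K p"
          using y by (simp add: K_def)
        then have "x = 0"
          using K by blast
        then show ?thesis
          using x(2) linear_between_0[OF f(1) M.carr_subspace] by simp
      qed
      then have "\<forall>p. H p = {0}"
        using cvs.subspace_0[OF H_sub(1)] by blast
      then show ?thesis ..
    next
      assume K: "\<forall>p. K p = homog M p"
      have "y \<in> H p" if "y \<in> homog N p" for y p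
        using surj[OF that] K by (auto simp: K_def)
      then show ?thesis
        using H_sub(2) by blast
    qed
  qed
qed


section \<open>Parity change\<close>

context pmod
begin

lemma carr_Pi [simp]: "carr (Pi_mod M) = carr M"
  unfolding carr_def by (auto simp: Pi_mod_def) (metis add.commute)+

lemma homog_Pi [simp]: "homog (Pi_mod M) p = homog M (p + 1)"
  by (simp add: Pi_mod_def)

lemma act_Pi:
  assumes "X \<in> pe_homog n p" "x \<in> carr M"
  shows "act (Pi_mod M) X x = psign p *\<^sub>C act M X x"
  using assms by (cases p) (simp_all add: Pi_mod_def gl_part_homog_eq cscale_one)

lemma act_Pi_parts:
  assumes "X \<in> pe n" "x \<in> carr M"
  shows "act (Pi_mod M) X x = act M (gl_part 0 X) x - act M (gl_part 1 X) x"
  by (simp add: Pi_mod_def cscale_one)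

lemma pmod_Pi: "pmod (Pi_mod M) n"
proof
  show "cvs.subspace (homog (Pi_mod M) p)" for p
    by (simp add: homog_subspace)
  show "homog (Pi_mod M) 0 \<inter> homog (Pi_mod M) 1 = {0}"
    using homog_Int by auto
next
  fix X assume "X \<in> pe n"
  then show "linear_between (carr (Pi_mod M)) (carr (Pi_mod M)) (act (Pi_mod M) X)"
    by (intro linear_betweenI)
      (simp_all add: act_Pi_parts carr_diff carr_add carr_scale pe_homog_pe[OF gl_part_pe] act_add act_scale
        cvs.scale_right_diff_distrib)
next
  fix x assume "x \<in> carr (Pi_mod M)"
  then show "linear_between (pe n) (carr (Pi_mod M)) (\<lambda>X. act (Pi_mod M) X x)"
    using cvs.subspace_add[OF subspace_pe] cvs.subspace_scale[OF subspace_pe]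
    by (intro linear_betweenI)
      (simp_all add: act_Pi_parts carr_diff pe_homog_pe[OF gl_part_pe] gl_part_add gl_part_scale act_add_left act_scale_left
        cvs.scale_right_diff_distrib)
next
  fix X p x q assume "X \<in> pe_homog n p" "x \<in> homog (Pi_mod M) q"
  then show "act (Pi_mod M) X x \<in> homog (Pi_mod M) (p + q)"
    using act_homog[of X p x "q + 1"] homog_scale by (simp add: act_Pi homog_carr ac_simps)
next
  fix X p Y q x assume X: "X \<in> pe_homog n p" and Y: "Y \<in> pe_homog n q" and x: "x \<in> carr (Pi_mod M)"
  note [simp] = pe_homog_pe[OF X] pe_homog_pe[OF Y]
  show "act (Pi_mod M) (mmul (idx n) X Y - psign (p * q) *\<^sub>C mmul (idx n) Y X) x =
      act (Pi_mod M) X (act (Pi_mod M) Y x) - psign (p * q) *\<^sub>C act (Pi_mod M) Y (act (Pi_mod M) X x)"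
    using x by (simp add: act_Pi[OF mmul_pe_bracket[OF X Y]] act_Pi[OF X] act_Pi[OF Y] act_bracket[OF X Y]
        carr_scale act_scale psign_add cvs.scale_right_diff_distrib ac_simps)
qed

text \<open>The identity map serves. The two records need not be equal, since their actions may
  differ on arguments outside \<open>pe n\<close>.\<close>

lemma Pi_Pi_isomorphic: "isomorphic n M (Pi_mod (Pi_mod M))"
proof -
  interpret Pi: pmod "Pi_mod M" n
    by (rule pmod_Pi)
  have "mod_hom n M (Pi_mod (Pi_mod M)) id"
    by (rule mod_homI[OF pmod_axioms Pi.pmod_Pi])
      (auto intro!: linear_betweenI simp: Pi.act_Pi act_Pi Pi.homog_Pi pe_homog_pe cscale_one)
  then show ?thesis
    unfolding isomorphic_def mod_iso_def by auto
qed

lemma simple_Pi: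
  assumes "simple_mod n M"
  shows "simple_mod n (Pi_mod M)"
  unfolding pmod.simple_mod_iff[OF pmod_Pi]
proof (intro conjI allI impI)
  obtain p where "homog M p \<noteq> {0}"
    using assms simple_mod_iff by blast
  then show "\<exists>p. homog (Pi_mod M) p \<noteq> {0}"
    by (intro exI[of _ "p + 1"]) simp
next
  fix H assume H: "graded_stable n (Pi_mod M) H"
  have H_sub: "cvs.subspace (H p)" "H p \<subseteq> homog M (p + 1)" for p
    using H by (auto simp: graded_stable_def)
  have "act M X x \<in> H (p + q + 1)" if "X \<in> pe_homog n p" "x \<in> H (q + 1)" for X x p q
  proof -
    have "act M X x = psign p *\<^sub>C act (Pi_mod M) X x"
      using that homog_carr H_sub(2) by (subst act_Pi[OF that(1)]) (auto simp: cscale_one)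
    moreover have "act (Pi_mod M) X x \<in> H (p + (q + 1))"
      using that H by (auto simp: graded_stable_def)
    ultimately show ?thesis
      using cvs.subspace_scale[OF H_sub(1)] by (simp add: ac_simps)
  qed
  then have "graded_stable n M (\<lambda>p. H (p + 1))"
    using H_sub(1) H_sub(2)[of "_ + 1"] by (auto simp: graded_stable_def)
  then have "(\<forall>p. H (p + 1) = {0}) \<or> (\<forall>p. H (p + 1) = homog M p)"
    using assms simple_mod_iff by blast
  then show "(\<forall>p. H p = {0}) \<or> (\<forall>p. H p = homog (Pi_mod M) p)"
    by (metis bit_plus_plus(2) homog_Pi)
qed

end

section \<open>Dual modules\<close>

lemma cscale_complex [simp]: "c *\<^sub>C z = c * z" for z :: complex
  by (simp add: cscale_complex_def)

lemma cscale_apply [simp]: "(c *\<^sub>C f) x = c *\<^sub>C f x"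
  by (simp add: cscale_fun_def)

section \<open>Functionals on a subspace of the ambient type\<close>

definition restrict0 :: "'a set \<Rightarrow> ('a \<Rightarrow> 'b::zero) \<Rightarrow> 'a \<Rightarrow> 'b"
  where "restrict0 S f = (\<lambda>x. if x \<in> S then f x else 0)"

lemma restrict0_apply [simp]: "x \<in> S \<Longrightarrow> restrict0 S f x = f x" "x \<notin> S \<Longrightarrow> restrict0 S f x = 0"
  by (simp_all add: restrict0_def)

definition functionals :: "'a::complex_space set \<Rightarrow> ('a \<Rightarrow> complex) set"
  where "functionals S = {\<phi>. linear_between S UNIV \<phi> \<and> (\<forall>x. x \<notin> S \<longrightarrow> \<phi> x = 0)}"

lemma functionalsI:
  assumes "\<And>x y. x \<in> S \<Longrightarrow> y \<in> S \<Longrightarrow> \<phi> (x + y) = \<phi> x + \<phi> y" "\<And>c x. x \<in> S \<Longrightarrow> \<phi> (c *\<^sub>C x) = c * \<phi> x"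
    "\<And>x. x \<notin> S \<Longrightarrow> \<phi> x = 0"
  shows "\<phi> \<in> functionals S"
  using assms by (simp add: functionals_def linear_between_def)

lemma functionalsD:
  assumes "\<phi> \<in> functionals S"
  shows "x \<in> S \<Longrightarrow> y \<in> S \<Longrightarrow> \<phi> (x + y) = \<phi> x + \<phi> y" "x \<in> S \<Longrightarrow> \<phi> (c *\<^sub>C x) = c * \<phi> x"
    "x \<notin> S \<Longrightarrow> \<phi> x = 0" "linear_between S UNIV \<phi>"
  using assms by (auto simp: functionals_def linear_between_def)

lemma functionals_restrict0:
  assumes "cvs.subspace S" "linear_between S T f" "linear_between T UNIV \<phi>"
  shows "restrict0 S (\<lambda>x. \<phi> (f x)) \<in> functionals S"
  using cvs.subspace_add[OF assms(1)] cvs.subspace_scale[OF assms(1)] linear_betweenD[OF assms(2)] linear_betweenD[OF assms(3)]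
  by (intro functionalsI) auto

lemma functionals_clin:
  assumes "cvs.subspace S" "clin \<phi>"
  shows "restrict0 S \<phi> \<in> functionals S"
  using cvs.subspace_add[OF assms(1)] cvs.subspace_scale[OF assms(1)] cvsp.linear_add[OF assms(2)] cvsp.linear_scale[OF assms(2)]
  by (intro functionalsI) auto

lemma functionals_separate:
  assumes "cvs.subspace S" "cvs.subspace A" "x \<in> S" "x \<notin> A"
  obtains \<phi> where "\<phi> \<in> functionals S" "\<And>y. y \<in> A \<Longrightarrow> \<phi> y = 0" "\<phi> x = 1"
proof -
  obtain \<phi> where \<phi>: "clin \<phi>" "\<And>y. y \<in> A \<Longrightarrow> \<phi> y = 0" "\<phi> x = (1::complex)"
    using exists_separating_functional[OF assms(2,4)] by blast
  show ?thesis
    using \<phi> assms functionals_clin[OF assms(1) \<phi>(1)] by (intro that[of "restrict0 S \<phi>"]) (auto simp: restrict0_def)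
qed

lemma functionals_expand:
  fixes S :: "'a::complex_space set"
  assumes "fin_dim S" "cvs.subspace S"
  obtains B and d :: "'a \<Rightarrow> 'a \<Rightarrow> complex" where "finite B" "B \<subseteq> S" "\<And>b. d b \<in> functionals S"
    "\<And>\<phi>. \<phi> \<in> functionals S \<Longrightarrow> \<phi> = (\<Sum>b\<in>B. \<phi> b *\<^sub>C d b)"
proof -
  obtain B and d :: "'a \<Rightarrow> 'a \<Rightarrow> complex" where B: "finite B" "B \<subseteq> S"
    "\<And>b. clin (d b)" "\<And>x. x \<in> S \<Longrightarrow> x = (\<Sum>b\<in>B. d b x *\<^sub>C b)"
    using dual_basis_functionals[OF assms] by blast
  have sum_apply: "(\<Sum>b\<in>A. f b) x = (\<Sum>b\<in>A. f b x)" for A and f :: "'a \<Rightarrow> 'a \<Rightarrow> complex" and x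
    by (induction A rule: infinite_finite_induct) simp_all
  have "\<phi> = (\<Sum>b\<in>B. \<phi> b *\<^sub>C restrict0 S (d b))" if \<phi>: "\<phi> \<in> functionals S" for \<phi>
  proof
    fix x
    show "\<phi> x = (\<Sum>b\<in>B. \<phi> b *\<^sub>C restrict0 S (d b)) x"
    proof (cases "x \<in> S")
      case True
      have "\<phi> x = \<phi> (\<Sum>b\<in>B. d b x *\<^sub>C b)"
        using B(4)[OF True] by simp
      also have "\<dots> = (\<Sum>b\<in>B. \<phi> (d b x *\<^sub>C b))"
        using B(2) by (intro linear_between_sum[OF functionalsD(4)[OF \<phi>] assms(2)] cvs.subspace_scale[OF assms(2)]) blast
      also have "\<dots> = (\<Sum>b\<in>B. d b x * \<phi> b)"
        using B(2) by (intro sum.cong refl functionalsD(2)[OF \<phi>]) blast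
      finally show ?thesis
        using True by (simp add: sum_apply ac_simps)
    next
      case False
      then show ?thesis
        using functionalsD(3)[OF \<phi>] by (simp add: sum_apply)
    qed
  qed
  then show ?thesis
    using that[of B "\<lambda>b. restrict0 S (d b)"] B(1,2) functionals_clin[OF assms(2) B(3)] by blast
qed

lemma fin_dim_functionals:
  assumes "fin_dim S" "cvs.subspace S"
  shows "fin_dim (functionals S)"
proof -
  obtain B d where B: "finite B" "B \<subseteq> S" "\<And>b. d b \<in> functionals S"
    "\<And>\<phi>. \<phi> \<in> functionals S \<Longrightarrow> \<phi> = (\<Sum>b\<in>B. \<phi> b *\<^sub>C d b)"
    using functionals_expand[OF assms] by blast
  have "\<phi> \<in> cvs.span (d ` B)" if "\<phi> \<in> functionals S" for \<phi>
    by (subst B(4)[OF that]) (intro cvs.span_sum cvs.span_scale cvs.span_base imageI)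
  then show ?thesis
    using B(1) unfolding fin_dim_def by blast
qed

text \<open>The vector is the sum of \<open>\<xi> (d b) *\<^sub>C b\<close> over the finite set
  \<open>B\<close> of \<open>functionals_expand\<close>. This description of the bidual turns linear
  tests on the dual into evaluations at vectors of \<open>S\<close>.\<close>

lemma functionals_reflexive:
  assumes "fin_dim S" "cvs.subspace S" "cvs.subspace (functionals S)"
    and \<xi>: "linear_between (functionals S) UNIV (\<xi> :: _ \<Rightarrow> complex)"
  obtains x where "x \<in> S" "\<And>\<phi>. \<phi> \<in> functionals S \<Longrightarrow> \<xi> \<phi> = \<phi> x"
proof -
  obtain B d where B: "finite B" "B \<subseteq> S" "\<And>b. d b \<in> functionals S"
    "\<And>\<phi>. \<phi> \<in> functionals S \<Longrightarrow> \<phi> = (\<Sum>b\<in>B. \<phi> b *\<^sub>C d b)"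
    using functionals_expand[OF assms(1,2)] by blast
  have in_S: "\<xi> (d b) *\<^sub>C b \<in> S" if "b \<in> B" for b
    using that B(2) cvs.subspace_scale[OF assms(2)] by blast
  show ?thesis
  proof (rule that)
    show "(\<Sum>b\<in>B. \<xi> (d b) *\<^sub>C b) \<in> S"
      using in_S by (rule cvs.subspace_sum[OF assms(2)])
    fix \<phi> assume \<phi>: "\<phi> \<in> functionals S"
    have "\<xi> \<phi> = \<xi> (\<Sum>b\<in>B. \<phi> b *\<^sub>C d b)"
      using B(4)[OF \<phi>] by simp
    also have "\<dots> = (\<Sum>b\<in>B. \<xi> (\<phi> b *\<^sub>C d b))"
      by (intro linear_between_sum[OF \<xi> assms(3)] cvs.subspace_scale[OF assms(3)] B(3))
    also have "\<dots> = (\<Sum>b\<in>B. \<xi> (d b) * \<phi> b)"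
      by (intro sum.cong refl) (simp add: linear_betweenD(3)[OF \<xi> B(3)])
    also have "\<dots> = (\<Sum>b\<in>B. \<phi> (\<xi> (d b) *\<^sub>C b))"
      using B(2) functionalsD(2)[OF \<phi>] by (intro sum.cong refl) auto
    also have "\<dots> = \<phi> (\<Sum>b\<in>B. \<xi> (d b) *\<^sub>C b)"
      by (intro linear_between_sum[OF functionalsD(4)[OF \<phi>] assms(2), symmetric] in_S)
    finally show "\<xi> \<phi> = \<phi> (\<Sum>b\<in>B. \<xi> (d b) *\<^sub>C b)" .
  qed
qed

text \<open>The double annihilator of \<open>K\<close> is \<open>K\<close>: a functional on the dual
  that separates \<open>\<phi>\<close> from \<open>K\<close> is evaluation at a vector by
  reflexivity, and this vector contradicts \<open>ann\<close>.\<close>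

lemma functionals_annihilator:
  assumes S: "fin_dim S" "cvs.subspace S" "cvs.subspace (functionals S)"
    and K: "cvs.subspace K" "K \<subseteq> functionals S" and \<phi>: "\<phi> \<in> functionals S"
    and ann: "\<And>x. x \<in> S \<Longrightarrow> (\<And>\<psi>. \<psi> \<in> K \<Longrightarrow> \<psi> x = 0) \<Longrightarrow> \<phi> x = 0"
  shows "\<phi> \<in> K"
proof (rule ccontr)
  assume "\<phi> \<notin> K"
  then obtain \<xi> where \<xi>: "clin \<xi>" "\<And>\<psi>. \<psi> \<in> K \<Longrightarrow> \<xi> \<psi> = 0" "\<xi> \<phi> = (1::complex)"
    using exists_separating_functional[OF K(1)] by blast
  have "linear_between (functionals S) UNIV \<xi>"
    using \<xi>(1) by (rule clin_linear_between) simp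
  then obtain x where x: "x \<in> S" "\<And>\<phi>. \<phi> \<in> functionals S \<Longrightarrow> \<xi> \<phi> = \<phi> x"
    using functionals_reflexive[OF S] by blast
  have "\<phi> x = 0"
    using x(2)[symmetric] K(2) \<xi>(2) by (intro ann[OF x(1)]) (simp add: subset_iff)
  then show False
    using x(2)[OF \<phi>] \<xi>(3) by simp
qed

context gspace
begin

lemma dual_homog: "homog (dual_mod M) p = {\<phi> \<in> functionals (carr M). \<forall>x\<in>homog M (p + 1). \<phi> x = 0}"
  by (auto simp: dual_mod_def functionals_def)

lemma functionals_subspace: "cvs.subspace (functionals (carr M))"
  unfolding cvs.subspace_def functionals_def linear_between_def by (auto simp: algebra_simps)

lemma dual_gspace: "gspace (dual_mod M)"
proof
  show "cvs.subspace (homog (dual_mod M) p)" for p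
    using functionals_subspace unfolding cvs.subspace_def dual_homog by auto
  have "\<phi> = 0" if "\<phi> \<in> homog (dual_mod M) 0" "\<phi> \<in> homog (dual_mod M) 1" for \<phi>
  proof
    fix x
    have \<phi>: "\<phi> \<in> functionals (carr M)"
      using that by (simp add: dual_homog)
    show "\<phi> x = 0 x"
    proof (cases "x \<in> carr M")
      case True
      then show ?thesis
      proof (induction rule: carr_induct)
        case (homog q y)
        then show ?case
          using that by (cases q) (auto simp: dual_homog)
      qed (simp add: functionalsD(1)[OF \<phi>])
    qed (simp add: functionalsD(3)[OF \<phi>])
  qed
  then show "homog (dual_mod M) 0 \<inter> homog (dual_mod M) 1 = {0}"
    using cvs.subspace_0[OF functionals_subspace] by (auto simp: dual_homog)
qed

lemma functional_hpart:
  assumes "\<phi> \<in> functionals (carr M)"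
  shows "restrict0 (carr M) (\<lambda>x. \<phi> (hpart M p x)) \<in> homog (dual_mod M) p"
proof -
  have "linear_between (carr M) (carr M) (hpart M p)"
    using hpart_linear[of p] homog_carr by (auto simp: linear_between_def)
  then show ?thesis
    using functionals_restrict0[OF carr_subspace _ functionalsD(4)[OF assms]] 
      linear_between_0[OF functionalsD(4)[OF assms] carr_subspace]
    by (auto simp: dual_homog hpart_homog homog_carr)
qed

lemma dual_carr: "carr (dual_mod M) = functionals (carr M)"
proof (intro subset_antisym subsetI)
  fix \<phi> assume "\<phi> \<in> carr (dual_mod M)"
  then show "\<phi> \<in> functionals (carr M)"
    using cvs.subspace_add[OF functionals_subspace] unfolding carr_def dual_homog by auto
next
  fix \<phi> assume \<phi>: "\<phi> \<in> functionals (carr M)"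
  let ?h = "\<lambda>p. restrict0 (carr M) (\<lambda>x. \<phi> (hpart M p x))"
  have "\<phi> = ?h 0 + ?h 1"
  proof
    fix x
    show "\<phi> x = (?h 0 + ?h 1) x"
      using functionalsD(1)[OF \<phi> hpart_carr hpart_carr, of x x 0 1] functionalsD(3)[OF \<phi>, of x] hpart_sum[of x 0]
      by (cases "x \<in> carr M") auto
  qed
  then show "\<phi> \<in> carr (dual_mod M)"
    using functional_hpart[OF \<phi>, of 0] functional_hpart[OF \<phi>, of 1] unfolding carr_def by blast
qed

text \<open>A functional of parity \<open>q\<close> sees only the part of parity \<open>q\<close> of
  its argument, so its sign may be put on the argument instead.\<close>

lemma dual_parop:
  assumes "\<phi> \<in> carr (dual_mod M)"
  shows "parop (dual_mod M) r \<phi> = restrict0 (carr M) (\<lambda>x. \<phi> (parop M r x))"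
proof -
  interpret d: gspace "dual_mod M" by (rule dual_gspace)
  show ?thesis
    using assms
  proof (induction rule: d.carr_induct)
    case (homog q \<psi>)
    then have \<psi>: "\<psi> \<in> functionals (carr M)" "\<And>x. x \<in> homog M (q + 1) \<Longrightarrow> \<psi> x = 0"
      by (auto simp: dual_homog)
    have "psign (r * q) * \<psi> x = \<psi> (parop M r x)" if "x \<in> carr M" for x
      using that
    proof (induction rule: carr_induct)
      case (homog s y)
      then show ?case
        using \<psi>(2)[of y] functionalsD(2)[OF \<psi>(1) homog_carr[OF homog]]
        by (cases "s = q") (auto simp: parop_homog[OF homog], (cases s; cases q; auto))
    qed (simp add: functionalsD(1)[OF \<psi>(1)] parop_add algebra_simps)
    then show ?case
      using functionalsD(3)[OF \<psi>(1)] by (auto simp: d.parop_homog[OF homog] restrict0_def fun_eq_iff)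
  next
    case (add \<phi> \<psi>)
    show ?case
      unfolding d.parop_add[OF add(1,2)] add(3,4) by (rule ext) (simp add: restrict0_def)
  qed
qed

end

context pmod
begin

text \<open>The double sum in \<open>dual_mod\<close> runs over the parities of \<open>X\<close> and
  of the functional; for homogeneous \<open>X\<close> the first sum reduces to one term and the
  second is \<open>parop\<close>.\<close>

lemma dual_act_homog:
  assumes X: "X \<in> pe_homog n p" and \<phi>: "\<phi> \<in> functionals (carr M)"
  shows "act (dual_mod M) X \<phi> = restrict0 (carr M) (\<lambda>x. - \<phi> (parop M p (act M X x)))"
proof
  fix x
  show "act (dual_mod M) X \<phi> x = restrict0 (carr M) (\<lambda>x. - \<phi> (parop M p (act M X x))) x"
  proof (cases "x \<in> carr M")
    case True
    have *: "(\<Sum>q\<in>{0,1}. psign (r * q) * \<phi> (hpart M q y)) = \<phi> (parop M r y)" if "y \<in> carr M" for r y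
      using that by (simp add: parop_eq functionalsD(1,2)[OF \<phi>] carr_scale)
    have "\<phi> (0) = 0"
      by (rule linear_between_0[OF functionalsD(4)[OF \<phi>] carr_subspace])
    then show ?thesis
      using True X
      by (cases p) (simp_all add: dual_mod_def gl_part_homog_eq pe_homog_pe[OF X] parop_eq functionalsD(1,2)[OF \<phi>] carr_scale
          cscale_one linear_between_diff[OF functionalsD(4)[OF \<phi>] carr_subspace])
  qed (simp add: dual_mod_def)
qed

lemma dual_act_add:
  assumes "X \<in> pe n" "Y \<in> pe n" "\<phi> \<in> functionals (carr M)"
  shows "act (dual_mod M) (X + Y) \<phi> = act (dual_mod M) X \<phi> + act (dual_mod M) Y \<phi>"
  using assms
  by (auto simp: dual_mod_def fun_eq_iff gl_part_add act_add_left pe_homog_pe[OF gl_part_pe] hpart_add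
      functionalsD(1)[OF assms(3)] algebra_simps)

lemma dual_act_scale:
  assumes "X \<in> pe n" "\<phi> \<in> functionals (carr M)"
  shows "act (dual_mod M) (c *\<^sub>C X) \<phi> = c *\<^sub>C act (dual_mod M) X \<phi>"
  using assms
  by (auto simp: dual_mod_def fun_eq_iff gl_part_scale act_scale_left pe_homog_pe[OF gl_part_pe] hpart_scale
      functionalsD(2)[OF assms(2)] algebra_simps)

lemma dual_act_in:
  assumes X: "X \<in> pe_homog n p" and \<phi>: "\<phi> \<in> functionals (carr M)"
  shows "act (dual_mod M) X \<phi> \<in> functionals (carr M)"
  unfolding dual_act_homog[OF X \<phi>] using pe_homog_pe[OF X]
  by (intro functionalsI)
    (simp_all add: carr_add carr_scale act_add act_scale parop_add parop_scale functionalsD(1,2)[OF \<phi>])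

lemma pmod_dual: "pmod (dual_mod M) n"
proof -
  interpret d: gspace "dual_mod M" by (rule dual_gspace)
  have parts: "act (dual_mod M) X \<phi> = act (dual_mod M) (gl_part 0 X) \<phi> + act (dual_mod M) (gl_part 1 X) \<phi>"
    if "X \<in> pe n" "\<phi> \<in> functionals (carr M)" for X \<phi>
    using dual_act_add[OF gl_part_pe[THEN pe_homog_pe] gl_part_pe[THEN pe_homog_pe], OF that(1,1,2), of 0 1] gl_part_sum[of X] by simp
  have in_f: "act (dual_mod M) X \<phi> \<in> functionals (carr M)" if "X \<in> pe n" "\<phi> \<in> functionals (carr M)" for X \<phi>
    unfolding parts[OF that] by (intro cvs.subspace_add[OF functionals_subspace] dual_act_in[OF gl_part_pe] that)
  show ?thesis
  proof
    fix X assume X: "X \<in> pe n"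
    show "linear_between (carr (dual_mod M)) (carr (dual_mod M)) (act (dual_mod M) X)"
      unfolding dual_carr
    proof (rule linear_betweenI)
      fix \<phi> assume "\<phi> \<in> functionals (carr M)"
      then show "act (dual_mod M) X \<phi> \<in> functionals (carr M)"
        by (rule in_f[OF X])
    next
      fix \<phi> \<psi> assume "\<phi> \<in> functionals (carr M)" "\<psi> \<in> functionals (carr M)"
      then show "act (dual_mod M) X (\<phi> + \<psi>) = act (dual_mod M) X \<phi> + act (dual_mod M) X \<psi>"
        by (intro ext) (simp add: parts[OF X] cvs.subspace_add[OF functionals_subspace] dual_act_homog[OF gl_part_pe[OF X]] restrict0_def)
    next
      fix c \<phi> assume "\<phi> \<in> functionals (carr M)"
      then show "act (dual_mod M) X (c *\<^sub>C \<phi>) = c *\<^sub>C act (dual_mod M) X \<phi>"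
        by (intro ext) (simp add: parts[OF X] cvs.subspace_scale[OF functionals_subspace] dual_act_homog[OF gl_part_pe[OF X]] restrict0_def algebra_simps)
    qed
  next
    fix \<phi> assume "\<phi> \<in> carr (dual_mod M)"
    then show "linear_between (pe n) (carr (dual_mod M)) (\<lambda>X. act (dual_mod M) X \<phi>)"
      unfolding dual_carr
      by (intro linear_betweenI in_f dual_act_add dual_act_scale)
  next
    fix X p \<phi> q assume X: "X \<in> pe_homog n p" and \<phi>: "\<phi> \<in> homog (dual_mod M) q"
    have "\<phi> (parop M p (act M X x)) = 0" if "x \<in> homog M (p + q + 1)" for x
      using \<phi> parop_in[OF act_homog[OF X that]] by (auto simp: dual_homog ac_simps)
    then show "act (dual_mod M) X \<phi> \<in> homog (dual_mod M) (p + q)"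
      using \<phi> dual_act_in[OF X] homog_carr by (auto simp: dual_homog dual_act_homog[OF X])
  next
    fix X p Y q \<phi> assume X: "X \<in> pe_homog n p" and Y: "Y \<in> pe_homog n q" and "\<phi> \<in> carr (dual_mod M)"
    then have \<phi>: "\<phi> \<in> functionals (carr M)" by (simp add: dual_carr)
    note \<phi>' = dual_act_in[OF X \<phi>] dual_act_in[OF Y \<phi>]
    note [simp] = pe_homog_pe[OF X] pe_homog_pe[OF Y]
    have neg: "\<phi> (- y) = - \<phi> y" if "y \<in> carr M" for y
      using that linear_between_neg[OF functionalsD(4)[OF \<phi>]] by simp
    show "act (dual_mod M) (mmul (idx n) X Y - psign (p * q) *\<^sub>C mmul (idx n) Y X) \<phi> =
        act (dual_mod M) X (act (dual_mod M) Y \<phi>) - psign (p * q) *\<^sub>C act (dual_mod M) Y (act (dual_mod M) X \<phi>)"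
    proof
      fix x
      show "act (dual_mod M) (mmul (idx n) X Y - psign (p * q) *\<^sub>C mmul (idx n) Y X) \<phi> x =
        (act (dual_mod M) X (act (dual_mod M) Y \<phi>) - psign (p * q) *\<^sub>C act (dual_mod M) Y (act (dual_mod M) X \<phi>)) x"
      proof (cases "x \<in> carr M")
        case True
        \<comment> \<open>Transposition reverses the order: applying \<open>Y\<close> and then
          \<open>X\<close> to \<open>\<phi>\<close> evaluates it at \<open>YX\<close>. The sign
          arises when \<open>parop M p\<close> passes the action of \<open>Y\<close>.\<close>
        define XY where "XY = parop M (p + q) (act M X (act M Y x))"
        define YX where "YX = parop M (p + q) (act M Y (act M X x))"
        have in_M: "XY \<in> carr M" "YX \<in> carr M"
          using True by (simp_all add: XY_def YX_def)
        have "act (dual_mod M) (mmul (idx n) X Y - psign (p * q) *\<^sub>C mmul (idx n) Y X) \<phi> x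
            = - \<phi> (XY - psign (p * q) *\<^sub>C YX)"
          using True by (simp add: dual_act_homog[OF mmul_pe_bracket[OF X Y] \<phi>] act_bracket[OF X Y] XY_def YX_def
              linear_between_diff[OF parop_linear carr_subspace] parop_scale carr_scale)
        also have "\<dots> = - \<phi> XY + psign (p * q) * \<phi> YX"
          using in_M by (simp add: linear_between_diff[OF functionalsD(4)[OF \<phi>] carr_subspace] carr_scale functionalsD(2)[OF \<phi>])
        finally have 1: "act (dual_mod M) (mmul (idx n) X Y - psign (p * q) *\<^sub>C mmul (idx n) Y X) \<phi> x
            = - \<phi> XY + psign (p * q) * \<phi> YX" .
        have 2: "act (dual_mod M) X (act (dual_mod M) Y \<phi>) x = psign (p * q) * \<phi> YX"
          using True by (simp only: dual_act_homog[OF X \<phi>'(2)], simp add: dual_act_homog[OF Y \<phi>] YX_def parop_act[OF X] parop_act[OF Y]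
              carr_scale act_scale parop_scale functionalsD(2)[OF \<phi>] parop_parop psign_add distrib_right distrib_left ac_simps)
        have 3: "act (dual_mod M) Y (act (dual_mod M) X \<phi>) x = psign (p * q) * \<phi> XY"
          using True by (simp only: dual_act_homog[OF Y \<phi>'(1)], simp add: dual_act_homog[OF X \<phi>] XY_def parop_act[OF X] parop_act[OF Y]
              carr_scale act_scale parop_scale functionalsD(2)[OF \<phi>] parop_parop psign_add distrib_right distrib_left ac_simps)
        show ?thesis
          by (simp add: 1 2 3)
      qed (simp add: dual_act_homog[OF mmul_pe_bracket[OF X Y] \<phi>] dual_act_homog[OF X \<phi>'(2)] dual_act_homog[OF Y \<phi>'(1)])
    qed
  qed
qed

end


text \<open>A graded stable family \<open>H\<close> in \<open>M\<close> has a graded stable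
  annihilator \<open>A\<close> in the dual. If \<open>A\<close> is zero, separating functionals
  force \<open>H\<close> to be everything; if \<open>A\<close> is everything, they force
  \<open>H\<close> to be zero.\<close>

lemma (in pmod) simple_if_dual_simple:
  assumes "simple_mod n (dual_mod M)"
  shows "simple_mod n M"
  unfolding simple_mod_iff
proof (intro conjI allI impI)
  interpret d: pmod "dual_mod M" n by (rule pmod_dual)
  have simple: "\<exists>p. homog (dual_mod M) p \<noteq> {0}"
    "\<And>H. graded_stable n (dual_mod M) H \<Longrightarrow> (\<forall>p. H p = {0}) \<or> (\<forall>p. H p = homog (dual_mod M) p)"
    using assms by (auto simp: d.simple_mod_iff)
  show "\<exists>p. homog M p \<noteq> {0}"
  proof (rule ccontr)
    assume "\<not> (\<exists>p. homog M p \<noteq> {0})"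
    then have M: "carr M = {0}"
      by (simp add: carr_def)
    have "\<phi> = 0" if "\<phi> \<in> functionals (carr M)" for \<phi>
      using that linear_between_0[OF functionalsD(4)[OF that] carr_subspace] functionalsD(3)[OF that] M
      by (metis ext singletonD zero_fun_def)
    then show False
      using simple(1) d.homog_carr d.homog_0 unfolding dual_carr by blast
  qed
  fix H assume H: "graded_stable n M H"
  have H_sub: "cvs.subspace (H p)" "H p \<subseteq> homog M p" for p
    using H by (auto simp: graded_stable_def)
  interpret N: gspace "\<lparr>homog = H, act = act M\<rparr>"
  proof
    have "H 0 \<inter> H 1 \<subseteq> homog M 0 \<inter> homog M 1"
      using H_sub(2) by blast
    then show "homog \<lparr>homog = H, act = act M\<rparr> 0 \<inter> homog \<lparr>homog = H, act = act M\<rparr> 1 = {0}"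
      using homog_Int cvs.subspace_0[OF H_sub(1)] by auto
  qed (simp add: H_sub)
  let ?N = "carr \<lparr>homog = H, act = act M\<rparr>"
  have H_M: "x \<in> carr M" if "x \<in> H p" for x p
    using that H_sub(2) homog_carr by blast
  have N_M: "?N \<subseteq> carr M"
    by (auto elim!: N.carr_obtain[where p = 0] intro!: carr_add dest: H_M)
  have hpart_N: "hpart M p x \<in> H p" if x: "x \<in> ?N" for x p
  proof -
    obtain y z where yz: "y \<in> H p" "z \<in> H (p + 1)" "x = y + z"
      using N.carr_obtain[OF x, of p thesis] by simp
    then have "hpart M p x = y"
      using H_sub(2) hpart_unique by blast
    then show ?thesis using yz by simp
  qed
  have H_N: "x \<in> ?N" if "x \<in> H p" for x p
    using N.homog_carr[of x p] that by simp
  define A where "A p = {\<phi> \<in> homog (dual_mod M) p. \<forall>x\<in>?N. \<phi> x = 0}" for p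
  have "act (dual_mod M) X \<phi> \<in> A (p + q)" if X: "X \<in> pe_homog n p" and \<phi>: "\<phi> \<in> A q" for X \<phi> p q
  proof -
    have act_N: "parop M p (act M X x) \<in> ?N" if "x \<in> ?N" for x
      using that
    proof (induction rule: N.carr_induct)
      case (homog r y)
      then have "act M X y \<in> H (p + r)"
        using H X by (auto simp: graded_stable_def)
      moreover from this have "act M X y \<in> homog M (p + r)"
        using H_sub(2) by blast
      ultimately show ?case
        using H_N[OF cvs.subspace_scale[OF H_sub(1)]] by (simp add: parop_homog)
    next
      case (add y z)
      then show ?case
        using N_M pe_homog_pe[OF X] by (simp add: act_add parop_add subset_iff N.carr_add)
    qed
    have "\<phi> \<in> functionals (carr M)"
      using \<phi> by (simp add: A_def dual_homog)
    then have "act (dual_mod M) X \<phi> x = 0" if "x \<in> ?N" for x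
      using \<phi> act_N[OF that] N_M that by (auto simp: A_def dual_act_homog[OF X])
    then show ?thesis
      using \<phi> d.act_homog[OF X] by (simp add: A_def)
  qed
  then have "graded_stable n (dual_mod M) A"
    using d.homog_subspace by (auto simp: graded_stable_def A_def cvs.subspace_def)
  from simple(2)[OF this] show "(\<forall>p. H p = {0}) \<or> (\<forall>p. H p = homog M p)"
  proof
    assume A: "\<forall>p. A p = {0}"
    have "x \<in> H p" if x: "x \<in> homog M p" for x p
    proof (rule ccontr)
      assume "x \<notin> H p"
      then have "x \<notin> ?N"
        using hpart_N[of x p] hpart_homog[OF x, of p] by auto
      then obtain \<phi> where \<phi>: "\<phi> \<in> functionals (carr M)" "\<And>y. y \<in> ?N \<Longrightarrow> \<phi> y = 0" "\<phi> x = 1"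
        using functionals_separate[OF carr_subspace N.carr_subspace homog_carr[OF x]] by blast
      \<comment> \<open>The separating functional may be inhomogeneous. Its part of parity
        \<open>p\<close> still vanishes on \<open>?N\<close>, because \<open>?N\<close> is
        graded.\<close>
      have "restrict0 (carr M) (\<lambda>x. \<phi> (hpart M p x)) \<in> A p"
        using functional_hpart[OF \<phi>(1), of p] \<phi>(2)[OF H_N[OF hpart_N]] N_M by (auto simp: A_def)
      then have "restrict0 (carr M) (\<lambda>x. \<phi> (hpart M p x)) = 0"
        using A by blast
      then have "\<phi> (hpart M p x) = 0"
        using homog_carr[OF x] by (metis restrict0_apply(1) zero_fun_apply)
      then show False
        using \<phi>(3) hpart_homog[OF x, of p] by simp
    qed
    then show ?thesis
      using H_sub(2) by blast
  next
    assume A: "\<forall>p. A p = homog (dual_mod M) p"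
    have zero: "\<phi> x = 0" if "x \<in> H p" "\<phi> \<in> carr (dual_mod M)" for \<phi> x p
      using that(2)
    proof (induction rule: d.carr_induct)
      case (homog q \<psi>)
      then show ?case
        using A H_N[OF that(1)] by (auto simp: A_def)
    qed simp
    have "x = 0" if x: "x \<in> H p" for x p
    proof (rule ccontr)
      assume "x \<noteq> 0"
      then have "x \<notin> {0}"
        by simp
      then obtain \<phi> where \<phi>: "\<phi> \<in> functionals (carr M)" "\<phi> x = 1"
        by (rule functionals_separate[OF carr_subspace cvs.subspace_single_0 H_M[OF x]])
      then show False
        using zero[OF x, of \<phi>] by (simp add: dual_carr)
    qed
    then show ?thesis
      using cvs.subspace_0[OF H_sub(1)] by blast
  qed
qed

lemma mod_hom_dual:
  assumes "pmod M n" "pmod N n" "mod_hom n M N f"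
  shows "mod_hom n (dual_mod N) (dual_mod M) (dual_map M f)"
proof -
  interpret M: pmod M n by fact
  interpret N: pmod N n by fact
  note f = mod_homD[OF assms(3)]
  have eq: "dual_map M f \<phi> = restrict0 (carr M) (\<lambda>x. \<phi> (f x))" for \<phi> :: "_ \<Rightarrow> complex"
    by (simp add: dual_map_def restrict0_def)
  have in_f: "dual_map M f \<phi> \<in> functionals (carr M)" if "\<phi> \<in> functionals (carr N)" for \<phi>
    unfolding eq by (rule functionals_restrict0[OF M.carr_subspace f(1) functionalsD(4)[OF that]])
  show ?thesis
  proof (rule mod_homI[OF N.pmod_dual M.pmod_dual])
    show "linear_between (carr (dual_mod N)) (carr (dual_mod M)) (dual_map M f)"
      by (rule linear_betweenI) (auto simp: N.dual_carr M.dual_carr in_f, auto simp: eq restrict0_def fun_eq_iff)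
  next
    fix p \<phi> assume "\<phi> \<in> homog (dual_mod N) p"
    then show "dual_map M f \<phi> \<in> homog (dual_mod M) p"
      using in_f f(2) M.homog_carr by (auto simp: M.dual_homog N.dual_homog) (simp add: eq)
  next
    fix X p \<phi> assume X: "X \<in> pe_homog n p" and "\<phi> \<in> carr (dual_mod N)"
    then have \<phi>: "\<phi> \<in> functionals (carr N)"
      by (simp add: N.dual_carr)
    note X' = pe_homog_pe[OF X]
    show "dual_map M f (act (dual_mod N) X \<phi>) = act (dual_mod M) X (dual_map M f \<phi>)"
      unfolding N.dual_act_homog[OF X \<phi>] M.dual_act_homog[OF X in_f[OF \<phi>]]
      using linear_betweenD(1)[OF f(1)] X' f(3)[OF X', symmetric]
      by (auto simp: eq restrict0_def fun_eq_iff mod_hom_parop[OF M.gspace_axioms N.gspace_axioms assms(3)])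
  qed
qed

lemma isomorphic_dual:
  assumes "pmod M n" "pmod N n" "isomorphic n M N"
  shows "isomorphic n (dual_mod N) (dual_mod M)"
proof -
  interpret M: pmod M n by fact
  interpret N: pmod N n by fact
  obtain f where f: "mod_iso n M N f"
    using assms(3) by (auto simp: isomorphic_def)
  then have hom: "mod_hom n M N f" and bij: "bij_betw f (carr M) (carr N)"
    by (auto simp: mod_iso_def)
  note fD = mod_homD[OF hom]
  obtain g where g: "mod_iso n N M g"
    using isomorphic_sym[OF assms] by (auto simp: isomorphic_def)
  have "mod_iso n (dual_mod N) (dual_mod M) (dual_map M f)"
  proof (rule mod_isoI[OF N.dual_gspace mod_hom_dual[OF assms(1,2) hom]])
    fix \<phi> assume \<phi>: "\<phi> \<in> carr (dual_mod N)" "dual_map M f \<phi> = 0"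
    show "\<phi> = 0"
    proof
      fix y
      show "\<phi> y = 0 y"
      proof (cases "y \<in> carr N")
        case True
        then have "y \<in> f ` carr M"
          using bij by (simp add: bij_betw_def)
        then obtain x where x: "x \<in> carr M" "f x = y"
          by blast
        then show ?thesis
          using fun_cong[OF \<phi>(2), of x] by (simp add: dual_map_def)
      qed (use \<phi>(1) functionalsD(3) in \<open>auto simp: N.dual_carr\<close>)
    qed
  next
    fix \<psi> assume "\<psi> \<in> carr (dual_mod M)"
    then have \<psi>: "\<psi> \<in> functionals (carr M)"
      by (simp add: M.dual_carr)
    define h where "h = inv_into (carr M) f"
    have hf: "h (f x) = x" if "x \<in> carr M" for x
      using bij that unfolding h_def by (simp add: bij_betw_inv_into_left)
    have fh: "f (h y) = y" "h y \<in> carr M" if "y \<in> carr N" for y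
      using bij that unfolding h_def by (simp_all add: bij_betw_inv_into_right bij_betw_def inv_into_into)
    have "linear_between (carr N) (carr M) h"
    proof (rule linear_betweenI)
      fix x y assume "x \<in> carr N" "y \<in> carr N"
      then show "h (x + y) = h x + h y"
        using hf[of "h x + h y"] fh by (simp add: linear_betweenD(2)[OF fD(1)] M.carr_add)
    next
      fix c x assume "x \<in> carr N"
      then show "h (c *\<^sub>C x) = c *\<^sub>C h x"
        using hf[of "c *\<^sub>C h x"] fh by (simp add: linear_betweenD(3)[OF fD(1)] M.carr_scale)
    qed (rule fh)
    from functionals_restrict0[OF N.carr_subspace this functionalsD(4)[OF \<psi>]]
    have "restrict0 (carr N) (\<lambda>y. \<psi> (h y)) \<in> carr (dual_mod N)"
      by (simp add: N.dual_carr)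
    moreover have "dual_map M f (restrict0 (carr N) (\<lambda>y. \<psi> (h y))) = \<psi>"
      using hf functionalsD(3)[OF \<psi>] linear_betweenD(1)[OF fD(1)] by (auto simp: dual_map_def fun_eq_iff)
    ultimately show "\<exists>\<phi>\<in>carr (dual_mod N). dual_map M f \<phi> = \<psi>"
      by blast
  qed
  then show ?thesis
    unfolding isomorphic_def by blast
qed

lemma (in pmod) parop_Pi:
  assumes "x \<in> carr M"
  shows "parop (Pi_mod M) r x = psign r *\<^sub>C parop M r x"
proof -
  interpret Pi: pmod "Pi_mod M" n by (rule pmod_Pi)
  show ?thesis
    using assms
  proof (induction rule: carr_induct)
    case (homog q y)
    then have "y \<in> homog (Pi_mod M) (q + 1)" by simp
    then show ?case
      unfolding parop_homog[OF homog] by (simp add: Pi.parop_homog[of _ "q + 1"] distrib_left psign_add ac_simps)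
  next
    case (add y z)
    then show ?case
      using Pi.parop_add by (simp add: parop_add cscale_add_right)
  qed
qed

text \<open>Both sides consist of the functionals on \<open>carr M\<close>, but odd elements act on
  them with opposite signs. Composition with \<open>parop M 1\<close> corrects this.\<close>

lemma (in pmod) dual_Pi_isomorphic: "isomorphic n (dual_mod (Pi_mod M)) (Pi_mod (dual_mod M))"
proof -
  interpret Pi: pmod "Pi_mod M" n by (rule pmod_Pi)
  interpret d: pmod "dual_mod M" n by (rule pmod_dual)
  let ?f = "\<lambda>\<phi>. restrict0 (carr M) (\<lambda>x. \<phi> (parop M 1 x))"
  have carr1: "carr (dual_mod (Pi_mod M)) = functionals (carr M)" "carr (Pi_mod (dual_mod M)) = functionals (carr M)"
    by (simp_all add: Pi.dual_carr dual_carr)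
  have in_f: "?f \<phi> \<in> functionals (carr M)" if "\<phi> \<in> functionals (carr M)" for \<phi>
    by (rule functionals_restrict0[OF carr_subspace parop_linear functionalsD(4)[OF that]])
  have ff: "?f (?f \<phi>) = \<phi>" if "\<phi> \<in> functionals (carr M)" for \<phi>
    using functionalsD(3)[OF that] by (auto simp: fun_eq_iff restrict0_def parop_parop)
  have hom: "mod_hom n (dual_mod (Pi_mod M)) (Pi_mod (dual_mod M)) ?f"
  proof (rule mod_homI[OF Pi.pmod_dual d.pmod_Pi])
    show "linear_between (carr (dual_mod (Pi_mod M))) (carr (Pi_mod (dual_mod M))) ?f"
      unfolding carr1 by (rule linear_betweenI) (use in_f in blast, auto simp: restrict0_def fun_eq_iff)
  next
    fix p \<phi> assume "\<phi> \<in> homog (dual_mod (Pi_mod M)) p"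
    then show "?f \<phi> \<in> homog (Pi_mod (dual_mod M)) p"
      using in_f parop_in homog_carr by (auto simp: Pi.dual_homog dual_homog)
  next
    fix X p \<phi> assume X: "X \<in> pe_homog n p" and "\<phi> \<in> carr (dual_mod (Pi_mod M))"
    then have \<phi>: "\<phi> \<in> functionals (carr M)" by (simp add: carr1)
    note [simp] = pe_homog_pe[OF X]
    have "?f (act (dual_mod (Pi_mod M)) X \<phi>) = psign p *\<^sub>C act (dual_mod M) X (?f \<phi>)"
    proof
      fix x
      show "?f (act (dual_mod (Pi_mod M)) X \<phi>) x = (psign p *\<^sub>C act (dual_mod M) X (?f \<phi>)) x"
        using Pi.dual_act_homog[OF X, of \<phi>] \<phi>
        by (cases "x \<in> carr M") (auto simp: dual_act_homog[OF X in_f[OF \<phi>]] act_Pi[OF X] parop_Pi parop_scale carr_scale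
            parop_act[OF X] parop_parop functionalsD(2)[OF \<phi>] add.commute distrib_left distrib_right psign_add act_scale cscale_cscale)
    qed
    then show "?f (act (dual_mod (Pi_mod M)) X \<phi>) = act (Pi_mod (dual_mod M)) X (?f \<phi>)"
      using in_f[OF \<phi>] by (simp add: d.act_Pi[OF X] dual_carr)
  qed
  have "mod_iso n (dual_mod (Pi_mod M)) (Pi_mod (dual_mod M)) ?f"
  proof (rule mod_isoI[OF Pi.dual_gspace hom])
    fix \<phi> assume "\<phi> \<in> carr (dual_mod (Pi_mod M))" "?f \<phi> = 0"
    then show "\<phi> = 0"
      using ff[of \<phi>] unfolding carr1 by (auto simp: restrict0_def zero_fun_def)
  next
    fix \<psi> assume "\<psi> \<in> carr (Pi_mod (dual_mod M))"
    then show "\<exists>\<phi>\<in>carr (dual_mod (Pi_mod M)). ?f \<phi> = \<psi>"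
      using ff in_f unfolding carr1 by blast
  qed
  then show ?thesis
    unfolding isomorphic_def by blast
qed


section \<open>Integrability\<close>

declare One_nat_def [simp del]

section \<open>The matrix group GL(n)\<close>

lemma mmul_assoc: "finite I \<Longrightarrow> mmul I (mmul I a b) c = mmul I a (mmul I b c)"
  unfolding mmul_def sum_distrib_left sum_distrib_right
  by (intro ext, subst sum.swap) (simp add: ac_simps)

lemma mmul_mone: "finite I \<Longrightarrow> a \<in> mats I \<Longrightarrow> mmul I (mone I) a = a" "finite I \<Longrightarrow> a \<in> mats I \<Longrightarrow> mmul I a (mone I) = a"
proof -
  assume I: "finite I" and a: "a \<in> mats I"
  have "(\<Sum>k\<in>I. mone I i k * a k j) = (\<Sum>k\<in>I. if i = k then a k j else 0)" for i j
    by (rule sum.cong) (auto simp: mone_def)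
  then show "mmul I (mone I) a = a"
    using I a by (auto simp: mmul_def fun_eq_iff mats_def sum.delta')
  have "(\<Sum>k\<in>I. a i k * mone I k j) = (\<Sum>k\<in>I. if k = j then a i k else 0)" for i j
    by (rule sum.cong) (auto simp: mone_def)
  then show "mmul I a (mone I) = a"
    using I a by (auto simp: mmul_def fun_eq_iff mats_def sum.delta)
qed

lemma mats_mmul: "a \<in> mats I \<Longrightarrow> b \<in> mats I \<Longrightarrow> mmul I a b \<in> mats I"
  unfolding mats_def
proof (intro CollectI allI impI)
  fix i j assume ab: "a \<in> {X. \<forall>i j. X i j \<noteq> 0 \<longrightarrow> i \<in> I \<and> j \<in> I}" "b \<in> {X. \<forall>i j. X i j \<noteq> 0 \<longrightarrow> i \<in> I \<and> j \<in> I}"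
  assume "mmul I a b i j \<noteq> 0"
  then obtain k where "a i k * b k j \<noteq> 0"
    unfolding mmul_def by (rule sum.not_neutral_contains_not_neutral)
  then have "a i k \<noteq> 0" "b k j \<noteq> 0"
    by simp_all
  then show "i \<in> I \<and> j \<in> I"
    using ab by blast
qed

definition GL_inv :: "nat \<Rightarrow> (nat \<Rightarrow> nat \<Rightarrow> complex) \<Rightarrow> nat \<Rightarrow> nat \<Rightarrow> complex" where
  "GL_inv n g = (SOME h. h \<in> mats {1..n} \<and> mmul {1..n} g h = mone {1..n} \<and> mmul {1..n} h g = mone {1..n})"

lemma GL_inv:
  assumes "g \<in> GL n"
  shows "GL_inv n g \<in> GL n" "mmul {1..n} g (GL_inv n g) = mone {1..n}" "mmul {1..n} (GL_inv n g) g = mone {1..n}"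
proof -
  have "\<exists>h. h \<in> mats {1..n} \<and> mmul {1..n} g h = mone {1..n} \<and> mmul {1..n} h g = mone {1..n}"
    using assms by (auto simp: GL_def)
  from someI_ex[OF this] show "GL_inv n g \<in> GL n" "mmul {1..n} g (GL_inv n g) = mone {1..n}"
    "mmul {1..n} (GL_inv n g) g = mone {1..n}"
    using assms unfolding GL_inv_def[symmetric] by (auto simp: GL_def)
qed

lemma GL_mats: "g \<in> GL n \<Longrightarrow> g \<in> mats {1..n}"
  by (simp add: GL_def)

lemma GL_inv_unique:
  assumes "g \<in> GL n" "h \<in> mats {1..n}" "mmul {1..n} g h = mone {1..n}"
  shows "GL_inv n g = h"
proof -
  have "GL_inv n g = mmul {1..n} (GL_inv n g) (mmul {1..n} g h)"
    using GL_mats[OF GL_inv(1)[OF assms(1)]] by (simp add: assms(3) mmul_mone)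
  also have "\<dots> = mmul {1..n} (mmul {1..n} (GL_inv n g) g) h"
    by (simp only: mmul_assoc finite_atLeastAtMost)
  also have "\<dots> = h"
    using assms by (simp add: GL_inv mmul_mone)
  finally show ?thesis .
qed

lemma GL_inv_mmul:
  assumes g: "g \<in> GL n" and h: "h \<in> GL n"
  shows "mmul {1..n} g h \<in> GL n" "GL_inv n (mmul {1..n} g h) = mmul {1..n} (GL_inv n h) (GL_inv n g)"
proof -
  note m = GL_mats[OF g] GL_mats[OF h] GL_mats[OF GL_inv(1)[OF g]] GL_mats[OF GL_inv(1)[OF h]]
  have a: "mmul {1..n} (mmul {1..n} g h) (mmul {1..n} (GL_inv n h) (GL_inv n g)) = mone {1..n}" (is "?a = _")
  proof -
    have "?a = mmul {1..n} g (mmul {1..n} (mmul {1..n} h (GL_inv n h)) (GL_inv n g))"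
      by (simp only: mmul_assoc finite_atLeastAtMost)
    then show ?thesis
      using m by (simp add: GL_inv[OF g] GL_inv[OF h] mmul_mone)
  qed
  have b: "mmul {1..n} (mmul {1..n} (GL_inv n h) (GL_inv n g)) (mmul {1..n} g h) = mone {1..n}" (is "?b = _")
  proof -
    have "?b = mmul {1..n} (GL_inv n h) (mmul {1..n} (mmul {1..n} (GL_inv n g) g) h)"
      by (simp only: mmul_assoc finite_atLeastAtMost)
    then show ?thesis
      using m by (simp add: GL_inv[OF g] GL_inv[OF h] mmul_mone)
  qed
  show c: "mmul {1..n} g h \<in> GL n"
    using a b m mats_mmul unfolding GL_def by blast
  show "GL_inv n (mmul {1..n} g h) = mmul {1..n} (GL_inv n h) (GL_inv n g)"
    using GL_inv_unique[OF c mats_mmul a] m by blast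
qed

lemma mone_GL: "mone {1..n} \<in> GL n" "GL_inv n (mone {1..n}) = mone {1..n}"
proof -
  have "mone {1..n} \<in> mats {1..n}"
    by (auto simp: mone_def mats_def split: if_splits)
  moreover from this have "mmul {1..n} (mone {1..n}) (mone {1..n}) = mone {1..n}"
    by (simp add: mmul_mone)
  ultimately show a: "mone {1..n} \<in> GL n" and "GL_inv n (mone {1..n}) = mone {1..n}"
    using GL_inv_unique unfolding GL_def by blast+
qed

text \<open>\<open>\<gamma> 0\<close> is idempotent and invertible, hence the identity
  matrix.\<close>

lemma one_param_inverse:
  assumes "one_param n A \<gamma>"
  shows "GL_inv n (\<gamma> t) = \<gamma> (- t)"
proof -
  have \<gamma>: "\<gamma> t \<in> GL n" "\<gamma> (s + t) = mmul {1..n} (\<gamma> s) (\<gamma> t)" for s t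
    using assms by (auto simp: one_param_def)
  have "\<gamma> 0 = mmul {1..n} (GL_inv n (\<gamma> 0)) (mmul {1..n} (\<gamma> 0) (\<gamma> 0))"
    using GL_mats[OF \<gamma>(1)[of 0]] by (simp add: mmul_assoc[symmetric, of "{1..n}"] GL_inv[OF \<gamma>(1)] mmul_mone)
  also have "\<dots> = mone {1..n}"
    using \<gamma>(2)[of 0 0] by (simp add: GL_inv[OF \<gamma>(1)])
  finally have "mmul {1..n} (\<gamma> t) (\<gamma> (- t)) = mone {1..n}"
    using \<gamma>(2)[of t "- t"] by simp
  then show ?thesis
    using GL_inv_unique[OF \<gamma>(1) GL_mats[OF \<gamma>(1)]] by simp
qed

lemma gl_emb_pe: "A \<in> mats {1..n} \<Longrightarrow> gl_emb A \<in> pe_homog n 0"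
  unfolding pe_homog_iff gl_homog_def self_adj_def
proof (intro conjI CollectI allI impI)
  assume A: "A \<in> mats {1..n}"
  show "gl_emb A \<in> mats (idx n)"
    unfolding mats_def
  proof (intro CollectI allI impI)
    fix i j assume "gl_emb A i j \<noteq> 0"
    then show "i \<in> idx n \<and> j \<in> idx n"
      using A by (cases i; cases j) (auto simp: gl_emb_def mats_def)
  qed
  fix i j
  show "gl_emb A i j = -1 * psign ((par i + par j) * par j) * gl_emb A (dix j) (dix i)"
    by (cases i; cases j) (simp_all add: gl_emb_def)
  assume "gl_emb A i j \<noteq> 0"
  then show "par i + par j = 0"
    by (cases i; cases j) (simp_all add: gl_emb_def)
qed

definition integral_action ::
    "nat \<Rightarrow> 'v::complex_space smod \<Rightarrow> ((nat \<Rightarrow> nat \<Rightarrow> complex) \<Rightarrow> 'v \<Rightarrow> 'v) \<Rightarrow> bool" where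
  "integral_action n M G \<longleftrightarrow>
     (\<forall>g\<in>GL n. linear_between (carr M) (carr M) (G g) \<and> (\<forall>p. G g ` homog M p \<subseteq> homog M p)) \<and>
     (\<forall>x\<in>carr M. G (mone {1..n}) x = x) \<and>
     (\<forall>g\<in>GL n. \<forall>h\<in>GL n. \<forall>x\<in>carr M. G (mmul {1..n} g h) x = G g (G h x)) \<and>
     (\<forall>A\<in>mats {1..n}. \<forall>\<gamma>. one_param n A \<gamma> \<longrightarrow>
        (\<forall>x\<in>carr M. \<forall>\<xi>::'v \<Rightarrow> complex. linear_between (carr M) UNIV \<xi> \<longrightarrow>
           ((\<lambda>t. \<xi> (G (\<gamma> t) x)) has_field_derivative \<xi> (act M (gl_emb A) x)) (at 0)))"

lemma integrates_iff: "integrates n M \<longleftrightarrow> (\<exists>G. integral_action n M G)"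
  unfolding integrates_def integral_action_def ..

lemma integral_actionD:
  assumes "integral_action n M G"
  shows "g \<in> GL n \<Longrightarrow> linear_between (carr M) (carr M) (G g)"
    and "g \<in> GL n \<Longrightarrow> x \<in> homog M p \<Longrightarrow> G g x \<in> homog M p"
    and "x \<in> carr M \<Longrightarrow> G (mone {1..n}) x = x"
    and "g \<in> GL n \<Longrightarrow> h \<in> GL n \<Longrightarrow> x \<in> carr M \<Longrightarrow> G (mmul {1..n} g h) x = G g (G h x)"
    and "A \<in> mats {1..n} \<Longrightarrow> one_param n A \<gamma> \<Longrightarrow> x \<in> carr M \<Longrightarrow> linear_between (carr M) UNIV (\<xi> :: _ \<Rightarrow> complex) \<Longrightarrow>
       ((\<lambda>t. \<xi> (G (\<gamma> t) x)) has_field_derivative \<xi> (act M (gl_emb A) x)) (at 0)"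
  using assms unfolding integral_action_def by (simp_all add: image_subset_iff)

lemma in_F_iff: "in_F n M \<longleftrightarrow> pmod M n \<and> fin_dim (carr M) \<and> integrates n M"
  by (simp add: in_F_def pe_module_iff fin_dim_def)

text \<open>The group acts contragrediently, by composing a functional with the action of the
  inverse matrix.\<close>

lemma in_F_dual:
  assumes "in_F n M"
  shows "in_F n (dual_mod M)"
proof -
  have M: "pmod M n" "fin_dim (carr M)" "integrates n M"
    using assms by (auto simp: in_F_iff)
  interpret pmod M n by fact
  obtain G where G': "integral_action n M G"
    using M(3) by (auto simp: integrates_iff)
  note G = integral_actionD(1-4)[OF G'] and der = integral_actionD(5)[OF G']
  define G' where "G' g \<phi> = restrict0 (carr M) (\<lambda>x. \<phi> (G (GL_inv n g) x) :: complex)" for g \<phi>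
  have G_carr: "G g x \<in> carr M" if "g \<in> GL n" "x \<in> carr M" for g x
    using linear_betweenD(1)[OF G(1)] that by blast
  have in_f: "G' g \<phi> \<in> functionals (carr M)" if "g \<in> GL n" "\<phi> \<in> functionals (carr M)" for g \<phi>
    unfolding G'_def by (rule functionals_restrict0[OF carr_subspace G(1)[OF GL_inv(1)] functionalsD(4)]) (use that in auto)
  have "integrates n (dual_mod M)"
    unfolding integrates_iff integral_action_def
  proof (intro exI[of _ G'] conjI ballI allI impI)
    fix g assume g: "g \<in> GL n"
    show "linear_between (carr (dual_mod M)) (carr (dual_mod M)) (G' g)"
      unfolding dual_carr by (rule linear_betweenI) (use in_f g in blast, auto simp: G'_def restrict0_def fun_eq_iff)
    show "G' g ` homog (dual_mod M) p \<subseteq> homog (dual_mod M) p" for p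
      using in_f[OF g] G(2)[OF GL_inv(1)[OF g]] homog_carr by (auto simp: dual_homog) (simp add: G'_def)
  next
    fix \<phi> assume "\<phi> \<in> carr (dual_mod M)"
    then have "\<phi> \<in> functionals (carr M)" by (simp add: dual_carr)
    then show "G' (mone {1..n}) \<phi> = \<phi>"
      using G(3) functionalsD(3) by (auto simp: G'_def mone_GL restrict0_def fun_eq_iff)
  next
    fix g h \<phi> assume "g \<in> GL n" "h \<in> GL n" "\<phi> \<in> carr (dual_mod M)"
    then show "G' (mmul {1..n} g h) \<phi> = G' g (G' h \<phi>)"
      using G_carr GL_inv(1) by (auto simp: G'_def GL_inv_mmul restrict0_def fun_eq_iff G(4))
  next
    fix A \<gamma> \<phi> and \<xi> :: "('a \<Rightarrow> complex) \<Rightarrow> complex"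
    assume A: "A \<in> mats {1..n}" "one_param n A \<gamma>" and "\<phi> \<in> carr (dual_mod M)" "linear_between (carr (dual_mod M)) UNIV \<xi>"
    then have \<phi>: "\<phi> \<in> functionals (carr M)" and \<xi>: "linear_between (functionals (carr M)) UNIV \<xi>"
      by (auto simp: dual_carr)
    \<comment> \<open>A linear test on the dual is evaluation at a vector \<open>x\<close>, so the
      derivative in question is that of a matrix coefficient of \<open>M\<close>.\<close>
    obtain x where x: "x \<in> carr M" "\<And>\<phi>. \<phi> \<in> functionals (carr M) \<Longrightarrow> \<xi> \<phi> = \<phi> x"
      using functionals_reflexive[OF M(2) carr_subspace functionals_subspace \<xi>] by blast
    \<comment> \<open>Stated at \<open>- 0\<close> to match the chain rule for the inner map
      \<open>- t\<close>, which produces the minus sign of the dual action.\<close>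
    have "((\<lambda>t. \<phi> (G (\<gamma> t) x)) has_field_derivative \<phi> (act M (gl_emb A) x)) (at (- 0))"
      using der[OF A x(1) functionalsD(4)[OF \<phi>]] by simp
    from DERIV_chain2[OF this DERIV_minus[OF DERIV_ident]]
    have "((\<lambda>t. \<phi> (G (\<gamma> (- t)) x)) has_field_derivative - \<phi> (act M (gl_emb A) x)) (at 0)"
      by simp
    moreover have "\<gamma> t \<in> GL n" for t
      using A(2) by (simp add: one_param_def)
    then have "\<xi> (G' (\<gamma> t) \<phi>) = \<phi> (G (\<gamma> (- t)) x)" for t
      using x(1) by (simp only: x(2)[OF in_f[OF _ \<phi>]]) (simp add: G'_def one_param_inverse[OF A(2)])
    moreover have "\<xi> (act (dual_mod M) (gl_emb A) \<phi>) = - \<phi> (act M (gl_emb A) x)"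
      using x(1) pe_homog_pe[OF gl_emb_pe[OF A(1)]]
      by (simp only: x(2)[OF dual_act_in[OF gl_emb_pe[OF A(1)] \<phi>]]) (simp add: dual_act_homog[OF gl_emb_pe[OF A(1)] \<phi>])
    ultimately show "((\<lambda>t. \<xi> (G' (\<gamma> t) \<phi>)) has_field_derivative \<xi> (act (dual_mod M) (gl_emb A) \<phi>)) (at 0)"
      by simp
  qed
  then show ?thesis
    using pmod_dual fin_dim_functionals[OF M(2) carr_subspace] by (simp add: in_F_iff dual_carr)
qed

text \<open>The image of gl(n) is even, so parity change leaves its action alone and the same group
  action serves.\<close>

lemma in_F_Pi:
  assumes "in_F n M"
  shows "in_F n (Pi_mod M)"
proof -
  have M: "pmod M n" "fin_dim (carr M)" "integrates n M"
    using assms by (auto simp: in_F_iff)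
  interpret pmod M n by fact
  have act: "act (Pi_mod M) (gl_emb A) x = act M (gl_emb A) x" if "A \<in> mats {1..n}" "x \<in> carr M" for A x
    using act_Pi[OF gl_emb_pe] that by (simp add: cscale_one)
  obtain G where "integral_action n M G"
    using M(3) by (auto simp: integrates_iff)
  then have "integral_action n (Pi_mod M) G"
    unfolding integral_action_def using act by simp
  then have "integrates n (Pi_mod M)"
    unfolding integrates_iff by blast
  then show ?thesis
    using M(2) pmod_Pi by (simp add: in_F_iff)
qed


section \<open>Generalized kernels\<close>

definition gen_ker :: "'a::complex_space set \<Rightarrow> ('a \<Rightarrow> 'a) \<Rightarrow> 'a set"
  where "gen_ker U T = {x \<in> U. \<exists>m>0. (T ^^ m) x = 0}"

lemma linear_between_funpow:
  assumes "linear_between U U T"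
  shows "linear_between U U (T ^^ m)"
proof (induction m)
  case 0
  then show ?case by (simp add: linear_between_def)
next
  case (Suc m)
  then show ?case
    using assms by (auto simp: linear_between_def)
qed

lemma funpow_zero_mono:
  assumes "linear_between U U T" "cvs.subspace U" "x \<in> U" "(T ^^ m) x = 0" "m \<le> m'"
  shows "(T ^^ m') x = 0"
proof -
  have "(T ^^ m') x = (T ^^ (m' - m)) ((T ^^ m) x)"
    using assms(5) by (metis add.commute funpow_add comp_apply le_add_diff_inverse)
  then show ?thesis
    using assms(4) linear_between_0[OF linear_between_funpow[OF assms(1)] assms(2)] by simp
qed

lemma gen_ker_subspace:
  assumes "linear_between U U T" "cvs.subspace U"
  shows "cvs.subspace (gen_ker U T)"
  unfolding cvs.subspace_def
proof (intro conjI ballI allI)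
  show "0 \<in> gen_ker U T"
    unfolding gen_ker_def using cvs.subspace_0[OF assms(2)] linear_between_0[OF assms]
    by (auto intro: exI[of _ 1])
next
  fix x y assume "x \<in> gen_ker U T" "y \<in> gen_ker U T"
  then obtain a b where x: "x \<in> U" "a > 0" "(T ^^ a) x = 0" and y: "y \<in> U" "b > 0" "(T ^^ b) y = 0"
    unfolding gen_ker_def by blast
  have "(T ^^ (a + b)) (x + y) = 0"
    using linear_betweenD(2)[OF linear_between_funpow[OF assms(1)] x(1) y(1), of "a + b"]
      funpow_zero_mono[OF assms x(1,3), of "a + b"] funpow_zero_mono[OF assms y(1,3), of "a + b"] by simp
  then show "x + y \<in> gen_ker U T"
    unfolding gen_ker_def using x(1,2) y(1) cvs.subspace_add[OF assms(2)] by (auto intro!: exI[of _ "a + b"])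
next
  fix c x assume "x \<in> gen_ker U T"
  then show "c *\<^sub>C x \<in> gen_ker U T"
    unfolding gen_ker_def using cvs.subspace_scale[OF assms(2)] linear_betweenD(3)[OF linear_between_funpow[OF assms(1)]]
    by (auto intro: exI)
qed

text \<open>A common exponent is the maximum of the exponents of a finite basis.\<close>

lemma gen_ker_exponent:
  assumes "linear_between U U T" "cvs.subspace U" "fin_dim U"
  obtains m where "\<And>x m'. x \<in> gen_ker U T \<Longrightarrow> m \<le> m' \<Longrightarrow> (T ^^ m') x = 0"
proof -
  note sub = gen_ker_subspace[OF assms(1,2)]
  have "fin_dim (gen_ker U T)"
    by (rule fin_dim_mono[OF assms(3)]) (auto simp: gen_ker_def)
  then obtain B where B: "finite B" "cvs.independent B" "B \<subseteq> gen_ker U T" "cvs.span B = gen_ker U T"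
    by (rule fin_dim_basis[OF _ sub])
  have "\<forall>b\<in>B. \<exists>m. (T ^^ m) b = 0"
    using B(3) unfolding gen_ker_def by blast
  then obtain e where e: "\<And>b. b \<in> B \<Longrightarrow> (T ^^ e b) b = 0"
    by metis
  define m where "m = Max (insert 0 (e ` B))"
  have le: "e b \<le> m" if "b \<in> B" for b
    using that B(1) by (simp add: m_def)
  show ?thesis
  proof (rule that)
    fix x m' assume x: "x \<in> gen_ker U T" and m': "m \<le> m'"
    note lin = linear_between_funpow[OF assms(1), of m']
    have BU: "b \<in> U" if "b \<in> B" for b
      using that B(3) unfolding gen_ker_def by blast
    obtain u where u: "x = (\<Sum>b\<in>B. u b *\<^sub>C b)"
      using span_finiteE[OF B(1)] x B(4) by metis
    have "(T ^^ m') x = (\<Sum>b\<in>B. (T ^^ m') (u b *\<^sub>C b))"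
      unfolding u by (intro linear_between_sum[OF lin assms(2)] cvs.subspace_scale[OF assms(2)] BU)
    also have "\<dots> = 0"
    proof (intro sum.neutral ballI)
      fix b assume b: "b \<in> B"
      have "(T ^^ m') b = 0"
        using funpow_zero_mono[OF assms(1,2) BU[OF b] e[OF b]] le[OF b] m' by simp
      then show "(T ^^ m') (u b *\<^sub>C b) = 0"
        using linear_betweenD(3)[OF lin BU[OF b]] by simp
    qed
    finally show "(T ^^ m') x = 0" .
  qed
qed

text \<open>For large \<open>m\<close> the power \<open>T ^^ m\<close> is injective on its own
  image: if it kills \<open>(T ^^ m) z\<close>, then \<open>z\<close> lies in
  \<open>gen_ker U T\<close>, so that \<open>(T ^^ m) z\<close> is already zero. Hence it maps its
  image onto itself, and any \<open>x\<close> differs from some element of the image by a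
  generalized kernel vector.\<close>

lemma fitting:
  assumes T: "linear_between U U T" and U: "cvs.subspace U" "fin_dim U"
  obtains m where "\<And>x m'. x \<in> gen_ker U T \<Longrightarrow> m \<le> m' \<Longrightarrow> (T ^^ m') x = 0"
    "\<And>x m'. x \<in> U \<Longrightarrow> m \<le> m' \<Longrightarrow> \<exists>z\<in>U. x - (T ^^ m') z \<in> gen_ker U T"
proof -
  obtain m0 where m0: "\<And>x m'. x \<in> gen_ker U T \<Longrightarrow> m0 \<le> m' \<Longrightarrow> (T ^^ m') x = 0"
    using gen_ker_exponent[OF T U] by blast
  show ?thesis
  \<comment> \<open>The successor makes every admissible exponent positive, as
    \<open>gen_ker\<close> demands.\<close>
  proof (rule that[of "Suc m0"])
    fix x m' assume "x \<in> gen_ker U T" "Suc m0 \<le> m'"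
    then show "(T ^^ m') x = 0"
      using m0 by simp
  next
    fix x m assume x: "x \<in> U" and m: "Suc m0 \<le> m"
    let ?S = "T ^^ m"
    note lin = linear_between_funpow[OF T, of m]
    have SU: "?S ` U \<subseteq> U"
      using linear_betweenD(1)[OF lin] by blast
    have sub: "cvs.subspace (?S ` U)"
      unfolding cvs.subspace_def
    proof (intro conjI ballI allI)
      show "0 \<in> ?S ` U"
        using linear_between_0[OF lin U(1)] cvs.subspace_0[OF U(1)] by (metis imageI)
      show "a + b \<in> ?S ` U" if ab: "a \<in> ?S ` U" "b \<in> ?S ` U" for a b
      proof -
        obtain y z where "y \<in> U" "z \<in> U" "a = ?S y" "b = ?S z"
          using ab by blast
        then show ?thesis
          using linear_betweenD(2)[OF lin, of y z] cvs.subspace_add[OF U(1), of y z] by (metis imageI)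
      qed
      show "c *\<^sub>C a \<in> ?S ` U" if a: "a \<in> ?S ` U" for c a
      proof -
        obtain y where "y \<in> U" "a = ?S y"
          using a by blast
        then show ?thesis
          using linear_betweenD(3)[OF lin, of y c] cvs.subspace_scale[OF U(1), of y c] by (metis imageI)
      qed
    qed
    have twice: "(T ^^ (m + m)) y = ?S (?S y)" for y
      by (simp add: funpow_add)
    have "?S ` (?S ` U) = ?S ` U"
    proof (rule fin_dim_inj_surj[OF fin_dim_mono[OF U(2) SU] sub])
      show "linear_between (?S ` U) (?S ` U) ?S"
        using lin SU by (auto simp: linear_between_def)
      fix y assume "y \<in> ?S ` U" "?S y = 0"
      then obtain z where z: "z \<in> U" "y = ?S z" "(T ^^ (m + m)) z = 0"
        using twice by auto
      then have "z \<in> gen_ker U T"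
        unfolding gen_ker_def using m by (auto intro!: exI[of _ "m + m"])
      then show "y = 0"
        using m0[of z m] m z(2) by simp
    qed
    moreover have "?S x \<in> ?S ` U"
      using x by simp
    ultimately obtain z where z: "z \<in> U" "?S x = ?S (?S z)"
      by (metis imageE)
    have "?S (x - ?S z) = 0"
      using linear_between_diff[OF lin U(1) x linear_betweenD(1)[OF lin z(1)]] z(2) by simp
    then have "x - ?S z \<in> gen_ker U T"
      unfolding gen_ker_def using m cvs.subspace_diff[OF U(1) x linear_betweenD(1)[OF lin z(1)]]
      by (auto intro!: exI[of _ m])
    then show "\<exists>z\<in>U. x - ?S z \<in> gen_ker U T"
      using z(1) by blast
  qed
qed

text \<open>The generalized kernel of \<open>S\<close> is orthogonal to the images of high powers of
  \<open>T\<close>, and these images together with \<open>gen_ker U T\<close> exhaust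
  \<open>U\<close>. So the perfect pairing restricts to a perfect pairing of the two generalized
  kernels.\<close>

lemma gen_ker_pairing:
  fixes e :: "'b::complex_space \<Rightarrow> 'a::complex_space \<Rightarrow> complex"
  assumes U: "cvs.subspace U" "fin_dim U" and T: "linear_between U U T"
    and W: "cvs.subspace W" and S: "linear_between W W S"
    and e: "\<And>w. w \<in> W \<Longrightarrow> linear_between U UNIV (e w)"
    and e_0: "\<And>u. u \<in> U \<Longrightarrow> e 0 u = 0"
    and inj: "\<And>w. w \<in> W \<Longrightarrow> (\<And>u. u \<in> U \<Longrightarrow> e w u = 0) \<Longrightarrow> w = 0"
    and surj: "\<And>\<psi>. \<psi> \<in> functionals U \<Longrightarrow> \<exists>w\<in>W. \<forall>u\<in>U. e w u = \<psi> u"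
    and adj: "\<And>w u. w \<in> W \<Longrightarrow> u \<in> U \<Longrightarrow> e (S w) u = - e w (T u)"
  shows "\<And>w. w \<in> gen_ker W S \<Longrightarrow> (\<And>u. u \<in> gen_ker U T \<Longrightarrow> e w u = 0) \<Longrightarrow> w = 0"
    and "\<And>\<psi>. \<psi> \<in> functionals (gen_ker U T) \<Longrightarrow> \<exists>w\<in>gen_ker W S. \<forall>u\<in>gen_ker U T. e w u = \<psi> u"
proof -
  have adj_pow: "e ((S ^^ m) w) u = (-1) ^ m * e w ((T ^^ m) u)" if "w \<in> W" "u \<in> U" for m w u
    using that
  proof (induction m arbitrary: u)
    case (Suc m)
    have "e ((S ^^ Suc m) w) u = - e ((S ^^ m) w) (T u)"
      using adj linear_betweenD(1)[OF linear_between_funpow[OF S] Suc.prems(1)] Suc.prems(2) by simp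
    also have "\<dots> = (-1) ^ Suc m * e w ((T ^^ Suc m) u)"
      using Suc.IH[OF Suc.prems(1) linear_betweenD(1)[OF T Suc.prems(2)]] by (simp add: funpow_swap1)
    finally show ?case .
  qed simp
  note Tm = linear_betweenD(1)[OF linear_between_funpow[OF T]]
  note Sm = linear_betweenD(1)[OF linear_between_funpow[OF S]]
  obtain m0 where m0: "\<And>x m'. x \<in> gen_ker U T \<Longrightarrow> m0 \<le> m' \<Longrightarrow> (T ^^ m') x = 0"
    "\<And>x m'. x \<in> U \<Longrightarrow> m0 \<le> m' \<Longrightarrow> \<exists>z\<in>U. x - (T ^^ m') z \<in> gen_ker U T"
    using fitting[OF T U] by blast
  have gen_U: "x \<in> U" if "x \<in> gen_ker U T" for x
    using that by (simp add: gen_ker_def)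
  show "w = 0" if w: "w \<in> gen_ker W S" and zero: "\<And>u. u \<in> gen_ker U T \<Longrightarrow> e w u = 0" for w
  proof (rule inj)
    show wW: "w \<in> W"
      using w by (simp add: gen_ker_def)
    obtain a where a: "(S ^^ a) w = 0"
      using w by (auto simp: gen_ker_def)
    fix u assume u: "u \<in> U"
    \<comment> \<open>The exponent is at least \<open>m0\<close>, for the decomposition of
      \<open>u\<close>, and at least \<open>a\<close>, so that this power of \<open>S\<close> kills
      \<open>w\<close>.\<close>
    obtain z where z: "z \<in> U" "u - (T ^^ (m0 + a)) z \<in> gen_ker U T"
      using m0(2)[OF u, of "m0 + a"] by auto
    have S0: "(S ^^ (m0 + a)) w = 0"
      using funpow_zero_mono[OF S W wW a, of "m0 + a"] by simp
    have "e w ((T ^^ (m0 + a)) z) = (-1) ^ (m0 + a) * e ((S ^^ (m0 + a)) w) z"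
      using adj_pow[OF wW z(1), of "m0 + a"] by (simp flip: power_mult_distrib mult.assoc)
    also have "\<dots> = 0"
      using S0 e_0[OF z(1)] by simp
    finally have "e w ((T ^^ (m0 + a)) z) = 0" .
    then show "e w u = 0"
      using zero[OF z(2)] linear_between_diff[OF e[OF wW] U(1) u Tm[OF z(1)], of "m0 + a"] by simp
  qed
  show "\<exists>w\<in>gen_ker W S. \<forall>u\<in>gen_ker U T. e w u = \<psi> u" if \<psi>: "\<psi> \<in> functionals (gen_ker U T)" for \<psi>
  proof -
    define m where "m = Suc m0"
    note sub = gen_ker_subspace[OF T U(1)]
    \<comment> \<open>The projection to \<open>gen_ker U T\<close> along the image of
      \<open>T ^^ m\<close>.\<close>
    define p where "p u = (THE y. y \<in> gen_ker U T \<and> (\<exists>z\<in>U. u = y + (T ^^ m) z))" for u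
    have p_eq: "p u = y" if y: "y \<in> gen_ker U T" "z \<in> U" "u = y + (T ^^ m) z" for u y z
      unfolding p_def
    proof (rule the_equality)
      show "y \<in> gen_ker U T \<and> (\<exists>z\<in>U. u = y + (T ^^ m) z)"
        using y by blast
      fix y' assume "y' \<in> gen_ker U T \<and> (\<exists>z\<in>U. u = y' + (T ^^ m) z)"
      then obtain z' where z': "y' \<in> gen_ker U T" "z' \<in> U" "u = y' + (T ^^ m) z'"
        by blast
      have "(T ^^ m) z - (T ^^ m) z' = y' - y"
        using y(3) z'(3) by (simp add: algebra_simps)
      then have d: "z - z' \<in> U" "(T ^^ m) (z - z') = y' - y"
        using linear_between_diff[OF linear_between_funpow[OF T] U(1) y(2) z'(2), of m] cvs.subspace_diff[OF U(1) y(2) z'(2)]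
        by simp_all
      have "(T ^^ m) ((T ^^ m) (z - z')) = 0"
        unfolding d(2) by (rule m0(1)[OF cvs.subspace_diff[OF sub z'(1) y(1)]]) (simp add: m_def)
      then have "(T ^^ (m + m)) (z - z') = 0"
        by (simp add: funpow_add)
      then have "z - z' \<in> gen_ker U T"
        unfolding gen_ker_def using d(1) by (auto simp: m_def intro!: exI[of _ "Suc m0 + Suc m0"])
      then have "y' - y = 0"
        using m0(1)[of "z - z'" m] d(2) by (simp add: m_def)
      then show "y' = y"
        by simp
    qed
    have decomp: "\<exists>z\<in>U. p u \<in> gen_ker U T \<and> u = p u + (T ^^ m) z" if u: "u \<in> U" for u
    proof -
      obtain z where z: "z \<in> U" "u - (T ^^ m) z \<in> gen_ker U T"
        using m0(2)[OF u, of m] by (auto simp: m_def)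
      then have "p u = u - (T ^^ m) z"
        by (intro p_eq[of _ z]) simp_all
      then show ?thesis
        using z by (intro bexI[of _ z]) simp_all
    qed
    have p_lin: "linear_between U (gen_ker U T) p"
    proof (rule linear_betweenI)
      show "p u \<in> gen_ker U T" if "u \<in> U" for u
        using decomp[OF that] by blast
    next
      fix u v assume "u \<in> U" "v \<in> U"
      then obtain y z where y: "y \<in> U" "p u \<in> gen_ker U T" "u = p u + (T ^^ m) y"
        and z: "z \<in> U" "p v \<in> gen_ker U T" "v = p v + (T ^^ m) z"
        using decomp by blast
      have "u + v = (p u + p v) + (T ^^ m) (y + z)"
        using arg_cong2[OF y(3) z(3), of "(+)"] linear_betweenD(2)[OF linear_between_funpow[OF T] y(1) z(1), of m]
        by (simp add: ac_simps)
      then show "p (u + v) = p u + p v"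
        by (intro p_eq[of _ "y + z"] cvs.subspace_add[OF sub y(2) z(2)] cvs.subspace_add[OF U(1) y(1) z(1)])
    next
      fix c u assume "u \<in> U"
      then obtain y where y: "y \<in> U" "p u \<in> gen_ker U T" "u = p u + (T ^^ m) y"
        using decomp by blast
      have "c *\<^sub>C u = c *\<^sub>C p u + (T ^^ m) (c *\<^sub>C y)"
        using arg_cong[OF y(3), of "\<lambda>u. c *\<^sub>C u"] linear_betweenD(3)[OF linear_between_funpow[OF T] y(1), of m c]
        by (simp add: cscale_add_right)
      then show "p (c *\<^sub>C u) = c *\<^sub>C p u"
        by (intro p_eq[of _ "c *\<^sub>C y"] cvs.subspace_scale[OF sub y(2)] cvs.subspace_scale[OF U(1) y(1)])
    qed
    have p_id: "p u = u" if "u \<in> gen_ker U T" for u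
      using that linear_between_0[OF linear_between_funpow[OF T] U(1), of m]
      by (intro p_eq[of _ 0] cvs.subspace_0[OF U(1)]) simp_all
    have p_im: "p ((T ^^ m) u) = 0" if "u \<in> U" for u
      using that by (intro p_eq[of _ u] cvs.subspace_0[OF sub]) simp_all
    \<comment> \<open>\<open>\<psi>\<close> is extended by zero to the image of
      \<open>T ^^ m\<close>. The element \<open>w\<close> representing the extension is killed by
      \<open>S ^^ m\<close>, because pairing it with that image gives zero.\<close>
    obtain w where w: "w \<in> W" "\<And>u. u \<in> U \<Longrightarrow> e w u = \<psi> (p u)"
      using surj[OF functionals_restrict0[OF U(1) p_lin functionalsD(4)[OF \<psi>]]] by auto
    have "(S ^^ m) w = 0"
    proof (rule inj[OF Sm[OF w(1)]])
      fix u assume "u \<in> U"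
      then show "e ((S ^^ m) w) u = 0"
        using adj_pow[OF w(1), of u m] w(2)[OF Tm, of u m] p_im[of u] linear_between_0[OF functionalsD(4)[OF \<psi>] sub]
        by simp
    qed
    then have "w \<in> gen_ker W S"
      unfolding gen_ker_def using w(1) by (auto simp: m_def intro!: exI[of _ "Suc m0"])
    moreover have "e w u = \<psi> u" if "u \<in> gen_ker U T" for u
      using w(2)[OF gen_U[OF that]] p_id[OF that] by simp
    ultimately show ?thesis
      by blast
  qed
qed


section \<open>Tensor products and the tensor Casimir\<close>

definition tcarr :: "nat \<Rightarrow> 'v::complex_space smod \<Rightarrow> (ix \<Rightarrow> 'v) set"
  where "tcarr n M = {t. (\<forall>j\<in>idx n. t j \<in> carr M) \<and> (\<forall>j. j \<notin> idx n \<longrightarrow> t j = 0)}"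

lemma tensor_homog: "homog (tensor_V n M) p =
    {t. (\<forall>j\<in>idx n. t j \<in> homog M (p + par j)) \<and> (\<forall>j. j \<notin> idx n \<longrightarrow> t j = 0)}"
  by (simp add: tensor_V_def)

context pmod
begin

lemma tcarr_carr: "t \<in> tcarr n M \<Longrightarrow> t j \<in> carr M"
  by (cases "j \<in> idx n") (auto simp: tcarr_def)

lemma tcarr_0: "t \<in> tcarr n M \<Longrightarrow> j \<notin> idx n \<Longrightarrow> t j = 0"
  by (auto simp: tcarr_def)

lemma tcarrI: "(\<And>j. j \<in> idx n \<Longrightarrow> t j \<in> carr M) \<Longrightarrow> (\<And>j. j \<notin> idx n \<Longrightarrow> t j = 0) \<Longrightarrow> t \<in> tcarr n M"
  by (auto simp: tcarr_def)

lemma tcarr_subspace: "cvs.subspace (tcarr n M)"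
  unfolding cvs.subspace_def by (auto simp: tcarr_def carr_add carr_scale)

lemma tensor_gspace: "gspace (tensor_V n M)"
proof
  show "cvs.subspace (homog (tensor_V n M) p)" for p
    unfolding cvs.subspace_def tensor_homog by (auto simp: homog_add homog_scale)
  have "t = 0" if t: "t \<in> homog (tensor_V n M) 0" "t \<in> homog (tensor_V n M) 1" for t
  proof
    fix j
    show "t j = 0 j"
      using t homog_disjoint[of "t j" "par j"] by (cases "j \<in> idx n") (auto simp: tensor_homog add.commute)
  qed
  then show "homog (tensor_V n M) 0 \<inter> homog (tensor_V n M) 1 = {0}"
    by (auto simp: tensor_homog)
qed

lemma tensor_carr: "carr (tensor_V n M) = tcarr n M"
proof (intro subset_antisym subsetI)
  fix t assume "t \<in> carr (tensor_V n M)"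
  then obtain a b where "a \<in> homog (tensor_V n M) 0" "b \<in> homog (tensor_V n M) 1" "t = a + b"
    by (auto simp: carr_def)
  then show "t \<in> tcarr n M"
    by (intro tcarrI) (auto simp: tensor_homog intro!: carr_add intro: homog_carr)
next
  fix t assume t: "t \<in> tcarr n M"
  let ?h = "\<lambda>p j. hpart M (p + par j) (t j)"
  have "?h p \<in> homog (tensor_V n M) p" for p
    using tcarr_carr[OF t] tcarr_0[OF t] by (auto simp: tensor_homog)
  moreover have "t = ?h 0 + ?h 1"
    using hpart_sum[OF tcarr_carr[OF t]] by (simp add: fun_eq_iff) (metis add.commute)
  ultimately show "t \<in> carr (tensor_V n M)"
    unfolding carr_def by blast
qed

lemma tensor_op_eq:
  assumes a: "linear_between (carr M) (carr M) a" and t: "t \<in> tcarr n M"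
  shows "tensor_op n M a Y t = (\<lambda>i. \<Sum>j\<in>idx n. Y i j *\<^sub>C a (parop M (par i + par j) (t j)))"
proof
  fix i
  have "(\<Sum>q\<in>{0,1}. (psign (r * q) * c) *\<^sub>C a (hpart M q x)) = c *\<^sub>C a (parop M r x)" if "x \<in> carr M" for c r x
    using that by (simp add: parop_eq linear_betweenD(2,3)[OF a] carr_scale cscale_add_right cscale_cscale mult.commute)
  then show "tensor_op n M a Y t i = (\<Sum>j\<in>idx n. Y i j *\<^sub>C a (parop M (par i + par j) (t j)))"
    using tcarr_carr[OF t] unfolding tensor_op_def by simp
qed

lemma tensor_act:
  assumes X: "X \<in> pe n" and t: "t \<in> tcarr n M"
  shows "act (tensor_V n M) X t = (\<lambda>i. act M X (t i) + (\<Sum>j\<in>idx n. X i j *\<^sub>C parop M (par i + par j) (t j)))"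
proof
  fix i
  have id: "linear_between (carr M) (carr M) id"
    by (simp add: linear_between_def)
  have "(\<Sum>j\<in>idx n. mone (idx n) i j *\<^sub>C act M X (parop M (par i + par j) (t j)))
      = (\<Sum>j\<in>idx n. if i = j then act M X (t j) else 0)"
    using tcarr_carr[OF t] by (intro sum.cong refl) (auto simp: mone_def cscale_one)
  also have "\<dots> = act M X (t i)"
    using tcarr_0[OF t, of i] X by (auto simp: sum.delta')
  finally show "act (tensor_V n M) X t i = act M X (t i) + (\<Sum>j\<in>idx n. X i j *\<^sub>C parop M (par i + par j) (t j))"
    using t X by (simp add: tensor_V_def tensor_op_eq[OF act_linear[OF X]] tensor_op_eq[OF id])
qed

lemma tensor_act_homog:
  assumes X: "X \<in> pe_homog n x" and t: "t \<in> tcarr n M"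
  shows "act (tensor_V n M) X t = (\<lambda>i. act M X (t i) + (\<Sum>j\<in>idx n. X i j *\<^sub>C parop M x (t j)))"
proof -
  have "X i j *\<^sub>C parop M (par i + par j) (t j) = X i j *\<^sub>C parop M x (t j)" for i j
    using pe_homog_par[OF X, of i j] by (cases "X i j = 0") auto
  then show ?thesis
    by (simp only: tensor_act[OF pe_homog_pe[OF X] t])
qed

lemma tensor_act_in:
  assumes X: "X \<in> pe n" and t: "t \<in> tcarr n M"
  shows "act (tensor_V n M) X t \<in> tcarr n M"
proof (rule tcarrI)
  fix j assume j: "j \<notin> idx n"
  then have "X j i = 0" for i
    using pe_idx[OF X, of j i] by auto
  then show "act (tensor_V n M) X t j = 0"
    using tcarr_0[OF t j] X by (simp add: tensor_act[OF X t])
qed (use X tcarr_carr[OF t] in \<open>auto simp: tensor_act[OF X t] intro!: carr_add carr_sum carr_scale\<close>)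

lemma pmod_tensor: "pmod (tensor_V n M) n"
proof -
  interpret t: gspace "tensor_V n M" by (rule tensor_gspace)
  note add = cvs.subspace_add[OF tcarr_subspace] and scale = cvs.subspace_scale[OF tcarr_subspace]
  show ?thesis
  proof
    fix X assume X: "X \<in> pe n"
    show "linear_between (carr (tensor_V n M)) (carr (tensor_V n M)) (act (tensor_V n M) X)"
      unfolding tensor_carr
    proof (rule linear_betweenI)
      show "act (tensor_V n M) X t \<in> tcarr n M" if "t \<in> tcarr n M" for t
        by (rule tensor_act_in[OF X that])
    next
      fix s t assume "s \<in> tcarr n M" "t \<in> tcarr n M"
      then show "act (tensor_V n M) X (s + t) = act (tensor_V n M) X s + act (tensor_V n M) X t"
        by (simp add: tensor_act[OF X] add fun_eq_iff tcarr_carr act_add[OF X] parop_add cscale_add_right sum.distrib ac_simps)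
    next
      fix c t assume "t \<in> tcarr n M"
      then show "act (tensor_V n M) X (c *\<^sub>C t) = c *\<^sub>C act (tensor_V n M) X t"
        by (simp add: tensor_act[OF X] scale fun_eq_iff tcarr_carr act_scale[OF X] parop_scale
            cscale_add_right cvs.scale_sum_right cscale_cscale ac_simps)
    qed
  next
    fix t assume "t \<in> carr (tensor_V n M)"
    then have t: "t \<in> tcarr n M"
      by (simp add: tensor_carr)
    show "linear_between (pe n) (carr (tensor_V n M)) (\<lambda>X. act (tensor_V n M) X t)"
      unfolding tensor_carr
    proof (rule linear_betweenI)
      show "act (tensor_V n M) X t \<in> tcarr n M" if "X \<in> pe n" for X
        by (rule tensor_act_in[OF that t])
    next
      fix X Y assume "X \<in> pe n" "Y \<in> pe n"
      then show "act (tensor_V n M) (X + Y) t = act (tensor_V n M) X t + act (tensor_V n M) Y t"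
        using cvs.subspace_add[OF subspace_pe] tcarr_carr[OF t]
        by (simp add: tensor_act[OF _ t] fun_eq_iff act_add_left cscale_add_left sum.distrib ac_simps)
    next
      fix c X assume "X \<in> pe n"
      then show "act (tensor_V n M) (c *\<^sub>C X) t = c *\<^sub>C act (tensor_V n M) X t"
        using cvs.subspace_scale[OF subspace_pe] tcarr_carr[OF t]
        by (simp add: tensor_act[OF _ t] fun_eq_iff act_scale_left cscale_add_right cvs.scale_sum_right cscale_cscale ac_simps)
    qed
  next
    fix X p t q assume X: "X \<in> pe_homog n p" and t: "t \<in> homog (tensor_V n M) q"
    have t': "t \<in> tcarr n M"
      using t.homog_carr[OF t] by (simp add: tensor_carr)
    show "act (tensor_V n M) X t \<in> homog (tensor_V n M) (p + q)"
      unfolding tensor_homog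
    proof (intro CollectI conjI ballI allI impI)
      fix j assume j: "j \<in> idx n"
      have "X j i *\<^sub>C parop M p (t i) \<in> homog M (p + q + par j)" if i: "i \<in> idx n" for i
      proof (cases "X j i = 0")
        case False
        then have p: "p = par j + par i"
          using pe_homog_par[OF X] by auto
        have "t i \<in> homog M (q + par i)"
          using t i by (simp add: tensor_homog)
        moreover have "p + q + par j = q + par i"
          unfolding p by (cases "par i"; cases "par j"; simp)
        ultimately show ?thesis
          using homog_scale[OF parop_in[of "t i" "q + par i" p], of "X j i"] by (simp only:)
      qed simp
      moreover have "act M X (t j) \<in> homog M (p + q + par j)"
        using act_homog[OF X, of "t j" "q + par j"] t j by (simp add: tensor_homog add.assoc)
      ultimately show "act (tensor_V n M) X t j \<in> homog M (p + q + par j)"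
        unfolding tensor_act_homog[OF X t'] by (intro homog_add cvs.subspace_sum[OF homog_subspace])
    next
      fix j assume "j \<notin> idx n"
      then show "act (tensor_V n M) X t j = 0"
        using tcarr_0[OF tensor_act_in[OF pe_homog_pe[OF X] t']] by simp
    qed
  next
    fix X p Y q t assume X: "X \<in> pe_homog n p" and Y: "Y \<in> pe_homog n q" and "t \<in> carr (tensor_V n M)"
    then have t: "t \<in> tcarr n M" by (simp add: tensor_carr)
    note [simp] = pe_homog_pe[OF X] pe_homog_pe[OF Y]
    note XYt = tensor_act_in[OF pe_homog_pe[OF X] t] tensor_act_in[OF pe_homog_pe[OF Y] t]
    \<comment> \<open>When \<open>X\<close> and \<open>Y\<close> trade places, the two mixed terms
      are exchanged up to \<open>psign (p * q)\<close>. They cancel in the super commutator, and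
      only the first and the last term survive.\<close>
    have prod: "act (tensor_V n M) X (act (tensor_V n M) Y t) i = act M X (act M Y (t i))
        + ((\<Sum>j\<in>idx n. Y i j *\<^sub>C act M X (parop M q (t j)))
        + psign (p * q) *\<^sub>C (\<Sum>j\<in>idx n. X i j *\<^sub>C act M Y (parop M p (t j)))
        + (\<Sum>j\<in>idx n. mmul (idx n) X Y i j *\<^sub>C parop M (p + q) (t j)))"
      if X: "X \<in> pe_homog n p" and Y: "Y \<in> pe_homog n q" for X Y p q i
    proof -
      note [simp] = pe_homog_pe[OF X] pe_homog_pe[OF Y]
      have "(\<Sum>j\<in>idx n. X i j *\<^sub>C parop M p (\<Sum>k\<in>idx n. Y j k *\<^sub>C parop M q (t k)))
          = (\<Sum>j\<in>idx n. \<Sum>k\<in>idx n. (X i j * Y j k) *\<^sub>C parop M (p + q) (t k))"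
        using tcarr_carr[OF t] by (intro sum.cong refl) (simp add: parop_sum carr_scale parop_scale parop_parop cvs.scale_sum_right cscale_cscale)
      also have "\<dots> = (\<Sum>j\<in>idx n. mmul (idx n) X Y i j *\<^sub>C parop M (p + q) (t j))"
        by (subst sum.swap) (simp add: mmul_def cvs.scale_sum_left)
      finally show ?thesis
        using tcarr_carr[OF t]
        by (simp only: tensor_act_homog[OF X tensor_act_in[OF pe_homog_pe[OF Y] t]])
          (simp add: tensor_act_homog[OF Y t] act_add act_sum parop_add carr_sum carr_scale act_scale
            cscale_add_right sum.distrib parop_act[OF Y] cvs.scale_sum_right cscale_cscale ac_simps)
    qed
    show "act (tensor_V n M) (mmul (idx n) X Y - psign (p * q) *\<^sub>C mmul (idx n) Y X) t =
        act (tensor_V n M) X (act (tensor_V n M) Y t) - psign (p * q) *\<^sub>C act (tensor_V n M) Y (act (tensor_V n M) X t)"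
    proof
      fix i
      have eq: "psign (q * p) = psign (p * q)"
        by (simp add: mult.commute)
      show "act (tensor_V n M) (mmul (idx n) X Y - psign (p * q) *\<^sub>C mmul (idx n) Y X) t i =
        (act (tensor_V n M) X (act (tensor_V n M) Y t) - psign (p * q) *\<^sub>C act (tensor_V n M) Y (act (tensor_V n M) X t)) i"
        using tcarr_carr[OF t]
        by (simp add: tensor_act_homog[OF mmul_pe_bracket[OF X Y] t] prod[OF X Y] prod[OF Y X] act_bracket[OF X Y] eq
            cvs.scale_left_diff_distrib sum_subtractf add.commute[of q p] cscale_add_right cscale_cscale cscale_one cvs.scale_sum_right
            flip: mult.assoc)
    qed
  qed
qed

lemma tensor_parop:
  assumes "t \<in> tcarr n M"
  shows "parop (tensor_V n M) r t = (\<lambda>j. psign (r * par j) *\<^sub>C parop M r (t j))"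
proof -
  interpret t: pmod "tensor_V n M" n by (rule pmod_tensor)
  have "t \<in> carr (tensor_V n M)"
    using assms by (simp add: tensor_carr)
  then show ?thesis
  proof (induction rule: t.carr_induct)
    case (homog q t)
    have "psign (r * q) *\<^sub>C t j = psign (r * par j) *\<^sub>C parop M r (t j)" for j
    proof (cases "j \<in> idx n")
      case True
      then show ?thesis
        using homog by (simp add: tensor_homog parop_homog[of _ "q + par j"] distrib_left psign_add cscale_cscale ac_simps)
    qed (use homog in \<open>simp add: tensor_homog\<close>)
    then show ?case
      by (simp add: t.parop_homog[OF homog] fun_eq_iff)
  next
    case (add s t)
    then show ?case
      unfolding t.parop_add[OF add(1,2)] add(3,4)
      by (auto simp: tensor_carr tcarr_carr parop_add cscale_add_right)
  qed
qed

lemma fin_dim_tcarr: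
  assumes "fin_dim (carr M)"
  shows "fin_dim (tcarr n M)"
proof -
  obtain B where B: "finite B" "carr M \<subseteq> cvs.span B"
    using assms by (auto simp: fin_dim_def)
  let ?u = "\<lambda>i b j. if j = i then b else (0 :: 'v)"
  let ?C = "(\<lambda>(i, b). ?u i b) ` (idx n \<times> B)"
  have in_span: "?u i x \<in> cvs.span ?C" if i: "i \<in> idx n" and x: "x \<in> carr M" for i x
  proof -
    obtain u where u: "x = (\<Sum>b\<in>B. u b *\<^sub>C b)"
      using span_finiteE[OF B(1)] x B(2) by (metis subsetD)
    have sum_apply: "(\<Sum>b\<in>B. f b) j = (\<Sum>b\<in>B. f b j)" for f :: "'v \<Rightarrow> ix \<Rightarrow> 'v" and j
      using B(1) by (induction B) simp_all
    have "?u i x = (\<Sum>b\<in>B. u b *\<^sub>C ?u i b)"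
      by (auto simp: fun_eq_iff sum_apply u)
    also have "\<dots> \<in> cvs.span ?C"
      using i by (intro cvs.span_sum cvs.span_scale cvs.span_base) auto
    finally show ?thesis .
  qed
  have "t \<in> cvs.span ?C" if t: "t \<in> tcarr n M" for t
  proof -
    have sum_apply: "(\<Sum>i\<in>A. f i) j = (\<Sum>i\<in>A. f i j)" for f :: "ix \<Rightarrow> ix \<Rightarrow> 'v" and j A
      by (induction A rule: infinite_finite_induct) simp_all
    have "t = (\<Sum>i\<in>idx n. ?u i (t i))"
      using tcarr_0[OF t] by (auto simp: fun_eq_iff sum_apply sum.delta')
    also have "\<dots> \<in> cvs.span ?C"
      using tcarr_carr[OF t] by (intro cvs.span_sum in_span) auto
    finally show ?thesis .
  qed
  moreover have "finite ?C"
    using B(1) by simp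
  ultimately show ?thesis
    unfolding fin_dim_def by blast
qed

end

text \<open>The Casimir operator with the canonical element of \<open>dual_bases_canonical\<close>
  put in. The sum over a basis has become a sum over indices.\<close>

definition cas :: "nat \<Rightarrow> 'v::complex_space smod \<Rightarrow> (ix \<Rightarrow> 'v) \<Rightarrow> ix \<Rightarrow> 'v" where
  "cas n M t = (\<lambda>i. if i \<in> idx n
     then psign (par i) *\<^sub>C (\<Sum>j\<in>idx n. act M (rootm j i) (parop M (par i + par j) (t j))) else 0)"

context pmod
begin

lemma casimir_eq_cas:
  assumes BD: "dual_bases n B D" and t: "t \<in> tcarr n M"
  shows "casimir n B D M t = cas n M t"
proof
  fix i
  have B: "finite B" "\<And>b. b \<in> B \<Longrightarrow> b \<in> pe n" "\<And>b. b \<in> B \<Longrightarrow> D b \<in> mats (idx n)"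
    using BD dual_bases_finite[OF BD] by (auto simp: dual_bases_def pe_homog_pe pe_dual_eq)
  have sum_apply: "(\<Sum>b\<in>B. f b) i = (\<Sum>b\<in>B. f b i)" for f :: "gl \<Rightarrow> ix \<Rightarrow> 'v"
    using B(1) by (induction B) simp_all
  let ?P = "\<lambda>j. parop M (par i + par j) (t j)"
  have P: "?P j \<in> carr M" for j
    by (rule parop_carr[OF tcarr_carr[OF t]])
  have "casimir n B D M t i = (\<Sum>b\<in>B. \<Sum>j\<in>idx n. D b i j *\<^sub>C act M b (?P j))"
    unfolding casimir_def sum_apply by (intro sum.cong refl) (simp add: tensor_op_eq[OF act_linear[OF B(2)] t])
  also have "\<dots> = cas n M t i"
  proof (cases "i \<in> idx n")
    case True
    have "(\<Sum>b\<in>B. \<Sum>j\<in>idx n. D b i j *\<^sub>C act M b (?P j)) = (\<Sum>j\<in>idx n. \<Sum>b\<in>B. act M (D b i j *\<^sub>C b) (?P j))"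
      by (subst sum.swap) (intro sum.cong refl, simp add: act_scale_left[OF P] B(2))
    also have "\<dots> = (\<Sum>j\<in>idx n. act M (\<Sum>b\<in>B. D b i j *\<^sub>C b) (?P j))"
      by (intro sum.cong refl act_sum_left[OF P, symmetric] cvs.subspace_scale[OF subspace_pe] B(2))
    also have "\<dots> = (\<Sum>j\<in>idx n. psign (par i) *\<^sub>C act M (rootm j i) (?P j))"
      using True by (intro sum.cong refl) (simp add: dual_bases_canonical[OF BD] act_scale_left[OF P] rootm_pe)
    finally show ?thesis
      using True by (simp add: cas_def cvs.scale_sum_right)
  next
    case False
    then have "D b i j = 0" if "b \<in> B" for b j
      using B(3)[OF that] by (auto simp: mats_def)
    then show ?thesis
      using False by (simp add: cas_def)
  qed
  finally show "casimir n B D M t i = cas n M t i" .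
qed

lemma cas_linear: "linear_between (tcarr n M) (tcarr n M) (cas n M)"
proof (rule linear_betweenI)
  fix t assume t: "t \<in> tcarr n M"
  show "cas n M t \<in> tcarr n M"
    by (rule tcarrI) (auto simp: cas_def rootm_pe tcarr_carr[OF t] intro!: carr_scale carr_sum)
next
  fix s t assume st: "s \<in> tcarr n M" "t \<in> tcarr n M"
  show "cas n M (s + t) = cas n M s + cas n M t"
    using tcarr_carr[OF st(1)] tcarr_carr[OF st(2)]
    by (auto simp: cas_def fun_eq_iff parop_add act_add rootm_pe sum.distrib cscale_add_right)
next
  fix c t assume t: "t \<in> tcarr n M"
  show "cas n M (c *\<^sub>C t) = c *\<^sub>C cas n M t"
    using tcarr_carr[OF t]
    by (auto simp: cas_def fun_eq_iff parop_scale act_scale rootm_pe cvs.scale_sum_right cscale_cscale mult.commute)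
qed

lemma cas_homog:
  assumes "t \<in> homog (tensor_V n M) p"
  shows "cas n M t \<in> homog (tensor_V n M) p"
  unfolding tensor_homog
proof (intro CollectI conjI ballI allI impI)
  fix i assume i: "i \<in> idx n"
  have "act M (rootm j i) (parop M (par i + par j) (t j)) \<in> homog M (p + par i)" if j: "j \<in> idx n" for j
  proof -
    have "act M (rootm j i) (parop M (par i + par j) (t j)) \<in> homog M ((par j + par i) + (p + par j))"
      using assms j by (intro act_homog[OF rootm_pe_homog[OF j i]] parop_in) (simp add: tensor_homog)
    moreover have "(par j + par i) + (p + par j) = p + par i"
      by (cases "par i"; cases "par j"; simp)
    ultimately show ?thesis by (simp only:)
  qed
  then show "cas n M t i \<in> homog M (p + par i)"
    using i by (auto simp: cas_def intro!: homog_scale cvs.subspace_sum[OF homog_subspace])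
qed (simp add: cas_def)

text \<open>Moving \<open>X\<close> past \<open>rootm j i\<close> produces two correction sums. The
  one over the first index accounts for the action of \<open>X\<close> on the factor
  \<open>V\<close> before the Casimir operator; the one over the second index cancels its action on
  \<open>V\<close> afterwards.\<close>

lemma cas_act:
  assumes X: "X \<in> pe_homog n x" and t: "t \<in> tcarr n M"
  shows "cas n M (act (tensor_V n M) X t) = act (tensor_V n M) X (cas n M t)"
proof
  fix i
  note [simp] = pe_homog_pe[OF X] rootm_pe tcarr_carr[OF t]
  note cas_t = linear_betweenD(1)[OF cas_linear t]
  show "cas n M (act (tensor_V n M) X t) i = act (tensor_V n M) X (cas n M t) i"
  proof (cases "i \<in> idx n")
    case i: True
    let ?P = "\<lambda>i j. parop M (par i + par j) (t j)"
    let ?E = "\<lambda>j i. act M (rootm j i)"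
    \<comment> \<open>The common value of both sides: \<open>X\<close> acting on \<open>M\<close>
      first, plus \<open>X\<close> acting on the factor \<open>V\<close> first.\<close>
    let ?R = "psign (par i) *\<^sub>C ((\<Sum>j\<in>idx n. psign (x * (par i + par j)) *\<^sub>C ?E j i (act M X (?P i j)))
        + (\<Sum>j\<in>idx n. \<Sum>k\<in>idx n. X k j *\<^sub>C ?E k i (?P i j)))"
    have L: "cas n M (act (tensor_V n M) X t) i = ?R"
    proof -
      have "?E j i (parop M (par i + par j) (act (tensor_V n M) X t j))
          = psign (x * (par i + par j)) *\<^sub>C ?E j i (act M X (?P i j)) + (\<Sum>k\<in>idx n. X j k *\<^sub>C ?E j i (?P i k))"
        if j: "j \<in> idx n" for j
      proof -
        have "X j k *\<^sub>C parop M (par i + par j) (parop M x (t k)) = X j k *\<^sub>C ?P i k" for k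
        proof (cases "X j k = 0")
          case False
          then have "x = par j + par k"
            using pe_homog_par[OF X] by auto
          then have "par i + par j + x = par i + par k"
            by (cases "par i"; cases "par j"; cases "par k"; simp)
          then show ?thesis
            by (simp only: parop_parop[OF tcarr_carr[OF t]])
        qed simp
        then have "(\<Sum>k\<in>idx n. X j k *\<^sub>C parop M (par i + par j) (parop M x (t k))) = (\<Sum>k\<in>idx n. X j k *\<^sub>C ?P i k)"
          by (simp only:)
        then have "parop M (par i + par j) (act (tensor_V n M) X t j)
            = psign (x * (par i + par j)) *\<^sub>C act M X (?P i j) + (\<Sum>k\<in>idx n. X j k *\<^sub>C ?P i k)"
          by (simp add: tensor_act_homog[OF X t] parop_add carr_sum carr_scale parop_act[OF X] parop_sum parop_scale mult.commute)
        then show ?thesis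
          using i j by (simp add: act_add act_scale act_sum carr_sum carr_scale)
      qed
      then have "cas n M (act (tensor_V n M) X t) i = psign (par i) *\<^sub>C
          ((\<Sum>j\<in>idx n. psign (x * (par i + par j)) *\<^sub>C ?E j i (act M X (?P i j))) + (\<Sum>j\<in>idx n. \<Sum>k\<in>idx n. X j k *\<^sub>C ?E j i (?P i k)))"
        using i by (simp add: cas_def sum.distrib)
      then show ?thesis
        by (simp only: sum.swap[of "\<lambda>j k. X j k *\<^sub>C ?E j i (?P i k)"])
    qed
    have R: "act (tensor_V n M) X (cas n M t) i = ?R"
    proof -
      have "act M X (cas n M t i) = psign (par i) *\<^sub>C (\<Sum>j\<in>idx n. act M X (?E j i (?P i j)))"
        using i by (simp add: cas_def act_scale act_sum carr_sum)
      also have "(\<Sum>j\<in>idx n. act M X (?E j i (?P i j))) = (\<Sum>j\<in>idx n. psign (x * (par i + par j)) *\<^sub>C ?E j i (act M X (?P i j)))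
        + (\<Sum>j\<in>idx n. \<Sum>k\<in>idx n. X k j *\<^sub>C ?E k i (?P i j))
        - (\<Sum>j\<in>idx n. psign (x * (par i + par j)) *\<^sub>C (\<Sum>k\<in>idx n. X i k *\<^sub>C ?E j k (?P i j)))"
        unfolding sum.distrib[symmetric] sum_subtractf[symmetric]
        using i by (intro sum.cong refl) (simp add: act_rootm[OF X] add.commute)
      finally have 1: "act M X (cas n M t i) = ?R
          - psign (par i) *\<^sub>C (\<Sum>j\<in>idx n. psign (x * (par i + par j)) *\<^sub>C (\<Sum>k\<in>idx n. X i k *\<^sub>C ?E j k (?P i j)))"
        by (simp add: cvs.scale_right_diff_distrib)
      have "(\<Sum>k\<in>idx n. X i k *\<^sub>C parop M x (cas n M t k))
         = (\<Sum>k\<in>idx n. \<Sum>j\<in>idx n. psign (par i) *\<^sub>C psign (x * (par i + par j)) *\<^sub>C X i k *\<^sub>C ?E j k (?P i j))"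
      proof (intro sum.cong refl)
        fix k assume k: "k \<in> idx n"
        show "X i k *\<^sub>C parop M x (cas n M t k)
            = (\<Sum>j\<in>idx n. psign (par i) *\<^sub>C psign (x * (par i + par j)) *\<^sub>C X i k *\<^sub>C ?E j k (?P i j))"
        proof (cases "X i k = 0")
          case False
          then have x: "x = par i + par k"
            using pe_homog_par[OF X] by auto
          have "parop M x (?E j k (?P k j)) = psign (x * (par j + par k)) *\<^sub>C ?E j k (?P i j)" if j: "j \<in> idx n" for j
          proof -
            have "x + (par k + par j) = par i + par j"
              unfolding x by (cases "par i"; cases "par j"; cases "par k"; simp)
            then have "parop M x (?P k j) = ?P i j"
              by (simp only: parop_parop[OF tcarr_carr[OF t]])
            then show ?thesis
              using j k by (simp only: parop_act[OF rootm_pe_homog[OF j k] parop_carr[OF tcarr_carr[OF t]]])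
          qed
          then have "parop M x (cas n M t k) = psign (par k) *\<^sub>C (\<Sum>j\<in>idx n. psign (x * (par j + par k)) *\<^sub>C ?E j k (?P i j))"
            using k by (simp add: cas_def parop_scale carr_sum parop_sum)
          moreover have "psign (par k) * psign (x * (par j + par k)) = psign (par i) * psign (x * (par i + par j))" for j
            unfolding x by (cases "par i"; cases "par j"; cases "par k"; simp)
          ultimately show ?thesis
            by (simp add: cvs.scale_sum_right cscale_cscale mult.assoc mult.left_commute[of "X i k"] mult.commute[of "X i k"])
        qed simp
      qed
      also have "\<dots> = psign (par i) *\<^sub>C (\<Sum>j\<in>idx n. psign (x * (par i + par j)) *\<^sub>C (\<Sum>k\<in>idx n. X i k *\<^sub>C ?E j k (?P i j)))"
        by (subst sum.swap) (simp add: cvs.scale_sum_right)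
      finally show ?thesis
        unfolding tensor_act_homog[OF X cas_t] 1 by simp
    qed
    show ?thesis
      unfolding L R ..
  next
    case False
    then show ?thesis
      using tcarr_0[OF tensor_act_in[OF pe_homog_pe[OF X] cas_t]] by (simp add: cas_def)
  qed
qed

end


section \<open>Translation functors and duality\<close>

lemma submodule_parop:
  assumes "pmod M n" "submodule n N M" "x \<in> carr N"
  shows "parop N r x = parop M r x"
proof -
  interpret M: pmod M n by fact
  have N: "pmod N n"
    using assms(2) by (simp add: submodule_def pe_module_iff)
  then interpret N: pmod N n .
  have "mod_hom n N M id"
    using assms(2) submodule_carr[OF assms(2)] by (auto simp: mod_hom_def submodule_def linear_between_def)
  then show ?thesis
    using mod_hom_parop[OF N.gspace_axioms M.gspace_axioms _ assms(3)] by fastforce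
qed

definition kpar :: "int \<Rightarrow> bit"
  where "kpar k = (if even k then 0 else 1)"

lemma kpar_minus [simp]: "kpar (- k) = kpar k"
  by (simp add: kpar_def)

context pmod
begin

lemma pmod_Pi_pow: "pmod (Pi_pow k M) n"
  using pmod_Pi pmod_axioms by (simp add: Pi_pow_def)

lemma carr_Pi_pow [simp]: "carr (Pi_pow k M) = carr M"
  by (simp add: Pi_pow_def)

lemma homog_Pi_pow [simp]: "homog (Pi_pow k M) p = homog M (p + kpar k)"
  by (simp add: Pi_pow_def kpar_def)

lemma act_Pi_pow:
  assumes "X \<in> pe_homog n p" "x \<in> carr M"
  shows "act (Pi_pow k M) X x = psign (kpar k * p) *\<^sub>C act M X x"
  using act_Pi[OF assms] by (simp add: Pi_pow_def kpar_def cscale_one)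

lemma parop_Pi_pow:
  assumes "x \<in> carr M"
  shows "parop (Pi_pow k M) r x = psign (kpar k * r) *\<^sub>C parop M r x"
  using parop_Pi[OF assms] by (simp add: Pi_pow_def kpar_def cscale_one)

end

definition shift_cas :: "nat \<Rightarrow> 'v::complex_space smod \<Rightarrow> int \<Rightarrow> (ix \<Rightarrow> 'v) \<Rightarrow> ix \<Rightarrow> 'v"
  where "shift_cas n M k t = cas n M t - of_int k *\<^sub>C t"

context pmod
begin

lemma shift_cas_linear: "linear_between (tcarr n M) (tcarr n M) (shift_cas n M k)"
  using linear_betweenD[OF cas_linear] cvs.subspace_diff[OF tcarr_subspace] cvs.subspace_scale[OF tcarr_subspace]
  by (intro linear_betweenI) (auto simp: shift_cas_def cscale_add_right cvs.scale_right_diff_distrib mult.commute)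

lemma shift_cas_hom: "mod_hom n (tensor_V n M) (tensor_V n M) (shift_cas n M k)"
proof -
  interpret t: pmod "tensor_V n M" n by (rule pmod_tensor)
  show ?thesis
  proof (rule mod_homI[OF pmod_tensor pmod_tensor])
    show "linear_between (carr (tensor_V n M)) (carr (tensor_V n M)) (shift_cas n M k)"
      by (simp add: tensor_carr shift_cas_linear)
    show "shift_cas n M k x \<in> homog (tensor_V n M) p" if "x \<in> homog (tensor_V n M) p" for x p
      unfolding shift_cas_def by (intro t.homog_diff t.homog_scale cas_homog that)
    show "shift_cas n M k (act (tensor_V n M) X t) = act (tensor_V n M) X (shift_cas n M k t)"
      if X: "X \<in> pe_homog n p" and t: "t \<in> carr (tensor_V n M)" for X p t
    proof -
      have "cas n M t \<in> carr (tensor_V n M)"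
        using t linear_betweenD(1)[OF cas_linear] by (simp add: tensor_carr)
      then show ?thesis
        using t cas_act[OF X, of t]
        by (simp add: shift_cas_def tensor_carr t.act_scale[OF pe_homog_pe[OF X]] t.carr_scale[unfolded tensor_carr]
            linear_between_diff[OF t.act_linear[OF pe_homog_pe[OF X]] t.carr_subspace])
    qed
  qed
qed

lemma shift_cas_pow_hom: "mod_hom n (tensor_V n M) (tensor_V n M) (shift_cas n M k ^^ m)"
proof (induction m)
  case 0
  then show ?case
    by (simp add: mod_hom_def linear_between_def)
next
  case (Suc m)
  note a = mod_homD[OF Suc] and b = mod_homD[OF shift_cas_hom[of k]]
  show ?case
    unfolding mod_hom_def
  proof (intro conjI allI ballI subsetI)
    show "linear_between (carr (tensor_V n M)) (carr (tensor_V n M)) (shift_cas n M k ^^ Suc m)"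
      by (rule linear_between_funpow[OF b(1)])
    fix p y assume "y \<in> (shift_cas n M k ^^ Suc m) ` homog (tensor_V n M) p"
    then show "y \<in> homog (tensor_V n M) p"
      using a(2) b(2) by auto
  next
    fix X t assume "X \<in> pe n" "t \<in> carr (tensor_V n M)"
    then show "(shift_cas n M k ^^ Suc m) (act (tensor_V n M) X t) = act (tensor_V n M) X ((shift_cas n M k ^^ Suc m) t)"
      using a(3) b(3) linear_betweenD(1)[OF a(1)] by simp
  qed
qed

text \<open>The two forms of the Casimir operator are compared on \<open>tcarr n M\<close>, which
  the shifted operator preserves, so their powers agree there.\<close>

lemma Theta'_homog:
  assumes BD: "dual_bases n B D"
  shows "homog (Theta' n B D k M) p = homog (tensor_V n M) p \<inter> gen_ker (tcarr n M) (shift_cas n M k)"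
proof -
  interpret t: pmod "tensor_V n M" n by (rule pmod_tensor)
  have pow: "((\<lambda>s. casimir n B D M s - of_int k *\<^sub>C s) ^^ m) t = (shift_cas n M k ^^ m) t" if t: "t \<in> tcarr n M" for m t
  proof (induction m)
    case (Suc m)
    let ?t = "(shift_cas n M k ^^ m) t"
    have "?t \<in> tcarr n M"
      by (rule linear_betweenD(1)[OF linear_between_funpow[OF shift_cas_linear] t])
    then show ?case
      unfolding funpow.simps comp_apply Suc.IH by (simp only: shift_cas_def[of n M k ?t] casimir_eq_cas[OF BD])
  qed simp
  have "t \<in> tcarr n M" if "t \<in> homog (tensor_V n M) p" for t
    using t.homog_carr[OF that] by (simp add: tensor_carr)
  then show ?thesis
    by (auto simp: Theta'_def gen_ker_def pow)
qed

lemma Theta'_submodule: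
  assumes BD: "dual_bases n B D"
  shows "submodule n (Theta' n B D k M) (tensor_V n M)"
proof -
  interpret t: pmod "tensor_V n M" n by (rule pmod_tensor)
  let ?H = "\<lambda>p. homog (Theta' n B D k M) p"
  have "Theta' n B D k M = \<lparr>homog = ?H, act = act (tensor_V n M)\<rparr>"
    by (simp add: Theta'_def)
  moreover have "submodule n \<lparr>homog = ?H, act = act (tensor_V n M)\<rparr> (tensor_V n M)"
  proof (rule t.submoduleI)
    show "cvs.subspace (?H p)" for p
      unfolding Theta'_homog[OF BD]
      by (intro cvs.subspace_inter t.homog_subspace gen_ker_subspace[OF shift_cas_linear tcarr_subspace])
    fix X p t q assume X: "X \<in> pe_homog n p" and t: "t \<in> ?H q"
    then have t': "t \<in> homog (tensor_V n M) q" "t \<in> gen_ker (tcarr n M) (shift_cas n M k)"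
      by (auto simp: Theta'_homog[OF BD])
    obtain m where m: "m > 0" "(shift_cas n M k ^^ m) t = 0"
      using t'(2) by (auto simp: gen_ker_def)
    have "(shift_cas n M k ^^ m) (act (tensor_V n M) X t) = 0"
      using m mod_homD(3)[OF shift_cas_pow_hom pe_homog_pe[OF X] t.homog_carr[OF t'(1)]] pe_homog_pe[OF X] by simp
    then show "act (tensor_V n M) X t \<in> ?H (p + q)"
      using t.act_homog[OF X t'(1)] t.homog_carr[OF t.act_homog[OF X t'(1)]] m(1)
      by (auto simp: Theta'_homog[OF BD] gen_ker_def tensor_carr)
  qed (simp add: Theta'_homog[OF BD])
  ultimately show ?thesis
    by simp
qed

lemma pmod_Theta': "dual_bases n B D \<Longrightarrow> pmod (Theta' n B D k M) n"
  using Theta'_submodule by (simp add: submodule_def pe_module_iff)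

text \<open>The shifted Casimir operator is even, so its generalized kernel contains the homogeneous
  parts of its elements.\<close>

lemma Theta'_carr:
  assumes BD: "dual_bases n B D"
  shows "carr (Theta' n B D k M) = gen_ker (tcarr n M) (shift_cas n M k)"
proof -
  interpret t: pmod "tensor_V n M" n by (rule pmod_tensor)
  interpret th: pmod "Theta' n B D k M" n by (rule pmod_Theta'[OF BD])
  show ?thesis
  proof (intro subset_antisym subsetI)
    fix t assume "t \<in> carr (Theta' n B D k M)"
    then show "t \<in> gen_ker (tcarr n M) (shift_cas n M k)"
    proof (induction rule: th.carr_induct)
      case (add y z)
      then show ?case
        by (intro cvs.subspace_add[OF gen_ker_subspace[OF shift_cas_linear tcarr_subspace]])
    qed (simp add: Theta'_homog[OF BD])
  next
    fix t assume t: "t \<in> gen_ker (tcarr n M) (shift_cas n M k)"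
    then obtain m where m: "t \<in> carr (tensor_V n M)" "m > 0" "(shift_cas n M k ^^ m) t = 0"
      by (auto simp: gen_ker_def tensor_carr)
    have "(shift_cas n M k ^^ m) (hpart (tensor_V n M) p t) = 0" for p
      using mod_hom_hpart[OF t.gspace_axioms t.gspace_axioms shift_cas_pow_hom m(1)] m(3) by simp
    then have "hpart (tensor_V n M) p t \<in> homog (Theta' n B D k M) p" for p
      using m t.hpart_carr[OF m(1)] by (auto simp: Theta'_homog[OF BD] gen_ker_def tensor_carr)
    then show "t \<in> carr (Theta' n B D k M)"
      using th.carr_add[OF th.homog_carr th.homog_carr] t.hpart_sum[OF m(1), of 0] by metis
  qed
qed

lemma pmod_Theta: "dual_bases n B D \<Longrightarrow> pmod (Theta n B D k M) n"
  unfolding Theta_def by (rule pmod.pmod_Pi_pow[OF pmod_Theta'])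

lemma Theta_carr:
  assumes BD: "dual_bases n B D"
  shows "carr (Theta n B D k M) = gen_ker (tcarr n M) (shift_cas n M k)"
  by (simp add: Theta_def pmod.carr_Pi_pow[OF pmod_Theta'[OF BD]] Theta'_carr[OF BD])

end

text \<open>Evaluation on \<open>M\<close> combined with the odd form on \<open>V\<close>: index
  \<open>i\<close> meets \<open>dix i\<close>, and \<open>parop M (par i)\<close> is the Koszul sign
  for moving a basis vector past an element of \<open>M\<close>. Up to the constant
  \<open>psign e\<close>, the parameter \<open>e\<close> composes the second argument with the
  \<open>e\<close>-th power of the parity involution of the tensor product. With
  \<open>e = kpar k\<close> this absorbs the twist by \<open>\<Pi>^k\<close>.\<close>

definition tpair :: "nat \<Rightarrow> 'v::complex_space smod \<Rightarrow> bit \<Rightarrow> (ix \<Rightarrow> 'v \<Rightarrow> complex) \<Rightarrow> (ix \<Rightarrow> 'v) \<Rightarrow> complex" where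
  "tpair n M e t s = (\<Sum>i\<in>idx n. psign (e * par i) * t i (parop M (par i + e) (s (dix i))))"

context pmod
begin

lemma tcarr_dual: "t \<in> tcarr n (dual_mod M) \<Longrightarrow> t i \<in> functionals (carr M)"
  using pmod.tcarr_carr[OF pmod_dual] by (simp add: dual_carr)

lemma tpair_linear:
  assumes t: "t \<in> tcarr n (dual_mod M)"
  shows "linear_between (tcarr n M) UNIV (tpair n M e t)"
  by (rule linear_betweenI)
    (simp_all add: tpair_def tcarr_carr functionalsD(1,2)[OF tcarr_dual[OF t]] parop_add parop_scale
      distrib_left sum.distrib sum_distrib_left mult.left_commute)

lemma tpair_add_left: "tpair n M e (t + t') s = tpair n M e t s + tpair n M e t' s"
  and tpair_diff_left: "tpair n M e (t - t') s = tpair n M e t s - tpair n M e t' s"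
  and tpair_scale_left: "tpair n M e (c *\<^sub>C t) s = c * tpair n M e t s"
  and tpair_0_left: "tpair n M e 0 s = 0"
  by (simp_all add: tpair_def distrib_left right_diff_distrib sum.distrib sum_subtractf sum_distrib_left mult.left_commute)

text \<open>The action on \<open>M\<close> is transposed by definition of the dual, that on
  \<open>V\<close> because \<open>X\<close> is skew for the odd form. The minus sign and the outer
  \<open>parop\<close> are those of a dual action, so the defect is
  \<open>psign ((1 + e) * x)\<close>, which parity changes account for in
  \<open>eta_iso\<close>.\<close>

lemma tpair_act:
  assumes X: "X \<in> pe_homog n x" and t: "t \<in> tcarr n (dual_mod M)" and s: "s \<in> tcarr n M"
  shows "tpair n M e (act (tensor_V n (dual_mod M)) X t) s
    = - psign ((1 + e) * x) * tpair n M e t (parop (tensor_V n M) x (act (tensor_V n M) X s))"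
proof -
  interpret d: pmod "dual_mod M" n by (rule pmod_dual)
  note [simp] = pe_homog_pe[OF X] tcarr_carr[OF s]
  note t' = tcarr_dual[OF t]
  let ?S = "\<lambda>i. parop M (par i + e) (s (dix i))"
  have sum_apply: "(\<Sum>b\<in>A. f b) i = (\<Sum>b\<in>A. f b i)" for f :: "ix \<Rightarrow> 'v \<Rightarrow> complex" and A i
    by (induction A rule: infinite_finite_induct) simp_all
  have neg: "t i (c *\<^sub>C y) = c * t i y" if "y \<in> carr M" for i c y
    by (rule functionalsD(2)[OF t' that])
  have dpar: "parop (dual_mod M) x (t j) y = t j (parop M x y)" if "y \<in> carr M" for j y
    using that t' by (simp add: dual_parop dual_carr)
  have "tpair n M e (act (tensor_V n (dual_mod M)) X t) s
     = (\<Sum>i\<in>idx n. psign (e * par i) * (- t i (parop M x (act M X (?S i))) + (\<Sum>j\<in>idx n. X i j * t j (parop M x (?S i)))))"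
    unfolding tpair_def d.tensor_act_homog[OF X t]
    by (intro sum.cong refl) (simp add: sum_apply dual_act_homog[OF X t'] dpar)
  also have "\<dots> = (\<Sum>i\<in>idx n. psign (e * par i) * - t i (parop M x (act M X (?S i))))
     + (\<Sum>j\<in>idx n. \<Sum>i\<in>idx n. psign (e * par i) * X i j * t j (parop M x (?S i)))"
    unfolding distrib_left sum.distrib sum_distrib_left by (subst sum.swap) (simp only: mult.assoc)
  finally have L: "tpair n M e (act (tensor_V n (dual_mod M)) X t) s
     = (\<Sum>i\<in>idx n. psign (e * par i) * - t i (parop M x (act M X (?S i))))
     + (\<Sum>j\<in>idx n. \<Sum>i\<in>idx n. psign (e * par i) * X i j * t j (parop M x (?S i)))" .
  have "parop M (par i + e) (parop (tensor_V n M) x (act (tensor_V n M) X s) (dix i))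
     = psign (x * (par i + 1)) *\<^sub>C parop M (par i + e + x) (act M X (s (dix i)))
     + psign (x * (par i + 1)) *\<^sub>C (\<Sum>j\<in>idx n. X (dix i) (dix j) *\<^sub>C parop M (par i + e) (s (dix j)))" for i
  proof -
    have "parop M (par i + e) (parop (tensor_V n M) x (act (tensor_V n M) X s) (dix i))
       = psign (x * (par i + 1)) *\<^sub>C parop M (par i + e + x) (act M X (s (dix i)))
       + psign (x * (par i + 1)) *\<^sub>C (\<Sum>j\<in>idx n. X (dix i) j *\<^sub>C parop M (par i + e) (s j))"
      by (simp only: tensor_parop[OF tensor_act_in[OF pe_homog_pe[OF X] s]])
        (simp add: tensor_act_homog[OF X s] parop_scale parop_add
          carr_add carr_sum carr_scale parop_parop parop_sum cscale_add_right add.assoc)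
    also have "(\<Sum>j\<in>idx n. X (dix i) j *\<^sub>C parop M (par i + e) (s j))
       = (\<Sum>j\<in>idx n. X (dix i) (dix j) *\<^sub>C parop M (par i + e) (s (dix j)))"
      by (rule sum_dix[symmetric])
    finally show ?thesis .
  qed
  then have R: "tpair n M e t (parop (tensor_V n M) x (act (tensor_V n M) X s))
     = (\<Sum>i\<in>idx n. psign (e * par i) * psign (x * (par i + 1)) * t i (parop M (par i + e + x) (act M X (s (dix i)))))
     + (\<Sum>j\<in>idx n. \<Sum>i\<in>idx n. psign (e * par j) * psign (x * (par j + 1)) * X (dix j) (dix i) * t j (parop M (par j + e) (s (dix i))))"
    by (simp add: tpair_def functionalsD(1)[OF t'] neg carr_sum carr_scale linear_between_sum[OF functionalsD(4)[OF t'] carr_subspace]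
        sum.distrib distrib_left sum_distrib_left mult.assoc)
  \<comment> \<open>The summands from the action on \<open>M\<close>; the sign arises when
    \<open>parop\<close> passes \<open>X\<close>.\<close>
  have 1: "psign (e * par i) * - t i (parop M x (act M X (?S i)))
    = - psign ((1 + e) * x) * (psign (e * par i) * psign (x * (par i + 1)) * t i (parop M (par i + e + x) (act M X (s (dix i)))))" for i
  proof -
    have "parop M (par i + e + x) (act M X (s (dix i))) = parop M x (parop M (par i + e) (act M X (s (dix i))))"
      by (simp add: parop_parop add.commute)
    then have "t i (parop M (par i + e + x) (act M X (s (dix i)))) = psign ((par i + e) * x) * t i (parop M x (act M X (?S i)))"
      by (simp add: parop_act[OF X] parop_scale neg)
    then show ?thesis
      by (cases "par i"; cases e; cases x; simp)
  qed
  \<comment> \<open>The summands from the action on \<open>V\<close>; skewness exchanges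
    \<open>(i, j)\<close> with \<open>(dix j, dix i)\<close>.\<close>
  have 2: "psign (e * par i) * X i j * t j (parop M x (?S i))
    = - psign ((1 + e) * x) * (psign (e * par j) * psign (x * (par j + 1)) * X (dix j) (dix i) * t j (parop M (par j + e) (s (dix i))))" for i j
  proof (cases "X i j = 0")
    case True
    then show ?thesis
      using pe_adj[OF pe_homog_pe[OF X], of "dix j" "dix i"] by simp
  next
    case False
    then have x: "x = par i + par j"
      using pe_homog_par[OF X] by auto
    have "x + (par i + e) = par j + e"
      unfolding x by (cases "par i"; cases "par j"; cases e; simp)
    then have "parop M x (?S i) = parop M (par j + e) (s (dix i))"
      by (simp only: parop_parop[OF tcarr_carr[OF s]])
    moreover have "psign (e * par i) * X i j = - psign ((1 + e) * x) * (psign (e * par j) * psign (x * (par j + 1)) * X (dix j) (dix i))"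
      unfolding pe_adj[OF pe_homog_pe[OF X], of i j] x
      by (cases "par i"; cases "par j"; cases e; simp)
    ultimately show ?thesis
      by simp
  qed
  show ?thesis
    unfolding L R 1 2 sum_distrib_left distrib_left ..
qed

text \<open>The minus sign is that of the transposed action of \<open>rootm j i\<close> on
  \<open>M\<close>. On the other side, replacing \<open>i\<close> by \<open>dix i\<close> turns
  \<open>rootm i (dix j)\<close> into a multiple of \<open>rootm j i\<close>; its sign combines with
  the prefactor \<open>psign (par j + 1)\<close> so that no further minus sign remains, in
  accordance with the self-adjointness of the second tensor factor.\<close>

lemma tpair_cas:
  assumes t: "t \<in> tcarr n (dual_mod M)" and s: "s \<in> tcarr n M"
  shows "tpair n M e (cas n (dual_mod M) t) s = - tpair n M e t (cas n M s)"
proof -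
  interpret d: pmod "dual_mod M" n by (rule pmod_dual)
  note [simp] = tcarr_carr[OF s] rootm_pe
  note t' = tcarr_dual[OF t]
  let ?S = "\<lambda>i. parop M (par i + e) (s (dix i))"
  have sum_apply: "(\<Sum>b\<in>A. f b) i = (\<Sum>b\<in>A. f b i)" for f :: "ix \<Rightarrow> 'v \<Rightarrow> complex" and A i
    by (induction A rule: infinite_finite_induct) simp_all
  have E: "act (dual_mod M) (rootm j i) (parop (dual_mod M) (par i + par j) (t j)) y = - t j (act M (rootm j i) y)"
    if ij: "i \<in> idx n" "j \<in> idx n" and y: "y \<in> carr M" for i j y
  proof -
    have "parop (dual_mod M) (par i + par j) (t j) \<in> functionals (carr M)"
      using d.parop_carr[OF d.tcarr_carr[OF t]] by (simp add: dual_carr)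
    moreover have "parop (dual_mod M) (par i + par j) (t j) z = t j (parop M (par i + par j) z)" if "z \<in> carr M" for z
      using that t' by (simp add: dual_parop dual_carr)
    moreover have "par i + par j + (par j + par i) = 0"
      by (cases "par i"; cases "par j"; simp)
    ultimately show ?thesis
      using ij y by (simp add: dual_act_homog[OF rootm_pe_homog[OF ij(2,1)]] parop_parop)
  qed
  have L: "tpair n M e (cas n (dual_mod M) t) s
     = (\<Sum>j\<in>idx n. \<Sum>i\<in>idx n. psign (e * par i) * psign (par i) * - t j (act M (rootm j i) (?S i)))"
    unfolding tpair_def
    by (subst sum.swap, intro sum.cong refl)
      (simp add: cas_def sum_apply E sum_distrib_left mult.assoc sum_negf)
  have P: "parop M (par j + e) (cas n M s (dix j))
     = psign (par j + 1) *\<^sub>C (\<Sum>i\<in>idx n. (psign ((par j + e) * (par i + par j)) * - psign ((par i + par j) * par i)) *\<^sub>C act M (rootm j i) (?S i))"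
    if j: "j \<in> idx n" for j
  proof -
    have "cas n M s (dix j) = psign (par j + 1) *\<^sub>C (\<Sum>i\<in>idx n. act M (rootm i (dix j)) (parop M (par j + 1 + par i) (s i)))"
      using j by (simp add: cas_def)
    also have "(\<Sum>i\<in>idx n. act M (rootm i (dix j)) (parop M (par j + 1 + par i) (s i)))
      = (\<Sum>i\<in>idx n. act M (rootm (dix i) (dix j)) (parop M (par j + 1 + par (dix i)) (s (dix i))))"
      by (rule sum_dix[symmetric])
    finally have "parop M (par j + e) (cas n M s (dix j))
      = psign (par j + 1) *\<^sub>C (\<Sum>i\<in>idx n. parop M (par j + e) (act M (rootm (dix i) (dix j)) (parop M (par j + 1 + par (dix i)) (s (dix i)))))"
      using j by (simp add: parop_scale carr_sum parop_sum)
    also have "(\<Sum>i\<in>idx n. parop M (par j + e) (act M (rootm (dix i) (dix j)) (parop M (par j + 1 + par (dix i)) (s (dix i)))))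
      = (\<Sum>i\<in>idx n. (psign ((par j + e) * (par i + par j)) * - psign ((par i + par j) * par i)) *\<^sub>C act M (rootm j i) (?S i))"
    proof (intro sum.cong refl)
      fix i assume i: "i \<in> idx n"
      have par: "par (dix i) + par (dix j) = par i + par j"
        "par j + e + (par j + 1 + par (dix i)) = par i + e"
        "(par j + par i) * par i = (par i + par j) * par i"
        by (cases "par i"; cases "par j"; cases e; simp)+
      have "parop M (par j + e) (act M (rootm (dix i) (dix j)) (parop M (par j + 1 + par (dix i)) (s (dix i))))
        = psign ((par j + e) * (par i + par j)) *\<^sub>C act M (rootm (dix i) (dix j)) (parop M (par j + e + (par j + 1 + par (dix i))) (s (dix i)))"
      proof -
        have "rootm (dix i) (dix j) \<in> pe_homog n (par i + par j)"
          using rootm_pe_homog[of "dix i" n "dix j"] i j by (simp only: par(1) dix_in_idx)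
        then show ?thesis
          by (simp only: parop_act parop_carr parop_parop tcarr_carr[OF s])
      qed
      also have "\<dots> = psign ((par j + e) * (par i + par j)) *\<^sub>C act M (rootm (dix i) (dix j)) (?S i)"
        by (simp only: par(2))
      also have "\<dots> = (psign ((par j + e) * (par i + par j)) * - psign ((par i + par j) * par i)) *\<^sub>C act M (rootm j i) (?S i)"
      proof -
        have "rootm (dix i) (dix j) = (- psign ((par i + par j) * par i)) *\<^sub>C rootm j i"
          using rootm_dix[of i j] by (simp only: par(3))
        then show ?thesis
          using i j by (simp only: act_scale_left rootm_pe parop_carr tcarr_carr[OF s] cscale_cscale)
      qed
      finally show "parop M (par j + e) (act M (rootm (dix i) (dix j)) (parop M (par j + 1 + par (dix i)) (s (dix i))))
        = (psign ((par j + e) * (par i + par j)) * - psign ((par i + par j) * par i)) *\<^sub>C act M (rootm j i) (?S i)" .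
    qed
    finally show ?thesis .
  qed
  define c where "c i j = psign ((par j + e) * (par i + par j)) * - psign ((par i + par j) * par i)" for i j
  have "tpair n M e t (cas n M s) = (\<Sum>j\<in>idx n. \<Sum>i\<in>idx n. psign (e * par j) * psign (par j + 1) *
     c i j * t j (act M (rootm j i) (?S i)))"
    unfolding tpair_def
    by (intro sum.cong refl)
      (simp add: P[folded c_def] functionalsD(2)[OF t'] carr_sum carr_scale linear_between_sum[OF functionalsD(4)[OF t'] carr_subspace]
        sum_distrib_left mult.assoc)
  also have "\<dots> = - tpair n M e (cas n (dual_mod M) t) s"
  proof -
    have "psign (e * par j) * psign (par j + 1) * c i j
      = psign (e * par i) * psign (par i)" for i j
      unfolding c_def by (cases "par i"; cases "par j"; cases e; simp)
    then show ?thesis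
      unfolding L sum_negf[symmetric] by simp
  qed
  finally show ?thesis
    by simp
qed

text \<open>Tested on elements whose only nonzero coordinate is at \<open>dix i\<close>.\<close>

lemma tpair_inj:
  assumes t: "t \<in> tcarr n (dual_mod M)" and zero: "\<And>s. s \<in> tcarr n M \<Longrightarrow> tpair n M e t s = 0"
  shows "t = 0"
proof (intro ext)
  fix i x
  note t' = tcarr_dual[OF t, of i]
  show "t i x = 0 i x"
  proof (cases "i \<in> idx n \<and> x \<in> carr M")
    case True
    let ?s = "\<lambda>j. if j = dix i then parop M (par i + e) x else 0"
    have "?s \<in> tcarr n M"
      using True by (intro tcarrI) auto
    from zero[OF this] have "(\<Sum>j\<in>idx n. if j = i then psign (e * par i) * t i x else 0) = 0"
    proof -
      have "tpair n M e t ?s = (\<Sum>j\<in>idx n. if j = i then psign (e * par i) * t i x else 0)"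
        unfolding tpair_def
        using True linear_between_0[OF functionalsD(4)[OF tcarr_dual[OF t]] carr_subspace]
        by (intro sum.cong refl) (auto simp: parop_parop)
      then show ?thesis
        using zero[OF \<open>?s \<in> tcarr n M\<close>] by simp
    qed
    then show ?thesis
      using True by (simp add: sum.delta)
  qed (use functionalsD(3)[OF t'] pmod.tcarr_0[OF pmod_dual t] in auto)
qed

lemma tpair_surj:
  assumes \<psi>: "\<psi> \<in> functionals (tcarr n M)"
  shows "\<exists>t\<in>tcarr n (dual_mod M). \<forall>s\<in>tcarr n M. tpair n M e t s = \<psi> s"
proof -
  interpret d: pmod "dual_mod M" n by (rule pmod_dual)
  define u where "u i x = (\<lambda>j. if j = i then x else 0 :: 'v)" for i :: ix and x
  \<comment> \<open>Each coordinate is read off from \<open>\<psi>\<close> on elements with a single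
    coordinate. The sign factors of \<open>tpair\<close> are their own inverses and therefore
    reappear unchanged.\<close>
  define t where "t i = (if i \<in> idx n then restrict0 (carr M) (\<lambda>x. psign (e * par i) * \<psi> (u (dix i) (parop M (par i + e) x))) else 0)" for i
  have u_in: "u i x \<in> tcarr n M" if "i \<in> idx n" "x \<in> carr M" for i x
    using that by (intro tcarrI) (auto simp: u_def)
  have u_add: "u i (x + y) = u i x + u i y" and u_scale: "u i (c *\<^sub>C x) = c *\<^sub>C u i x" for i c x y
    by (auto simp: fun_eq_iff u_def)
  have t_in: "t i \<in> functionals (carr M)" if "i \<in> idx n" for i
    using that u_in[of "dix i"] carr_add carr_scale
    by (intro functionalsI) (simp_all add: t_def parop_add parop_scale u_add u_scale functionalsD(1,2)[OF \<psi>] distrib_left mult.left_commute)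
  have "t \<in> tcarr n (dual_mod M)"
    by (rule d.tcarrI) (simp_all add: dual_carr t_in, simp add: t_def)
  moreover have "tpair n M e t s = \<psi> s" if s: "s \<in> tcarr n M" for s
  proof -
    have sum_apply: "(\<Sum>i\<in>A. f i) j = (\<Sum>i\<in>A. f i j)" for f :: "ix \<Rightarrow> ix \<Rightarrow> 'v" and j A
      by (induction A rule: infinite_finite_induct) simp_all
    have "tpair n M e t s = (\<Sum>i\<in>idx n. \<psi> (u (dix i) (s (dix i))))"
      unfolding tpair_def by (intro sum.cong refl) (simp add: t_def parop_parop tcarr_carr[OF s])
    also have "\<dots> = (\<Sum>i\<in>idx n. \<psi> (u i (s i)))"
      by (rule sum_dix)
    also have "\<dots> = \<psi> (\<Sum>i\<in>idx n. u i (s i))"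
      by (intro linear_between_sum[OF functionalsD(4)[OF \<psi>] tcarr_subspace, symmetric] u_in tcarr_carr[OF s])
    also have "(\<Sum>i\<in>idx n. u i (s i)) = s"
      using tcarr_0[OF s] by (auto simp: fun_eq_iff sum_apply u_def sum.delta')
    finally show ?thesis .
  qed
  ultimately show ?thesis
    by blast
qed

end


definition eta :: "nat \<Rightarrow> gl set \<Rightarrow> (gl \<Rightarrow> gl) \<Rightarrow> int \<Rightarrow> 'v::complex_space smod
    \<Rightarrow> (ix \<Rightarrow> 'v \<Rightarrow> complex) \<Rightarrow> (ix \<Rightarrow> 'v) \<Rightarrow> complex" where
  "eta n B D k M t = restrict0 (carr (Theta n B D (- k) M)) (tpair n M (kpar k) t)"

context pmod
begin

lemma Theta_homog_tensor:
  assumes "dual_bases n B D" "t \<in> homog (Theta n B D k M) p"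
  shows "t \<in> homog (tensor_V n M) (p + kpar k)"
  using assms by (simp add: Theta_def pmod.homog_Pi_pow[OF pmod_Theta'] Theta'_homog)

text \<open>In the second equation the sign by which \<open>Pi_pow\<close> twists the action cancels
  the one by which it changes \<open>parop\<close>; this combination is what a dual action evaluates
  at.\<close>

lemma Theta_act:
  assumes BD: "dual_bases n B D" and X: "X \<in> pe_homog n x" and t: "t \<in> carr (Theta n B D k M)"
  shows "act (Theta n B D k M) X t = psign (kpar k * x) *\<^sub>C act (tensor_V n M) X t"
    and "parop (Theta n B D k M) x (act (Theta n B D k M) X t) = parop (tensor_V n M) x (act (tensor_V n M) X t)"
proof -
  interpret th: pmod "Theta' n B D k M" n by (rule pmod_Theta'[OF BD])
  have t': "t \<in> carr (Theta' n B D k M)"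
    using t by (simp add: Theta_def)
  have act: "act (Theta' n B D k M) = act (tensor_V n M)"
    by (simp add: Theta'_def)
  show eq: "act (Theta n B D k M) X t = psign (kpar k * x) *\<^sub>C act (tensor_V n M) X t"
    unfolding Theta_def by (simp add: th.act_Pi_pow[OF X t'] act)
  have in_th: "act (tensor_V n M) X t \<in> carr (Theta' n B D k M)"
    using th.act_carr[OF pe_homog_pe[OF X] t'] by (simp add: act)
  show "parop (Theta n B D k M) x (act (Theta n B D k M) X t) = parop (tensor_V n M) x (act (tensor_V n M) X t)"
    unfolding eq submodule_parop[OF pmod_tensor Theta'_submodule[OF BD] in_th, symmetric] unfolding Theta_def
    using in_th by (simp add: th.parop_Pi_pow th.carr_scale th.parop_scale cscale_cscale cscale_one)
qed

text \<open>By \<open>tpair_cas\<close>, shifting by \<open>k\<close> on one side is minus the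
  adjoint of shifting by \<open>- k\<close> on the other, so \<open>gen_ker_pairing\<close> gives
  bijectivity. The rest is a comparison of parities and signs.\<close>

lemma eta_iso:
  assumes BD: "dual_bases n B D" and fin: "fin_dim (carr M)"
  shows "mod_iso n (Theta n B D k (dual_mod M)) (Pi_mod (dual_mod (Theta n B D (- k) M))) (eta n B D k M)"
proof -
  interpret d: pmod "dual_mod M" n by (rule pmod_dual)
  let ?L = "Theta n B D k (dual_mod M)" and ?R = "Theta n B D (- k) M"
  interpret L: pmod ?L n by (rule d.pmod_Theta[OF BD])
  interpret R: pmod ?R n by (rule pmod_Theta[OF BD])
  interpret dR: pmod "dual_mod ?R" n by (rule R.pmod_dual)
  let ?e = "tpair n M (kpar k)"
  have Lc: "carr ?L = gen_ker (tcarr n (dual_mod M)) (shift_cas n (dual_mod M) k)"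
    by (rule d.Theta_carr[OF BD])
  have Rc: "carr ?R = gen_ker (tcarr n M) (shift_cas n M (- k))"
    by (rule Theta_carr[OF BD])
  have L_t: "t \<in> tcarr n (dual_mod M)" if "t \<in> carr ?L" for t
    using that by (simp add: Lc gen_ker_def)
  have R_t: "s \<in> tcarr n M" if "s \<in> carr ?R" for s
    using that by (simp add: Rc gen_ker_def)
  have adj: "?e (shift_cas n (dual_mod M) k t) s = - ?e t (shift_cas n M (- k) s)"
    if t: "t \<in> tcarr n (dual_mod M)" and s: "s \<in> tcarr n M" for t s
  proof -
    have "?e (shift_cas n (dual_mod M) k t) s = ?e (cas n (dual_mod M) t) s - of_int k * ?e t s"
      by (simp add: shift_cas_def tpair_diff_left tpair_scale_left)
    also have "\<dots> = - (?e t (cas n M s) + of_int k * ?e t s)"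
      by (simp add: tpair_cas[OF t s])
    also have "?e t (cas n M s) + of_int k * ?e t s = ?e t (shift_cas n M (- k) s)"
      using linear_betweenD(2)[OF tpair_linear[OF t] linear_betweenD(1)[OF cas_linear s] cvs.subspace_scale[OF tcarr_subspace s], of "kpar k" "of_int k"]
        linear_betweenD(3)[OF tpair_linear[OF t] s, of "kpar k" "of_int k"]
      by (simp add: shift_cas_def)
    finally show ?thesis .
  qed
  have inj: "t = 0" if "t \<in> tcarr n (dual_mod M)" "\<And>s. s \<in> tcarr n M \<Longrightarrow> ?e t s = 0" for t
    using that by (rule tpair_inj)
  note pairing = gen_ker_pairing[where e = ?e, OF tcarr_subspace fin_dim_tcarr[OF fin] shift_cas_linear d.tcarr_subspace d.shift_cas_linear]
  have pairing_inj: "t = 0" if "t \<in> gen_ker (tcarr n (dual_mod M)) (shift_cas n (dual_mod M) k)"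
    "\<And>s. s \<in> gen_ker (tcarr n M) (shift_cas n M (- k)) \<Longrightarrow> ?e t s = 0" for t
    by (rule pairing(1), fact tpair_linear, rule tpair_0_left, fact inj, fact tpair_surj, fact adj, fact that, fact that)
  have pairing_surj: "\<exists>t\<in>gen_ker (tcarr n (dual_mod M)) (shift_cas n (dual_mod M) k).
      \<forall>s\<in>gen_ker (tcarr n M) (shift_cas n M (- k)). ?e t s = \<psi> s"
    if "\<psi> \<in> functionals (gen_ker (tcarr n M) (shift_cas n M (- k)))" for \<psi>
    by (rule pairing(2), fact tpair_linear, rule tpair_0_left, fact inj, fact tpair_surj, fact adj, fact that)
  have in_f: "eta n B D k M t \<in> functionals (carr ?R)" if t: "t \<in> carr ?L" for t
    unfolding eta_def using linear_betweenD(2,3)[OF tpair_linear[OF L_t[OF t]]] R_t R.carr_add R.carr_scale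
    by (intro functionalsI) simp_all
  have "mod_hom n ?L (Pi_mod (dual_mod ?R)) (eta n B D k M)"
  proof (rule mod_homI[OF L.pmod_axioms dR.pmod_Pi])
    show "linear_between (carr ?L) (carr (Pi_mod (dual_mod ?R))) (eta n B D k M)"
      unfolding dR.carr_Pi R.dual_carr
      by (rule linear_betweenI) (use in_f in blast, auto simp: eta_def restrict0_def fun_eq_iff tpair_add_left tpair_scale_left)
  next
    fix p t assume t: "t \<in> homog ?L p"
    \<comment> \<open>Degree \<open>p\<close> of \<open>Pi_mod (dual_mod ?R)\<close> consists of the
      functionals vanishing on degree \<open>p\<close> of \<open>?R\<close>. The pairing vanishes
      there because \<open>i\<close> and \<open>dix i\<close> have opposite parities.\<close>
    have "?e t s = 0" if s: "s \<in> homog ?R p" for s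
      unfolding tpair_def
    proof (intro sum.neutral ballI)
      fix i assume i: "i \<in> idx n"
      have "s (dix i) \<in> homog M (p + kpar k + par i + 1)"
      proof -
        have "\<forall>j\<in>idx n. s j \<in> homog M (p + kpar k + par j)"
          using Theta_homog_tensor[OF BD s] by (simp add: tensor_homog)
        then have "s (dix i) \<in> homog M (p + kpar k + par (dix i))"
          using i by (simp only: dix_in_idx)
        then show ?thesis
          by (simp only: par_simps add.assoc)
      qed
      then have "parop M (par i + kpar k) (s (dix i)) \<in> homog M (p + kpar k + par i + 1)"
        by (rule parop_in)
      moreover have "t i \<in> homog (dual_mod M) (p + kpar k + par i)"
        using d.Theta_homog_tensor[OF BD t] i by (simp add: tensor_homog)
      ultimately show "psign (kpar k * par i) * t i (parop M (par i + kpar k) (s (dix i))) = 0"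
        by (simp add: dual_homog)
    qed
    then show "eta n B D k M t \<in> homog (Pi_mod (dual_mod ?R)) p"
      using in_f[OF L.homog_carr[OF t]] R.homog_carr by (simp add: R.dual_homog) (simp add: eta_def)
  next
    fix X x t assume X: "X \<in> pe_homog n x" and t: "t \<in> carr ?L"
    have "eta n B D k M (act ?L X t) s = (psign x *\<^sub>C act (dual_mod ?R) X (eta n B D k M t)) s" for s
    proof (cases "s \<in> carr ?R")
      case True
      have "parop ?R x (act ?R X s) \<in> carr ?R"
        using True pe_homog_pe[OF X] by simp
      \<comment> \<open>The twist of \<open>Theta\<close> on the left and the defect in
        \<open>tpair_act\<close> together leave exactly the sign of a single
        \<open>Pi_mod\<close>.\<close>
      moreover have "psign (kpar k * x) * psign ((1 + kpar k) * x) = psign x"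
        by (cases x; cases "kpar k"; simp)
      ultimately show ?thesis
        using True
        by (simp only: R.dual_act_homog[OF X in_f[OF t]] cscale_apply) (simp add: eta_def d.Theta_act(1)[OF BD X t] tpair_scale_left
            tpair_act[OF X L_t[OF t] R_t[OF True]] Theta_act(2)[OF BD X True] flip: mult.assoc)
    next
      case False
      then show ?thesis
        by (simp only: R.dual_act_homog[OF X in_f[OF t]] cscale_apply) (simp add: eta_def)
    qed
    then show "eta n B D k M (act ?L X t) = act (Pi_mod (dual_mod ?R)) X (eta n B D k M t)"
      using in_f[OF t] by (simp add: dR.act_Pi[OF X] R.dual_carr fun_eq_iff)
  qed
  then show ?thesis
  proof (rule mod_isoI[OF L.gspace_axioms])
    fix t assume t: "t \<in> carr ?L" "eta n B D k M t = 0"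
    show "t = 0"
    proof (rule pairing_inj)
      show "t \<in> gen_ker (tcarr n (dual_mod M)) (shift_cas n (dual_mod M) k)"
        using t(1) by (simp only: Lc)
      show "?e t s = 0" if "s \<in> gen_ker (tcarr n M) (shift_cas n M (- k))" for s
        using fun_cong[OF t(2), of s] that by (simp add: eta_def Rc)
    qed
  next
    fix \<psi> assume "\<psi> \<in> carr (Pi_mod (dual_mod ?R))"
    then have \<psi>: "\<psi> \<in> functionals (carr ?R)"
      by (simp add: R.dual_carr)
    then obtain t where t: "t \<in> carr ?L" "\<forall>s\<in>carr ?R. ?e t s = \<psi> s"
      using pairing_surj[OF \<psi>[unfolded Rc]] unfolding Lc Rc by blast
    have "eta n B D k M t = \<psi>"
      using t(2) functionalsD(3)[OF \<psi>] by (auto simp: eta_def restrict0_def fun_eq_iff)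
    then show "\<exists>t\<in>carr ?L. eta n B D k M t = \<psi>"
      using t(1) by blast
  qed
qed

end

section \<open>Naturality of the Casimir operator and of the isomorphism\<close>

lemma cas_natural:
  assumes "pmod M n" "pmod N n" "mod_hom n M N f" "s \<in> tcarr n M"
  shows "Theta_map f s \<in> tcarr n N" "cas n N (Theta_map f s) = Theta_map f (cas n M s)"
proof -
  interpret M: pmod M n by fact
  interpret N: pmod N n by fact
  note f = mod_homD[OF assms(3)]
  note s = M.tcarr_carr[OF assms(4)]
  have f0: "f 0 = 0"
    by (rule linear_between_0[OF f(1) M.carr_subspace])
  show "Theta_map f s \<in> tcarr n N"
    using s linear_betweenD(1)[OF f(1)] M.tcarr_0[OF assms(4)] f0 by (intro N.tcarrI) (auto simp: Theta_map_def)
  show "cas n N (Theta_map f s) = Theta_map f (cas n M s)"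
  proof
    fix i
    show "cas n N (Theta_map f s) i = Theta_map f (cas n M s) i"
    proof (cases "i \<in> idx n")
      case True
      have "f (\<Sum>j\<in>idx n. act M (rootm j i) (parop M (par i + par j) (s j)))
         = (\<Sum>j\<in>idx n. act N (rootm j i) (parop N (par i + par j) (f (s j))))"
        using True s
        by (simp add: linear_between_sum[OF f(1) M.carr_subspace] rootm_pe f(3)
            mod_hom_parop[OF M.gspace_axioms N.gspace_axioms assms(3)])
      then show ?thesis
        using True s by (simp add: cas_def Theta_map_def linear_betweenD(3)[OF f(1)] M.carr_sum rootm_pe)
    qed (simp add: cas_def Theta_map_def f0)
  qed
qed

lemma Theta_map_gen_ker:
  assumes "pmod M n" "pmod N n" "mod_hom n M N f" "s \<in> gen_ker (tcarr n M) (shift_cas n M k)"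
  shows "Theta_map f s \<in> gen_ker (tcarr n N) (shift_cas n N k)"
proof -
  interpret M: pmod M n by fact
  interpret N: pmod N n by fact
  note f = mod_homD[OF assms(3)]
  obtain m where s: "s \<in> tcarr n M" and m: "m > 0" "(shift_cas n M k ^^ m) s = 0"
    using assms(4) by (auto simp: gen_ker_def)
  have shift: "shift_cas n N k (Theta_map f t) = Theta_map f (shift_cas n M k t)" if t: "t \<in> tcarr n M" for t
  proof -
    have "cas n M t \<in> tcarr n M"
      by (rule linear_betweenD(1)[OF M.cas_linear t])
    then show ?thesis
      unfolding shift_cas_def cas_natural(2)[OF assms(1-3) t]
      using t by (auto simp: Theta_map_def fun_eq_iff M.tcarr_carr M.carr_scale linear_betweenD(3)[OF f(1)]
          linear_between_diff[OF f(1) M.carr_subspace])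
  qed
  have "(shift_cas n N k ^^ m) (Theta_map f s) = Theta_map f ((shift_cas n M k ^^ m) s)" for m
  proof (induction m)
    case (Suc m)
    then show ?case
      using shift[OF linear_betweenD(1)[OF linear_between_funpow[OF M.shift_cas_linear] s]] by simp
  qed simp
  then have "(shift_cas n N k ^^ m) (Theta_map f s) = 0"
    using m(2) linear_between_0[OF f(1) M.carr_subspace] by (simp add: Theta_map_def fun_eq_iff)
  then show ?thesis
    unfolding gen_ker_def using cas_natural(1)[OF assms(1-3) s] m(1) by blast
qed

lemma eta_natural:
  assumes M: "pmod M n" and N: "pmod N n" and BD: "dual_bases n B D" and f: "mod_hom n M N f"
    and t: "t \<in> carr (Theta n B D k (dual_mod N))"
  shows "eta n B D k M (Theta_map (dual_map M f) t) = dual_map (Theta n B D (- k) M) (Theta_map f) (eta n B D k N t)"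
proof
  interpret M: pmod M n by fact
  interpret N: pmod N n by fact
  fix s
  show "eta n B D k M (Theta_map (dual_map M f) t) s = dual_map (Theta n B D (- k) M) (Theta_map f) (eta n B D k N t) s"
  proof (cases "s \<in> carr (Theta n B D (- k) M)")
    case True
    then have s: "s \<in> gen_ker (tcarr n M) (shift_cas n M (- k))"
      by (simp add: M.Theta_carr[OF BD])
    then have s': "s i \<in> carr M" for i
      using M.tcarr_carr by (auto simp: gen_ker_def)
    have "Theta_map f s \<in> carr (Theta n B D (- k) N)"
      using Theta_map_gen_ker[OF M N f s] by (simp add: N.Theta_carr[OF BD])
    then show ?thesis
      using True s' by (simp add: eta_def dual_map_def tpair_def Theta_map_def
          mod_hom_parop[OF M.gspace_axioms N.gspace_axioms f])
  qed (simp add: eta_def dual_map_def)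
qed


section \<open>Weight vectors\<close>

text \<open>The eigenvalue of \<open>rootm p p\<close> on the basis vector with index
  \<open>r\<close>, by \<open>rootm_diag\<close>.\<close>

definition ev :: "ix \<Rightarrow> ix \<Rightarrow> int"
  where "ev p r = (if r = p then 1 else if r = dix p then -1 else 0)"

text \<open>The eigenvalue of \<open>rootm p p\<close> on a vector of weight \<open>wt\<close>; the
  sign for \<open>Inr\<close> comes from
  \<open>rootm (Inr i) (Inr i) = - rootm (Inl i) (Inl i)\<close>.\<close>

definition wtx :: "(nat \<Rightarrow> int) \<Rightarrow> ix \<Rightarrow> int"
  where "wtx wt p = case_sum wt (\<lambda>i. - wt i) p"

text \<open>The weight \<open>wt\<close> plus \<open>k\<close> times the weight
  \<open>\<epsilon>_r - \<epsilon>_s\<close> of \<open>rootm r s\<close>.\<close>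

definition shiftw :: "(nat \<Rightarrow> int) \<Rightarrow> int \<Rightarrow> ix \<Rightarrow> ix \<Rightarrow> nat \<Rightarrow> int"
  where "shiftw wt k r s = (\<lambda>i. wt i + k * (ev (Inl i) r - ev (Inl i) s))"

lemma wtx_simps [simp]: "wtx wt (Inl i) = wt i" "wtx wt (Inr i) = - wt i"
  by (simp_all add: wtx_def)

lemma ev_simps [simp]: "ev p p = 1" "ev p (dix p) = -1" "ev (dix p) r = - ev p r"
  by (auto simp: ev_def)

lemma ev_other: "r \<noteq> p \<Longrightarrow> r \<noteq> dix p \<Longrightarrow> ev p r = 0"
  by (simp add: ev_def)

lemma wtx_shiftw: "wtx (shiftw wt k r s) p = wtx wt p + k * (ev p r - ev p s)"
proof (cases p)
  case (Inr i)
  then show ?thesis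
    using ev_simps(3)[of "Inl i" r] ev_simps(3)[of "Inl i" s] by (simp add: shiftw_def algebra_simps)
qed (simp add: shiftw_def)

lemma rootm_nonzero: "rootm p q i j \<noteq> 0 \<Longrightarrow> i = p \<and> j = q \<or> i = dix q \<and> j = dix p"
  by (auto simp: rootm_def split: if_splits)

lemma rootm_diag: "rootm p p i j = (if i = j then of_int (ev p i) else 0)"
  by (auto simp: rootm_def ev_def)

text \<open>Zero counts as a vector of every weight in a module, so root vectors map weight vectors
  to weight vectors without exception.\<close>

definition wvec :: "nat \<Rightarrow> 'v::complex_space smod \<Rightarrow> (nat \<Rightarrow> int) \<Rightarrow> 'v \<Rightarrow> bool"
  where "wvec n M wt x \<longleftrightarrow> x \<in> carr M \<and> (\<forall>p\<in>idx n. act M (rootm p p) x = of_int (wtx wt p) *\<^sub>C x)"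

text \<open>Induction over a finite spanning set: if \<open>g\<close> is one of its elements, with
  eigenvalue \<open>c\<close>, then \<open>T - c\<close> applied to \<open>v - k g\<close> removes
  \<open>g\<close> and leaves a nonzero multiple of \<open>v\<close> in the span of the
  rest.\<close>

lemma eigenvector_not_in_span:
  assumes S: "cvs.subspace S" and T: "linear_between S S T"
    and G: "G \<subseteq> S" "\<And>g. g \<in> G \<Longrightarrow> \<exists>c. c \<noteq> d \<and> T g = c *\<^sub>C g"
    and v: "v \<in> S" "T v = d *\<^sub>C v" "v \<noteq> 0"
  shows "v \<notin> cvs.span G"
proof
  assume "v \<in> cvs.span G"
  then obtain t where t: "finite t" "t \<subseteq> G" "v \<in> cvs.span t"
    unfolding cvs.span_explicit by (auto intro!: cvs.span_sum cvs.span_scale cvs.span_base)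
  from t(1,2,3) show False
  proof (induction t rule: finite_induct)
    case empty
    then show ?case
      using v(3) by simp
  next
    case (insert g t)
    then obtain c where c: "c \<noteq> d" "T g = c *\<^sub>C g"
      using G(2) by blast
    have sub: "insert g t \<subseteq> S"
      using insert.prems(1) G(1) by blast
    obtain k where k: "v - k *\<^sub>C g \<in> cvs.span t"
      using insert.prems(2) unfolding cvs.span_insert by blast
    let ?y = "v - k *\<^sub>C g"
    have T_span: "T y \<in> cvs.span t" if "y \<in> cvs.span t" for y
    proof -
      have "y \<in> S \<and> T y \<in> cvs.span t"
        using that
      proof (induction rule: cvs.span_induct_alt)
        case base
        then show ?case
          using linear_between_0[OF T S] cvs.subspace_0[OF S] by (simp add: cvs.span_zero)
      next
        case (step a x y)
        then obtain b where "T x = b *\<^sub>C x"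
          using G(2) insert.prems(1) by blast
        moreover have "x \<in> S" "a *\<^sub>C x \<in> S"
          using step sub cvs.subspace_scale[OF S] by blast+
        ultimately show ?case
          using step linear_betweenD(2)[OF T, of "a *\<^sub>C x" y] linear_betweenD(3)[OF T, of x a] cvs.subspace_add[OF S]
          by (simp add: cvs.span_add cvs.span_scale cvs.span_base)
      qed
      then show ?thesis ..
    qed
    have gS: "g \<in> S" "k *\<^sub>C g \<in> S"
      using sub cvs.subspace_scale[OF S] by blast+
    have "T ?y - c *\<^sub>C ?y = (d - c) *\<^sub>C v"
      using linear_between_diff[OF T S v(1) gS(2)] linear_betweenD(3)[OF T gS(1), of k] c(2) v(2)
      by (simp add: cvs.scale_right_diff_distrib cvs.scale_left_diff_distrib cscale_cscale mult.commute)
    moreover have "T ?y - c *\<^sub>C ?y \<in> cvs.span t"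
      by (rule cvs.span_diff[OF T_span[OF k] cvs.span_scale[OF k]])
    ultimately have "(1 / (d - c)) *\<^sub>C (d - c) *\<^sub>C v \<in> cvs.span t"
      using cvs.span_scale by metis
    then have "v \<in> cvs.span t"
      using c(1) by (simp add: cscale_cscale cscale_one)
    then show False
      using insert.IH insert.prems(1) by blast
  qed
qed

text \<open>The eigenvalues \<open>c + j\<close> are pairwise distinct, so nonzero members would
  form an infinite independent family.\<close>

lemma eigenvector_string:
  assumes S: "cvs.subspace S" "fin_dim S" and T: "linear_between S S T"
    and u: "\<And>j. u j \<in> S" "\<And>j. T (u j) = (c + of_nat j) *\<^sub>C u j"
  shows "\<exists>j. u j = 0"
proof (rule ccontr)
  assume nz: "\<nexists>j. u j = 0"
  have not_in: "u m \<notin> cvs.span (u ` {..<m})" for m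
    by (rule eigenvector_not_in_span[OF S(1) T, of _ "c + of_nat m"]) (use u nz in auto)
  have ind: "cvs.independent (u ` {..<m}) \<and> card (u ` {..<m}) = m" for m
  proof (induction m)
    case (Suc m)
    have "u m \<notin> u ` {..<m}"
      using cvs.span_base[of "u m" "u ` {..<m}"] not_in[of m] by blast
    then show ?case
      using Suc not_in[of m] by (simp add: lessThan_Suc cvs.independent_insertI)
  qed (simp add: cvs.independent_empty)
  obtain B where B: "finite B" "S \<subseteq> cvs.span B"
    using S(2) by (auto simp: fin_dim_def)
  have "card (u ` {..<Suc (card B)}) \<le> card B"
    using cvs.independent_span_bound[OF B(1), of "u ` {..<Suc (card B)}"] ind[of "Suc (card B)"] u(1) B(2) by blast
  then show False
    using ind[of "Suc (card B)"] by simp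
qed

lemma last_nonzero:
  assumes "f 0 \<noteq> 0" "\<exists>j::nat. f j = 0"
  obtains k where "f k \<noteq> 0" "f (Suc k) = 0"
proof -
  define m where "m = (LEAST j. f j = 0)"
  have m: "f m = 0"
    unfolding m_def by (rule LeastI_ex[OF assms(2)])
  then obtain k where k: "m = Suc k"
    using assms(1) by (cases m) auto
  have "f k \<noteq> 0"
    using not_less_Least[of k "\<lambda>j. f j = 0"] k by (simp add: m_def)
  then show ?thesis
    using that m k by simp
qed

context pmod
begin

lemma wvec_rootm:
  assumes x: "wvec n M wt x" and rs: "r \<in> idx n" "s \<in> idx n"
  shows "wvec n M (shiftw wt 1 r s) (act M (rootm r s) x)"
proof -
  have xc: "x \<in> carr M"
    using x by (simp add: wvec_def)
  note [simp] = rootm_pe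
  have "act M (rootm p p) (act M (rootm r s) x) = of_int (wtx (shiftw wt 1 r s) p) *\<^sub>C act M (rootm r s) x" if p: "p \<in> idx n" for p
  proof -
    have 0: "rootm p p \<in> pe_homog n 0"
      using rootm_pe_homog[OF p p] by simp
    have "(\<Sum>k\<in>idx n. rootm p p k r *\<^sub>C act M (rootm k s) x) = (\<Sum>k\<in>idx n. if k = r then of_int (ev p k) *\<^sub>C act M (rootm k s) x else 0)"
      by (intro sum.cong refl) (simp add: rootm_diag)
    moreover have "(\<Sum>k\<in>idx n. rootm p p s k *\<^sub>C act M (rootm r k) x) = (\<Sum>k\<in>idx n. if s = k then of_int (ev p k) *\<^sub>C act M (rootm r k) x else 0)"
      by (intro sum.cong refl) (simp add: rootm_diag)
    ultimately have "act M (rootm p p) (act M (rootm r s) x) = act M (rootm r s) (act M (rootm p p) x)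
      + (of_int (ev p r) *\<^sub>C act M (rootm r s) x - of_int (ev p s) *\<^sub>C act M (rootm r s) x)"
      using act_rootm[OF 0 rs xc] rs by (simp add: sum.delta sum.delta' cscale_one)
    also have "act M (rootm r s) (act M (rootm p p) x) = of_int (wtx wt p) *\<^sub>C act M (rootm r s) x"
      using x p rs by (simp add: wvec_def act_scale)
    finally show ?thesis
      by (simp add: wtx_shiftw cvs.scale_left_distrib cvs.scale_left_diff_distrib)
  qed
  then show ?thesis
    using xc rs by (simp add: wvec_def)
qed

lemma wvec_rootm_funpow:
  assumes x: "wvec n M wt x" and rs: "r \<in> idx n" "s \<in> idx n"
  shows "wvec n M (shiftw wt (int j) r s) ((act M (rootm r s) ^^ j) x)"
proof (induction j)
  case 0
  then show ?case
    using x by (simp add: shiftw_def)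
next
  case (Suc j)
  have "shiftw (shiftw wt (int j) r s) 1 r s = shiftw wt (int (Suc j)) r s"
    by (simp add: shiftw_def fun_eq_iff algebra_simps)
  then show ?case
    using wvec_rootm[OF Suc rs] by simp
qed

text \<open>The bracket of two opposite root vectors lies in the Cartan subalgebra. If
  \<open>s = dix r\<close>, both matrix units of a root vector would contribute to the sums.\<close>

lemma rootm_rootm:
  assumes rs: "r \<in> idx n" "s \<in> idx n" "r \<noteq> s" "s \<noteq> dix r" and x: "x \<in> carr M"
  shows "act M (rootm s r) (act M (rootm r s) x) = psign (par r + par s) *\<^sub>C act M (rootm r s) (act M (rootm s r) x)
    + (act M (rootm s s) x - psign (par r + par s) *\<^sub>C act M (rootm r r) x)"
proof -
  have sr: "s \<noteq> r" "r \<noteq> dix s"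
    using rs by auto
  have "(\<Sum>k\<in>idx n. rootm s r k r *\<^sub>C act M (rootm k s) x) = (\<Sum>k\<in>idx n. if k = s then act M (rootm k s) x else 0)"
    using rs sr by (intro sum.cong refl) (auto simp: rootm_def cscale_one)
  then have 1: "(\<Sum>k\<in>idx n. rootm s r k r *\<^sub>C act M (rootm k s) x) = act M (rootm s s) x"
    using rs by (simp add: sum.delta)
  have "(\<Sum>k\<in>idx n. rootm s r s k *\<^sub>C act M (rootm r k) x) = (\<Sum>k\<in>idx n. if k = r then act M (rootm r k) x else 0)"
    using rs sr by (intro sum.cong refl) (auto simp: rootm_def cscale_one)
  then have 2: "(\<Sum>k\<in>idx n. rootm s r s k *\<^sub>C act M (rootm r k) x) = act M (rootm r r) x"
    using rs by (simp add: sum.delta)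
  have 3: "(par s + par r) * (par r + par s) = par r + par s"
    by (cases "par r"; cases "par s"; simp)
  show ?thesis
    using act_rootm[OF rootm_pe_homog[OF rs(2,1)] rs(1,2) x] by (simp only: 1 2 3)
qed

text \<open>Representation theory of \<open>sl(2)\<close>: a string that starts at a vector killed
  by \<open>rootm s r\<close> has the difference of two weight entries as its length.\<close>

lemma even_root_string:
  assumes rs: "r \<in> idx n" "s \<in> idx n" "r \<noteq> s" "par r = par s"
    and v: "wvec n M wt v" "v \<noteq> 0" "act M (rootm s r) v = 0" and fin: "fin_dim (carr M)"
  obtains k where "(act M (rootm r s) ^^ k) v \<noteq> 0" "(act M (rootm r s) ^^ Suc k) v = 0" "wtx wt s - wtx wt r = int k"
proof -
  let ?u = "\<lambda>j. (act M (rootm r s) ^^ j) v"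
  have sr: "s \<noteq> dix r" "r \<noteq> dix s"
    using rs(4) by auto
  note [simp] = rootm_pe rs(1,2)
  have wu: "wvec n M (shiftw wt (int j) r s) (?u j)" for j
    by (rule wvec_rootm_funpow[OF v(1) rs(1,2)])
  then have uc: "?u j \<in> carr M" for j
    unfolding wvec_def by blast
  have ev: "ev r s = 0" "ev s r = 0"
    using rs(3) sr by (auto simp: ev_other)
  have Er: "act M (rootm r r) (?u j) = of_int (wtx wt r + int j) *\<^sub>C ?u j"
    and Es: "act M (rootm s s) (?u j) = of_int (wtx wt s - int j) *\<^sub>C ?u j" for j
    using wu[of j] rs(1,2) by (auto simp: wvec_def wtx_shiftw ev)
  have "\<exists>j. ?u j = 0"
    by (rule eigenvector_string[OF carr_subspace fin act_linear[of "rootm r r"], where c = "of_int (wtx wt r)"])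
      (use uc Er in simp_all)
  then obtain k where k: "?u k \<noteq> 0" "?u (Suc k) = 0"
    using last_nonzero[of ?u] v(2) by auto
  define m where "m = wtx wt s - wtx wt r"
  \<comment> \<open>The usual \<open>sl(2)\<close> coefficient. At the last nonzero member of the
    string it must vanish, which forces \<open>m = k\<close>.\<close>
  have raise: "act M (rootm s r) (?u (Suc j)) = of_int ((int j + 1) * (m - int j)) *\<^sub>C ?u j" for j
  proof (induction j)
    case 0
    have "act M (rootm s r) (act M (rootm r s) v) = act M (rootm s s) v - act M (rootm r r) v"
      using rootm_rootm[OF rs(1,2,3) sr(1) uc[of 0]] v(3) rs(4) by (simp add: cscale_one)
    then show ?case
      using Er[of 0] Es[of 0] by (simp add: m_def cvs.scale_left_diff_distrib)
  next
    case (Suc j)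
    have "act M (rootm s r) (?u (Suc (Suc j))) = act M (rootm r s) (act M (rootm s r) (?u (Suc j)))
      + (act M (rootm s s) (?u (Suc j)) - act M (rootm r r) (?u (Suc j)))"
      using rootm_rootm[OF rs(1,2,3) sr(1) uc[of "Suc j"]] rs(4) by (simp add: cscale_one)
    also have "act M (rootm r s) (act M (rootm s r) (?u (Suc j))) = of_int ((int j + 1) * (m - int j)) *\<^sub>C ?u (Suc j)"
      unfolding Suc using uc[of j] by (simp add: act_scale)
    also have "of_int ((int j + 1) * (m - int j)) *\<^sub>C ?u (Suc j) + (act M (rootm s s) (?u (Suc j)) - act M (rootm r r) (?u (Suc j)))
      = of_int ((int j + 1) * (m - int j) + ((wtx wt s - int (Suc j)) - (wtx wt r + int (Suc j)))) *\<^sub>C ?u (Suc j)"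
      unfolding Er Es by (simp only: cvs.scale_left_distrib cvs.scale_left_diff_distrib of_int_add of_int_diff)
    also have "(int j + 1) * (m - int j) + ((wtx wt s - int (Suc j)) - (wtx wt r + int (Suc j))) = (int (Suc j) + 1) * (m - int (Suc j))"
      by (simp add: m_def algebra_simps)
    finally show ?case .
  qed
  have "of_int ((int k + 1) * (m - int k)) *\<^sub>C ?u k = 0"
    using raise[of k] k(2) by simp
  then have "(int k + 1) * (m - int k) = 0"
    using k(1) by (metis cvs.scale_eq_0_iff of_int_eq_0_iff)
  then have "m = int k"
    by simp
  then show ?thesis
    using that k unfolding m_def by blast
qed

text \<open>The bracket of an odd root vector with itself is twice its square, and it vanishes
  because twice the root is not a root.\<close>

lemma odd_root_square:
  assumes rs: "r \<in> idx n" "s \<in> idx n" "par r + par s = 1" and x: "x \<in> carr M"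
  shows "act M (rootm r s) (act M (rootm r s) x) = 0"
proof -
  have rs': "r \<noteq> s"
    using rs(3) by auto
  have "(\<Sum>k\<in>idx n. rootm r s k r *\<^sub>C act M (rootm k s) x) = 0"
    using rs' by (intro sum.neutral ballI) (auto simp: rootm_def)
  moreover have "(\<Sum>k\<in>idx n. rootm r s s k *\<^sub>C act M (rootm r k) x) = 0"
    using rs' by (intro sum.neutral ballI) (auto simp: rootm_def)
  ultimately have "act M (rootm r s) (act M (rootm r s) x) = - act M (rootm r s) (act M (rootm r s) x)"
    using act_rootm[OF rootm_pe_homog[OF rs(1,2)] rs(1,2) x] rs(3) by simp
  then have "2 *\<^sub>C act M (rootm r s) (act M (rootm r s) x) = 0"
    using cscale_add_left[of 1 1 "act M (rootm r s) (act M (rootm r s) x)"] by (simp add: cscale_one eq_neg_iff_add_eq_0)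
  then show ?thesis
    by simp
qed

text \<open>A vector killed by both opposite root vectors is killed by their bracket
  \<open>rootm s s + rootm r r\<close>.\<close>

lemma odd_root_weight:
  assumes rs: "r \<in> idx n" "s \<in> idx n" "par r + par s = 1" "s \<noteq> dix r"
    and v: "wvec n M wt v" "v \<noteq> 0" "act M (rootm s r) v = 0" "act M (rootm r s) v = 0"
  shows "wtx wt s + wtx wt r = 0"
proof -
  have vc: "v \<in> carr M" and rs': "r \<noteq> s"
    using v(1) rs(3) by (auto simp: wvec_def)
  have "act M (rootm s s) v + act M (rootm r r) v = 0"
    using rootm_rootm[OF rs(1,2) rs' rs(4) vc] v(3,4) rs(1-3) by (simp add: rootm_pe)
  then have "of_int (wtx wt s + wtx wt r) *\<^sub>C v = 0"
    using v(1) rs(1,2) by (simp add: wvec_def cvs.scale_left_distrib)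
  then show ?thesis
    using v(2) by (metis cvs.scale_eq_0_iff of_int_eq_0_iff)
qed

end


section \<open>Singular vectors and reflections\<close>

text \<open>A function \<open>w\<close> with \<open>w (dix p) = - w p\<close> that is injective on the index set orders the basis
  of \<open>V\<^sub>n\<close>; the root vectors \<open>rootm p q\<close> with \<open>w p > w q\<close> are the positive ones of a Borel subalgebra.\<close>

definition polar :: "nat \<Rightarrow> (ix \<Rightarrow> int) \<Rightarrow> bool"
  where "polar n w \<longleftrightarrow> (\<forall>p. w (dix p) = - w p) \<and> inj_on w (idx n)"

definition singular :: "nat \<Rightarrow> 'v::complex_space smod \<Rightarrow> (ix \<Rightarrow> int) \<Rightarrow> (nat \<Rightarrow> int) \<Rightarrow> 'v \<Rightarrow> bool" where
  "singular n M w wt v \<longleftrightarrow> wvec n M wt v \<and> v \<noteq> 0 \<and> (\<exists>q. v \<in> homog M q) \<and>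
     (\<forall>p\<in>idx n. \<forall>q\<in>idx n. w q < w p \<longrightarrow> act M (rootm p q) v = 0)"

text \<open>The pairing of the weight with \<open>w\<close>. By \<open>degree_shiftw\<close> a root
  vector \<open>rootm p q\<close> changes it by \<open>w p - w q\<close>, so the negative ones lower
  it strictly.\<close>

definition degree :: "nat \<Rightarrow> (ix \<Rightarrow> int) \<Rightarrow> (nat \<Rightarrow> int) \<Rightarrow> int"
  where "degree n w wt = (\<Sum>i=1..n. wt i * w (Inl i))"

lemma degree_shiftw:
  assumes "polar n w" "r \<in> idx n" "s \<in> idx n"
  shows "degree n w (shiftw wt k r s) = degree n w wt + k * (w r - w s)"
proof -
  have ev: "(\<Sum>i=1..n. ev (Inl i) r * w (Inl i)) = w r" if r: "r \<in> idx n" for r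
  proof (cases r)
    case (Inl a)
    have "(\<Sum>i=1..n. ev (Inl i) r * w (Inl i)) = (\<Sum>i=1..n. if i = a then w (Inl i) else 0)"
      by (intro sum.cong refl) (auto simp: ev_def Inl)
    then show ?thesis
      using r Inl by (simp add: sum.delta)
  next
    case (Inr a)
    have "w (Inr a) = - w (Inl a)"
      using assms(1) dix_simps(1)[of a] unfolding polar_def by metis
    moreover have "(\<Sum>i=1..n. ev (Inl i) r * w (Inl i)) = (\<Sum>i=1..n. if i = a then - w (Inl i) else 0)"
      by (intro sum.cong refl) (auto simp: ev_def Inr)
    ultimately show ?thesis
      using r Inr by (simp add: sum.delta)
  qed
  have "degree n w (shiftw wt k r s) = degree n w wt
      + k * ((\<Sum>i=1..n. ev (Inl i) r * w (Inl i)) - (\<Sum>i=1..n. ev (Inl i) s * w (Inl i)))"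
    by (simp add: degree_def shiftw_def distrib_right sum.distrib sum_subtractf sum_distrib_left algebra_simps)
  then show ?thesis
    by (simp add: ev assms)
qed

text \<open>The element of the Cartan subalgebra whose eigenvalue on a weight vector is the
  degree.\<close>

definition degree_op :: "nat \<Rightarrow> 'v::complex_space smod \<Rightarrow> (ix \<Rightarrow> int) \<Rightarrow> 'v \<Rightarrow> 'v"
  where "degree_op n M w x = (\<Sum>i=1..n. of_int (w (Inl i)) *\<^sub>C act M (rootm (Inl i) (Inl i)) x)"

text \<open>At least one negative root vector has been applied, so that \<open>v\<close> itself is
  not generated: in a simple module the span of this set is a complement of the line through a
  singular \<open>v\<close>.\<close>

inductive_set descend :: "nat \<Rightarrow> 'v::complex_space smod \<Rightarrow> (ix \<Rightarrow> int) \<Rightarrow> 'v \<Rightarrow> 'v set"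
  for n M w v where
  base: "p \<in> idx n \<Longrightarrow> q \<in> idx n \<Longrightarrow> w p < w q \<Longrightarrow> act M (rootm p q) v \<in> descend n M w v"
| step: "y \<in> descend n M w v \<Longrightarrow> p \<in> idx n \<Longrightarrow> q \<in> idx n \<Longrightarrow> w p < w q \<Longrightarrow> act M (rootm p q) y \<in> descend n M w v"

context pmod
begin

lemma degree_op_linear: "linear_between (carr M) (carr M) (degree_op n M w)"
  by (rule linear_betweenI)
    (auto simp: degree_op_def rootm_pe act_add act_scale cscale_add_right sum.distrib cvs.scale_sum_right cscale_cscale mult.commute
      intro!: carr_sum carr_scale)

lemma degree_op_wvec:
  assumes "wvec n M wt x"
  shows "degree_op n M w x = of_int (degree n w wt) *\<^sub>C x"
proof -
  have "degree_op n M w x = (\<Sum>i=1..n. of_int (w (Inl i)) *\<^sub>C of_int (wt i) *\<^sub>C x)"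
    unfolding degree_op_def using assms by (intro sum.cong refl) (simp add: wvec_def)
  then show ?thesis
    by (simp add: degree_def cscale_cscale mult.commute cvs.scale_sum_left)
qed

lemma descend_weight:
  assumes w: "polar n w" and v: "wvec n M wt v" "v \<in> homog M q0"
  shows "y \<in> descend n M w v \<Longrightarrow> \<exists>wt' q. wvec n M wt' y \<and> y \<in> homog M q \<and> degree n w wt' < degree n w wt"
proof (induction rule: descend.induct)
  case (base p q)
  then show ?case
    using wvec_rootm[OF v(1) base(1,2)] act_homog[OF rootm_pe_homog[OF base(1,2)] v(2)]
      degree_shiftw[OF w base(1,2), of wt 1] base(3)
    by (intro exI[of _ "shiftw wt 1 p q"] exI[of _ "par p + par q + q0"]) simp
next
  case (step y p q)
  then obtain wt' q' where y: "wvec n M wt' y" "y \<in> homog M q'" "degree n w wt' < degree n w wt"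
    by blast
  show ?case
    using wvec_rootm[OF y(1) step(2,3)] act_homog[OF rootm_pe_homog[OF step(2,3)] y(2)] y(3) step(4)
      degree_shiftw[OF w step(2,3), of wt' 1]
    by (intro exI[of _ "shiftw wt' 1 p q"] exI[of _ "par p + par q + q'"]) simp
qed

text \<open>The lowering part of a triangular decomposition. The span of \<open>v\<close> and of
  what negative root vectors make of it is stable under all root vectors, hence is everything by
  simplicity; degrees separate \<open>v\<close> from the rest.\<close>

lemma generated_by_singular:
  assumes w: "polar n w" and v: "singular n M w wt v" and simple: "simple_mod n M"
  shows "carr M = cvs.span (insert v (descend n M w v))" "v \<notin> cvs.span (descend n M w v)"
    and "\<And>p q x. p \<in> idx n \<Longrightarrow> q \<in> idx n \<Longrightarrow> w p < w q \<Longrightarrow> x \<in> carr M \<Longrightarrow> act M (rootm p q) x \<in> cvs.span (descend n M w v)"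
    and "\<And>p x. p \<in> idx n \<Longrightarrow> x \<in> cvs.span (descend n M w v) \<Longrightarrow> act M (rootm p p) x \<in> cvs.span (descend n M w v)"
    and "\<And>q x. x \<in> cvs.span (descend n M w v) \<Longrightarrow> hpart M q x \<in> cvs.span (descend n M w v)"
proof -
  let ?G = "descend n M w v"
  obtain q0 where v': "wvec n M wt v" "v \<in> homog M q0" "v \<noteq> 0"
    "\<And>p q. p \<in> idx n \<Longrightarrow> q \<in> idx n \<Longrightarrow> w q < w p \<Longrightarrow> act M (rootm p q) v = 0"
    using v unfolding singular_def by blast
  have G: "\<exists>wt' q. wvec n M wt' y \<and> y \<in> homog M q \<and> degree n w wt' < degree n w wt" if "y \<in> ?G" for y
    by (rule descend_weight[OF w v'(1,2) that])
  have vc: "v \<in> carr M"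
    by (rule homog_carr[OF v'(2)])
  have Gc: "y \<in> carr M" if "y \<in> ?G" for y
    using G[OF that] homog_carr by blast
  have span_c: "cvs.span ?G \<subseteq> carr M" "cvs.span (insert v ?G) \<subseteq> carr M"
    using Gc vc by (intro cvs.span_minimal carr_subspace, blast)+
  have span_le: "cvs.span ?G \<subseteq> cvs.span (insert v ?G)"
    by (rule cvs.span_mono) blast
  have lin_span: "f y \<in> cvs.span C" if f: "linear_between (carr M) (carr M) f" and B: "B \<subseteq> carr M" "\<And>b. b \<in> B \<Longrightarrow> f b \<in> cvs.span C"
    and y: "y \<in> cvs.span B" for f B C y
  proof -
    have "y \<in> carr M \<and> f y \<in> cvs.span C"
      using y
    proof (induction rule: cvs.span_induct_alt)
      case base
      then show ?case
        using linear_between_0[OF f carr_subspace] by (simp add: cvs.span_zero)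
    next
      case (step a x y)
      then have "x \<in> carr M" "a *\<^sub>C x \<in> carr M"
        using B(1) carr_scale by blast+
      then show ?case
        using step B(2)[of x] linear_betweenD(2)[OF f, of "a *\<^sub>C x" y] linear_betweenD(3)[OF f, of x a]
        by (simp add: carr_add cvs.span_add cvs.span_scale)
    qed
    then show ?thesis ..
  qed
  note [simp] = rootm_pe
  have lower: "act M (rootm p q) x \<in> cvs.span ?G" if pq: "p \<in> idx n" "q \<in> idx n" "w p < w q" and x: "x \<in> cvs.span (insert v ?G)" for p q x
  proof (rule lin_span[OF act_linear _ _ x])
    show "insert v ?G \<subseteq> carr M"
      using vc Gc by blast
    show "act M (rootm p q) b \<in> cvs.span ?G" if "b \<in> insert v ?G" for b
      using that descend.base[OF pq, of M v] descend.step[OF _ pq, of b M v] cvs.span_base[of _ ?G] by blast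
  qed (use pq in simp)
  \<comment> \<open>By induction on the number of negative root vectors applied: moving a root
    vector past the outermost one leaves brackets, which are combinations of root vectors applied to
    a shorter product.\<close>
  have gen: "\<forall>p\<in>idx n. \<forall>q\<in>idx n. act M (rootm p q) y \<in> cvs.span (insert v ?G)" if "y \<in> insert v ?G" for y
  proof -
    have base: "act M (rootm p q) v \<in> cvs.span (insert v ?G)" if pq: "p \<in> idx n" "q \<in> idx n" for p q
    proof -
      consider "p = q" | "w q < w p" | "w p < w q"
        using w pq unfolding polar_def inj_on_def by (metis linorder_neqE_linordered_idom)
      then show ?thesis
      proof cases
        case 1
        then show ?thesis
          using v'(1) pq by (simp add: wvec_def cvs.span_scale cvs.span_base)
      next
        case 2
        then show ?thesis
          using v'(4) pq by (simp add: cvs.span_zero)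
      next
        case 3
        then show ?thesis
          using lower[OF pq 3] cvs.span_base[of v "insert v ?G"] span_le by blast
      qed
    qed
    have step: "act M (rootm p q) (act M (rootm r s) z) \<in> cvs.span (insert v ?G)"
      if rs: "r \<in> idx n" "s \<in> idx n" "w r < w s" and z: "z \<in> carr M"
        "\<forall>p\<in>idx n. \<forall>q\<in>idx n. act M (rootm p q) z \<in> cvs.span (insert v ?G)" and pq: "p \<in> idx n" "q \<in> idx n" for p q r s z
    proof -
      have "act M (rootm r s) (act M (rootm p q) z) \<in> cvs.span (insert v ?G)"
        using lower[OF rs] z(2) pq span_le by blast
      then show ?thesis
        unfolding act_rootm[OF rootm_pe_homog[OF pq] rs(1,2) z(1)]
        using z(2) rs(1,2) by (intro cvs.span_add cvs.span_diff cvs.span_scale cvs.span_sum) auto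
    qed
    have "\<forall>p\<in>idx n. \<forall>q\<in>idx n. act M (rootm p q) y \<in> cvs.span (insert v ?G)" if "y \<in> ?G" for y
      using that
    proof (induction rule: descend.induct)
      case (base r s)
      then show ?case
        using step[OF base vc] \<open>\<And>q p. \<lbrakk>p \<in> idx n; q \<in> idx n\<rbrakk> \<Longrightarrow> act M (rootm p q) v \<in> cvs.span (insert v ?G)\<close> by blast
    next
      case (step y r s)
      then show ?case
        using \<open>\<And>r s z p q. \<lbrakk>r \<in> idx n; s \<in> idx n; w r < w s; z \<in> carr M;
          \<forall>p\<in>idx n. \<forall>q\<in>idx n. act M (rootm p q) z \<in> cvs.span (insert v ?G); p \<in> idx n; q \<in> idx n\<rbrakk>
          \<Longrightarrow> act M (rootm p q) (act M (rootm r s) z) \<in> cvs.span (insert v ?G)\<close>[OF step(2-4) Gc[OF step(1)]] by blast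
    qed
    then show ?thesis
      using that base by blast
  qed
  have stable: "act M X x \<in> cvs.span (insert v ?G)" if X: "X \<in> pe n" and x: "x \<in> cvs.span (insert v ?G)" for X x
  proof -
    have "act M (rootm p q) x \<in> cvs.span (insert v ?G)" if pq: "p \<in> idx n" "q \<in> idx n" for p q
      by (rule lin_span[OF act_linear _ _ x]) (use vc Gc gen pq in auto)
    note E = this
    have "x \<in> carr M"
      using x span_c(2) by blast
    then show ?thesis
      unfolding act_expand[OF X \<open>x \<in> carr M\<close>] by (intro cvs.span_sum cvs.span_scale E)
  qed
  have hlin: "linear_between (carr M) (carr M) (hpart M q)" for q
    using hpart_linear[of q] homog_carr by (auto simp: linear_between_def)
  have graded: "hpart M q x \<in> cvs.span C" if x: "x \<in> cvs.span C" and C: "C \<subseteq> insert v ?G" for q x C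
  proof (rule lin_span[OF hlin _ _ x])
    show "C \<subseteq> carr M"
      using C vc Gc by blast
    fix b assume b: "b \<in> C"
    then obtain r where "b \<in> homog M r"
      using C v'(2) G by blast
    then show "hpart M q b \<in> cvs.span C"
      using b hpart_homog[of b r q] by (simp add: cvs.span_base cvs.span_zero)
  qed
  show "hpart M q x \<in> cvs.span ?G" if "x \<in> cvs.span ?G" for q x
    using graded[OF that] by blast
  have "graded_stable n M (\<lambda>p. cvs.span (insert v ?G) \<inter> homog M p)"
    unfolding graded_stable_def
    using cvs.subspace_inter[OF cvs.subspace_span homog_subspace] stable[OF pe_homog_pe] act_homog by auto
  then have "(\<forall>p. cvs.span (insert v ?G) \<inter> homog M p = {0}) \<or> (\<forall>p. cvs.span (insert v ?G) \<inter> homog M p = homog M p)"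
    using simple unfolding simple_mod_iff by blast
  moreover have "v \<in> cvs.span (insert v ?G) \<inter> homog M q0"
    using v'(2) by (simp add: cvs.span_base)
  ultimately have "homog M p \<subseteq> cvs.span (insert v ?G)" for p
    using v'(3) by blast
  note homog_span = this
  have "x \<in> cvs.span (insert v ?G)" if "x \<in> carr M" for x
    using that
  proof (induction rule: carr_induct)
    case (homog q y)
    then show ?case
      using homog_span by blast
  qed (rule cvs.span_add)
  then show carr: "carr M = cvs.span (insert v ?G)"
    using span_c(2) by blast
  show "v \<notin> cvs.span ?G"
  \<comment> \<open>On \<open>descend\<close> the operator \<open>degree_op\<close> has eigenvalues
    strictly below the one at \<open>v\<close>.\<close>
  proof (rule eigenvector_not_in_span[OF carr_subspace degree_op_linear[of w]])
    show "?G \<subseteq> carr M"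
      using Gc by blast
    show "\<exists>c. c \<noteq> of_int (degree n w wt) \<and> degree_op n M w g = c *\<^sub>C g" if g: "g \<in> ?G" for g
    proof -
      obtain wt' where "wvec n M wt' g" "degree n w wt' < degree n w wt"
        using G[OF g] by blast
      then show ?thesis
        using degree_op_wvec by (intro exI[of _ "of_int (degree n w wt')"]) auto
    qed
  qed (use vc v'(3) degree_op_wvec[OF v'(1)] in auto)
  show "act M (rootm p q) x \<in> cvs.span ?G" if "p \<in> idx n" "q \<in> idx n" "w p < w q" "x \<in> carr M" for p q x
    using lower[OF that(1-3)] that(4) carr by simp
  show "act M (rootm p p) x \<in> cvs.span ?G" if p: "p \<in> idx n" and x: "x \<in> cvs.span ?G" for p x
  proof (rule lin_span[OF act_linear _ _ x])
    fix b assume b: "b \<in> ?G"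
    then obtain wt' where "wvec n M wt' b"
      using G by blast
    then show "act M (rootm p p) b \<in> cvs.span ?G"
      using b p by (simp add: wvec_def cvs.span_scale cvs.span_base)
  qed (use p Gc in auto)
qed

text \<open>The module is spanned by \<open>u\<close> and by weight vectors of smaller degree, so it
  cannot contain a nonzero weight vector of degree above that of \<open>u\<close>. With the roles
  exchanged, the two degrees are equal.\<close>

lemma singular_degree_unique:
  assumes w: "polar n w" and simple: "simple_mod n M" and v: "singular n M w wt v" and u: "singular n M w wt' u"
  shows "degree n w wt \<le> degree n w wt'"
proof (rule ccontr)
  assume less: "\<not> degree n w wt \<le> degree n w wt'"
  have uD: "wvec n M wt' u" "\<exists>q. u \<in> homog M q" and vD: "wvec n M wt v" "v \<noteq> 0"
    using u v by (auto simp: singular_def)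
  have "v \<notin> cvs.span (insert u (descend n M w u))"
  proof (rule eigenvector_not_in_span[OF carr_subspace degree_op_linear[of w]])
    show "insert u (descend n M w u) \<subseteq> carr M"
      using generated_by_singular(1)[OF w u simple] cvs.span_superset by blast
    show "\<exists>c. c \<noteq> of_int (degree n w wt) \<and> degree_op n M w g = c *\<^sub>C g" if g: "g \<in> insert u (descend n M w u)" for g
    proof -
      have "\<exists>wt''. wvec n M wt'' g \<and> degree n w wt'' \<le> degree n w wt'"
        using g uD descend_weight[OF w uD(1)] by (metis insert_iff less_imp_le order_refl)
      then obtain wt'' where "wvec n M wt'' g" "degree n w wt'' < degree n w wt"
        using less by force
      then show ?thesis
        using degree_op_wvec by (intro exI[of _ "of_int (degree n w wt'')"]) auto
    qed
  qed (use vD degree_op_wvec[OF vD(1)] in \<open>auto simp: wvec_def\<close>)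
  then show False
    using generated_by_singular(1)[OF w u simple] vD(1) by (simp add: wvec_def)
qed

text \<open>The functional is 1 at \<open>v\<close> and 0 on the span of \<open>descend\<close>.
  Root vectors negative for \<open>w\<close> map the module into this span, so they kill the
  functional: it is singular for the opposite order.\<close>

lemma dual_singular:
  assumes w: "polar n w" and v: "singular n M w wt v" and simple: "simple_mod n M"
  shows "\<exists>\<phi>. singular n (dual_mod M) (\<lambda>p. - w p) (\<lambda>i. - wt i) \<phi>"
proof -
  interpret d: pmod "dual_mod M" n by (rule pmod_dual)
  note gen = generated_by_singular[OF w v simple]
  let ?R = "cvs.span (descend n M w v)"
  obtain q0 where v': "wvec n M wt v" "v \<in> homog M q0"
    using v unfolding singular_def by blast
  have vc: "v \<in> carr M"
    by (rule homog_carr[OF v'(2)])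
  obtain \<phi> where \<phi>: "\<phi> \<in> functionals (carr M)" "\<And>y. y \<in> ?R \<Longrightarrow> \<phi> y = 0" "\<phi> v = 1"
    using functionals_separate[OF carr_subspace cvs.subspace_span vc gen(2)] by blast
  have Rc: "?R \<subseteq> carr M"
    unfolding gen(1) by (rule cvs.span_mono) blast
  have decomp: "\<exists>k. x - k *\<^sub>C v \<in> ?R" if "x \<in> carr M" for x
    using that unfolding gen(1) cvs.span_insert by blast
  \<comment> \<open>The span of \<open>descend\<close> is graded, so \<open>\<phi>\<close> has the
    parity of \<open>v\<close>.\<close>
  have "\<phi> y = 0" if y: "y \<in> homog M (q0 + 1)" for y
  proof -
    obtain k where k: "y - k *\<^sub>C v \<in> ?R"
      using decomp[OF homog_carr[OF y]] by blast
    have "hpart M (q0 + 1) (y - k *\<^sub>C v) = y"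
      using hpart_homog[OF y, of "q0 + 1"] hpart_homog[OF homog_scale[OF v'(2)], of "q0 + 1" k] homog_carr[OF y] carr_scale[OF vc]
      by (simp add: linear_between_diff[OF hpart_linear carr_subspace])
    then show ?thesis
      using \<phi>(2)[OF gen(5)[OF k, of "q0 + 1"]] by simp
  qed
  then have hom: "\<phi> \<in> homog (dual_mod M) q0"
    using \<phi>(1) by (simp add: dual_homog)
  have "act (dual_mod M) (rootm p p) \<phi> = of_int (wtx (\<lambda>i. - wt i) p) *\<^sub>C \<phi>" if p: "p \<in> idx n" for p
  proof
    fix x
    have 0: "rootm p p \<in> pe_homog n 0"
      using rootm_pe_homog[OF p p] by simp
    have neg: "wtx (\<lambda>i. - wt i) p = - wtx wt p"
      by (cases p) simp_all
    show "act (dual_mod M) (rootm p p) \<phi> x = (of_int (wtx (\<lambda>i. - wt i) p) *\<^sub>C \<phi>) x"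
    proof (cases "x \<in> carr M")
      case True
      obtain k where k: "x - k *\<^sub>C v \<in> ?R"
        using decomp[OF True] by blast
      define r where "r = x - k *\<^sub>C v"
      have r: "r \<in> ?R" "r \<in> carr M" "x = k *\<^sub>C v + r"
        using k Rc by (auto simp: r_def)
      have "\<phi> (act M (rootm p p) x) = of_int (wtx wt p) * \<phi> x"
        using v'(1) p r(2) \<phi>(2)[OF gen(4)[OF p r(1)]] \<phi>(2)[OF r(1)]
        by (simp add: r(3) act_add act_scale rootm_pe wvec_def carr_scale functionalsD(1,2)[OF \<phi>(1)] mult.left_commute)
      then show ?thesis
        using True p by (simp add: dual_act_homog[OF 0 \<phi>(1)] rootm_pe neg)
    qed (use functionalsD(3)[OF \<phi>(1)] in \<open>simp add: dual_act_homog[OF 0 \<phi>(1)]\<close>)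
  qed
  then have "wvec n (dual_mod M) (\<lambda>i. - wt i) \<phi>"
    using \<phi>(1) by (simp add: wvec_def dual_carr)
  moreover have "act (dual_mod M) (rootm p q) \<phi> = 0" if pq: "p \<in> idx n" "q \<in> idx n" "w p < w q" for p q
  proof
    fix x
    show "act (dual_mod M) (rootm p q) \<phi> x = 0 x"
    proof (cases "x \<in> carr M")
      case True
      have y: "act M (rootm p q) x \<in> ?R"
        by (rule gen(3)[OF pq True])
      have "parop M (par p + par q) (act M (rootm p q) x) \<in> ?R"
        unfolding parop_eq by (intro cvs.span_add cvs.span_scale gen(5) y)
      then show ?thesis
        using True \<phi>(2) by (simp add: dual_act_homog[OF rootm_pe_homog[OF pq(1,2)] \<phi>(1)])
    qed (simp add: dual_act_homog[OF rootm_pe_homog[OF pq(1,2)] \<phi>(1)])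
  qed
  moreover have "\<phi> \<noteq> 0"
    using \<phi>(3) by auto
  ultimately have "singular n (dual_mod M) (\<lambda>p. - w p) (\<lambda>i. - wt i) \<phi>"
    using hom unfolding singular_def by auto
  then show ?thesis
    by blast
qed

text \<open>Crossing a wall: the orders \<open>w\<close> and \<open>w'\<close> differ only in the positions of \<open>r\<close> and \<open>s\<close>
  (and of their duals), so that \<open>rootm r s\<close> becomes positive.\<close>

lemma crossing:
  assumes w: "polar n w" and w': "polar n w'" and rs: "r \<in> idx n" "s \<in> idx n" "r \<noteq> s" "w r < w s" "w' s < w' r"
    and same: "\<And>p q. p \<in> idx n \<Longrightarrow> q \<in> idx n \<Longrightarrow> (p, q) \<notin> {(r, s), (s, r), (dix s, dix r), (dix r, dix s)} \<Longrightarrow>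
      w q < w p \<longleftrightarrow> w' q < w' p"
    and v: "singular n M w wt v" and fin: "fin_dim (carr M)"
  shows "\<exists>k. singular n M w' (shiftw wt (int k) r s) ((act M (rootm r s) ^^ k) v)
    \<and> (par r = par s \<longrightarrow> wtx wt s - wtx wt r = int k)
    \<and> (par r \<noteq> par s \<longrightarrow> k \<le> 1)
    \<and> (par r \<noteq> par s \<longrightarrow> s \<noteq> dix r \<longrightarrow> k = 0 \<longrightarrow> wtx wt s + wtx wt r = 0)
    \<and> (\<forall>p\<in>idx n. \<forall>q\<in>idx n. (p, q) \<noteq> (s, r) \<longrightarrow> (p, q) \<noteq> (dix r, dix s) \<longrightarrow> w q < w p \<longrightarrow>
      act M (rootm p q) ((act M (rootm r s) ^^ k) v) = 0)"
proof -
  let ?u = "\<lambda>j. (act M (rootm r s) ^^ j) v"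
  obtain q0 where v': "wvec n M wt v" "v \<in> homog M q0" "v \<noteq> 0"
    "\<And>p q. p \<in> idx n \<Longrightarrow> q \<in> idx n \<Longrightarrow> w q < w p \<Longrightarrow> act M (rootm p q) v = 0"
    using v unfolding singular_def by blast
  note [simp] = rootm_pe rs(1,2)
  have odd: "w (dix p) = - w p" "w' (dix p) = - w' p" for p
    using w w' by (auto simp: polar_def)
  \<comment> \<open>The pairs that are positive for both orders. Their root vectors kill every
    member of the string, so at its end only the crossed root remains to be examined.\<close>
  define N where "N = {(p, q). p \<in> idx n \<and> q \<in> idx n \<and> w q < w p \<and> w' q < w' p}"
  have NI: "(p, q) \<in> N" if "p \<in> idx n" "q \<in> idx n" "w' q < w' p" "(p, q) \<noteq> (r, s)" "(p, q) \<noteq> (dix s, dix r)" for p q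
  proof -
    have "(p, q) \<noteq> (s, r)" "(p, q) \<noteq> (dix r, dix s)"
      using that(3) rs(5) odd by auto
    then show ?thesis
      using that same[OF that(1,2)] by (simp add: N_def)
  qed
  have uw: "wvec n M (shiftw wt (int j) r s) (?u j)" for j
    by (rule wvec_rootm_funpow[OF v'(1) rs(1,2)])
  then have uc: "?u j \<in> carr M" for j
    unfolding wvec_def by blast
  have uh: "\<exists>q. ?u j \<in> homog M q" for j
  proof (induction j)
    case (Suc j)
    then show ?case
      using act_homog[OF rootm_pe_homog[OF rs(1,2)]] by (metis comp_apply funpow.simps(2))
  qed (use v'(2) in auto)
  \<comment> \<open>The bracket of a root in \<open>N\<close> with the crossed root stays in
    \<open>N\<close>: the resulting pairs are positive for \<open>w'\<close> and differ from the
    crossed ones, and by \<open>same\<close> no other pair has changed its order.\<close>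
  have N_step: "act M (rootm p q) (act M (rootm r s) x) = 0"
    if x: "x \<in> carr M" "\<And>p q. (p, q) \<in> N \<Longrightarrow> act M (rootm p q) x = 0" and pq: "(p, q) \<in> N" for x p q
  proof -
    have pq': "p \<in> idx n" "q \<in> idx n" "w q < w p" "w' q < w' p"
      using pq by (auto simp: N_def)
    have a: "rootm p q k r *\<^sub>C act M (rootm k s) x = 0" if k: "k \<in> idx n" for k
    proof (cases "rootm p q k r = 0")
      case False
      then have "w' r < w' k" "k \<noteq> r"
        using rootm_nonzero[OF False] pq' odd by auto
      moreover have "(k, s) \<noteq> (dix s, dix r)"
        using \<open>k \<noteq> r\<close> by auto
      ultimately have "(k, s) \<in> N"
        using rs k by (intro NI) auto
      then show ?thesis
        using x(2) by simp
    qed simp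
    have b: "rootm p q s k *\<^sub>C act M (rootm r k) x = 0" if k: "k \<in> idx n" for k
    proof (cases "rootm p q s k = 0")
      case False
      then have "w' k < w' s" "k \<noteq> s"
        using rootm_nonzero[OF False] pq' odd by auto
      moreover have "(r, k) \<noteq> (dix s, dix r)"
        using \<open>k \<noteq> s\<close> by auto
      ultimately have "(r, k) \<in> N"
        using rs k by (intro NI) auto
      then show ?thesis
        using x(2) by simp
    qed simp
    have "(\<Sum>k\<in>idx n. rootm p q k r *\<^sub>C act M (rootm k s) x) = 0" "(\<Sum>k\<in>idx n. rootm p q s k *\<^sub>C act M (rootm r k) x) = 0"
      by (intro sum.neutral ballI a, assumption) (intro sum.neutral ballI b, assumption)
    then show ?thesis
      unfolding act_rootm[OF rootm_pe_homog[OF pq'(1,2)] rs(1,2) x(1)] x(2)[OF pq] by simp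
  qed
  have uN: "act M (rootm p q) (?u j) = 0" if "(p, q) \<in> N" for p q j
    using that
  proof (induction j arbitrary: p q)
    case 0
    then show ?case
      using v'(4) by (simp add: N_def)
  next
    case (Suc j)
    then show ?case
      using N_step[OF uc[of j]] by simp
  qed
  have up: "act M (rootm s r) v = 0"
    using v'(4)[OF rs(2,1,4)] .
  \<comment> \<open>For an even root, \<open>k\<close> is the length of the \<open>sl(2)\<close>
    string. For an odd one the root vector squares to zero, which leaves 0 and 1.\<close>
  have "\<exists>k. ?u k \<noteq> 0 \<and> ?u (Suc k) = 0 \<and> (par r = par s \<longrightarrow> wtx wt s - wtx wt r = int k) \<and> (par r \<noteq> par s \<longrightarrow> k \<le> 1)"
  proof (cases "par r = par s")
    case True
    then show ?thesis
      using even_root_string[OF rs(1-3) True v'(1,3) up fin] by metis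
  next
    case False
    then have par: "par r + par s = 1"
      by (cases "par r"; cases "par s"; simp)
    have sq: "act M (rootm r s) (act M (rootm r s) v) = 0"
      using odd_root_square[OF rs(1,2) par uc[of 0]] by simp
    show ?thesis
    proof (cases "act M (rootm r s) v = 0")
      case True
      then show ?thesis
        using False v'(3) by (intro exI[of _ 0]) simp
    next
      case nz: False
      then show ?thesis
        using False sq by (intro exI[of _ "Suc 0"]) (simp add: One_nat_def)
    qed
  qed
  then obtain k where k: "?u k \<noteq> 0" "?u (Suc k) = 0" "par r = par s \<Longrightarrow> wtx wt s - wtx wt r = int k" "par r \<noteq> par s \<Longrightarrow> k \<le> 1"
    by blast
  have last: "act M (rootm r s) (?u k) = 0"
    using k(2) by simp
  \<comment> \<open>The dual pair carries the same root vector up to a scalar.\<close>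
  then have last': "act M (rootm (dix s) (dix r)) (?u k) = 0"
    unfolding rootm_dix by (simp add: act_scale_left uc del: cvs.scale_minus_left)
  have "act M (rootm p q) (?u k) = 0" if "p \<in> idx n" "q \<in> idx n" "w' q < w' p" for p q
    using NI[OF that] uN last last' by blast
  then have sing: "singular n M w' (shiftw wt (int k) r s) (?u k)"
    using uw uh k(1) unfolding singular_def by blast
  show ?thesis
  proof (intro exI[of _ k] conjI impI ballI)
    show "singular n M w' (shiftw wt (int k) r s) (?u k)"
      by (rule sing)
    show "par r = par s \<Longrightarrow> wtx wt s - wtx wt r = int k" "par r \<noteq> par s \<Longrightarrow> k \<le> 1"
      by (fact k(3), fact k(4))
    assume "par r \<noteq> par s" "s \<noteq> dix r" "k = 0"
    moreover from this have "par r + par s = 1"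
      by (cases "par r"; cases "par s"; simp)
    ultimately show "wtx wt s + wtx wt r = 0"
      using odd_root_weight[OF rs(1,2) _ _ v'(1,3) up] last by simp
  next
    fix p q assume "p \<in> idx n" "q \<in> idx n" "(p, q) \<noteq> (s, r)" "(p, q) \<noteq> (dix r, dix s)" "w q < w p"
    moreover from this have "(p, q) \<noteq> (r, s)" "(p, q) \<noteq> (dix s, dix r)"
      using rs(4) odd by auto
    ultimately have "(p, q) \<in> N"
      using same[of p q] by (auto simp: N_def)
    then show "act M (rootm p q) (?u k) = 0"
      by (rule uN)
  qed
qed

text \<open>A reflection in \<open>2\<epsilon>\<^sub>i\<close>, whose negative is not a root, does not change the singular vector.\<close>

lemma crossing_self_dual:
  assumes w: "polar n w" and w': "polar n w'" and i: "Inl i \<in> idx n" "w (Inl i) < w (Inr i)" "w' (Inr i) < w' (Inl i)"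
    and same: "\<And>p q. p \<in> idx n \<Longrightarrow> q \<in> idx n \<Longrightarrow> (p, q) \<notin> {(Inl i, Inr i), (Inr i, Inl i)} \<Longrightarrow>
      w q < w p \<longleftrightarrow> w' q < w' p"
    and v: "singular n M w wt v" and fin: "fin_dim (carr M)" and simple: "simple_mod n M"
  shows "singular n M w' wt v"
proof -
  have ri: "Inr i \<in> idx n" "Inl i \<noteq> Inr i"
    using i(1) by auto
  have same': "w q < w p \<longleftrightarrow> w' q < w' p" if "p \<in> idx n" "q \<in> idx n"
    "(p, q) \<notin> {(Inl i, Inr i), (Inr i, Inl i), (dix (Inr i), dix (Inl i)), (dix (Inl i), dix (Inr i))}" for p q
    by (rule same) (use that in auto)
  obtain k where k: "singular n M w' (shiftw wt (int k) (Inl i) (Inr i)) ((act M (rootm (Inl i) (Inr i)) ^^ k) v)"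
    "k \<le> 1"
    "\<And>p q. p \<in> idx n \<Longrightarrow> q \<in> idx n \<Longrightarrow> (p, q) \<noteq> (Inr i, Inl i) \<Longrightarrow> w q < w p \<Longrightarrow>
      act M (rootm p q) ((act M (rootm (Inl i) (Inr i)) ^^ k) v) = 0"
    using crossing[OF w w' i(1) ri i(2,3) same' v fin] by auto
  let ?u = "(act M (rootm (Inl i) (Inr i)) ^^ k) v"
  have "k = 0"
  proof (rule ccontr)
    assume "k \<noteq> 0"
    then have k1: "int k = 1"
      using k(2) by simp
    \<comment> \<open>Since \<open>-2 \<epsilon>_i\<close> is not a root, a nonzero image under the
      crossed root vector is singular for the old order \<open>w\<close> as well.\<close>
    have "rootm (Inr i) (Inl i) = 0"
      by (intro ext) (simp add: rootm_def)
    moreover have "?u \<in> carr M"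
      using k(1) by (simp add: singular_def wvec_def)
    ultimately have "act M (rootm p q) ?u = 0" if "p \<in> idx n" "q \<in> idx n" "w q < w p" for p q
      using k(3)[OF that(1,2) _ that(3)] by (cases "(p, q) = (Inr i, Inl i)") auto
    then have "singular n M w (shiftw wt 1 (Inl i) (Inr i)) ?u"
      using k(1) unfolding singular_def k1 by blast
    \<comment> \<open>Contradiction: the crossed root vector is negative for \<open>w\<close>, so it
      has lowered the degree.\<close>
    then have "degree n w wt \<le> degree n w (shiftw wt 1 (Inl i) (Inr i))"
      by (rule singular_degree_unique[OF w simple v])
    then show False
      using i(2) by (simp add: degree_shiftw[OF w i(1) ri(1)])
  qed
  then show ?thesis
    using k(1) by (simp add: shiftw_def)
qed

end


section \<open>The reflection path\<close>

text \<open>A list containing exactly one of \<open>Inl i\<close>, \<open>Inr i\<close> for each \<open>i\<close> encodes a complete isotropic flag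
  of \<open>V\<^sub>n\<close>, hence a Borel subalgebra.\<close>

definition und :: "ix \<Rightarrow> nat"
  where "und p = case_sum id id p"

lemma und_simps [simp]: "und (Inl i) = i" "und (Inr i) = i" "und (dix p) = und p"
  by (simp_all add: und_def) (cases p; simp)

lemma und_eq_iff: "und p = und q \<longleftrightarrow> p = q \<or> p = dix q"
  by (cases p; cases q) auto

lemma und_idx: "und p \<in> {1..n} \<longleftrightarrow> p \<in> idx n"
  by (cases p) simp_all

definition flag :: "nat \<Rightarrow> ix list \<Rightarrow> bool"
  where "flag n l \<longleftrightarrow> distinct (map und l) \<and> und ` set l = {1..n}"

lemma flag_idx: "flag n l \<Longrightarrow> und p \<in> und ` set l \<longleftrightarrow> p \<in> idx n"
  unfolding flag_def by (simp only: und_idx)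

text \<open>Ranks are counted from the end of the list and start with 1. With opposite ranks for the
  duals, no index occurring in the list has rank 0, and changing the last entry to its dual crosses
  just the step from -1 to 1.\<close>

fun rk :: "ix list \<Rightarrow> ix \<Rightarrow> int" where
  "rk [] p = 0"
| "rk (x # xs) p = (if p = x then int (length xs) + 1 else if p = dix x then - (int (length xs) + 1) else rk xs p)"

lemma rk_dix: "rk l (dix p) = - rk l p"
  by (induction l) auto

lemma rk_map_dix: "rk (map dix l) p = - rk l p"
  by (induction l) auto

lemma rk_bound: "\<bar>rk l p\<bar> \<le> int (length l)"
  by (induction l) (auto simp: abs_le_iff)

lemma rk_nonzero: "und p \<in> und ` set l \<Longrightarrow> rk l p \<noteq> 0"
  by (induction l) (auto simp: und_eq_iff)

lemma rk_inj: "und p \<in> und ` set l \<Longrightarrow> und q \<in> und ` set l \<Longrightarrow> rk l p = rk l q \<Longrightarrow> p = q"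
proof (induction l)
  case (Cons x l)
  have b: "rk l y \<noteq> int (length l) + 1" "rk l y \<noteq> - (int (length l) + 1)" for y
    using rk_bound[of l y] by linarith+
  have e: "und y \<in> und ` set l" if "und y \<in> und ` set (x # l)" "y \<noteq> x" "y \<noteq> dix x" for y
    using that by (auto simp: und_eq_iff)
  consider "p = x" | "p = dix x" "p \<noteq> x" | "p \<noteq> x" "p \<noteq> dix x" by blast
  then show ?case
  proof cases
    case 1
    then show ?thesis
      using Cons.prems(3) b[of q] by (auto split: if_splits)
  next
    case 2
    then show ?thesis
      using Cons.prems(3) b[of q] by (auto split: if_splits)
  next
    case 3
    then show ?thesis
      using Cons.prems b[of p] e[of p] e[of q] Cons.IH by (cases "q = x"; cases "q = dix x") (auto split: if_splits)
  qed
qed simp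

lemma polar_rk: "flag n l \<Longrightarrow> polar n (rk l)"
  unfolding polar_def inj_on_def flag_def using rk_dix rk_inj und_idx by metis

lemma rk_swap:
  assumes "distinct (map und (xs @ p # q # ys))"
  shows "rk (xs @ q # p # ys) z = (if z = p then int (length ys) + 1 else if z = dix p then - (int (length ys) + 1)
      else if z = q then int (length ys) + 2 else if z = dix q then - (int (length ys) + 2) else rk (xs @ p # q # ys) z)"
    and "rk (xs @ p # q # ys) p = int (length ys) + 2" "rk (xs @ p # q # ys) q = int (length ys) + 1"
  using assms by (induction xs) (auto simp: und_eq_iff)

lemma rk_flip:
  assumes "distinct (map und (xs @ [p]))"
  shows "rk (xs @ [dix p]) z = (if z = p then -1 else if z = dix p then 1 else rk (xs @ [p]) z)"
    and "rk (xs @ [p]) p = 1"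
  using assms by (induction xs) (auto simp: und_eq_iff)

section \<open>The invariant along the path of Borel subalgebras\<close>

fun altsum :: "(nat \<Rightarrow> int) \<Rightarrow> ix list \<Rightarrow> int" where
  "altsum wt [] = 0"
| "altsum wt (p # l) = (if even (wtx wt p) then 1 else -1) - altsum wt l"

lemma altsum_append: "altsum wt (xs @ ys) = altsum wt xs + (-1) ^ length xs * altsum wt ys"
  by (induction xs) (auto simp: algebra_simps)

lemma altsum_cong: "(\<And>p. p \<in> set l \<Longrightarrow> even (wtx wt p) \<longleftrightarrow> even (wtx wt' p)) \<Longrightarrow> altsum wt l = altsum wt' l"
  by (induction l) auto

text \<open>The singular vector and its weight are forgotten on purpose: they change along the path,
  whereas \<open>c\<close> stays.\<close>

definition reachable :: "nat \<Rightarrow> 'v::complex_space smod \<Rightarrow> int \<Rightarrow> ix list \<Rightarrow> bool" where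
  "reachable n M c l \<longleftrightarrow> flag n l \<and> (\<exists>wt v. singular n M (rk l) wt v \<and> altsum wt l = c)"

context pmod
begin

text \<open>Exchanging the neighbours \<open>p\<close> and \<open>q\<close> reverses only this pair
  and its dual pair, so \<open>crossing\<close> applies, with \<open>rootm q p\<close> as the root
  vector that becomes positive.\<close>

lemma reachable_swap:
  assumes l: "reachable n M c (xs @ p # q # ys)" and fin: "fin_dim (carr M)"
  shows "reachable n M c (xs @ q # p # ys)"
proof -
  let ?l = "xs @ p # q # ys" and ?l' = "xs @ q # p # ys"
  have fl: "flag n ?l"
    using l by (simp add: reachable_def)
  then have dist: "distinct (map und ?l)"
    by (simp add: flag_def)
  have fl': "flag n ?l'"
    using fl by (auto simp: flag_def)
  obtain wt v where v: "singular n M (rk ?l) wt v" "altsum wt ?l = c"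
    using l by (auto simp: reachable_def)
  have in_idx: "p \<in> idx n" "q \<in> idx n"
    using flag_idx[OF fl, of p] flag_idx[OF fl, of q] by simp_all
  have pq: "p \<noteq> q" "p \<noteq> dix q" "q \<noteq> dix p"
    using dist by auto
  note rk = rk_swap(2,3)[OF dist] and rk' = rk_swap(1)[OF dist]
  let ?c = "int (length ys)"
  \<comment> \<open>The remaining indices have ranks outside the four values that are exchanged,
    hence compare with them as before.\<close>
  have other: "rk ?l z \<noteq> ?c + 1" "rk ?l z \<noteq> ?c + 2" "rk ?l z \<noteq> - (?c + 1)" "rk ?l z \<noteq> - (?c + 2)"
    if "z \<in> idx n" "z \<notin> {p, q, dix p, dix q}" for z
  proof -
    have inj: "rk ?l z = rk ?l y \<Longrightarrow> z = y" if "y \<in> idx n" for y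
      using rk_inj[of z ?l y] \<open>z \<in> idx n\<close> that flag_idx[OF fl] by blast
    have "rk ?l z \<noteq> rk ?l p" "rk ?l z \<noteq> rk ?l q" "rk ?l z \<noteq> rk ?l (dix p)" "rk ?l z \<noteq> rk ?l (dix q)"
      using inj in_idx that(2) dix_in_idx by blast+
    then show "rk ?l z \<noteq> ?c + 1" "rk ?l z \<noteq> ?c + 2" "rk ?l z \<noteq> - (?c + 1)" "rk ?l z \<noteq> - (?c + 2)"
      by (simp_all only: rk_dix rk) auto
  qed
  have val: "rk ?l (dix p) = - (?c + 2)" "rk ?l (dix q) = - (?c + 1)"
    "rk ?l' p = ?c + 1" "rk ?l' q = ?c + 2" "rk ?l' (dix p) = - (?c + 1)" "rk ?l' (dix q) = - (?c + 2)"
    using pq rk by (auto simp: rk_dix rk' simp del: rk.simps)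
  have same: "rk ?l b < rk ?l a \<longleftrightarrow> rk ?l' b < rk ?l' a"
    if ab: "a \<in> idx n" "b \<in> idx n" "(a, b) \<notin> {(q, p), (p, q), (dix p, dix q), (dix q, dix p)}" for a b
  proof -
    have out: "rk ?l' z = rk ?l z" if "z \<notin> {p, q, dix p, dix q}" for z
      using that rk'[of z] by auto
    have a: "a \<in> {p, q, dix p, dix q} \<or> a \<notin> {p, q, dix p, dix q}" and b: "b \<in> {p, q, dix p, dix q} \<or> b \<notin> {p, q, dix p, dix q}"
      by blast+
    show ?thesis
    proof (cases "a \<in> {p, q, dix p, dix q}")
      case True
      show ?thesis
      proof (cases "b \<in> {p, q, dix p, dix q}")
        case b: True
        then show ?thesis
          using True ab(3) by (elim insertE emptyE; simp only: val rk; simp)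
      next
        case False
        then show ?thesis
          using True other[OF ab(2) False] unfolding out[OF False] by (elim insertE emptyE; simp only: val rk; linarith)
      qed
    next
      case a: False
      show ?thesis
      proof (cases "b \<in> {p, q, dix p, dix q}")
        case True
        then show ?thesis
          using other[OF ab(1) a] unfolding out[OF a] by (elim insertE emptyE; simp only: val rk; linarith)
      next
        case False
        then show ?thesis
          by (simp only: out[OF a] out[OF False])
      qed
    qed
  qed
  have less: "rk ?l q < rk ?l p" "rk ?l' p < rk ?l' q"
    unfolding val rk by simp_all
  have neq: "q \<noteq> p" using pq by blast
  obtain k where k: "singular n M (rk ?l') (shiftw wt (int k) q p) ((act M (rootm q p) ^^ k) v)"
    "par q = par p \<Longrightarrow> wtx wt p - wtx wt q = int k"
    "par q \<noteq> par p \<Longrightarrow> k \<le> 1"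
    "par q \<noteq> par p \<Longrightarrow> p \<noteq> dix q \<Longrightarrow> k = 0 \<Longrightarrow> wtx wt p + wtx wt q = 0"
    using crossing[OF polar_rk[OF fl] polar_rk[OF fl'] in_idx(2,1) neq less same v(1) fin] by blast
  let ?wt' = "shiftw wt (int k) q p"
  have outer: "wtx ?wt' z = wtx wt z" if "z \<in> set xs \<union> set ys" for z
  proof -
    have "z \<noteq> p" "z \<noteq> q" "z \<noteq> dix p" "z \<noteq> dix q"
      using that dist by auto (metis image_eqI und_simps(3))+
    then have "p \<noteq> z" "p \<noteq> dix z" "q \<noteq> z" "q \<noteq> dix z"
      by auto
    then show ?thesis
      unfolding wtx_shiftw by (simp add: ev_other)
  qed
  have "altsum ?wt' xs = altsum wt xs" "altsum ?wt' ys = altsum wt ys"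
    using outer by (auto intro!: altsum_cong)
  \<comment> \<open>Neighbours enter \<open>altsum\<close> with opposite signs, so it suffices to
    compare this difference.\<close>
  moreover have "(if even (wtx ?wt' q) then 1 else -1) - (if even (wtx ?wt' p) then 1 else -1)
    = (if even (wtx wt p) then 1 else -1) - (if even (wtx wt q) then 1 else (-1::int))"
  proof -
    have w: "wtx ?wt' q = wtx wt q + int k" "wtx ?wt' p = wtx wt p - int k"
      unfolding wtx_shiftw using pq by (simp_all add: ev_other)
    show ?thesis
    proof (cases "par q = par p")
      case True
      then have "wtx ?wt' q = wtx wt p" "wtx ?wt' p = wtx wt q"
        using w k(2) by simp_all
      then show ?thesis
        by simp
    next
      case False
      then consider "k = 0" | "k = 1"
        using k(3) by linarith
      then show ?thesis
      proof cases
        case 1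
        then have "wtx wt p = - wtx wt q"
          using k(4)[OF False] pq by simp
        then show ?thesis
          unfolding w using 1 by simp
      next
        case 2
        then show ?thesis
          unfolding w by auto
      qed
    qed
  qed
  ultimately have "altsum ?wt' ?l' = altsum wt ?l"
    by (simp add: altsum_append)
  then show ?thesis
    using k(1) fl' v(2) unfolding reachable_def by blast
qed

text \<open>The last entry has rank 1 and its dual rank -1, with no rank between them, so only this
  one pair is reversed.\<close>

lemma reachable_flip:
  assumes l: "reachable n M c (xs @ [Inr i])" and fin: "fin_dim (carr M)" and simple: "simple_mod n M"
  shows "reachable n M c (xs @ [Inl i])"
proof -
  let ?l = "xs @ [Inr i]" and ?l' = "xs @ [Inl i]"
  have fl: "flag n ?l"
    using l by (simp add: reachable_def)
  then have dist: "distinct (map und ?l)"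
    by (simp add: flag_def)
  have fl': "flag n ?l'"
    using fl by (auto simp: flag_def)
  obtain wt v where v: "singular n M (rk ?l) wt v" "altsum wt ?l = c"
    using l by (auto simp: reachable_def)
  have in_idx: "Inl i \<in> idx n"
    using flag_idx[OF fl, of "Inl i"] by simp
  then have in_idx': "Inr i \<in> idx n"
    by simp
  note rk = rk_flip(2)[OF dist] and rk' = rk_flip(1)[OF dist, unfolded dix_simps]
  have rkl: "rk ?l (Inl i) = -1"
    using rk_dix[of ?l "Inr i"] rk by simp
  have other: "rk ?l z \<noteq> 1" "rk ?l z \<noteq> -1" if "z \<in> idx n" "z \<notin> {Inl i, Inr i}" for z
  proof -
    have "rk ?l z \<noteq> rk ?l (Inl i)" "rk ?l z \<noteq> rk ?l (Inr i)"
      using rk_inj[of z ?l "Inl i"] rk_inj[of z ?l "Inr i"] that flag_idx[OF fl] in_idx in_idx' by blast+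
    then show "rk ?l z \<noteq> 1" "rk ?l z \<noteq> -1"
      unfolding rk rkl by simp_all
  qed
  have nz: "rk ?l z \<noteq> 0" if "z \<in> idx n" for z
    using rk_nonzero[of z ?l] that flag_idx[OF fl, of z] by blast
  have val: "rk ?l' (Inr i) = -1" "rk ?l' (Inl i) = 1"
    using rk'[of "Inr i"] rk'[of "Inl i"] by simp_all
  have "singular n M (rk ?l') wt v"
  proof (rule crossing_self_dual[OF polar_rk[OF fl] polar_rk[OF fl'] in_idx _ _ _ v(1) fin simple])
    show "rk ?l (Inl i) < rk ?l (Inr i)" "rk ?l' (Inr i) < rk ?l' (Inl i)"
      unfolding rk rkl val by simp_all
    fix a b assume ab: "a \<in> idx n" "b \<in> idx n" "(a, b) \<notin> {(Inl i, Inr i), (Inr i, Inl i)}"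
    have out: "rk ?l' z = rk ?l z" if "z \<notin> {Inl i, Inr i}" for z
      using that rk'[of z] by auto
    show "rk ?l b < rk ?l a \<longleftrightarrow> rk ?l' b < rk ?l' a"
    proof (cases "a \<in> {Inl i, Inr i}")
      case True
      show ?thesis
      proof (cases "b \<in> {Inl i, Inr i}")
        case b: True
        then show ?thesis
          using True ab(3) by auto
      next
        case False
        then show ?thesis
          using True other[OF ab(2) False] nz[OF ab(2)] unfolding out[OF False]
          by (elim insertE emptyE; simp only: val rk rkl; linarith)
      qed
    next
      case a: False
      show ?thesis
      proof (cases "b \<in> {Inl i, Inr i}")
        case True
        then show ?thesis
          using other[OF ab(1) a] nz[OF ab(1)] unfolding out[OF a] by (elim insertE emptyE; simp only: val rk rkl; linarith)
      next
        case False
        then show ?thesis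
          by (simp only: out[OF a] out[OF False])
      qed
    qed
  qed
  moreover have "altsum wt ?l' = altsum wt ?l"
    by (simp add: altsum_append)
  ultimately show ?thesis
    using fl' v(2) unfolding reachable_def by blast
qed

lemma reachable_rotate:
  assumes fin: "fin_dim (carr M)"
  shows "reachable n M c (ys @ x # zs) \<Longrightarrow> reachable n M c (x # ys @ zs)"
proof (induction ys arbitrary: zs rule: rev_induct)
  case (snoc y ys)
  then have "reachable n M c (ys @ x # y # zs)"
    using reachable_swap[OF _ fin, of c ys y x zs] by simp
  then show ?case
    using snoc.IH[of "y # zs"] by simp
qed simp

text \<open>Each round flips the last entry and moves it to the front, so that after all rounds the
  indices stand in their original order.\<close>

lemma reachable_opposite:
  assumes fin: "fin_dim (carr M)" and simple: "simple_mod n M"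
  shows "reachable n M c (map Inl ys @ map Inr xs) \<Longrightarrow> reachable n M c (map Inl (xs @ ys))"
proof (induction xs arbitrary: ys rule: rev_induct)
  case (snoc x xs)
  have "reachable n M c ((map Inl ys @ map Inr xs) @ [Inl x])"
    using snoc.prems reachable_flip[OF _ fin simple, of c "map Inl ys @ map Inr xs" x] by simp
  then have "reachable n M c (Inl x # map Inl ys @ map Inr xs)"
    using reachable_rotate[OF fin, of c "map Inl ys @ map Inr xs" "Inl x" "[]"] by simp
  then show ?case
    using snoc.IH[of "x # ys"] by simp
qed simp

end

section \<open>The two ends of the path\<close>

lemma rk_upt:
  assumes "i \<in> {a..<b}"
  shows "rk (map Inr [a..<b]) (Inr i) = int b - int i" "rk (map Inr [a..<b]) (Inl i) = int i - int b"
proof -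
  have *: "rk (map Inr [b - d..<b]) (Inr i) = int b - int i" if "b - d \<le> i" "i < b" "d \<le> b" for d
    using that
  proof (induction d)
    case (Suc d)
    have "[b - Suc d..<b] = (b - Suc d) # [b - d..<b]"
      using Suc.prems by (subst upt_conv_Cons) (auto simp: Suc_diff_Suc)
    then show ?case
      using Suc by (cases "i = b - Suc d") auto
  qed simp
  show "rk (map Inr [a..<b]) (Inr i) = int b - int i"
    using *[of "b - a"] assms by simp
  then show "rk (map Inr [a..<b]) (Inl i) = int i - int b"
    using rk_dix[of "map Inr [a..<b]" "Inr i"] by simp
qed

text \<open>The alternating signs are those contributed by \<open>rho i = i - 1\<close>. Parity is
  blind to signs, so \<open>g\<close> may be \<open>Inl\<close> or \<open>Inr\<close>.\<close>

lemma altsum_upt: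
  assumes "\<And>i. even (wtx wt (g i)) \<longleftrightarrow> even (wt i)"
  shows "altsum wt (map g [1..<Suc n]) = kappa n wt"
proof (induction n)
  case 0
  then show ?case
    by (simp add: kappa_def)
next
  case (Suc n)
  have upt: "[1..<Suc (Suc n)] = [1..<Suc n] @ [Suc n]"
    by (rule upt_Suc_append) simp
  have "altsum wt (map g [1..<Suc (Suc n)]) = kappa n wt + (-1) ^ n * (if even (wt (Suc n)) then 1 else -1)"
    unfolding upt map_append altsum_append Suc using assms by (simp del: upt_Suc)
  also have "\<dots> = kappa (Suc n) wt"
    by (simp add: kappa_def rho_def)
  finally show ?case .
qed

lemma flag_upt: "flag n (map Inr [1..<Suc n])"
  by (auto simp: flag_def comp_def image_image)


section \<open>Subquotients of the dual module\<close>

text \<open>Quotients are realised on a graded complement, so that they live in the same type.\<close>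

lemma (in pmod) quotient_model:
  assumes H: "graded_stable n M H"
  obtains S \<pi> where "pmod S n" "mod_hom n M S \<pi>" "\<And>p. homog S p \<subseteq> homog M p" "\<And>c. c \<in> carr S \<Longrightarrow> \<pi> c = c"
    "\<And>z. z \<in> carr M \<Longrightarrow> z - \<pi> z \<in> carr \<lparr>homog = H, act = act M\<rparr>"
    "\<And>z. z \<in> carr \<lparr>homog = H, act = act M\<rparr> \<Longrightarrow> \<pi> z = 0"
proof -
  have H_sub: "cvs.subspace (H p)" "H p \<subseteq> homog M p" for p
    using H by (auto simp: graded_stable_def)
  let ?K = "\<lparr>homog = H, act = act M\<rparr>"
  have sub: "submodule n ?K M"
    using H by (intro submoduleI) (auto simp: graded_stable_def)
  then interpret K: pmod ?K n
    by (simp add: submodule_def pe_module_iff)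
  note K_M = submodule_carr[OF sub]
  have "\<forall>p. \<exists>g. clin g \<and> (\<forall>x\<in>H p. g x = 0) \<and> (\<forall>x. x - g x \<in> H p)"
    using exists_complement_projection[OF H_sub(1)] by metis
  then obtain g where g: "\<And>p. clin (g p)" "\<And>p x. x \<in> H p \<Longrightarrow> g p x = 0" "\<And>p x. x - g p x \<in> H p"
    by metis
  have gg: "g p (g p x) = g p x" for p x
    using g(2)[OF g(3)[of x p]] by (simp add: cvsp.linear_diff[OF g(1)])
  have g_homog: "g p x \<in> homog M p" if "x \<in> homog M p" for p x
    using homog_diff[OF that, of "x - g p x"] g(3)[of x p] H_sub(2) by auto
  \<comment> \<open>An even projection: each parity is projected along its own piece of
    \<open>H\<close>.\<close>
  define \<pi> where "\<pi> x = g 0 (hpart M 0 x) + g 1 (hpart M 1 x)" for x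
  have \<pi>_homog: "\<pi> x = g p x" if "x \<in> homog M p" for p x
    using that by (cases p) (simp_all add: \<pi>_def hpart_homog cvsp.linear_0[OF g(1)])
  define S where "S = \<lparr>homog = (\<lambda>p. {x \<in> homog M p. g p x = x}), act = (\<lambda>X x. \<pi> (act M X x))\<rparr>"
  have homog_S: "homog S p = {x \<in> homog M p. g p x = x}" and act_S: "act S X x = \<pi> (act M X x)" for p X x
    by (simp_all add: S_def)
  interpret S: gspace S
  proof
    show "cvs.subspace (homog S p)" for p
      unfolding cvs.subspace_def homog_S
      by (auto simp: homog_add homog_scale cvsp.linear_0[OF g(1)] cvsp.linear_add[OF g(1)] cvsp.linear_scale[OF g(1)])
    have "homog S 0 \<inter> homog S 1 \<subseteq> homog M 0 \<inter> homog M 1"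
      by (auto simp: homog_S)
    moreover have "0 \<in> homog S p" for p
      by (simp add: homog_S cvsp.linear_0[OF g(1)])
    ultimately show "homog S 0 \<inter> homog S 1 = {0}"
      unfolding homog_Int by blast
  qed
  have S_M: "x \<in> carr M" if "x \<in> carr S" for x
    using that by (induction rule: S.carr_induct) (auto simp: homog_S intro: homog_carr carr_add)
  have \<pi>_lin: "linear_between (carr M) (carr S) \<pi>"
  proof (rule linear_betweenI)
    show "\<pi> x \<in> carr S" if "x \<in> carr M" for x
      unfolding \<pi>_def using that g_homog[OF hpart_in] gg
      by (intro S.carr_add S.homog_carr[where p = 0] S.homog_carr[where p = 1]) (auto simp: homog_S intro: S.homog_carr)
  qed (simp_all add: \<pi>_def hpart_add hpart_scale cvsp.linear_add[OF g(1)] cvsp.linear_scale[OF g(1)] cscale_add_right)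
  have \<pi>_id: "\<pi> x = x" if "x \<in> carr S" for x
    using that
  proof (induction rule: S.carr_induct)
    case (homog q y)
    then show ?case
      using \<pi>_homog[of y q] by (simp add: homog_S)
  next
    case (add y z)
    then show ?case
      by (simp add: linear_betweenD(2)[OF \<pi>_lin] S_M)
  qed
  have \<pi>_K: "\<pi> x = 0" if "x \<in> carr ?K" for x
    using that
  proof (induction rule: K.carr_induct)
    case (homog q y)
    then show ?case
      using \<pi>_homog[of y q] g(2)[of y q] H_sub(2)[of q] by auto
  next
    case (add y z)
    then show ?case
      by (simp add: linear_betweenD(2)[OF \<pi>_lin] K_M)
  qed
  have \<pi>_diff: "x - \<pi> x \<in> carr ?K" if "x \<in> carr M" for x
  proof -
    have "x - \<pi> x = (hpart M 0 x - g 0 (hpart M 0 x)) + (hpart M 1 x - g 1 (hpart M 1 x))"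
      using hpart_sum[OF that, of 0] by (simp add: \<pi>_def algebra_simps)
    then show ?thesis
      using K.carr_add[OF K.homog_carr[of _ 0] K.homog_carr[of _ 1]] g(3) by simp
  qed
  \<comment> \<open>\<open>z\<close> and \<open>\<pi> z\<close> differ by an element of the
    submodule, which remains in it under the action and is then killed by \<open>\<pi>\<close>.
    Hence the action followed by \<open>\<pi>\<close> respects brackets.\<close>
  have \<pi>_act: "\<pi> (act M X (\<pi> z)) = \<pi> (act M X z)" if X: "X \<in> pe n" and z: "z \<in> carr M" for X z
  proof -
    have "act M X (z - \<pi> z) \<in> carr ?K"
      using K.act_carr[OF X \<pi>_diff[OF z]] by simp
    then have "\<pi> (act M X (z - \<pi> z)) = 0"
      by (rule \<pi>_K)
    moreover have "\<pi> z \<in> carr M"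
      using S_M linear_betweenD(1)[OF \<pi>_lin z] .
    ultimately show ?thesis
      using X z by (simp add: linear_between_diff[OF act_linear[OF X] carr_subspace] linear_between_diff[OF \<pi>_lin carr_subspace])
  qed
  have S: "pmod S n"
  proof
    fix X assume X: "X \<in> pe n"
    show "linear_between (carr S) (carr S) (act S X)"
      by (rule linear_betweenI)
        (simp_all add: act_S S_M X linear_betweenD[OF \<pi>_lin] act_add act_scale)
  next
    fix x assume "x \<in> carr S"
    then show "linear_between (pe n) (carr S) (\<lambda>X. act S X x)"
      by (intro linear_betweenI) (simp_all add: act_S S_M linear_betweenD[OF \<pi>_lin] act_add_left act_scale_left)
  next
    fix X p x q assume X: "X \<in> pe_homog n p" and x: "x \<in> homog S q"
    have "act M X x \<in> homog M (p + q)"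
      using act_homog[OF X] x by (simp add: homog_S)
    then show "act S X x \<in> homog S (p + q)"
      using \<pi>_homog[of "act M X x" "p + q"] g_homog gg by (simp add: homog_S act_S)
  next
    fix X p Y q x assume X: "X \<in> pe_homog n p" and Y: "Y \<in> pe_homog n q" and x: "x \<in> carr S"
    note [simp] = pe_homog_pe[OF X] pe_homog_pe[OF Y]
    show "act S (mmul (idx n) X Y - psign (p * q) *\<^sub>C mmul (idx n) Y X) x =
        act S X (act S Y x) - psign (p * q) *\<^sub>C act S Y (act S X x)"
      using S_M[OF x] by (simp add: act_S \<pi>_act act_bracket[OF X Y] linear_between_diff[OF \<pi>_lin carr_subspace] carr_scale
          linear_betweenD(3)[OF \<pi>_lin])
  qed
  have "mod_hom n M S \<pi>"
  proof (rule mod_homI[OF pmod_axioms S \<pi>_lin])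
    show "\<pi> x \<in> homog S p" if "x \<in> homog M p" for p x
      using that g_homog gg by (simp add: \<pi>_homog homog_S)
    show "\<pi> (act M X x) = act S X (\<pi> x)" if "X \<in> pe_homog n p" "x \<in> carr M" for X p x
      using that \<pi>_act pe_homog_pe by (simp add: act_S)
  qed
  then show ?thesis
    using that[OF S] \<pi>_id \<pi>_K \<pi>_diff by (auto simp: homog_S)
qed

definition annih :: "'v::complex_space smod \<Rightarrow> ('v \<Rightarrow> complex) set \<Rightarrow> bit \<Rightarrow> 'v set"
  where "annih M F p = {m \<in> homog M p. \<forall>\<phi>\<in>F. \<phi> m = 0}"

lemma annihD:
  assumes "m \<in> annih M F p"
  shows "m \<in> homog M p" "\<phi> \<in> F \<Longrightarrow> \<phi> m = 0"
  using assms unfolding annih_def by blast+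

context pmod
begin

lemma annih_stable:
  assumes F: "F \<subseteq> functionals (carr M)" "\<And>X p \<phi>. X \<in> pe_homog n p \<Longrightarrow> \<phi> \<in> F \<Longrightarrow> act (dual_mod M) X \<phi> \<in> F"
  shows "graded_stable n M (annih M F)"
proof -
  have lin: "\<phi> 0 = 0" "x \<in> carr M \<Longrightarrow> y \<in> carr M \<Longrightarrow> \<phi> (x + y) = \<phi> x + \<phi> y" "x \<in> carr M \<Longrightarrow> \<phi> (c *\<^sub>C x) = c * \<phi> x"
    if "\<phi> \<in> F" for \<phi> x y c
    using functionalsD(1,2)[of \<phi> "carr M"] linear_between_0[OF functionalsD(4) carr_subspace, of \<phi>] that F(1) by auto
  have "cvs.subspace (annih M F p)" for p
    unfolding cvs.subspace_def
  proof (intro conjI ballI allI)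
    show "0 \<in> annih M F p"
      using lin(1) by (simp add: annih_def)
    fix x y assume x: "x \<in> annih M F p" and y: "y \<in> annih M F p"
    then have "x \<in> carr M" "y \<in> carr M"
      using homog_carr by (auto simp: annih_def)
    then have "\<phi> (x + y) = 0" if "\<phi> \<in> F" for \<phi>
      using lin(2)[OF that] annihD(2)[OF x that] annihD(2)[OF y that] by simp
    then show "x + y \<in> annih M F p"
      using x y by (simp add: annih_def homog_add)
  next
    fix c x assume x: "x \<in> annih M F p"
    then have "x \<in> carr M"
      using homog_carr by (auto simp: annih_def)
    then have "\<phi> (c *\<^sub>C x) = 0" if "\<phi> \<in> F" for \<phi>
      using lin(3)[OF that] annihD(2)[OF x that] by simp
    then show "c *\<^sub>C x \<in> annih M F p"
      using x by (simp add: annih_def homog_scale)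
  qed
  moreover have "act M X x \<in> annih M F (p + q)" if X: "X \<in> pe_homog n p" and x: "x \<in> annih M F q" for X p x q
  proof -
    have x': "x \<in> homog M q" "x \<in> carr M"
      using x homog_carr by (auto simp: annih_def)
    note y = act_homog[OF X x'(1)]
    have "\<phi> (act M X x) = 0" if \<phi>: "\<phi> \<in> F" for \<phi>
    proof -
      have "act (dual_mod M) X \<phi> x = 0"
        using annihD(2)[OF x F(2)[OF X \<phi>]] .
      then have "psign (p * (p + q)) * \<phi> (act M X x) = 0"
        using x'(2) \<phi> F(1) lin(3)[OF \<phi> homog_carr[OF y]] by (simp add: dual_act_homog[OF X, of \<phi>] subset_iff parop_homog[OF y])
      then show ?thesis
        by simp
    qed
    then show ?thesis
      using y by (simp add: annih_def)
  qed
  ultimately show ?thesis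
    by (auto simp: graded_stable_def annih_def)
qed

text \<open>If \<open>F\<close> is closed under parity parts, the homogeneous parts of an
  annihilated vector are annihilated: \<open>\<phi>\<close> at the part of parity \<open>p\<close>
  equals the parity part of \<open>\<phi>\<close> at the whole vector.\<close>

lemma annih_carr:
  assumes F: "F \<subseteq> functionals (carr M)" "\<And>p \<phi>. \<phi> \<in> F \<Longrightarrow> hpart (dual_mod M) p \<phi> \<in> F"
  shows "carr \<lparr>homog = annih M F, act = act M\<rparr> = {m \<in> carr M. \<forall>\<phi>\<in>F. \<phi> m = 0}"
proof (intro subset_antisym subsetI)
  fix m assume "m \<in> carr \<lparr>homog = annih M F, act = act M\<rparr>"
  then obtain a b where m: "a \<in> annih M F 0" "b \<in> annih M F 1" "m = a + b"
    by (auto simp: carr_def)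
  then have ab: "a \<in> carr M" "b \<in> carr M"
    using homog_carr by (auto simp: annih_def)
  moreover have "\<phi> m = 0" if "\<phi> \<in> F" for \<phi>
    using functionalsD(1)[OF F(1)[THEN subsetD, OF that] ab] annihD(2)[OF m(1) that] annihD(2)[OF m(2) that]
    by (simp add: m(3))
  ultimately show "m \<in> {m \<in> carr M. \<forall>\<phi>\<in>F. \<phi> m = 0}"
    using m(3) by (simp add: carr_add)
next
  interpret d: pmod "dual_mod M" n by (rule pmod_dual)
  fix m assume m: "m \<in> {m \<in> carr M. \<forall>\<phi>\<in>F. \<phi> m = 0}"
  then have m': "m \<in> carr M"
    by simp
  have "hpart M p m \<in> annih M F p" for p
  proof -
    have "\<phi> (hpart M p m) = 0" if \<phi>: "\<phi> \<in> F" for \<phi>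
    proof -
      have \<phi>': "\<phi> \<in> functionals (carr M)"
        using \<phi> F(1) by blast
      then have c: "\<phi> \<in> carr (dual_mod M)"
        by (simp add: dual_carr)
      have h: "hpart (dual_mod M) q \<phi> \<in> homog (dual_mod M) q" for q
        by (rule d.hpart_in[OF c])
      have hm: "hpart M p m \<in> homog M p" "hpart M (p + 1) m \<in> homog M (p + 1)" and mc: "hpart M q m \<in> carr M" for q
        using m by auto
      have "\<phi> (hpart M p m) = hpart (dual_mod M) p \<phi> (hpart M p m) + hpart (dual_mod M) (p + 1) \<phi> (hpart M p m)"
        using fun_cong[OF d.hpart_sum[OF c, of p]] by simp
      also have "hpart (dual_mod M) (p + 1) \<phi> (hpart M p m) = 0"
        using h[of "p + 1"] hm(1) by (simp add: dual_homog)
      also have "hpart (dual_mod M) p \<phi> (hpart M p m) = hpart (dual_mod M) p \<phi> m"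
      proof -
        have "hpart (dual_mod M) p \<phi> m = hpart (dual_mod M) p \<phi> (hpart M p m) + hpart (dual_mod M) p \<phi> (hpart M (p + 1) m)"
          using functionalsD(1)[OF F(1)[THEN subsetD, OF F(2)[OF \<phi>, of p]] mc[of p] mc[of "p + 1"]]
          by (simp only: hpart_sum[OF m', of p, symmetric])
        then show ?thesis
          using h[of p] hm(2) by (simp add: dual_homog)
      qed
      also have "\<dots> = 0"
        using m F(2)[OF \<phi>] by blast
      finally show ?thesis
        by simp
    qed
    then show ?thesis
      using m by (simp add: annih_def)
  qed
  then show "m \<in> carr \<lparr>homog = annih M F, act = act M\<rparr>"
    using hpart_sum[of m 0] m unfolding carr_def by auto
qed

text \<open>Write \<open>S\<close> as \<open>N / K\<close> inside the dual. Then \<open>S'\<close>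
  is the annihilator of \<open>K\<close> modulo that of \<open>N\<close>, and restricting the
  functionals in \<open>N\<close> identifies its dual with \<open>N / K\<close>, by the double
  annihilator property.\<close>

lemma dual_subquotient:
  assumes fin: "fin_dim (carr M)" and S: "subquotient n S (dual_mod M)"
  obtains S' where "subquotient n S' M" "isomorphic n S (dual_mod S')"
proof -
  interpret d: pmod "dual_mod M" n by (rule pmod_dual)
  obtain N f where N: "submodule n N (dual_mod M)" and f: "mod_hom n N S f" "f ` carr N = carr S"
    using S by (auto simp: subquotient_def)
  interpret S: pmod S n
    using S by (simp add: subquotient_def pe_module_iff)
  interpret N: pmod N n
    using N by (simp add: submodule_def pe_module_iff)
  note fD = mod_homD[OF f(1)]
  have act_N: "act N = act (dual_mod M)" and homog_N: "homog N p \<subseteq> homog (dual_mod M) p" for p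
    using N by (auto simp: submodule_def)
  have Nf: "carr N \<subseteq> functionals (carr M)"
    using submodule_carr[OF N] by (auto simp: dual_carr)
  have N_hpart: "hpart (dual_mod M) p \<phi> = hpart N p \<phi>" if "\<phi> \<in> carr N" for p \<phi>
  proof -
    have "hpart N p \<phi> \<in> homog (dual_mod M) p" "hpart N (p + 1) \<phi> \<in> homog (dual_mod M) (p + 1)"
      using homog_N N.hpart_in[OF that] by blast+
    from d.hpart_unique[OF this] show ?thesis
      using N.hpart_sum[OF that, of p] by simp
  qed
  define K where "K = {\<phi> \<in> carr N. f \<phi> = 0}"
  have KN: "K \<subseteq> carr N" by (auto simp: K_def)
  have K_sub: "cvs.subspace K"
    unfolding cvs.subspace_def K_def
    using linear_betweenD(2,3)[OF fD(1)] linear_between_0[OF fD(1) N.carr_subspace] N.carr_add N.carr_scale by auto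
  have K_act: "act (dual_mod M) X \<phi> \<in> K" if X: "X \<in> pe_homog n p" and \<phi>: "\<phi> \<in> K" for X p \<phi>
    using \<phi> fD(3)[OF pe_homog_pe[OF X]] N.act_carr[OF pe_homog_pe[OF X]] S.act_0[OF pe_homog_pe[OF X]] by (simp add: K_def act_N)
  have K_hpart: "hpart (dual_mod M) p \<phi> \<in> K" if "\<phi> \<in> K" for p \<phi>
    using that mod_hom_hpart[OF N.gspace_axioms S.gspace_axioms f(1)] by (simp add: K_def N_hpart)
  have N_act: "act (dual_mod M) X \<phi> \<in> carr N" if X: "X \<in> pe_homog n p" and \<phi>: "\<phi> \<in> carr N" for X p \<phi>
    using N.act_carr[OF pe_homog_pe[OF X] \<phi>] by (simp add: act_N)
  have N_hpart': "hpart (dual_mod M) p \<phi> \<in> carr N" if "\<phi> \<in> carr N" for p \<phi>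
    using that by (simp add: N_hpart)
  have Kf: "K \<subseteq> functionals (carr M)"
    using KN Nf by blast
  let ?L = "\<lparr>homog = annih M K, act = act M\<rparr>"
  have L_stable: "graded_stable n M (annih M K)"
    by (rule annih_stable[OF Kf K_act])
  have L: "submodule n ?L M"
    using L_stable by (intro submoduleI) (auto simp: graded_stable_def)
  then interpret L: pmod ?L n
    by (simp add: submodule_def pe_module_iff)
  have L_carr: "carr ?L = {m \<in> carr M. \<forall>\<phi>\<in>K. \<phi> m = 0}"
    by (rule annih_carr[OF Kf K_hpart])
  have "graded_stable n ?L (annih M (carr N))"
    using annih_stable[OF Nf N_act] KN by (auto simp: graded_stable_def annih_def)
  then obtain S' \<pi> where S': "pmod S' n" and \<pi>: "mod_hom n ?L S' \<pi>" "\<And>p. homog S' p \<subseteq> annih M K p" "\<And>c. c \<in> carr S' \<Longrightarrow> \<pi> c = c"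
    "\<And>z. z \<in> carr ?L \<Longrightarrow> z - \<pi> z \<in> carr \<lparr>homog = annih M (carr N), act = act M\<rparr>"
    "\<And>z. z \<in> carr \<lparr>homog = annih M (carr N), act = act M\<rparr> \<Longrightarrow> \<pi> z = 0"
    using L.quotient_model[of "annih M (carr N)"] by auto
  interpret S': pmod S' n by (rule S')
  interpret dS': pmod "dual_mod S'" n by (rule S'.pmod_dual)
  note \<pi>D = mod_homD[OF \<pi>(1)]
  have N0: "carr \<lparr>homog = annih M (carr N), act = act M\<rparr> = {m \<in> carr M. \<forall>\<phi>\<in>carr N. \<phi> m = 0}"
    by (rule annih_carr[OF Nf N_hpart'])
  have S'_L: "c \<in> carr ?L" if "c \<in> carr S'" for c
    using that
  proof (induction rule: S'.carr_induct)
    case (homog q y)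
    then show ?case
      using \<pi>(2) L.homog_carr[of y q] by auto
  qed (rule L.carr_add)
  have L_M: "c \<in> carr M" if "c \<in> carr ?L" for c
    using that L_carr by blast
  have S'_homog: "y \<in> homog M q" if "y \<in> homog S' q" for y q
    using that \<pi>(2) by (auto simp: annih_def)
  have parop_S': "parop S' r c = parop M r c" if "c \<in> carr S'" for c r
    using that
  proof (induction rule: S'.carr_induct)
    case (homog q y)
    then show ?case
      by (simp add: S'.parop_homog[OF homog] parop_homog[OF S'_homog[OF homog]])
  next
    case (add y z)
    then show ?case
      using L_M S'_L by (simp add: S'.parop_add parop_add)
  qed
  have \<phi>_\<pi>: "\<phi> (\<pi> z) = \<phi> z" if z: "z \<in> carr ?L" and \<phi>: "\<phi> \<in> carr N" for z \<phi>
  proof -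
    have "\<pi> z \<in> carr M"
      using L_M S'_L linear_betweenD(1)[OF \<pi>D(1) z] by blast
    moreover have "\<phi> (z - \<pi> z) = 0"
      using \<pi>(4)[OF z] \<phi> unfolding N0 by blast
    ultimately show ?thesis
      using linear_between_diff[OF functionalsD(4) carr_subspace, of \<phi> z "\<pi> z"] Nf \<phi> L_M[OF z] by auto
  qed
  have subq: "subquotient n S' M"
    unfolding subquotient_def
  proof (intro conjI exI)
    show "pe_module n S'"
      by (rule S'.pe_module)
    show "submodule n ?L M" "mod_hom n ?L S' \<pi>"
      by (rule L, rule \<pi>(1))
    have "c \<in> \<pi> ` carr ?L" if "c \<in> carr S'" for c
      using \<pi>(3)[OF that] S'_L[OF that] by (metis imageI)
    then show "\<pi> ` carr ?L = carr S'"
      using linear_betweenD(1)[OF \<pi>D(1)] by blast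
  qed
  \<comment> \<open>The choice of the preimage is immaterial: two of them differ by an element of
    \<open>K\<close>, which vanishes on \<open>carr S'\<close>.\<close>
  define \<theta> where "\<theta> s = restrict0 (carr S') (SOME \<phi>. \<phi> \<in> carr N \<and> f \<phi> = s)" for s
  have \<theta>: "\<theta> (f \<phi>) = restrict0 (carr S') \<phi>" if \<phi>: "\<phi> \<in> carr N" for \<phi>
  proof -
    define \<psi> where "\<psi> = (SOME \<psi>. \<psi> \<in> carr N \<and> f \<psi> = f \<phi>)"
    have \<psi>: "\<psi> \<in> carr N" "f \<psi> = f \<phi>"
      using someI[of "\<lambda>\<psi>. \<psi> \<in> carr N \<and> f \<psi> = f \<phi>" \<phi>] \<phi> unfolding \<psi>_def by auto
    have "\<psi> - \<phi> \<in> K"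
      using \<psi> \<phi> linear_between_diff[OF fD(1) N.carr_subspace \<psi>(1) \<phi>] N.carr_diff by (simp add: K_def)
    then have "\<psi> c = \<phi> c" if "c \<in> carr S'" for c
      using S'_L[OF that] unfolding L_carr by force
    then show ?thesis
      unfolding \<theta>_def \<psi>_def[symmetric] by (auto simp: restrict0_def fun_eq_iff)
  qed
  have lift: "\<exists>\<phi>\<in>carr N. f \<phi> = s" if s: "s \<in> carr S" for s
    using s f(2) by (metis imageE)
  have res: "restrict0 (carr S') \<phi> \<in> functionals (carr S')" if \<phi>: "\<phi> \<in> carr N" for \<phi>
    using L_M S'_L functionalsD(1,2)[of \<phi> "carr M"] Nf \<phi> S'.carr_add S'.carr_scale by (intro functionalsI) auto
  have "mod_hom n S (dual_mod S') \<theta>"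
  proof (rule mod_homI[OF S.pmod_axioms dS'.pmod_axioms])
    show "linear_between (carr S) (carr (dual_mod S')) \<theta>"
    proof (rule linear_betweenI)
      fix s assume "s \<in> carr S"
      then show "\<theta> s \<in> carr (dual_mod S')"
        using lift \<theta> res by (metis S'.dual_carr)
    next
      fix s t assume "s \<in> carr S" "t \<in> carr S"
      then obtain \<phi> \<psi> where \<phi>: "\<phi> \<in> carr N" "s = f \<phi>" "\<psi> \<in> carr N" "t = f \<psi>"
        using lift by metis
      then have "\<theta> (s + t) = restrict0 (carr S') (\<phi> + \<psi>)"
        using \<theta>[of "\<phi> + \<psi>"] N.carr_add by (simp add: linear_betweenD(2)[OF fD(1)])
      then show "\<theta> (s + t) = \<theta> s + \<theta> t"
        unfolding \<phi>(2,4) \<theta>[OF \<phi>(1)] \<theta>[OF \<phi>(3)] by (intro ext) (simp add: restrict0_def)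
    next
      fix c s assume "s \<in> carr S"
      then obtain \<phi> where \<phi>: "\<phi> \<in> carr N" "s = f \<phi>"
        using lift by metis
      then have "\<theta> (c *\<^sub>C s) = restrict0 (carr S') (c *\<^sub>C \<phi>)"
        using \<theta>[of "c *\<^sub>C \<phi>"] N.carr_scale by (simp add: linear_betweenD(3)[OF fD(1)])
      then show "\<theta> (c *\<^sub>C s) = c *\<^sub>C \<theta> s"
        unfolding \<phi>(2) \<theta>[OF \<phi>(1)] by (intro ext) (simp add: restrict0_def)
    qed
  next
    fix p s assume s: "s \<in> homog S p"
    obtain \<phi> where \<phi>: "\<phi> \<in> carr N" "f \<phi> = s"
      using lift[OF S.homog_carr[OF s]] by blast
    have h: "f (hpart N p \<phi>) = s" "hpart N p \<phi> \<in> carr N" "hpart N p \<phi> \<in> homog (dual_mod M) p"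
      using mod_hom_hpart[OF N.gspace_axioms S.gspace_axioms f(1) \<phi>(1), of p] S.hpart_homog[OF s, of p] \<phi> homog_N
        N.hpart_carr[OF \<phi>(1)] homog_N[THEN subsetD, OF N.hpart_in[OF \<phi>(1), of p]] by simp_all
    have "\<theta> s = restrict0 (carr S') (hpart N p \<phi>)"
      using \<theta>[OF h(2)] h(1) by simp
    then show "\<theta> s \<in> homog (dual_mod S') p"
      using res[OF h(2)] h(3) S'_homog S'.homog_carr by (auto simp: S'.dual_homog dual_homog)
  next
    fix X p s assume X: "X \<in> pe_homog n p" and "s \<in> carr S"
    then obtain \<phi> where \<phi>: "\<phi> \<in> carr N" "f \<phi> = s"
      using lift by blast
    note X' = pe_homog_pe[OF X]
    have \<phi>f: "\<phi> \<in> functionals (carr M)"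
      using \<phi>(1) Nf by blast
    have "\<theta> (act S X s) = restrict0 (carr S') (act N X \<phi>)"
      using \<theta>[OF N.act_carr[OF X' \<phi>(1)]] fD(3)[OF X' \<phi>(1)] \<phi>(2) by simp
    moreover have "act (dual_mod S') X (\<theta> s) = restrict0 (carr S') (act N X \<phi>)"
    proof
      fix c
      show "act (dual_mod S') X (\<theta> s) c = restrict0 (carr S') (act N X \<phi>) c"
      proof (cases "c \<in> carr S'")
        case True
        have cL: "c \<in> carr ?L" and cM: "c \<in> carr M"
          using S'_L[OF True] L_M by blast+
        have actL: "act M X c \<in> carr ?L"
          using L.act_carr[OF X' cL] by simp
        have par: "parop S' p (act S' X c) = \<pi> (parop M p (act M X c))"
        proof -
          have "act S' X c = \<pi> (act M X c)"
            using \<pi>D(3)[OF X' cL] \<pi>(3)[OF True] by simp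
          then have "parop S' p (act S' X c) = \<pi> (parop ?L p (act M X c))"
            using mod_hom_parop[OF L.gspace_axioms S'.gspace_axioms \<pi>(1) actL] by simp
          then show ?thesis
            using submodule_parop[OF pmod_axioms L actL] by simp
        qed
        have "parop M p (act M X c) \<in> carr ?L"
          using L.parop_carr[OF actL] submodule_parop[OF pmod_axioms L actL] by simp
        then have "\<phi> (\<pi> (parop M p (act M X c))) = \<phi> (parop M p (act M X c))"
          by (rule \<phi>_\<pi>[OF _ \<phi>(1)])
        moreover have "\<pi> (parop M p (act M X c)) \<in> carr S'"
          unfolding par[symmetric] using True X' by simp
        ultimately show ?thesis
          using True cM \<theta>[OF \<phi>(1)] \<phi>(2) res[OF \<phi>(1)]
          by (simp add: S'.dual_act_homog[OF X] act_N dual_act_homog[OF X \<phi>f] par)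
      qed (use \<theta>[OF \<phi>(1)] \<phi>(2) res[OF \<phi>(1)] in \<open>simp add: S'.dual_act_homog[OF X]\<close>)
    qed
    ultimately show "\<theta> (act S X s) = act (dual_mod S') X (\<theta> s)"
      by simp
  qed
  then have "mod_iso n S (dual_mod S') \<theta>"
  proof (rule mod_isoI[OF S.gspace_axioms])
    fix s assume s: "s \<in> carr S" "\<theta> s = 0"
    obtain \<phi> where \<phi>: "\<phi> \<in> carr N" "f \<phi> = s"
      using lift[OF s(1)] by blast
    have zero: "\<phi> c = 0" if "c \<in> carr S'" for c
      using fun_cong[OF s(2), of c] \<theta>[OF \<phi>(1)] \<phi>(2) that by simp
    have "\<phi> \<in> K"
    \<comment> \<open>Injectivity: \<open>\<phi>\<close> vanishes on \<open>carr S'\<close>, hence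
      on the whole annihilator of \<open>K\<close>, and so it lies in \<open>K\<close>.\<close>
    proof (rule functionals_annihilator[OF fin carr_subspace functionals_subspace K_sub Kf])
      show "\<phi> \<in> functionals (carr M)"
        using \<phi>(1) Nf by blast
      fix x assume x: "x \<in> carr M" "\<And>\<psi>. \<psi> \<in> K \<Longrightarrow> \<psi> x = 0"
      then have xL: "x \<in> carr ?L"
        unfolding L_carr by blast
      show "\<phi> x = 0"
        using \<phi>_\<pi>[OF xL \<phi>(1)] zero[OF linear_betweenD(1)[OF \<pi>D(1) xL]] by simp
    qed
    then show "s = 0"
      using \<phi>(2) by (simp add: K_def)
  next
    fix \<psi> assume "\<psi> \<in> carr (dual_mod S')"
    then have \<psi>: "\<psi> \<in> functionals (carr S')"
      by (simp add: S'.dual_carr)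
    \<comment> \<open>Surjectivity: pull \<open>\<psi>\<close> back to the annihilator of
      \<open>K\<close> and extend it to \<open>M\<close> along a complement. The extension vanishes
      on the annihilator of \<open>N\<close>, so it belongs to \<open>N\<close>.\<close>
    obtain g :: "'v \<Rightarrow> 'v" where g: "clin g" "\<And>x. x \<in> carr ?L \<Longrightarrow> g x = 0" "\<And>x. x - g x \<in> carr ?L"
      using exists_complement_projection[OF L.carr_subspace] by blast
    define \<Phi> where "\<Phi> = restrict0 (carr M) (\<lambda>x. \<psi> (\<pi> (x - g x)))"
    have Pg: "linear_between (carr M) (carr ?L) (\<lambda>x. x - g x)"
      by (rule linear_betweenI) (simp_all add: g(3) cvsp.linear_add[OF g(1)] cvsp.linear_scale[OF g(1)] cvs.scale_right_diff_distrib)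
    have "linear_between (carr ?L) UNIV (\<lambda>z. \<psi> (\<pi> z))"
      by (rule linear_betweenI) (simp_all add: linear_betweenD[OF \<pi>D(1)] functionalsD(1,2)[OF \<psi>])
    then have \<Phi>f: "\<Phi> \<in> functionals (carr M)"
      unfolding \<Phi>_def by (rule functionals_restrict0[OF carr_subspace Pg])
    have \<Phi>_L: "\<Phi> z = \<psi> (\<pi> z)" if "z \<in> carr ?L" for z
      using that L_M g(2) by (simp add: \<Phi>_def)
    have "\<Phi> \<in> carr N"
    proof (rule functionals_annihilator[OF fin carr_subspace functionals_subspace N.carr_subspace Nf \<Phi>f])
      fix x assume x: "x \<in> carr M" "\<And>\<psi>. \<psi> \<in> carr N \<Longrightarrow> \<psi> x = 0"
      then have "\<pi> x = 0" and xL: "x \<in> carr ?L"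
        using \<pi>(5) KN unfolding N0 L_carr by blast+
      then show "\<Phi> x = 0"
        using \<Phi>_L linear_between_0[OF functionalsD(4)[OF \<psi>] S'.carr_subspace] by simp
    qed
    moreover from this have "\<theta> (f \<Phi>) = \<psi>"
      using \<theta> \<Phi>_L S'_L \<pi>(3) functionalsD(3)[OF \<psi>] by (auto simp: restrict0_def fun_eq_iff)
    ultimately show "\<exists>s\<in>carr S. \<theta> s = \<psi>"
      using linear_betweenD(1)[OF fD(1)] by blast
  qed
  then show ?thesis
    using that[OF subq] unfolding isomorphic_def by blast
qed

end


section \<open>Highest weights of dual modules\<close>

lemma gl_emb_diag:
  "gl_emb (\<lambda>i j. if i = j \<and> i \<in> {1..n} then a i else 0) = (\<Sum>i=1..n. a i *\<^sub>C rootm (Inl i) (Inl i))"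
proof (intro ext)
  fix p q
  show "gl_emb (\<lambda>i j. if i = j \<and> i \<in> {1..n} then a i else 0) p q = (\<Sum>i=1..n. a i *\<^sub>C rootm (Inl i) (Inl i)) p q"
  proof (cases p)
    case (Inl x)
    have "(\<Sum>i=1..n. a i * rootm (Inl i) (Inl i) (Inl x) q) = (\<Sum>i=1..n. if x = i then (if q = Inl x then a i else 0) else 0)"
      by (intro sum.cong refl) (auto simp: rootm_def)
    then show ?thesis
      by (cases q) (auto simp: Inl gl_sum_apply gl_emb_def sum.delta')
  next
    case (Inr x)
    have "(\<Sum>i=1..n. a i * rootm (Inl i) (Inl i) (Inr x) q) = (\<Sum>i=1..n. if x = i then (if q = Inr x then - a i else 0) else 0)"
      by (intro sum.cong refl) (auto simp: rootm_def)
    then show ?thesis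
      by (cases q) (auto simp: Inr gl_sum_apply gl_emb_def sum.delta')
  qed
qed

lemma gl_emb_unit: "gl_emb (\<lambda>r s. if r = j \<and> s = i then 1 else 0) = rootm (Inl j) (Inl i)"
  by (intro ext) (auto simp: gl_emb_def rootm_def split: sum.splits)

text \<open>The given positive system as an order: ranks fall from \<open>Inr 1\<close> to
  \<open>Inr n\<close> and on from \<open>Inl n\<close> to \<open>Inl 1\<close>. Every
  \<open>Inr\<close> exceeds every \<open>Inl\<close>, which makes the root vectors in
  \<open>pe_minus n\<close> positive.\<close>

definition std :: "nat \<Rightarrow> ix \<Rightarrow> int"
  where "std n = rk (map Inr [1..<Suc n])"

lemma std_simps:
  assumes "i \<in> {1..n}"
  shows "std n (Inr i) = int (Suc n) - int i" "std n (Inl i) = int i - int (Suc n)"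
  using rk_upt[of i 1 "Suc n"] assms unfolding std_def by (simp_all del: upt_Suc)

context pmod
begin

lemma has_weight_wvec:
  assumes x: "x \<in> carr M"
  shows "has_weight n M wt x \<longleftrightarrow> wvec n M wt x"
proof
  assume h: "has_weight n M wt x"
  have Inl: "act M (rootm (Inl i) (Inl i)) x = of_int (wt i) *\<^sub>C x" if i: "i \<in> {1..n}" for i
  proof -
    let ?a = "\<lambda>k. if k = i then 1 else 0 :: complex"
    have "(\<Sum>k=1..n. ?a k *\<^sub>C rootm (Inl k) (Inl k)) = (\<Sum>k=1..n. if k = i then rootm (Inl k) (Inl k) else 0)"
      by (intro sum.cong refl) (simp add: cscale_one)
    also have "\<dots> = rootm (Inl i) (Inl i)"
      using i by (simp add: sum.delta)
    moreover have "(\<Sum>k=1..n. of_int (wt k) * ?a k) = of_int (wt i)"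
    proof -
      have "(\<Sum>k=1..n. of_int (wt k) * ?a k) = (\<Sum>k=1..n. if k = i then of_int (wt k) else 0)"
        by (intro sum.cong refl) simp
      then show ?thesis
        using i by (simp add: sum.delta)
    qed
    ultimately show ?thesis
      using h[unfolded has_weight_def gl_emb_diag, rule_format, of ?a] by simp
  qed
  have Inr: "act M (rootm (Inr i) (Inr i)) x = - (of_int (wt i) *\<^sub>C x)" if i: "i \<in> {1..n}" for i
  proof -
    have "rootm (Inr i) (Inr i) = (-1) *\<^sub>C rootm (Inl i) (Inl i)"
      using rootm_dix[of "Inl i" "Inl i"] by simp
    then have "act M (rootm (Inr i) (Inr i)) x = (-1) *\<^sub>C act M (rootm (Inl i) (Inl i)) x"
      using act_scale_left[OF x rootm_pe, of "Inl i" "Inl i" "-1"] i by (simp only: Inl_in_idx)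
    then show ?thesis
      using Inl[OF i] by simp
  qed
  have "act M (rootm p p) x = of_int (wtx wt p) *\<^sub>C x" if "p \<in> idx n" for p
    using that Inl Inr by (cases p) auto
  then show "wvec n M wt x"
    using x by (simp add: wvec_def)
next
  assume w: "wvec n M wt x"
  show "has_weight n M wt x"
    unfolding has_weight_def gl_emb_diag
  proof
    fix a :: "nat \<Rightarrow> complex"
    have pe: "a i *\<^sub>C rootm (Inl i) (Inl i) \<in> pe n" if "i \<in> {1..n}" for i
      using that by (intro cvs.subspace_scale[OF subspace_pe] rootm_pe) simp_all
    have "act M (\<Sum>i=1..n. a i *\<^sub>C rootm (Inl i) (Inl i)) x = (\<Sum>i=1..n. act M (a i *\<^sub>C rootm (Inl i) (Inl i)) x)"
      by (rule act_sum_left[OF x pe])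
    also have "\<dots> = (\<Sum>i=1..n. (of_int (wt i) * a i) *\<^sub>C x)"
      using w x by (intro sum.cong refl) (simp add: act_scale_left rootm_pe wvec_def cscale_cscale mult.commute)
    finally show "act M (\<Sum>i=1..n. a i *\<^sub>C rootm (Inl i) (Inl i)) x = (\<Sum>i=1..n. of_int (wt i) * a i) *\<^sub>C x"
      by (simp add: cvs.scale_sum_left)
  qed
qed

text \<open>Even positive roots occur twice, between \<open>Inl\<close> indices and between
  \<open>Inr\<close> indices, with proportional root vectors; the mixed positive pairs account for
  \<open>pe_minus n\<close>.\<close>

lemma highest_weight_singular:
  assumes x: "x \<in> homog M q"
  shows "highest_weight_vector n M wt x \<longleftrightarrow> singular n M (std n) wt x"
proof
  note xc = homog_carr[OF x]
  assume h: "highest_weight_vector n M wt x"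
  have "act M (rootm a b) x = 0" if ab: "a \<in> idx n" "b \<in> idx n" "std n b < std n a" for a b
  proof (cases a)
    case a: (Inl i)
    show ?thesis
    proof (cases b)
      case b: (Inl j)
      then show ?thesis
        using ab a h std_simps[of i n] std_simps[of j n] by (auto simp: highest_weight_vector_def gl_emb_unit)
    next
      case b: (Inr j)
      then show ?thesis
        using ab a std_simps[of i n] std_simps[of j n] by auto
    qed
  next
    case a: (Inr i)
    show ?thesis
    proof (cases b)
      case b: (Inl j)
      have "rootm a b \<in> pe_minus n"
        using rootm_pe[OF ab(1,2)] a b rootm_nonzero[of a b] by (force simp: pe_minus_def)
      then show ?thesis
        using h by (simp add: highest_weight_vector_def)
    next
      case b: (Inr j)
      have "act M (rootm (Inl j) (Inl i)) x = 0"
        using ab a b h std_simps[of i n] std_simps[of j n] by (auto simp: highest_weight_vector_def gl_emb_unit)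
      moreover have "rootm a b = (-1) *\<^sub>C rootm (Inl j) (Inl i)"
        using rootm_dix[where p = "Inl j" and q = "Inl i"] a b by simp
      moreover have "act M ((-1) *\<^sub>C rootm (Inl j) (Inl i)) x = (-1) *\<^sub>C act M (rootm (Inl j) (Inl i)) x"
        using ab a b by (intro act_scale_left[OF xc] rootm_pe) simp_all
      ultimately show ?thesis
        by simp
    qed
  qed
  then show "singular n M (std n) wt x"
    using h x has_weight_wvec[OF xc] by (auto simp: singular_def highest_weight_vector_def)
next
  note xc = homog_carr[OF x]
  assume s: "singular n M (std n) wt x"
  then have pos: "act M (rootm a b) x = 0" if "a \<in> idx n" "b \<in> idx n" "std n b < std n a" for a b
    using that by (auto simp: singular_def)
  have "act M X x = 0" if X: "X \<in> pe_minus n" for X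
  proof -
    have pe: "X \<in> pe n"
      using X by (simp add: pe_minus_def)
    have "(X p q / 2) *\<^sub>C act M (rootm p q) x = 0" if pq: "p \<in> idx n" "q \<in> idx n" for p q
    proof (cases "X p q = 0")
      case False
      then obtain i j where "p = Inr i" "q = Inl j"
        using X unfolding pe_minus_def by blast
      then show ?thesis
        using pos[OF pq] pq std_simps[of i n] std_simps[of j n] by simp
    qed simp
    then show ?thesis
      unfolding act_expand[OF pe xc] by (intro sum.neutral ballI)
  qed
  moreover have "act M (gl_emb (\<lambda>r s. if r = j \<and> s = i then 1 else 0)) x = 0"
    if "i \<in> {1..n}" "j \<in> {1..n}" "i < j" for i j
    unfolding gl_emb_unit using that std_simps[of i n] std_simps[of j n] by (intro pos) simp_all
  ultimately show "highest_weight_vector n M wt x"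
    using s xc has_weight_wvec[OF xc] by (auto simp: singular_def highest_weight_vector_def)
qed

text \<open>Differences of weight entries are lengths of strings, hence not negative.\<close>

lemma singular_dominant:
  assumes "singular n M (std n) wt x" and fin: "fin_dim (carr M)"
  shows "dominant n wt"
  unfolding dominant_def
proof (intro ballI impI)
  fix i j assume ij: "i \<in> {1..n}" "j \<in> {1..n}" "i \<le> j"
  show "wt i \<le> wt j"
  proof (cases "i = j")
    case False
    have x: "wvec n M wt x" "x \<noteq> 0" "act M (rootm (Inl j) (Inl i)) x = 0"
      using assms(1) ij False std_simps[of i n] std_simps[of j n] by (auto simp: singular_def)
    show ?thesis
    proof (rule even_root_string[OF _ _ _ _ x fin])
      fix k assume "wtx wt (Inl j) - wtx wt (Inl i) = int k"
      then show ?thesis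
        by simp
    qed (use ij False in auto)
  qed simp
qed

lemma singular_Pi:
  assumes "singular n M w wt x"
  shows "singular n (Pi_mod M) w wt x"
proof -
  obtain q where x: "x \<in> homog M q"
    using assms by (auto simp: singular_def)
  have "x \<in> homog (Pi_mod M) (q + 1)"
    using x by simp
  moreover have "act (Pi_mod M) (rootm a b) x = psign (par a + par b) *\<^sub>C act M (rootm a b) x" if "a \<in> idx n" "b \<in> idx n" for a b
    by (rule act_Pi[OF rootm_pe_homog[OF that] homog_carr[OF x]])
  ultimately show ?thesis
    using assms unfolding singular_def wvec_def
    by (intro conjI exI[of _ "q + 1"]) (simp_all add: cscale_one)
qed

text \<open>The path starts at the order \<open>std n\<close> and ends at its negative; passing to
  the dual restores \<open>std n\<close>. The weight is negated there, which changes no parity and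
  hence preserves \<open>kappa\<close>.\<close>

lemma dual_highest_weight:
  assumes fin: "fin_dim (carr M)" and simple: "simple_mod n M" and x: "x \<in> homog M q" "highest_weight_vector n M wt x"
  shows "\<exists>wt' \<phi>. singular n (dual_mod M) (std n) wt' \<phi> \<and> kappa n wt' = kappa n wt"
proof -
  have "singular n M (std n) wt x"
    using highest_weight_singular[OF x(1)] x(2) by simp
  moreover have "altsum wt (map Inr [1..<Suc n]) = kappa n wt"
    by (rule altsum_upt) simp
  ultimately have "reachable n M (kappa n wt) (map Inr [1..<Suc n])"
    unfolding reachable_def std_def using flag_upt by blast
  then have "reachable n M (kappa n wt) (map Inl [1..<Suc n])"
    using reachable_opposite[OF fin simple, of "kappa n wt" "[]" "[1..<Suc n]"] by (simp del: upt_Suc)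
  then obtain wt' v where v: "flag n (map Inl [1..<Suc n])" "singular n M (rk (map Inl [1..<Suc n])) wt' v"
    "altsum wt' (map Inl [1..<Suc n]) = kappa n wt"
    by (auto simp: reachable_def simp del: upt_Suc)
  obtain \<phi> where "singular n (dual_mod M) (\<lambda>p. - rk (map Inl [1..<Suc n]) p) (\<lambda>i. - wt' i) \<phi>"
    using dual_singular[OF polar_rk[OF v(1)] v(2) simple] by blast
  moreover have "(\<lambda>p. - rk (map Inl [1..<Suc n]) p) = std n"
    using rk_map_dix[of "map Inl [1..<Suc n]"] by (simp add: std_def comp_def fun_eq_iff del: upt_Suc)
  moreover have "kappa n (\<lambda>i. - wt' i) = kappa n wt"
  proof -
    have "kappa n (\<lambda>i. - wt' i) = kappa n wt'"
      unfolding kappa_def by (intro sum.cong refl) auto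
    moreover have "altsum wt' (map Inl [1..<Suc n]) = kappa n wt'"
      by (rule altsum_upt) simp
    ultimately show ?thesis
      using v(3) by simp
  qed
  ultimately show ?thesis
    by auto
qed

end

section \<open>Blocks under duality, and the final statement\<close>

lemma in_block_dual:
  fixes M :: "'v::complex_space smod"
  assumes "in_block n l M"
  shows "in_block n l (dual_mod M)"
  unfolding in_block_def
proof (intro conjI allI impI)
  have F: "in_F n M"
    using assms by (simp add: in_block_def)
  then show "in_F n (dual_mod M)"
    by (rule in_F_dual)
  have M: "pmod M n" "fin_dim (carr M)"
    using F by (auto simp: in_F_iff)
  interpret M: pmod M n by (rule M)
  fix S :: "('v \<Rightarrow> complex) smod"
  assume S: "subquotient n S (dual_mod M) \<and> simple_mod n S"
  have S_mod: "pmod S n"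
    using S by (simp add: subquotient_def pe_module_iff)
  obtain S' :: "'v smod" where S': "subquotient n S' M" "isomorphic n S (dual_mod S')"
    using M.dual_subquotient[OF M(2)] S by blast
  have S'_mod: "pmod S' n"
    using S'(1) by (simp add: subquotient_def pe_module_iff)
  have "simple_mod n S'"
    using isomorphic_simple[OF S_mod pmod.pmod_dual[OF S'_mod] S'(2)] S pmod.simple_if_dual_simple[OF S'_mod] by blast
  then obtain wt and T :: "'v smod" where T: "dominant n wt" "kappa n wt = l" "is_L n wt T"
    and iso: "isomorphic n S' T \<or> isomorphic n S' (Pi_mod T)"
    using assms S'(1) unfolding in_block_def by blast
  have FT: "in_F n T" and T_simple: "simple_mod n T"
    using T(3) by (auto simp: is_L_def)
  obtain x where x: "x \<in> homog T 0" "highest_weight_vector n T wt x"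
    using T(3) by (auto simp: is_L_def)
  have T_mod: "pmod T n" "fin_dim (carr T)"
    using FT by (auto simp: in_F_iff)
  interpret T: pmod T n by (rule T_mod)
  let ?D = "dual_mod T"
  interpret D: pmod ?D n by (rule T.pmod_dual)
  have FD: "in_F n ?D"
    by (rule in_F_dual[OF FT])
  have isoD: "isomorphic n S ?D \<or> isomorphic n S (Pi_mod ?D)"
    using iso
  proof
    assume "isomorphic n S' T"
    then have "isomorphic n (dual_mod S') ?D"
      by (intro isomorphic_sym[OF D.pmod_axioms pmod.pmod_dual[OF S'_mod]] isomorphic_dual[OF S'_mod T_mod(1)])
    then show ?thesis
      using isomorphic_trans[OF S'(2)] by blast
  next
    assume i: "isomorphic n S' (Pi_mod T)"
    have "isomorphic n (dual_mod S') (dual_mod (Pi_mod T))"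
      by (rule isomorphic_sym[OF pmod.pmod_dual[OF T.pmod_Pi] pmod.pmod_dual[OF S'_mod] isomorphic_dual[OF S'_mod T.pmod_Pi i]])
    then show ?thesis
      using isomorphic_trans[OF S'(2)] isomorphic_trans T.dual_Pi_isomorphic by blast
  qed
  have PiPi: "isomorphic n ?D (Pi_mod (Pi_mod ?D))"
    by (rule D.Pi_Pi_isomorphic)
  \<comment> \<open>Simplicity is carried over from \<open>S\<close>, in the second case through a
    double parity change.\<close>
  have D_simple: "simple_mod n ?D"
    using isoD
  proof
    assume "isomorphic n S ?D"
    then show ?thesis
      using isomorphic_simple[OF S_mod D.pmod_axioms] S by blast
  next
    assume "isomorphic n S (Pi_mod ?D)"
    then have "simple_mod n (Pi_mod ?D)"
      using isomorphic_simple[OF S_mod D.pmod_Pi] S by blast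
    then have "simple_mod n (Pi_mod (Pi_mod ?D))"
      by (rule pmod.simple_Pi[OF D.pmod_Pi])
    then show ?thesis
      using isomorphic_simple[OF pmod.pmod_Pi[OF D.pmod_Pi] D.pmod_axioms
        isomorphic_sym[OF D.pmod_axioms pmod.pmod_Pi[OF D.pmod_Pi] PiPi]] by blast
  qed
  obtain wt' \<phi> where \<phi>: "singular n ?D (std n) wt' \<phi>" "kappa n wt' = l"
    using T.dual_highest_weight[OF T_mod(2) T_simple x] T(2) by blast
  have dom: "dominant n wt'"
    using D.singular_dominant[OF \<phi>(1)] FD by (simp add: in_F_iff)
  obtain q where q: "\<phi> \<in> homog ?D q"
    using \<phi>(1) by (auto simp: singular_def)
  show "\<exists>wt (T :: ('v \<Rightarrow> complex) smod). dominant n wt \<and> kappa n wt = l \<and> is_L n wt T \<and>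
      (isomorphic n S T \<or> isomorphic n S (Pi_mod T))"
  \<comment> \<open>A model in the sense of \<open>is_L\<close> needs an even highest weight vector.
    If \<open>\<phi>\<close> is odd, the parity change of \<open>?D\<close> is taken as the
    model.\<close>
  proof (cases "q = 0")
    case True
    then have "is_L n wt' ?D"
      using FD D_simple q \<phi>(1) D.highest_weight_singular[OF q] unfolding is_L_def by blast
    then show ?thesis
      using dom \<phi>(2) isoD by blast
  next
    case False
    then have "q = 1"
      by (cases q) simp_all
    then have q': "\<phi> \<in> homog (Pi_mod ?D) 0"
      using q by simp
    have "is_L n wt' (Pi_mod ?D)"
      using in_F_Pi[OF FD] D.simple_Pi[OF D_simple] q' D.singular_Pi[OF \<phi>(1)]
        pmod.highest_weight_singular[OF D.pmod_Pi q'] unfolding is_L_def by blast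
    moreover have "isomorphic n S (Pi_mod ?D) \<or> isomorphic n S (Pi_mod (Pi_mod ?D))"
      using isoD isomorphic_trans[OF _ PiPi] by blast
    ultimately show ?thesis
      using dom \<phi>(2) by blast
  qed
qed

theorem theorem2:
  fixes n :: nat and B :: "gl set" and D :: "gl \<Rightarrow> gl"
  assumes "n \<ge> 1" and "dual_bases n B D"
  shows "(\<forall>l\<in>block_labels n. \<forall>M :: 'v::complex_space smod.
            in_block n l M \<longrightarrow> in_block n l (dual_mod M)) \<and>
    (\<forall>k :: int. \<exists>\<eta> :: 'v smod \<Rightarrow> (ix \<Rightarrow> 'v \<Rightarrow> complex) \<Rightarrow> ((ix \<Rightarrow> 'v) \<Rightarrow> complex).
       (\<forall>M\<in>block_objects n.
          mod_iso n (Theta n B D k (dual_mod M)) (Pi_mod (dual_mod (Theta n B D (- k) M))) (\<eta> M)) \<and>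
       (\<forall>M\<in>block_objects n. \<forall>N\<in>block_objects n. \<forall>f. mod_hom n M N f \<longrightarrow>
          (\<forall>x\<in>carr (Theta n B D k (dual_mod N)).
             \<eta> M (Theta_map (dual_map M f) x)
               = dual_map (Theta n B D (- k) M) (Theta_map f) (\<eta> N x))))"
proof (intro conjI ballI allI impI)
  show "in_block n l (dual_mod M)" if "in_block n l M" for l and M :: "'v smod"
    by (rule in_block_dual[OF that])
next
  fix k :: int
  have block: "pmod M n" "fin_dim (carr M)" if "M \<in> block_objects n" for M :: "'v smod"
    using that by (auto simp: block_objects_def in_block_def in_F_iff)
  show "\<exists>\<eta> :: 'v smod \<Rightarrow> (ix \<Rightarrow> 'v \<Rightarrow> complex) \<Rightarrow> ((ix \<Rightarrow> 'v) \<Rightarrow> complex).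
       (\<forall>M\<in>block_objects n.
          mod_iso n (Theta n B D k (dual_mod M)) (Pi_mod (dual_mod (Theta n B D (- k) M))) (\<eta> M)) \<and>
       (\<forall>M\<in>block_objects n. \<forall>N\<in>block_objects n. \<forall>f. mod_hom n M N f \<longrightarrow>
          (\<forall>x\<in>carr (Theta n B D k (dual_mod N)).
             \<eta> M (Theta_map (dual_map M f) x)
               = dual_map (Theta n B D (- k) M) (Theta_map f) (\<eta> N x)))"
  proof (intro exI[of _ "eta n B D k"] conjI ballI allI impI)
    fix M :: "'v smod" assume "M \<in> block_objects n"
    then show "mod_iso n (Theta n B D k (dual_mod M)) (Pi_mod (dual_mod (Theta n B D (- k) M))) (eta n B D k M)"
      by (intro pmod.eta_iso block assms(2))
  next
    fix M N :: "'v smod" and f t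
    assume "M \<in> block_objects n" "N \<in> block_objects n" "mod_hom n M N f" "t \<in> carr (Theta n B D k (dual_mod N))"
    then show "eta n B D k M (Theta_map (dual_map M f) t) = dual_map (Theta n B D (- k) M) (Theta_map f) (eta n B D k N t)"
      by (intro eta_natural block assms(2))
  qed
qed

end
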